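(* Let $d\ge 1$ be an integer, $\Omega\subset\mathbb{R}^d$ a bounded open domain whose boundary $\partial\Omega$ is of class $\mathcal C^2$, $\varepsilon>0$ and $\eta_\varepsilon>0$. Let $u_0,v_0,g$ satisfy: (H.1) $u_0,v_0\in H^1(\Omega)\cap L^\infty(\Omega)$ and $g\in H^1_{loc}([0,\infty);H^1(\Omega))\cap L^\infty([0,\infty)\times\Omega)$; (H.2) $g(0,\cdot)=u_0$ and $0\le v_0\le 1$ almost everywhere on $\Omega$; (H.3) $u_0-g(0,\cdot)\in H^1_0(\Omega)$ and $v_0-1\in H_0^1(\Omega)$; (H.4) $g(t)\in L^\infty(\partial\Omega)\cap H^{1/2}(\partial\Omega)$ for almost every $t\in(0,+\infty)$. Let $(u_1,v_1)$ and $(u_2,v_2)$ be two weak solutions (in the sense given in the context) of the system $$\partial_t u-\mathrm{div}((\eta_\varepsilon+v^2)\nabla u)=0,\qquad \partial_t v-\varepsilon\Delta v+\frac{v-1}{4\varepsilon}+v|\nabla u|^2=0\quad\text{in }(0,+\infty)\times\Omega,$$ with $(u,v)=(g,1)$ on $(0,+\infty)\times\partial\Omega$ and $(u(0,\cdot),v(0,\cdot))=(u_0,v_0)$ on $\Omega$. Suppose that $\nabla u_1,\nabla u_2\in L^{d+2}((0,T);L^{d+2}(\Omega))$ for every $T>0$. Then $(u_1,v_1)=(u_2,v_2)$.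
   Context: Weak solution: a pair $(u,v)\in\mathcal F=[L^2_{loc}([0,+\infty);H^1(\Omega))\cap H^1_{loc}([0,+\infty);L^2(\Omega))\cap L^\infty([0,+\infty)\times\Omega)]^2$ such that for every $\varphi\in\mathcal C_c^\infty((0,+\infty)\times\Omega)$, $$\int_0^{+\infty}\int_\Omega\left[\partial_t u\,\varphi+(\eta_\varepsilon+v^2)\nabla u\cdot\nabla\varphi\right]dx\,dt=0,$$ $$\int_0^{+\infty}\int_\Omega\left[\partial_t v\,\varphi+\varepsilon\nabla v\cdot\nabla\varphi+\frac{v-1}{4\varepsilon}\varphi+v|\nabla u|^2\varphi\right]dx\,dt=0,$$ and such that the boundary and initial conditions hold: $u(t)-g(t)\in H_0^1(\Omega)$ and $v(t)-1\in H_0^1(\Omega)$ for a.e. $t>0$, and $u(0,\cdot)=u_0$, $v(0,\cdot)=v_0$ (which makes sense since $H^1_{loc}([0,\infty);L^2(\Omega))\subset C^0([0,\infty);L^2(\Omega))$). *)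

theory Defs
  imports "HOL-Analysis.Analysis"
begin

text \<open>
  Elements of Lebesgue, Sobolev and Bochner spaces are represented by functions; equality in
  these spaces is equality almost everywhere.  Accordingly the norms below are seminorms on
  function representatives, and they are meaningful only on the space they belong to (outside of
  it, the integrals defining them take a dummy value).  A function of time and space is
  written in curried form \<open>u t x\<close>.
\<close>

section \<open>Smooth functions\<close>

primrec C_k :: "nat \<Rightarrow> ('a::euclidean_space \<Rightarrow> real) \<Rightarrow> bool" where
  "C_k 0 f \<longleftrightarrow> continuous_on UNIV f"
| "C_k (Suc k) f \<longleftrightarrow> (\<forall>x. f differentiable (at x)) \<and>
     (\<forall>b\<in>Basis. C_k k (\<lambda>x. frechet_derivative f (at x) b))"

definition C_infinity :: "('a::euclidean_space \<Rightarrow> real) set" where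
  "C_infinity = {f. \<forall>k. C_k k f}"

text \<open>Test functions on an open set are extended by zero to the whole space.\<close>

definition test_functions :: "'a::euclidean_space set \<Rightarrow> ('a \<Rightarrow> real) set" where
  "test_functions S = {\<phi> \<in> C_infinity. compact (closure {x. \<phi> x \<noteq> 0}) \<and> closure {x. \<phi> x \<noteq> 0} \<subseteq> S}"

definition gradient :: "('a::euclidean_space \<Rightarrow> real) \<Rightarrow> 'a \<Rightarrow> 'a" where
  "gradient f x = (\<Sum>b\<in>Basis. frechet_derivative f (at x) b *\<^sub>R b)"

text \<open>
  Near each boundary point the set is the region above the graph of a \<open>C\<^sup>2\<close> function, after a
  choice of the vertical unit direction \<open>n\<close>.  The function \<open>\<gamma>\<close> is evaluated only on the
  hyperplane orthogonal to \<open>n\<close>; a \<open>C\<^sup>2\<close> function on this hyperplane extends to the whole space,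
  constantly in the direction \<open>n\<close>.
\<close>

definition C2_boundary :: "'a::euclidean_space set \<Rightarrow> bool" where
  "C2_boundary \<Omega> \<longleftrightarrow> (\<forall>x0\<in>frontier \<Omega>. \<exists>r>0. \<exists>n \<gamma>. norm n = 1 \<and> C_k 2 \<gamma> \<and>
     \<Omega> \<inter> ball x0 r = {x \<in> ball x0 r. x \<bullet> n > \<gamma> (x - (x \<bullet> n) *\<^sub>R n)})"

section \<open>Lebesgue and Sobolev spaces\<close>

definition Lp :: "real \<Rightarrow> 'a measure \<Rightarrow> ('a \<Rightarrow> 'b::euclidean_space) set" where
  "Lp p M = {f \<in> borel_measurable M. integrable M (\<lambda>x. norm (f x) powr p)}"

definition Lp_norm :: "real \<Rightarrow> 'a measure \<Rightarrow> ('a \<Rightarrow> 'b::euclidean_space) \<Rightarrow> real" where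
  "Lp_norm p M f = (\<integral>x. norm (f x) powr p \<partial>M) powr (1 / p)"

definition L_inf :: "'a measure \<Rightarrow> ('a \<Rightarrow> real) set" where
  "L_inf M = {f \<in> borel_measurable M. \<exists>C. AE x in M. \<bar>f x\<bar> \<le> C}"

definition has_weak_gradient ::
  "'a::euclidean_space set \<Rightarrow> ('a \<Rightarrow> real) \<Rightarrow> ('a \<Rightarrow> 'a) \<Rightarrow> bool" where
  "has_weak_gradient \<Omega> f G \<longleftrightarrow> f \<in> Lp 2 (lebesgue_on \<Omega>) \<and> G \<in> Lp 2 (lebesgue_on \<Omega>) \<and>
     (\<forall>\<phi>\<in>test_functions \<Omega>.
        (\<integral>x. f x *\<^sub>R gradient \<phi> x \<partial>lebesgue_on \<Omega>) = - (\<integral>x. \<phi> x *\<^sub>R G x \<partial>lebesgue_on \<Omega>))"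

definition H1 :: "'a::euclidean_space set \<Rightarrow> ('a \<Rightarrow> real) set" where
  "H1 \<Omega> = {f. \<exists>G. has_weak_gradient \<Omega> f G}"

text \<open>Weak gradients on an open set are unique up to null sets, so the choice is immaterial.\<close>

definition weak_gradient :: "'a::euclidean_space set \<Rightarrow> ('a \<Rightarrow> real) \<Rightarrow> 'a \<Rightarrow> 'a" where
  "weak_gradient \<Omega> f = (SOME G. has_weak_gradient \<Omega> f G)"

definition H1_norm :: "'a::euclidean_space set \<Rightarrow> ('a \<Rightarrow> real) \<Rightarrow> real" where
  "H1_norm \<Omega> f = sqrt ((Lp_norm 2 (lebesgue_on \<Omega>) f)\<^sup>2
     + (Lp_norm 2 (lebesgue_on \<Omega>) (weak_gradient \<Omega> f))\<^sup>2)"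

definition H10 :: "'a::euclidean_space set \<Rightarrow> ('a \<Rightarrow> real) set" where
  "H10 \<Omega> = {f \<in> H1 \<Omega>. \<exists>\<phi>. (\<forall>n. \<phi> n \<in> test_functions \<Omega>) \<and>
     (\<lambda>n. H1_norm \<Omega> (\<lambda>x. f x - \<phi> n x)) \<longlonglongrightarrow> 0}"

section \<open>Boundary values\<close>

text \<open>
  Hausdorff measure of integer dimension \<open>s\<close>, normalised to agree with Lebesgue measure.
  In dimension 0 it is counting measure: \<open>0 ^ 0 = 1\<close> gives singletons weight 1, while the empty
  set needs weight 0.  Covering sets are required to be bounded because \<open>diameter\<close> is
  unspecified on unbounded sets.  The outer measure is metric, hence countably additive on the
  Borel sets, so that \<open>measure_of\<close> does not fall back to the zero measure.
\<close>

definition hausdorff_weight :: "nat \<Rightarrow> 'a::euclidean_space set \<Rightarrow> ennreal" where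
  "hausdorff_weight s C =
     (if C = {} then 0 else ennreal (unit_ball_vol (real s) * (diameter C / 2) ^ s))"

definition hausdorff_outer :: "nat \<Rightarrow> 'a::euclidean_space set \<Rightarrow> ennreal" where
  "hausdorff_outer s A = (SUP \<delta>\<in>{0<..}.
     INF C\<in>{C :: nat \<Rightarrow> 'a set. A \<subseteq> (\<Union>i. C i) \<and> (\<forall>i. bounded (C i) \<and> diameter (C i) \<le> \<delta>)}.
       \<Sum>i. hausdorff_weight s (C i))"

definition hausdorff_measure :: "nat \<Rightarrow> 'a::euclidean_space measure" where
  "hausdorff_measure s = measure_of UNIV (sets borel) (hausdorff_outer s)"

definition surface_measure :: "'a::euclidean_space set \<Rightarrow> 'a measure" where
  "surface_measure \<Omega> = restrict_space (hausdorff_measure (DIM('a) - 1)) (frontier \<Omega>)"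

text \<open>
  The trace on the boundary is the continuous extension, from \<open>H\<^sup>1(\<Omega>)\<close> to \<open>L\<^sup>2(\<partial>\<Omega>)\<close>,
  of the restriction to the boundary of functions that are smooth up to the boundary.
\<close>

definition has_trace :: "'a::euclidean_space set \<Rightarrow> ('a \<Rightarrow> real) \<Rightarrow> ('a \<Rightarrow> real) \<Rightarrow> bool" where
  "has_trace \<Omega> f h \<longleftrightarrow> f \<in> H1 \<Omega> \<and> h \<in> Lp 2 (surface_measure \<Omega>) \<and>
     (\<exists>F. (\<forall>n. F n \<in> C_infinity) \<and>
        (\<lambda>n. H1_norm \<Omega> (\<lambda>x. f x - F n x)) \<longlonglongrightarrow> 0 \<and>
        (\<lambda>n. Lp_norm 2 (surface_measure \<Omega>) (\<lambda>x. h x - F n x)) \<longlonglongrightarrow> 0)"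

text \<open>
  Gagliardo seminorm of order 1/2 on the boundary, of dimension \<open>d - 1\<close>: the exponent of the
  kernel is \<open>(d - 1) + 2 * (1/2) = d\<close>.  On the diagonal the integrand is 0.
\<close>

definition H_half_boundary :: "'a::euclidean_space set \<Rightarrow> ('a \<Rightarrow> real) set" where
  "H_half_boundary \<Omega> = {h \<in> Lp 2 (surface_measure \<Omega>).
     (\<integral>\<^sup>+x. (\<integral>\<^sup>+y. ennreal ((h x - h y)\<^sup>2 / dist x y ^ DIM('a)) \<partial>surface_measure \<Omega>)
        \<partial>surface_measure \<Omega>) < \<infinity>}"

section \<open>Bochner spaces\<close>

text \<open>
  A space of functions on which \<open>N\<close> is a seminorm is given by its carrier \<open>X\<close>.  It depends on the
  domain, hence is not a type, and the library's Bochner integral does not apply; the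
  following definitions are those of the library relativised to \<open>X\<close> and \<open>N\<close>.
\<close>

definition strongly_measurable ::
  "'t measure \<Rightarrow> ('a \<Rightarrow> 'b::euclidean_space) set \<Rightarrow> (('a \<Rightarrow> 'b) \<Rightarrow> real) \<Rightarrow>
   ('t \<Rightarrow> 'a \<Rightarrow> 'b) \<Rightarrow> bool" where
  "strongly_measurable M X N u \<longleftrightarrow>
     (\<exists>s. (\<forall>n. simple_function M (s n) \<and> s n ` space M \<subseteq> X) \<and>
        (AE t in M. u t \<in> X \<and> (\<lambda>n. N (\<lambda>x. u t x - s n t x)) \<longlonglongrightarrow> 0))"

definition has_Bochner_integral_in ::
  "'t measure \<Rightarrow> ('a \<Rightarrow> 'b::euclidean_space) set \<Rightarrow> (('a \<Rightarrow> 'b) \<Rightarrow> real) \<Rightarrow>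
   ('t \<Rightarrow> 'a \<Rightarrow> 'b) \<Rightarrow> ('a \<Rightarrow> 'b) \<Rightarrow> bool" where
  "has_Bochner_integral_in M X N u w \<longleftrightarrow> strongly_measurable M X N u \<and> w \<in> X \<and>
     (\<exists>s. (\<forall>n. simple_function M (s n) \<and> s n ` space M \<subseteq> X \<and>
               emeasure M {t \<in> space M. s n t \<noteq> (\<lambda>_. 0)} < \<infinity>) \<and>
        (\<lambda>n. \<integral>\<^sup>+t. ennreal (N (\<lambda>x. u t x - s n t x)) \<partial>M) \<longlonglongrightarrow> 0 \<and>
        (\<lambda>n. N (\<lambda>x. (\<Sum>y\<in>s n ` space M. measure M {t \<in> space M. s n t = y} *\<^sub>R y x) - w x))
          \<longlonglongrightarrow> 0)"

definition Bochner_Lp ::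
  "real \<Rightarrow> 't measure \<Rightarrow> ('a \<Rightarrow> 'b::euclidean_space) set \<Rightarrow> (('a \<Rightarrow> 'b) \<Rightarrow> real) \<Rightarrow>
   ('t \<Rightarrow> 'a \<Rightarrow> 'b) set" where
  "Bochner_Lp p M X N =
     {u. strongly_measurable M X N u \<and> integrable M (\<lambda>t. N (u t) powr p)}"

text \<open>\<open>L\<^sup>2\<^sub>l\<^sub>o\<^sub>c([0,\<infinity>); X)\<close>\<close>

definition L2_loc ::
  "('a \<Rightarrow> 'b::euclidean_space) set \<Rightarrow> (('a \<Rightarrow> 'b) \<Rightarrow> real) \<Rightarrow> (real \<Rightarrow> 'a \<Rightarrow> 'b) set" where
  "L2_loc X N = {u. \<forall>T>0. u \<in> Bochner_Lp 2 (lebesgue_on {0<..<T}) X N}"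

definition has_weak_time_derivative ::
  "('a \<Rightarrow> 'b::euclidean_space) set \<Rightarrow> (('a \<Rightarrow> 'b) \<Rightarrow> real) \<Rightarrow>
   (real \<Rightarrow> 'a \<Rightarrow> 'b) \<Rightarrow> (real \<Rightarrow> 'a \<Rightarrow> 'b) \<Rightarrow> bool" where
  "has_weak_time_derivative X N u u' \<longleftrightarrow> u \<in> L2_loc X N \<and> u' \<in> L2_loc X N \<and>
     (\<forall>\<psi>\<in>test_functions {0<..}. \<exists>w.
        has_Bochner_integral_in (lebesgue_on {0<..}) X N (\<lambda>t x. deriv \<psi> t *\<^sub>R u t x) w \<and>
        has_Bochner_integral_in (lebesgue_on {0<..}) X N (\<lambda>t x. \<psi> t *\<^sub>R u' t x) (\<lambda>x. - w x))"

text \<open>\<open>H\<^sup>1\<^sub>l\<^sub>o\<^sub>c([0,\<infinity>); X)\<close>\<close>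

definition H1_loc ::
  "('a \<Rightarrow> 'b::euclidean_space) set \<Rightarrow> (('a \<Rightarrow> 'b) \<Rightarrow> real) \<Rightarrow> (real \<Rightarrow> 'a \<Rightarrow> 'b) set" where
  "H1_loc X N = {u. \<exists>u'. has_weak_time_derivative X N u u'}"

definition weak_time_derivative ::
  "('a \<Rightarrow> 'b::euclidean_space) set \<Rightarrow> (('a \<Rightarrow> 'b) \<Rightarrow> real) \<Rightarrow>
   (real \<Rightarrow> 'a \<Rightarrow> 'b) \<Rightarrow> real \<Rightarrow> 'a \<Rightarrow> 'b" where
  "weak_time_derivative X N u = (SOME u'. has_weak_time_derivative X N u u')"

text \<open>
  Elements of \<open>H\<^sup>1\<^sub>l\<^sub>o\<^sub>c([0,\<infinity>); X)\<close> have a representative \<open>w\<close> in \<open>C([0,\<infinity>); X)\<close>, and their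
  value at time 0 is \<open>w 0\<close> (not the value at 0 of an arbitrary representative).
\<close>

definition continuous_representative ::
  "('a \<Rightarrow> 'b::euclidean_space) set \<Rightarrow> (('a \<Rightarrow> 'b) \<Rightarrow> real) \<Rightarrow>
   (real \<Rightarrow> 'a \<Rightarrow> 'b) \<Rightarrow> (real \<Rightarrow> 'a \<Rightarrow> 'b) \<Rightarrow> bool" where
  "continuous_representative X N u w \<longleftrightarrow> (\<forall>t\<ge>0. w t \<in> X) \<and>
     (\<forall>t\<ge>0. ((\<lambda>s. N (\<lambda>x. w s x - w t x)) \<longlongrightarrow> 0) (at t within {0..})) \<and>
     (AE t in lebesgue_on {0<..}. u t \<in> X \<and> N (\<lambda>x. u t x - w t x) = 0)"

definition initial_value ::
  "('a \<Rightarrow> 'b::euclidean_space) set \<Rightarrow> (('a \<Rightarrow> 'b) \<Rightarrow> real) \<Rightarrow>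
   (real \<Rightarrow> 'a \<Rightarrow> 'b) \<Rightarrow> 'a \<Rightarrow> 'b" where
  "initial_value X N u = (SOME f. \<exists>w. continuous_representative X N u w \<and> f = w 0)"

section \<open>Weak solutions\<close>

abbreviation L2 :: "'a::euclidean_space set \<Rightarrow> ('a \<Rightarrow> real) set" where
  "L2 \<Omega> \<equiv> Lp 2 (lebesgue_on \<Omega>)"

abbreviation L2_norm :: "'a::euclidean_space set \<Rightarrow> ('a \<Rightarrow> real) \<Rightarrow> real" where
  "L2_norm \<Omega> \<equiv> Lp_norm 2 (lebesgue_on \<Omega>)"

definition L_inf_space_time :: "'a::euclidean_space set \<Rightarrow> (real \<Rightarrow> 'a \<Rightarrow> real) set" where
  "L_inf_space_time \<Omega> = {u. (\<lambda>(t, x). u t x) \<in> L_inf (lebesgue_on ({0..} \<times> \<Omega>))}"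

definition solution_space :: "'a::euclidean_space set \<Rightarrow> (real \<Rightarrow> 'a \<Rightarrow> real) set" where
  "solution_space \<Omega> =
     L2_loc (H1 \<Omega>) (H1_norm \<Omega>) \<inter> H1_loc (L2 \<Omega>) (L2_norm \<Omega>) \<inter> L_inf_space_time \<Omega>"

definition weak_solution ::
  "'a::euclidean_space set \<Rightarrow> real \<Rightarrow> real \<Rightarrow> (real \<Rightarrow> 'a \<Rightarrow> real) \<Rightarrow>
   ('a \<Rightarrow> real) \<Rightarrow> ('a \<Rightarrow> real) \<Rightarrow>
   (real \<Rightarrow> 'a \<Rightarrow> real) \<Rightarrow> (real \<Rightarrow> 'a \<Rightarrow> real) \<Rightarrow> bool" where
  "weak_solution \<Omega> \<epsilon> \<eta> g u0 v0 u v \<longleftrightarrow>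
     u \<in> solution_space \<Omega> \<and> v \<in> solution_space \<Omega> \<and>
     (\<forall>\<phi>\<in>test_functions ({0<..} \<times> \<Omega>).
        (\<integral>t. (\<integral>x. weak_time_derivative (L2 \<Omega>) (L2_norm \<Omega>) u t x * \<phi> (t, x)
             + (\<eta> + (v t x)\<^sup>2) * (weak_gradient \<Omega> (u t) x \<bullet> gradient (\<lambda>y. \<phi> (t, y)) x)
           \<partial>lebesgue_on \<Omega>) \<partial>lebesgue_on {0<..}) = 0 \<and>
        (\<integral>t. (\<integral>x. weak_time_derivative (L2 \<Omega>) (L2_norm \<Omega>) v t x * \<phi> (t, x)
             + \<epsilon> * (weak_gradient \<Omega> (v t) x \<bullet> gradient (\<lambda>y. \<phi> (t, y)) x)
             + (v t x - 1) / (4 * \<epsilon>) * \<phi> (t, x)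
             + v t x * (norm (weak_gradient \<Omega> (u t) x))\<^sup>2 * \<phi> (t, x)
           \<partial>lebesgue_on \<Omega>) \<partial>lebesgue_on {0<..}) = 0) \<and>
     (AE t in lebesgue_on {0<..}. (\<lambda>x. u t x - g t x) \<in> H10 \<Omega> \<and> (\<lambda>x. v t x - 1) \<in> H10 \<Omega>) \<and>
     (AE x in lebesgue_on \<Omega>. initial_value (L2 \<Omega>) (L2_norm \<Omega>) u x = u0 x) \<and>
     (AE x in lebesgue_on \<Omega>. initial_value (L2 \<Omega>) (L2_norm \<Omega>) v x = v0 x)"

end

theory Submission
  imports Defs
begin

text \<open>
  The boundary values of the two solutions agree, so the differences \<open>U = u1 - u2\<close> and
  \<open>V = v1 - v2\<close> belong to \<open>H\<^sup>1\<^sub>0\<close> at almost every time, and they vanish at time 0.  Testing the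
  difference of the equations for \<open>u\<close> with \<open>U\<close> and of those for \<open>v\<close> with \<open>V\<close> is therefore
  allowed, and since \<open>\<eta> > 0\<close> controls the gradient of \<open>U\<close>, Young's inequality leaves
  \<open>1/2 * (\<parallel>U\<parallel>\<^sup>2 + \<parallel>V\<parallel>\<^sup>2)' + \<epsilon> * \<parallel>\<nabla>V\<parallel>\<^sup>2 \<le> c * \<integral> (|\<nabla>u1|\<^sup>2 + |\<nabla>u2|\<^sup>2) * V\<^sup>2\<close>.
  The right-hand side is bounded with the weighted inequality
  \<open>\<integral> h\<^sup>2 * f\<^sup>2 \<le> \<delta> * \<integral> |\<nabla>f|\<^sup>2 + C\<^sub>\<delta> * (1 + \<integral> h^(d+2)) * \<integral> f\<^sup>2\<close> for \<open>f\<close> in \<open>H\<^sup>1\<^sub>0\<close>,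
  in which \<open>\<delta>\<close> is chosen such that \<open>\<epsilon>\<close> absorbs the gradient of \<open>V\<close>.  What remains is
  \<open>y' \<le> k y\<close> for the squared norm \<open>y\<close> of the difference, with
  \<open>k = 2 K (1 + \<integral> |\<nabla>u1|^(d+2) + \<integral> |\<nabla>u2|^(d+2))\<close>, and this is integrable on bounded time
  intervals because the gradients are in \<open>L^(d+2)\<close> of space and time.  Gronwall's lemma
  gives \<open>y = 0\<close>.  The three ingredients are \<open>slice_energy_estimate\<close>, \<open>weighted_H10_square\<close> and
  \<open>Gronwall_zero\<close>.

  The weighted inequality is a consequence of the Gagliardo--Nirenberg inequality; the proof here
  is a direct one.  A function \<open>f\<close> is compared with its averages over balls of radii \<open>r\<^sub>k\<close>
  decreasing geometrically to 0.  One scale differs from the next by at most a multiple of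
  \<open>r\<^sub>k \<parallel>\<nabla>f\<parallel>\<close> in the norm of \<open>L\<^sup>2\<close>.  If a second average is taken, Fubini's theorem moves it to the
  weight: instead of the unbounded \<open>h\<^sup>2\<close> there are its averages over balls of radius \<open>r\<^sub>k\<close>, which
  are bounded because \<open>h\<close> is in \<open>L^(d+2)\<close>, with bounds that grow more slowly than \<open>r\<^sub>k^(-2)\<close>.  So the
  differences sum to a multiple of \<open>\<parallel>\<nabla>f\<parallel>\<close>, while the coarsest scale contributes a multiple of \<open>\<parallel>f\<parallel>\<close>
  (\<open>weighted_norm_le\<close>).

  The calculation above is formal in two respects.  First, the equations are only tested with
  smooth functions of space and time.  For a product \<open>\<psi>(t) \<zeta>(x)\<close> the fundamental lemma of the
  calculus of variations turns them into spatial identities at almost every time, where the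
  exceptional set of times depends on \<open>\<zeta>\<close>.  Countably many \<open>\<zeta>\<close> suffice, as \<open>U\<close> and \<open>V\<close> are
  strongly measurable and hence essentially separably valued (\<open>countable_test_functions\<close>), and
  the spatial identities extend by continuity to \<open>U(t)\<close> and \<open>V(t)\<close>, including the term
  with \<open>|\<nabla>u|\<^sup>2\<close>, by the weighted inequality once more.  Secondly, the derivative of \<open>\<parallel>U\<parallel>\<^sup>2\<close>
  has to be justified from the weak time derivative (\<open>energy_difference\<close>).  By
  Du Bois-Reymond's lemma, applied to the inner products with fixed functions, the continuous
  representative \<open>w\<close> satisfies \<open>\<parallel>w t - w s\<parallel> \<le> K t - K s\<close>, where \<open>K\<close> is a primitive of the norm
  of the time derivative.  Therefore the defect in the energy identity on \<open>[s, t]\<close> is quadratic in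
  \<open>K t - K s\<close>, and quantities with quadratically small increments are constant.
\<close>

section \<open>Square integrable functions\<close>

lemma Lp2_iff:
  "f \<in> Lp 2 M \<longleftrightarrow> f \<in> borel_measurable M \<and> integrable M (\<lambda>x. (norm (f x))\<^sup>2)"
  by (simp add: Lp_def)

lemma Lp2_norm: "Lp_norm 2 M f = sqrt (\<integral>x. (norm (f x))\<^sup>2 \<partial>M)"
  by (simp add: Lp_norm_def powr_half_sqrt)

lemma Lp2_norm_sq: "(Lp_norm 2 M f)\<^sup>2 = (\<integral>x. (norm (f x))\<^sup>2 \<partial>M)"
  by (simp add: Lp2_norm)

lemma Lp_norm_nonneg [simp]: "0 \<le> Lp_norm p M f"
  by (simp add: Lp_norm_def)

lemma Lp_norm_zero [simp]: "Lp_norm p M (\<lambda>x. 0) = 0"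
  by (simp add: Lp_norm_def)

lemma Lp2_measurable: "f \<in> Lp 2 M \<Longrightarrow> f \<in> borel_measurable M"
  by (simp add: Lp2_iff)

lemma Lp2_integrable: "f \<in> Lp 2 M \<Longrightarrow> integrable M (\<lambda>x. (norm (f x))\<^sup>2)"
  by (simp add: Lp2_iff)

lemma mult_norm_le_squares: "\<bar>a * b\<bar> \<le> a\<^sup>2 + (b::real)\<^sup>2"
proof -
  have "2 * \<bar>a * b\<bar> \<le> a\<^sup>2 + b\<^sup>2"
    using sum_squares_bound[of "\<bar>a\<bar>" "\<bar>b\<bar>"] by (simp add: abs_mult)
  then show ?thesis by (smt (verit) abs_ge_zero)
qed

lemma Lp2_integrable_norm_mult:
  assumes "f \<in> Lp 2 M" "g \<in> Lp 2 M"
  shows "integrable M (\<lambda>x. norm (f x) * norm (g x))"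
proof (rule Bochner_Integration.integrable_bound)
  show "integrable M (\<lambda>x. (norm (f x))\<^sup>2 + (norm (g x))\<^sup>2)"
    using assms by (simp add: Lp2_iff)
  show "(\<lambda>x. norm (f x) * norm (g x)) \<in> borel_measurable M"
    using assms by (auto simp: Lp2_iff)
  show "AE x in M. norm (norm (f x) * norm (g x)) \<le> norm ((norm (f x))\<^sup>2 + (norm (g x))\<^sup>2)"
    using order_trans[OF mult_norm_le_squares abs_ge_self]
    by (intro AE_I2) (simp only: real_norm_def)
qed

lemma Lp2_integrable_inner:
  assumes "f \<in> Lp 2 M" "g \<in> Lp 2 M"
  shows "integrable M (\<lambda>x. f x \<bullet> g x)"
proof (rule Bochner_Integration.integrable_bound)
  show "integrable M (\<lambda>x. norm (f x) * norm (g x))"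
    by (rule Lp2_integrable_norm_mult[OF assms])
  show "(\<lambda>x. f x \<bullet> g x) \<in> borel_measurable M"
    using assms by (auto simp: Lp2_iff)
  show "AE x in M. norm (f x \<bullet> g x) \<le> norm (norm (f x) * norm (g x))"
    using Cauchy_Schwarz_ineq2 by (intro AE_I2) auto
qed

lemma Lp2_integrable_mult:
  fixes f g :: "'a \<Rightarrow> real"
  assumes "f \<in> Lp 2 M" "g \<in> Lp 2 M"
  shows "integrable M (\<lambda>x. f x * g x)"
  using Lp2_integrable_inner[OF assms] by simp

lemma Lp2_integral_norm_mult_le:
  assumes f: "f \<in> Lp 2 M" and g: "g \<in> Lp 2 M"
  shows "(\<integral>x. norm (f x) * norm (g x) \<partial>M) \<le> Lp_norm 2 M f * Lp_norm 2 M g"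
proof -
  define I where "I = (\<integral>x. norm (f x) * norm (g x) \<partial>M)"
  have [measurable]: "f \<in> borel_measurable M" "g \<in> borel_measurable M"
    using f g by (auto simp: Lp2_iff)
  have I0: "I \<ge> 0" unfolding I_def by (intro integral_nonneg_AE) auto
  have "(\<integral>\<^sup>+x. ennreal (norm (f x)) * ennreal (norm (g x)) \<partial>M)\<^sup>2
      \<le> (\<integral>\<^sup>+x. (ennreal (norm (f x)))\<^sup>2 \<partial>M) * (\<integral>\<^sup>+x. (ennreal (norm (g x)))\<^sup>2 \<partial>M)"
    by (rule Cauchy_Schwarz_nn_integral) auto
  also have "(\<integral>\<^sup>+x. ennreal (norm (f x)) * ennreal (norm (g x)) \<partial>M) = ennreal I"
    unfolding I_def
    by (subst nn_integral_eq_integral[symmetric])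
      (auto simp: ennreal_mult Lp2_integrable_norm_mult[OF f g])
  also have "(\<integral>\<^sup>+x. (ennreal (norm (f x)))\<^sup>2 \<partial>M) = ennreal (\<integral>x. (norm (f x))\<^sup>2 \<partial>M)"
    by (subst nn_integral_eq_integral[symmetric]) (auto simp: ennreal_power Lp2_integrable[OF f])
  also have "(\<integral>\<^sup>+x. (ennreal (norm (g x)))\<^sup>2 \<partial>M) = ennreal (\<integral>x. (norm (g x))\<^sup>2 \<partial>M)"
    by (subst nn_integral_eq_integral[symmetric]) (auto simp: ennreal_power Lp2_integrable[OF g])
  finally have "ennreal (I\<^sup>2) \<le> ennreal ((Lp_norm 2 M f)\<^sup>2 * (Lp_norm 2 M g)\<^sup>2)"
    using I0 by (simp add: ennreal_power ennreal_mult' Lp2_norm_sq)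
  then have "I\<^sup>2 \<le> (Lp_norm 2 M f * Lp_norm 2 M g)\<^sup>2"
    by (subst (asm) ennreal_le_iff) (auto simp: power_mult_distrib)
  then show ?thesis
    unfolding I_def[symmetric] using Lp_norm_nonneg by (meson mult_nonneg_nonneg power2_le_imp_le)
qed

lemma Lp2_integral_inner_le:
  assumes f: "f \<in> Lp 2 M" and g: "g \<in> Lp 2 M"
  shows "\<bar>\<integral>x. f x \<bullet> g x \<partial>M\<bar> \<le> Lp_norm 2 M f * Lp_norm 2 M g"
proof -
  have "\<bar>\<integral>x. f x \<bullet> g x \<partial>M\<bar> \<le> (\<integral>x. norm (f x) * norm (g x) \<partial>M)"
    using Cauchy_Schwarz_ineq2
    by (intro integral_abs_bound[THEN order_trans] integral_mono)
       (auto intro!: integrable_abs Lp2_integrable_inner Lp2_integrable_norm_mult f g)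
  then show ?thesis using Lp2_integral_norm_mult_le[OF f g] by linarith
qed

lemma Lp2_integral_mult_le:
  fixes f g :: "'a \<Rightarrow> real"
  assumes f: "f \<in> Lp 2 M" and g: "g \<in> Lp 2 M"
  shows "\<bar>\<integral>x. f x * g x \<partial>M\<bar> \<le> Lp_norm 2 M f * Lp_norm 2 M g"
  using Lp2_integral_inner_le[OF assms] by simp

lemma Lp2_0 [simp]: "(\<lambda>x. 0) \<in> Lp 2 M"
  by (simp add: Lp2_iff)

lemma Lp2_scale: "f \<in> Lp 2 M \<Longrightarrow> (\<lambda>x. c *\<^sub>R f x) \<in> Lp 2 M"
  by (auto simp: Lp2_iff power_mult_distrib)

lemma Lp2_add:
  assumes f: "f \<in> Lp 2 M" and g: "g \<in> Lp 2 M"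
  shows "(\<lambda>x. f x + g x) \<in> Lp 2 M"
  unfolding Lp2_iff
proof
  show "(\<lambda>x. f x + g x) \<in> borel_measurable M" using f g by (auto simp: Lp2_iff)
  have "integrable M (\<lambda>x. (norm (f x))\<^sup>2 + 2 * (f x \<bullet> g x) + (norm (g x))\<^sup>2)"
    using f g by (simp add: Lp2_iff Lp2_integrable_inner[OF f g])
  then show "integrable M (\<lambda>x. (norm (f x + g x))\<^sup>2)"
    by (simp add: power2_norm_eq_inner inner_simps inner_commute algebra_simps)
qed

lemma Lp2_uminus: "f \<in> Lp 2 M \<Longrightarrow> (\<lambda>x. - f x) \<in> Lp 2 M"
  using Lp2_scale[of f M "-1"] by simp

lemma Lp2_diff: "f \<in> Lp 2 M \<Longrightarrow> g \<in> Lp 2 M \<Longrightarrow> (\<lambda>x. f x - g x) \<in> Lp 2 M"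
  using Lp2_add[of f M "\<lambda>x. - g x"] Lp2_uminus[of g M] by simp

lemma Lp2_norm_triangle:
  assumes f: "f \<in> Lp 2 M" and g: "g \<in> Lp 2 M"
  shows "Lp_norm 2 M (\<lambda>x. f x + g x) \<le> Lp_norm 2 M f + Lp_norm 2 M g"
proof (rule power2_le_imp_le)
  have "(Lp_norm 2 M (\<lambda>x. f x + g x))\<^sup>2
      = (\<integral>x. (norm (f x))\<^sup>2 + 2 * (f x \<bullet> g x) + (norm (g x))\<^sup>2 \<partial>M)"
    unfolding Lp2_norm_sq
    by (simp add: power2_norm_eq_inner inner_simps inner_commute algebra_simps)
  also have "\<dots> = (Lp_norm 2 M f)\<^sup>2 + 2 * (\<integral>x. f x \<bullet> g x \<partial>M) + (Lp_norm 2 M g)\<^sup>2"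
    using f g by (simp add: Lp2_iff Lp2_integrable_inner[OF f g] Lp2_norm_sq)
  also have "\<dots> \<le> (Lp_norm 2 M f + Lp_norm 2 M g)\<^sup>2"
    using Lp2_integral_inner_le[OF f g] by (simp add: power2_sum)
  finally show "(Lp_norm 2 M (\<lambda>x. f x + g x))\<^sup>2 \<le> (Lp_norm 2 M f + Lp_norm 2 M g)\<^sup>2" .
qed simp

lemma Lp2_norm_diff_triangle:
  assumes f: "f \<in> Lp 2 M" and g: "g \<in> Lp 2 M"
  shows "Lp_norm 2 M (\<lambda>x. f x - g x) \<le> Lp_norm 2 M f + Lp_norm 2 M g"
proof -
  have "Lp_norm 2 M (\<lambda>x. f x + - g x) \<le> Lp_norm 2 M f + Lp_norm 2 M (\<lambda>x. - g x)"
    by (intro Lp2_norm_triangle f Lp2_uminus g)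
  then show ?thesis by (simp add: Lp_norm_def)
qed

lemma Lp_norm_cong_AE:
  assumes "AE x in M. f x = g x" "f \<in> borel_measurable M" "g \<in> borel_measurable M"
  shows "Lp_norm p M f = Lp_norm p M g"
proof -
  have "(\<integral>x. norm (f x) powr p \<partial>M) = (\<integral>x. norm (g x) powr p \<partial>M)"
    using assms by (intro integral_cong_AE) auto
  then show ?thesis by (simp add: Lp_norm_def)
qed

lemma Lp2_norm_eq_0:
  assumes "f \<in> Lp 2 M" "Lp_norm 2 M f = 0"
  shows "AE x in M. f x = 0"
proof -
  have "(\<integral>x. (norm (f x))\<^sup>2 \<partial>M) = 0"
    using assms by (simp add: Lp2_norm)
  then have "AE x in M. (norm (f x))\<^sup>2 = 0"
    using integral_nonneg_eq_0_iff_AE[of M "\<lambda>x. (norm (f x))\<^sup>2"] assms(1) by (auto simp: Lp2_iff)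
  then show ?thesis by auto
qed

lemma Lp2_mono:
  assumes g: "g \<in> Lp 2 M" and f: "f \<in> borel_measurable M" and le: "AE x in M. norm (f x) \<le> norm (g x)"
  shows "f \<in> Lp 2 M" "Lp_norm 2 M f \<le> Lp_norm 2 M g"
proof -
  have i: "integrable M (\<lambda>x. (norm (f x))\<^sup>2)"
    by (rule Bochner_Integration.integrable_bound[of _ "\<lambda>x. (norm (g x))\<^sup>2"])
       (use g f le in \<open>auto simp: Lp2_iff power_mono\<close>)
  then show "f \<in> Lp 2 M" using f by (simp add: Lp2_iff)
  show "Lp_norm 2 M f \<le> Lp_norm 2 M g"
    unfolding Lp2_norm using i g le
    by (intro real_sqrt_le_mono integral_mono_AE) (auto simp: Lp2_iff power_mono)
qed

lemma Lp2_bounded_mult: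
  fixes a :: "'a \<Rightarrow> real"
  assumes f: "f \<in> Lp 2 M" and a: "a \<in> borel_measurable M" and le: "AE x in M. \<bar>a x\<bar> \<le> C"
  shows "(\<lambda>x. a x *\<^sub>R f x) \<in> Lp 2 M" "Lp_norm 2 M (\<lambda>x. a x *\<^sub>R f x) \<le> \<bar>C\<bar> * Lp_norm 2 M f"
proof -
  have 1: "(\<lambda>x. C *\<^sub>R f x) \<in> Lp 2 M" by (rule Lp2_scale[OF f])
  have 2: "AE x in M. norm (a x *\<^sub>R f x) \<le> norm (C *\<^sub>R f x)"
    using le by eventually_elim (auto intro!: mult_right_mono)
  have 3: "(\<lambda>x. a x *\<^sub>R f x) \<in> borel_measurable M" using a f by (auto simp: Lp2_iff)
  show "(\<lambda>x. a x *\<^sub>R f x) \<in> Lp 2 M" by (rule Lp2_mono(1)[OF 1 3 2])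
  have "Lp_norm 2 M (\<lambda>x. C *\<^sub>R f x) = \<bar>C\<bar> * Lp_norm 2 M f"
    by (simp add: Lp2_norm power_mult_distrib real_sqrt_mult)
  then show "Lp_norm 2 M (\<lambda>x. a x *\<^sub>R f x) \<le> \<bar>C\<bar> * Lp_norm 2 M f"
    using Lp2_mono(2)[OF 1 3 2] by simp
qed

lemma Lp2_bounded:
  assumes "finite_measure M" "f \<in> borel_measurable M" "AE x in M. norm (f x) \<le> C"
  shows "f \<in> Lp 2 M"
proof -
  interpret finite_measure M by fact
  have "integrable M (\<lambda>x. (norm (f x))\<^sup>2)"
    by (rule integrable_const_bound[where B="C\<^sup>2"]) (use assms in \<open>auto simp: power_mono\<close>)
  then show ?thesis using assms by (simp add: Lp2_iff)
qed

lemma Lp2_finite_integrable: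
  fixes f :: "'a \<Rightarrow> 'b::euclidean_space"
  assumes "finite_measure M" "f \<in> Lp 2 M"
  shows "integrable M f"
proof -
  interpret finite_measure M by fact
  have "integrable M (\<lambda>x. norm (f x) * norm (1::real))"
    by (rule Lp2_integrable_norm_mult[OF assms(2) Lp2_bounded[where C=1]]) (auto simp: assms(1))
  then show ?thesis using assms(2) by (simp add: Lp2_iff integrable_norm_iff)
qed

text \<open>Fatou's lemma for the norm.\<close>

lemma Lp2_Fatou:
  fixes f :: "nat \<Rightarrow> 'a \<Rightarrow> 'b::euclidean_space"
  assumes f: "\<And>n. f n \<in> Lp 2 M" and lim: "AE x in M. (\<lambda>n. f n x) \<longlonglongrightarrow> g x"
    and g: "g \<in> borel_measurable M" and le: "\<forall>\<^sub>F n in sequentially. Lp_norm 2 M (f n) \<le> C"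
  shows "g \<in> Lp 2 M" "Lp_norm 2 M g \<le> C"
proof -
  have [measurable]: "\<And>n. f n \<in> borel_measurable M" using f by (auto simp: Lp2_iff)
  obtain n0 where "Lp_norm 2 M (f n0) \<le> C" using eventually_happens[OF le] by auto
  then have C: "C \<ge> 0" using Lp_norm_nonneg[of 2 M "f n0"] by linarith
  have eq: "(\<integral>\<^sup>+x. ennreal ((norm (f n x))\<^sup>2) \<partial>M) = ennreal ((Lp_norm 2 M (f n))\<^sup>2)" for n
    unfolding Lp2_norm_sq by (intro nn_integral_eq_integral Lp2_integrable f) auto
  have "(\<integral>\<^sup>+x. ennreal ((norm (g x))\<^sup>2) \<partial>M) = (\<integral>\<^sup>+x. liminf (\<lambda>n. ennreal ((norm (f n x))\<^sup>2)) \<partial>M)"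
  proof (rule nn_integral_cong_AE, use lim in eventually_elim)
    fix x assume "(\<lambda>n. f n x) \<longlonglongrightarrow> g x"
    then have "(\<lambda>n. ennreal ((norm (f n x))\<^sup>2)) \<longlonglongrightarrow> ennreal ((norm (g x))\<^sup>2)"
      by (intro tendsto_intros) auto
    then show "ennreal ((norm (g x))\<^sup>2) = liminf (\<lambda>n. ennreal ((norm (f n x))\<^sup>2))"
      using lim_imp_Liminf[OF sequentially_bot] by metis
  qed
  also have "\<dots> \<le> liminf (\<lambda>n. \<integral>\<^sup>+x. ennreal ((norm (f n x))\<^sup>2) \<partial>M)"
    by (rule nn_integral_liminf) auto
  also have "\<dots> \<le> limsup (\<lambda>n. \<integral>\<^sup>+x. ennreal ((norm (f n x))\<^sup>2) \<partial>M)"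
    by (rule Liminf_le_Limsup) auto
  also have "\<dots> \<le> ennreal (C\<^sup>2)"
    by (rule Limsup_bounded) (use le in eventually_elim, auto simp: eq intro!: ennreal_leI power_mono)
  finally have nn: "(\<integral>\<^sup>+x. ennreal ((norm (g x))\<^sup>2) \<partial>M) \<le> ennreal (C\<^sup>2)" .
  then have i: "integrable M (\<lambda>x. (norm (g x))\<^sup>2)"
    using g by (intro integrableI_nonneg) (auto simp: le_less_trans)
  then show "g \<in> Lp 2 M" using g by (simp add: Lp2_iff)
  have "(\<integral>x. (norm (g x))\<^sup>2 \<partial>M) \<le> C\<^sup>2"
    using nn nn_integral_eq_integral[OF i] by (simp add: ennreal_le_iff)
  then show "Lp_norm 2 M g \<le> C" unfolding Lp2_norm using C real_sqrt_le_mono by fastforce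
qed

lemma Lp2_tendsto_AE_subseq:
  fixes f :: "nat \<Rightarrow> 'a \<Rightarrow> 'b::euclidean_space"
  assumes f: "\<And>n. f n \<in> Lp 2 M" and g: "g \<in> Lp 2 M"
    and lim: "(\<lambda>n. Lp_norm 2 M (\<lambda>x. f n x - g x)) \<longlonglongrightarrow> 0"
  shows "\<exists>r. strict_mono r \<and> (AE x in M. (\<lambda>n. f (r n) x) \<longlonglongrightarrow> g x)"
proof -
  have "\<exists>r::nat\<Rightarrow>nat. strict_mono r \<and> (AE x in M. (\<lambda>n. (norm (f (r n) x - g x))\<^sup>2) \<longlonglongrightarrow> 0)"
  proof (rule tendsto_L1_AE_subseq)
    show "integrable M (\<lambda>x. (norm (f n x - g x))\<^sup>2)" for n
      by (rule Lp2_integrable[OF Lp2_diff[OF f g]])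
    have "(\<lambda>n. (Lp_norm 2 M (\<lambda>x. f n x - g x))\<^sup>2) \<longlonglongrightarrow> 0\<^sup>2"
      by (rule tendsto_power[OF lim])
    then show "(\<lambda>n. \<integral>x. norm ((norm (f n x - g x))\<^sup>2) \<partial>M) \<longlonglongrightarrow> 0"
      by (simp add: Lp2_norm_sq)
  qed
  then obtain r :: "nat \<Rightarrow> nat"
    where r: "strict_mono r" "AE x in M. (\<lambda>n. (norm (f (r n) x - g x))\<^sup>2) \<longlonglongrightarrow> 0" by blast
  have "AE x in M. (\<lambda>n. f (r n) x) \<longlonglongrightarrow> g x"
    using r(2)
  proof eventually_elim
    case (elim x)
    then have "(\<lambda>n. sqrt ((norm (f (r n) x - g x))\<^sup>2)) \<longlonglongrightarrow> sqrt 0" by (rule tendsto_real_sqrt)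
    then show ?case by (simp add: LIM_zero_iff tendsto_norm_zero_iff)
  qed
  then show ?thesis using r(1) by blast
qed

lemma Lp2_norm_sum:
  assumes "\<And>i. i \<in> I \<Longrightarrow> f i \<in> Lp 2 M"
  shows "(\<lambda>x. \<Sum>i\<in>I. f i x) \<in> Lp 2 M \<and> Lp_norm 2 M (\<lambda>x. \<Sum>i\<in>I. f i x) \<le> (\<Sum>i\<in>I. Lp_norm 2 M (f i))"
  using assms
proof (induction I rule: infinite_finite_induct)
  case (insert i I)
  have i: "f i \<in> Lp 2 M" and I: "(\<lambda>x. \<Sum>i\<in>I. f i x) \<in> Lp 2 M"
      "Lp_norm 2 M (\<lambda>x. \<Sum>i\<in>I. f i x) \<le> (\<Sum>i\<in>I. Lp_norm 2 M (f i))"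
    using insert by auto
  show ?case
    using insert.hyps Lp2_add[OF i I(1)] Lp2_norm_triangle[OF i I(1)] I(2) by simp
qed auto

text \<open>
  Riesz--Fischer: along a subsequence the increments have summable norms, so that the series
  of their absolute values is square integrable and the subsequence converges almost everywhere.
\<close>

lemma Lp2_complete:
  fixes f :: "nat \<Rightarrow> 'a \<Rightarrow> 'b::euclidean_space"
  assumes f: "\<And>n. f n \<in> Lp 2 M"
    and cauchy: "\<And>e. e > 0 \<Longrightarrow> \<exists>N. \<forall>m\<ge>N. \<forall>n\<ge>N. Lp_norm 2 M (\<lambda>x. f m x - f n x) < e"
  shows "\<exists>g\<in>Lp 2 M. (\<lambda>n. Lp_norm 2 M (\<lambda>x. f n x - g x)) \<longlonglongrightarrow> 0"
proof -
  have [measurable]: "\<And>n. f n \<in> borel_measurable M" using f by (auto simp: Lp2_iff)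
  have "\<forall>k::nat. \<exists>N. \<forall>m\<ge>N. \<forall>n\<ge>N. Lp_norm 2 M (\<lambda>x. f m x - f n x) < (1/2)^k"
    using cauchy by auto
  then obtain N0 where N0: "\<And>k m n. m \<ge> N0 k \<Longrightarrow> n \<ge> N0 k \<Longrightarrow> Lp_norm 2 M (\<lambda>x. f m x - f n x) < (1/2)^k"
    by metis
  define r where "r k = (\<Sum>j\<le>k. N0 j) + k" for k
  have r_ge: "r m \<ge> N0 k" if "m \<ge> k" for m k
  proof -
    have "N0 k \<le> (\<Sum>j\<le>m. N0 j)" using that by (intro member_le_sum) auto
    then show ?thesis by (simp add: r_def)
  qed
  have r_ge': "r m \<ge> m" for m by (simp add: r_def)
  define D where "D k x = f (r (Suc k)) x - f (r k) x" for k x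
  have D: "D k \<in> Lp 2 M" for k unfolding D_def by (intro Lp2_diff f)
  have [measurable]: "D k \<in> borel_measurable M" for k using D by (auto simp: Lp2_iff)
  have ND: "Lp_norm 2 M (D k) \<le> (1/2)^k" for k
    unfolding D_def using N0[OF r_ge r_ge, of k "Suc k" k] by simp
  define S where "S n x = (\<Sum>k<n. norm (D k x))" for n x
  have SL: "S n \<in> Lp 2 M \<and> Lp_norm 2 M (S n) \<le> 2" for n
  proof -
    have 1: "(\<lambda>x. norm (D k x)) \<in> Lp 2 M" for k using D[of k] by (auto simp: Lp2_iff)
    have "S n \<in> Lp 2 M \<and> Lp_norm 2 M (S n) \<le> (\<Sum>k<n. Lp_norm 2 M (\<lambda>x. norm (D k x)))"
      unfolding S_def by (rule Lp2_norm_sum[OF 1])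
    moreover have "(\<Sum>k<n. Lp_norm 2 M (\<lambda>x. norm (D k x))) \<le> (\<Sum>k<n. (1/2)^k)"
      using ND by (intro sum_mono) (simp add: Lp_norm_def)
    moreover have "(\<Sum>k<n. (1/2::real)^k) \<le> 2"
      by (simp add: geometric_sum)
    ultimately show ?thesis by linarith
  qed
  have "(\<integral>\<^sup>+x. (SUP n. ennreal ((S n x)\<^sup>2)) \<partial>M) = (SUP n. \<integral>\<^sup>+x. ennreal ((S n x)\<^sup>2) \<partial>M)"
  proof (rule nn_integral_monotone_convergence_SUP)
    show "incseq (\<lambda>n x. ennreal ((S n x)\<^sup>2))"
      unfolding incseq_def le_fun_def
      by (auto intro!: ennreal_leI power_mono sum_mono2 simp: S_def sum_nonneg)
  qed (auto simp: S_def)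
  also have "\<dots> \<le> 4"
  proof (rule SUP_least)
    fix n
    have "(\<integral>\<^sup>+x. ennreal ((S n x)\<^sup>2) \<partial>M) = ennreal ((Lp_norm 2 M (S n))\<^sup>2)"
      unfolding Lp2_norm_sq
      using SL[of n] by (subst nn_integral_eq_integral) (auto simp: Lp2_iff)
    also have "\<dots> \<le> ennreal (2\<^sup>2)"
      using SL[of n] by (intro ennreal_leI power_mono) auto
    finally show "(\<integral>\<^sup>+x. ennreal ((S n x)\<^sup>2) \<partial>M) \<le> 4" by simp
  qed
  finally have fin: "(\<integral>\<^sup>+x. (SUP n. ennreal ((S n x)\<^sup>2)) \<partial>M) \<noteq> \<infinity>"
    by (auto simp: top_unique)
  have "AE x in M. (SUP n. ennreal ((S n x)\<^sup>2)) \<noteq> \<infinity>"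
    by (rule nn_integral_PInf_AE[OF _ fin]) (auto simp: S_def)
  then have conv: "AE x in M. convergent (\<lambda>k. f (r k) x)"
  proof eventually_elim
    case (elim x)
    then obtain B where B: "B \<ge> 0" "(SUP n. ennreal ((S n x)\<^sup>2)) = ennreal B" by (cases "(SUP n. ennreal ((S n x)\<^sup>2))") auto
    have "(S n x)\<^sup>2 \<le> B" for n
    proof -
      have "ennreal ((S n x)\<^sup>2) \<le> ennreal B" unfolding B(2)[symmetric] by (rule SUP_upper) simp
      then show ?thesis using B(1) by simp
    qed
    then have "S n x \<le> sqrt B" for n by (simp add: real_le_rsqrt)
    then have "summable (\<lambda>k. norm (D k x))"
      by (intro summableI_nonneg_bounded[where x="sqrt B"]) (auto simp: S_def)
    then have "summable (\<lambda>k. D k x)" by (rule summable_norm_cancel)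
    then have "convergent (\<lambda>n. \<Sum>k<n. D k x)" by (simp add: summable_iff_convergent)
    moreover have "(\<Sum>k<n. D k x) = f (r n) x - f (r 0) x" for n
      unfolding D_def by (rule sum_lessThan_telescope)
    ultimately have "convergent (\<lambda>n. (f (r n) x - f (r 0) x) + f (r 0) x)"
      by (intro convergent_add convergent_const) simp
    then show ?case by simp
  qed
  define g where "g x = lim (\<lambda>k. f (r k) x)" for x
  have gm: "g \<in> borel_measurable M" unfolding g_def by measurable
  have lim: "AE x in M. (\<lambda>k. f (r k) x) \<longlonglongrightarrow> g x"
    using conv unfolding g_def by eventually_elim (simp add: convergent_LIMSEQ_iff)
  have est: "(\<lambda>x. f n x - g x) \<in> Lp 2 M \<and> Lp_norm 2 M (\<lambda>x. f n x - g x) \<le> e"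
    if e: "e > 0" and N: "\<And>m n. m \<ge> N \<Longrightarrow> n \<ge> N \<Longrightarrow> Lp_norm 2 M (\<lambda>x. f m x - f n x) < e" and n: "n \<ge> N"
    for e N n
  proof -
    have 1: "AE x in M. (\<lambda>k. f n x - f (r k) x) \<longlonglongrightarrow> f n x - g x"
      using lim by eventually_elim (intro tendsto_intros)
    have 2: "\<forall>\<^sub>F k in sequentially. Lp_norm 2 M (\<lambda>x. f n x - f (r k) x) \<le> e"
      using eventually_ge_at_top[of N]
    proof eventually_elim
      case (elim k)
      then have "r k \<ge> N" using r_ge'[of k] by simp
      from N[OF n this] show ?case by simp
    qed
    have 3: "(\<lambda>x. f n x - g x) \<in> borel_measurable M" using gm by auto
    have 4: "(\<lambda>x. f n x - f (r k) x) \<in> Lp 2 M" for k by (intro Lp2_diff f)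
    show ?thesis using Lp2_Fatou[OF 4 1 3 2] by blast
  qed
  obtain N1 where N1: "\<And>m n. m \<ge> N1 \<Longrightarrow> n \<ge> N1 \<Longrightarrow> Lp_norm 2 M (\<lambda>x. f m x - f n x) < 1"
    using cauchy[of 1] by auto
  have "(\<lambda>x. f N1 x - g x) \<in> Lp 2 M"
    using est[where e=1 and N=N1 and n=N1] N1 by auto
  from Lp2_diff[OF f[of N1] this] have g: "g \<in> Lp 2 M" by simp
  have "(\<lambda>n. Lp_norm 2 M (\<lambda>x. f n x - g x)) \<longlonglongrightarrow> 0"
  proof (rule LIMSEQ_I)
    fix e :: real assume e: "e > 0"
    then obtain N where N: "\<And>m n. m \<ge> N \<Longrightarrow> n \<ge> N \<Longrightarrow> Lp_norm 2 M (\<lambda>x. f m x - f n x) < e/2"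
      using cauchy[of "e/2"] by auto
    have "norm (Lp_norm 2 M (\<lambda>x. f n x - g x) - 0) < e" if "n \<ge> N" for n
      using est[OF _ N that] e by auto
    then show "\<exists>N. \<forall>n\<ge>N. norm (Lp_norm 2 M (\<lambda>x. f n x - g x) - 0) < e" by blast
  qed
  then show ?thesis using g by blast
qed

section \<open>Seminormed function spaces\<close>

text \<open>
  Closure under differences and the triangle inequality for differences also give sums, negatives
  and the symmetry of the distance.
\<close>

definition seminormed_space :: "('a \<Rightarrow> 'b::real_vector) set \<Rightarrow> (('a \<Rightarrow> 'b) \<Rightarrow> real) \<Rightarrow> bool" where
  "seminormed_space X N \<longleftrightarrow> (\<lambda>_. 0) \<in> X \<and> N (\<lambda>_. 0) = 0 \<and>
     (\<forall>f\<in>X. \<forall>g\<in>X. (\<lambda>x. f x - g x) \<in> X \<and> N (\<lambda>x. f x - g x) \<le> N f + N g) \<and> (\<forall>f\<in>X. 0 \<le> N f)"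

lemma seminormed_space_Lp2: "seminormed_space (Lp 2 M) (Lp_norm 2 M)"
  unfolding seminormed_space_def by (auto intro: Lp2_diff Lp2_norm_diff_triangle)

lemma seminormed_spaceD:
  assumes "seminormed_space X N" "f \<in> X" "g \<in> X"
  shows "(\<lambda>x. f x - g x) \<in> X" "N (\<lambda>x. f x - g x) \<le> N f + N g" "0 \<le> N f"
    "(\<lambda>x. f x + g x) \<in> X" "N (\<lambda>x. f x + g x) \<le> N f + N g"
    "N (\<lambda>x. f x - g x) = N (\<lambda>x. g x - f x)"
proof -
  have z: "(\<lambda>_. 0) \<in> X" "N (\<lambda>_. 0) = 0" using assms(1) by (auto simp: seminormed_space_def)
  have d: "(\<lambda>x. f x - g x) \<in> X \<and> N (\<lambda>x. f x - g x) \<le> N f + N g" if "f \<in> X" "g \<in> X" for f g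
    using assms(1) that by (auto simp: seminormed_space_def)
  show "(\<lambda>x. f x - g x) \<in> X" "N (\<lambda>x. f x - g x) \<le> N f + N g" using d assms by auto
  show "0 \<le> N f" using assms by (auto simp: seminormed_space_def)
  have m: "(\<lambda>x. - f x) \<in> X" "N (\<lambda>x. - f x) \<le> N f" if "f \<in> X" for f
    using d[OF z(1) that] z(2) by auto
  have "(\<lambda>x. f x + g x) \<in> X \<and> N (\<lambda>x. f x + g x) \<le> N f + N (\<lambda>x. - g x)"
    using d[OF assms(2) m(1)[OF assms(3)]] by simp
  then show "(\<lambda>x. f x + g x) \<in> X" "N (\<lambda>x. f x + g x) \<le> N f + N g"
    using m(2)[OF assms(3)] by auto
  have "N (\<lambda>x. g x - f x) \<le> N (\<lambda>x. f x - g x)" if "f \<in> X" "g \<in> X" for f g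
    using m(2)[of "\<lambda>x. f x - g x"] d[OF that] by simp
  then show "N (\<lambda>x. f x - g x) = N (\<lambda>x. g x - f x)" using assms by (meson antisym)
qed

lemma seminormed_space_triangle:
  assumes "seminormed_space X N" "f \<in> X" "g \<in> X" "h \<in> X"
  shows "N (\<lambda>x. f x - h x) \<le> N (\<lambda>x. f x - g x) + N (\<lambda>x. g x - h x)"
  using seminormed_spaceD(5)[OF assms(1) seminormed_spaceD(1)[OF assms(1,2,3)]
      seminormed_spaceD(1)[OF assms(1,3,4)]] by simp

lemma seminormed_space_abs_diff:
  assumes "seminormed_space X N" "f \<in> X" "g \<in> X"
  shows "\<bar>N f - N g\<bar> \<le> N (\<lambda>x. f x - g x)"
proof -
  have z: "(\<lambda>_. 0) \<in> X" using assms(1) by (auto simp: seminormed_space_def)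
  have "N f \<le> N (\<lambda>x. f x - g x) + N g"
    using seminormed_space_triangle[OF assms(1,2,3) z] by simp
  moreover have "N g \<le> N (\<lambda>x. g x - f x) + N f"
    using seminormed_space_triangle[OF assms(1,3,2) z] by simp
  ultimately show ?thesis using seminormed_spaceD(6)[OF assms] by auto
qed

section \<open>Borel representatives\<close>

lemma lebesgue_on_AE_iff:
  assumes "S \<in> sets lebesgue"
  shows "(AE x in lebesgue_on S. P x) \<longleftrightarrow> (AE x in lborel. x \<in> S \<longrightarrow> P x)"
proof -
  have "(AE x in lebesgue_on S. P x) \<longleftrightarrow> (AE x in lebesgue. x \<in> S \<longrightarrow> P x)"
    using assms by (intro AE_restrict_space_iff) auto
  then show ?thesis by (simp add: AE_completion_iff)
qed

text \<open>
  Slices of a Lebesgue measurable function of two variables need not be measurable, those of a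
  Borel function are: this is why representatives are passed to before Fubini's theorem is used.
\<close>

lemma lebesgue_on_borel_representative:
  fixes f :: "'a::euclidean_space \<Rightarrow> 'b::euclidean_space"
  assumes S: "S \<in> sets lebesgue" and f: "f \<in> borel_measurable (lebesgue_on S)"
  obtains g where "g \<in> borel_measurable borel" "AE x in lborel. x \<in> S \<longrightarrow> f x = g x"
    "AE x in lborel. x \<notin> S \<longrightarrow> g x = 0"
proof -
  have "\<exists>h. h \<in> borel_measurable borel \<and> (AE x in lborel. (if x \<in> S then f x \<bullet> b else 0) = h x)" for b
  proof -
    have "(\<lambda>x. if x \<in> S then f x \<bullet> b else 0) \<in> borel_measurable (completion lborel)"
      by (rule borel_measurable_if_I) (use f S in auto)
    from completion_ex_borel_measurable_real[OF this] show ?thesis by auto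
  qed
  then have "\<exists>h. \<forall>b. h b \<in> borel_measurable borel \<and>
      (AE x in lborel. (if x \<in> S then f x \<bullet> b else 0) = h b x)"
    by (intro choice allI)
  then obtain h where h: "\<And>b. h b \<in> borel_measurable borel"
      "\<And>b. AE x in lborel. (if x \<in> S then f x \<bullet> b else 0) = h b x"
    by blast
  have "AE x in lborel. \<forall>b\<in>Basis. (if x \<in> S then f x \<bullet> b else 0) = h b x"
    using h(2) by (intro AE_ball_countable[THEN iffD2]) (auto simp: countable_finite)
  then have "AE x in lborel. (x \<in> S \<longrightarrow> f x = (\<Sum>b\<in>Basis. h b x *\<^sub>R b)) \<and>
      (x \<notin> S \<longrightarrow> (\<Sum>b\<in>Basis. h b x *\<^sub>R b) = 0)"
  proof eventually_elim
    case (elim x)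
    show ?case
    proof (cases "x \<in> S")
      case True
      then have "(\<Sum>b\<in>Basis. h b x *\<^sub>R b) = (\<Sum>b\<in>Basis. (f x \<bullet> b) *\<^sub>R b)"
        using elim by (intro sum.cong) auto
      then show ?thesis using True by (simp add: euclidean_representation)
    next
      case False
      then have "(\<Sum>b\<in>Basis. h b x *\<^sub>R b) = (\<Sum>b\<in>(Basis::'b set). 0)"
        using elim by (intro sum.cong) auto
      then show ?thesis using False by simp
    qed
  qed
  then have "AE x in lborel. x \<in> S \<longrightarrow> f x = (\<Sum>b\<in>Basis. h b x *\<^sub>R b)"
     "AE x in lborel. x \<notin> S \<longrightarrow> (\<Sum>b\<in>Basis. h b x *\<^sub>R b) = 0" by (auto elim: eventually_mono)
  with h(1) show thesis by (intro that[of "\<lambda>x. \<Sum>b\<in>Basis. h b x *\<^sub>R b"]) auto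
qed

lemma lebesgue_on_integral:
  fixes f g :: "'a::euclidean_space \<Rightarrow> 'b::euclidean_space"
  assumes S: "S \<in> sets borel" and g: "g \<in> borel_measurable borel"
    and eq: "AE x in lborel. x \<in> S \<longrightarrow> f x = g x" and f: "f \<in> borel_measurable (lebesgue_on S)"
  shows "integrable (lebesgue_on S) f \<longleftrightarrow> integrable lborel (\<lambda>x. indicator S x *\<^sub>R g x)"
    "integral\<^sup>L (lebesgue_on S) f = (\<integral>x. indicator S x *\<^sub>R g x \<partial>lborel)"
proof -
  have S': "S \<in> sets lebesgue" using S by auto
  have gm: "(\<lambda>x. indicator S x *\<^sub>R g x) \<in> borel_measurable lborel" using S g by measurable
  have gl: "g \<in> borel_measurable (lebesgue_on S)"
    using g by (intro measurable_restrict_space1 measurable_completion) auto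
  have ae: "AE x in lebesgue_on S. f x = g x" using eq lebesgue_on_AE_iff[OF S'] by auto
  have "integrable (lebesgue_on S) f \<longleftrightarrow> integrable (lebesgue_on S) g"
    using ae f gl by (intro integrable_cong_AE) auto
  also have "\<dots> \<longleftrightarrow> integrable lebesgue (\<lambda>x. indicator S x *\<^sub>R g x)"
    using S' by (intro integrable_restrict_space) auto
  also have "\<dots> \<longleftrightarrow> integrable lborel (\<lambda>x. indicator S x *\<^sub>R g x)"
    by (rule integrable_completion[OF gm])
  finally show "integrable (lebesgue_on S) f \<longleftrightarrow> integrable lborel (\<lambda>x. indicator S x *\<^sub>R g x)" .
  have "integral\<^sup>L (lebesgue_on S) f = integral\<^sup>L (lebesgue_on S) g"
    using ae f gl by (intro integral_cong_AE) auto
  also have "\<dots> = integral\<^sup>L lebesgue (\<lambda>x. indicator S x *\<^sub>R g x)"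
    using S' by (intro integral_restrict_space) auto
  also have "\<dots> = integral\<^sup>L lborel (\<lambda>x. indicator S x *\<^sub>R g x)"
    by (rule integral_completion[OF gm])
  finally show "integral\<^sup>L (lebesgue_on S) f = (\<integral>x. indicator S x *\<^sub>R g x \<partial>lborel)" .
qed

lemma finite_measure_lebesgue_on_bounded:
  assumes "bounded S" "S \<in> sets borel"
  shows "finite_measure (lebesgue_on (S::'a::euclidean_space set))"
proof
  have "emeasure lborel S < \<infinity>" using assms emeasure_bounded_finite by blast
  then show "emeasure (lebesgue_on S) (space (lebesgue_on S)) \<noteq> \<infinity>"
    using assms by (simp add: space_restrict_space emeasure_restrict_space emeasure_completion)
qed

lemma borel_measurable_lebesgue_on:
  fixes f :: "'a::euclidean_space \<Rightarrow> 'b::topological_space"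
  shows "f \<in> borel_measurable borel \<Longrightarrow> f \<in> borel_measurable (lebesgue_on S)"
  by (intro measurable_restrict_space1 measurable_completion) auto

section \<open>Calculus of smooth functions\<close>

lemma frechet_derivative_eq:
  "(f has_derivative f') (at x) \<Longrightarrow> frechet_derivative f (at x) = f'"
  by (metis frechet_derivative_at)

lemma C_k_SucI:
  assumes "\<And>x. (f has_derivative f' x) (at x)" "\<And>b. b \<in> Basis \<Longrightarrow> C_k k (\<lambda>x. f' x b)"
  shows "C_k (Suc k) f"
proof -
  have "frechet_derivative f (at x) = f' x" for x
    using frechet_derivative_eq[OF assms(1)] .
  then show ?thesis using assms by (auto simp: differentiable_def)
qed

lemma C_k_Suc_has_derivative:
  "C_k (Suc k) f \<Longrightarrow> (f has_derivative frechet_derivative f (at x)) (at x)"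
  by (simp add: frechet_derivative_works)

lemma C_k_Suc_imp: "C_k (Suc k) f \<Longrightarrow> C_k k f"
proof (induction k arbitrary: f)
  case 0
  then have "\<forall>x. f differentiable (at x)" by simp
  then show ?case by (simp add: continuous_at_imp_continuous_on differentiable_imp_continuous_within)
next
  case (Suc k)
  have "C_k k (\<lambda>x. frechet_derivative f (at x) b)" if "b \<in> Basis" for b
    using Suc.IH[of "\<lambda>x. frechet_derivative f (at x) b"] Suc.prems that by auto
  then show ?case using Suc.prems by auto
qed

lemma C_k_const: "C_k k (\<lambda>x. c)"
proof (induction k arbitrary: c)
  case (Suc k)
  then show ?case by (intro C_k_SucI[where f'="\<lambda>_ _. 0"]) auto
qed simp

lemma C_k_add: "C_k k f \<Longrightarrow> C_k k g \<Longrightarrow> C_k k (\<lambda>x. f x + g x)"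
proof (induction k arbitrary: f g)
  case (Suc k)
  show ?case
    by (intro C_k_SucI[where f'="\<lambda>x h. frechet_derivative f (at x) h + frechet_derivative g (at x) h"]
        has_derivative_add C_k_Suc_has_derivative[OF Suc.prems(1)] C_k_Suc_has_derivative[OF Suc.prems(2)] Suc.IH)
      (use Suc.prems in auto)
qed (auto intro: continuous_intros)

lemma C_k_sum: "(\<And>i. i \<in> I \<Longrightarrow> C_k k (f i)) \<Longrightarrow> C_k k (\<lambda>x. \<Sum>i\<in>I. f i x)"
  by (induction I rule: infinite_finite_induct) (auto intro: C_k_add C_k_const)

lemma C_k_mult: "C_k k f \<Longrightarrow> C_k k g \<Longrightarrow> C_k k (\<lambda>x. f x * g x)"
proof (induction k arbitrary: f g)
  case (Suc k)
  show ?case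
    by (intro C_k_SucI[where f'="\<lambda>x h. f x * frechet_derivative g (at x) h + frechet_derivative f (at x) h * g x"]
        has_derivative_mult C_k_Suc_has_derivative[OF Suc.prems(1)] C_k_Suc_has_derivative[OF Suc.prems(2)]
        C_k_add Suc.IH C_k_Suc_imp[OF Suc.prems(1)] C_k_Suc_imp[OF Suc.prems(2)])
      (use Suc.prems in auto)
qed (auto intro: continuous_intros)

lemma C_k_prod: "(\<And>i. i \<in> I \<Longrightarrow> C_k k (f i)) \<Longrightarrow> C_k k (\<lambda>x. \<Prod>i\<in>I. f i x)"
  by (induction I rule: infinite_finite_induct) (auto intro: C_k_mult C_k_const)

lemma C_k_affine:
  fixes f :: "'b::euclidean_space \<Rightarrow> real" and L :: "'a::euclidean_space \<Rightarrow> 'b"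
  assumes L: "bounded_linear L"
  shows "C_k k f \<Longrightarrow> C_k k (\<lambda>x. f (L x + a))"
proof (induction k arbitrary: f)
  case 0
  then have "continuous_on UNIV f" by simp
  moreover have "continuous_on UNIV (\<lambda>x. L x + a)"
    by (intro continuous_intros linear_continuous_on L)
  ultimately show ?case by (auto intro: continuous_on_compose2)
next
  case (Suc k)
  let ?D = "\<lambda>y. frechet_derivative f (at y)"
  have lin: "linear (?D y)" for y
    using Suc.prems by (intro linear_frechet_derivative) auto
  have D: "?D y h = (\<Sum>c\<in>Basis. (h \<bullet> c) * ?D y c)" for y h
    using Linear_Algebra.linear_componentwise[OF lin, of y h 1] by simp
  have 1: "((\<lambda>x. f (L x + a)) has_derivative (\<lambda>h. ?D (L x + a) (L h))) (at x)" for x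
    by (rule has_derivative_compose[OF _ C_k_Suc_has_derivative[OF Suc.prems]])
      (auto intro!: derivative_eq_intros bounded_linear_imp_has_derivative L)
  have 2: "C_k k (\<lambda>x. ?D (L x + a) (L b))" for b
    unfolding D[of _ "L b"]
    by (intro C_k_sum C_k_mult C_k_const Suc.IH) (use Suc.prems in auto)
  show ?case by (rule C_k_SucI[OF 1 2])
qed

lemma C_k_real_SucI:
  assumes "\<And>x. (f has_real_derivative f' x) (at x)" "C_k k f'"
  shows "C_k (Suc k) f"
proof (rule C_k_SucI)
  show "(f has_derivative (\<lambda>h. f' x * h)) (at x)" for x
    using assms(1) by (simp add: has_field_derivative_def)
  show "C_k k (\<lambda>x. f' x * b)" if "b \<in> Basis" for b
    using that assms(2) by simp
qed

lemma C_infinity_const: "(\<lambda>x. c) \<in> C_infinity"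
  by (simp add: C_infinity_def C_k_const)

lemma C_infinity_add: "f \<in> C_infinity \<Longrightarrow> g \<in> C_infinity \<Longrightarrow> (\<lambda>x. f x + g x) \<in> C_infinity"
  by (simp add: C_infinity_def C_k_add)

lemma C_infinity_mult: "f \<in> C_infinity \<Longrightarrow> g \<in> C_infinity \<Longrightarrow> (\<lambda>x. f x * g x) \<in> C_infinity"
  by (simp add: C_infinity_def C_k_mult)

lemma C_infinity_affine:
  "bounded_linear L \<Longrightarrow> f \<in> C_infinity \<Longrightarrow> (\<lambda>x. f (L x + a)) \<in> C_infinity"
  by (simp add: C_infinity_def C_k_affine)

lemma C_infinity_frechet_derivative:
  assumes "f \<in> C_infinity" "b \<in> Basis"
  shows "(\<lambda>x. frechet_derivative f (at x) b) \<in> C_infinity"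
proof -
  have "C_k (Suc k) f" for k using assms unfolding C_infinity_def by blast
  then show ?thesis using assms(2) by (auto simp: C_infinity_def)
qed

lemma C_infinity_has_derivative:
  "f \<in> C_infinity \<Longrightarrow> (f has_derivative frechet_derivative f (at x)) (at x)"
  using C_k_Suc_has_derivative[of 0] by (auto simp: C_infinity_def simp del: C_k.simps)

lemma C_infinity_continuous: "f \<in> C_infinity \<Longrightarrow> continuous_on UNIV f"
  using C_k.simps(1) by (auto simp: C_infinity_def simp del: C_k.simps)

lemma gradient_inner: "b \<in> Basis \<Longrightarrow> gradient f x \<bullet> b = frechet_derivative f (at x) b"
  by (simp add: gradient_def)

lemma has_derivative_gradient:
  assumes "(f has_derivative D) (at x)"
  shows "D = (\<lambda>h. gradient f x \<bullet> h)" "(f has_derivative (\<lambda>h. gradient f x \<bullet> h)) (at x)"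
proof -
  have eq: "frechet_derivative f (at x) = D" by (rule frechet_derivative_eq[OF assms])
  have lin: "linear D" using assms has_derivative_linear by blast
  have "D h = gradient f x \<bullet> h" for h
    using Linear_Algebra.linear_componentwise[OF lin, of h 1]
    unfolding gradient_def eq inner_sum_left inner_scaleR_left
    by (simp add: mult.commute inner_commute)
  then show "D = (\<lambda>h. gradient f x \<bullet> h)" by auto
  then show "(f has_derivative (\<lambda>h. gradient f x \<bullet> h)) (at x)" using assms by simp
qed

lemma gradient_eqI:
  assumes "(f has_derivative (\<lambda>h. v \<bullet> h)) (at x)"
  shows "gradient f x = v"
proof (rule euclidean_eqI)
  fix b :: 'a assume "b \<in> Basis"
  then show "gradient f x \<bullet> b = v \<bullet> b"
    using frechet_derivative_eq[OF assms] by (simp add: gradient_inner)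
qed

lemma gradient_mult:
  assumes "f \<in> C_infinity" "g \<in> C_infinity"
  shows "gradient (\<lambda>x. f x * g x) x = f x *\<^sub>R gradient g x + g x *\<^sub>R gradient f x"
proof (rule gradient_eqI)
  have "((\<lambda>x. f x * g x) has_derivative (\<lambda>h. f x * (gradient g x \<bullet> h) + (gradient f x \<bullet> h) * g x)) (at x)"
    by (intro has_derivative_mult has_derivative_gradient(2)[OF C_infinity_has_derivative] assms)
  then show "((\<lambda>x. f x * g x) has_derivative (\<lambda>h. (f x *\<^sub>R gradient g x + g x *\<^sub>R gradient f x) \<bullet> h)) (at x)"
    by (simp add: inner_add_left mult.commute)
qed

section \<open>Test functions\<close>

lemma test_functionsI:
  assumes "f \<in> C_infinity" "compact K" "K \<subseteq> S" "\<And>x. x \<notin> K \<Longrightarrow> f x = 0"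
  shows "f \<in> test_functions S"
proof -
  have "closure {x. f x \<noteq> 0} \<subseteq> K"
    using assms by (intro closure_minimal compact_imp_closed) auto
  moreover from this have "compact (closure {x. f x \<noteq> 0})"
    using assms(2) by (auto simp only: compact_eq_bounded_closed closed_closure intro: bounded_subset)
  ultimately show ?thesis using assms by (auto simp: test_functions_def)
qed

lemma test_functionsD:
  assumes "f \<in> test_functions S"
  shows "f \<in> C_infinity" "compact (closure {x. f x \<noteq> 0})" "closure {x. f x \<noteq> 0} \<subseteq> S"
    "x \<notin> S \<Longrightarrow> f x = 0" "x \<notin> closure {x. f x \<noteq> 0} \<Longrightarrow> f x = 0"
  using assms closure_subset[of "{x. f x \<noteq> 0}"] by (auto simp: test_functions_def)

lemma test_functions_mult:
  assumes "f \<in> C_infinity" "g \<in> test_functions S"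
  shows "(\<lambda>x. f x * g x) \<in> test_functions S"
proof (rule test_functionsI[OF C_infinity_mult[OF assms(1) test_functionsD(1)[OF assms(2)]]
        test_functionsD(2,3)[OF assms(2)]])
  fix x assume "x \<notin> closure {x. g x \<noteq> 0}"
  from test_functionsD(5)[OF assms(2) this] show "f x * g x = 0" by simp
qed

lemma test_functions_scale: "g \<in> test_functions S \<Longrightarrow> (\<lambda>x. c * g x) \<in> test_functions S"
  by (rule test_functions_mult[OF C_infinity_const])

lemma test_functions_add:
  assumes "f \<in> test_functions S" "g \<in> test_functions S"
  shows "(\<lambda>x. f x + g x) \<in> test_functions S"
proof (rule test_functionsI[where K="closure {x. f x \<noteq> 0} \<union> closure {x. g x \<noteq> 0}"])
  show "compact (closure {x. f x \<noteq> 0} \<union> closure {x. g x \<noteq> 0})"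
    using test_functionsD(2)[OF assms(1)] test_functionsD(2)[OF assms(2)] by (rule compact_Un)
  show "(\<lambda>x. f x + g x) \<in> C_infinity"
    by (intro C_infinity_add test_functionsD(1)[OF assms(1)] test_functionsD(1)[OF assms(2)])
  show "closure {x. f x \<noteq> 0} \<union> closure {x. g x \<noteq> 0} \<subseteq> S"
    using test_functionsD(3)[OF assms(1)] test_functionsD(3)[OF assms(2)] by (rule Un_least)
  fix x assume x: "x \<notin> closure {x. f x \<noteq> 0} \<union> closure {x. g x \<noteq> 0}"
  have "f x = 0" by (rule test_functionsD(5)[OF assms(1)]) (use x in blast)
  moreover have "g x = 0" by (rule test_functionsD(5)[OF assms(2)]) (use x in blast)
  ultimately show "f x + g x = 0" by simp
qed

lemma test_functions_diff:
  assumes "f \<in> test_functions S" "g \<in> test_functions S"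
  shows "(\<lambda>x. f x - g x) \<in> test_functions S"
  using test_functions_add[OF assms(1) test_functions_scale[OF assms(2), of "-1"]] by simp

lemma test_functions_continuous: "f \<in> test_functions S \<Longrightarrow> continuous_on UNIV f"
  using C_infinity_continuous test_functionsD(1) by blast

lemma test_functions_measurable: "f \<in> test_functions S \<Longrightarrow> f \<in> borel_measurable borel"
  by (intro borel_measurable_continuous_onI test_functions_continuous)

lemma test_functions_bounded:
  assumes "f \<in> test_functions S"
  obtains B where "B \<ge> 0" "\<And>x. \<bar>f x\<bar> \<le> B"
proof -
  have "compact (f ` closure {x. f x \<noteq> 0})"
    by (intro compact_continuous_image continuous_on_subset[OF test_functions_continuous[OF assms]]
        test_functionsD(2)[OF assms]) auto
  then obtain B where B: "\<And>x. x \<in> closure {x. f x \<noteq> 0} \<Longrightarrow> norm (f x) \<le> B"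
    using compact_imp_bounded bounded_iff by (metis imageI)
  have "\<bar>f x\<bar> \<le> \<bar>B\<bar>" for x
  proof (cases "x \<in> closure {x. f x \<noteq> 0}")
    case True
    from B[OF this] show ?thesis by simp
  next
    case False
    from test_functionsD(5)[OF assms this] show ?thesis by simp
  qed
  then show thesis by (intro that[of "\<bar>B\<bar>"]) auto
qed

lemma test_functions_derivative_outside:
  assumes "f \<in> test_functions S" "x \<notin> closure {x. f x \<noteq> 0}"
  shows "frechet_derivative f (at x) = (\<lambda>_. 0)"
proof -
  have z: "0 = f y" if "y \<in> - closure {x. f x \<noteq> 0}" for y
    using test_functionsD(5)[OF assms(1), of y] that by (metis ComplD)
  have "(f has_derivative (\<lambda>_. 0)) (at x)"
    by (rule has_derivative_transform_within_open[OF has_derivative_const, where s="- closure {x. f x \<noteq> 0}"])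
      (use assms(2) z in blast)+
  then show ?thesis by (rule frechet_derivative_eq)
qed

lemma test_functions_derivative:
  assumes "f \<in> test_functions S" "b \<in> Basis"
  shows "(\<lambda>x. frechet_derivative f (at x) b) \<in> test_functions S"
proof (rule test_functionsI[OF C_infinity_frechet_derivative[OF test_functionsD(1)[OF assms(1)] assms(2)]
        test_functionsD(2,3)[OF assms(1)]])
  fix x assume "x \<notin> closure {x. f x \<noteq> 0}"
  from test_functions_derivative_outside[OF assms(1) this]
  show "frechet_derivative f (at x) b = 0" by simp
qed

lemma test_functions_has_derivative:
  "f \<in> test_functions S \<Longrightarrow> (f has_derivative (\<lambda>h. gradient f x \<bullet> h)) (at x)"
  by (intro has_derivative_gradient(2)[OF C_infinity_has_derivative] test_functionsD(1))

lemma gradient_outside: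
  assumes "f \<in> test_functions S" "x \<notin> S"
  shows "gradient f x = 0"
proof -
  have "x \<notin> closure {x. f x \<noteq> 0}" using assms test_functionsD(3) by blast
  then show ?thesis using test_functions_derivative_outside[OF assms(1)] by (simp add: gradient_def)
qed

lemma gradient_continuous: "f \<in> test_functions S \<Longrightarrow> continuous_on UNIV (gradient f)"
  unfolding gradient_def[abs_def]
  by (intro continuous_intros test_functions_continuous[OF test_functions_derivative])

lemma gradient_measurable: "f \<in> test_functions S \<Longrightarrow> gradient f \<in> borel_measurable borel"
  by (intro borel_measurable_continuous_onI gradient_continuous)

lemma gradient_bounded:
  assumes "f \<in> test_functions S"
  obtains B where "B \<ge> 0" "\<And>x. norm (gradient f x) \<le> B"
proof -
  have "\<exists>B. \<forall>x. \<bar>frechet_derivative f (at x) b\<bar> \<le> B" if "b \<in> Basis" for b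
    using test_functions_bounded[OF test_functions_derivative[OF assms that]] by metis
  then obtain B where B: "\<And>b x. b \<in> Basis \<Longrightarrow> \<bar>frechet_derivative f (at x) b\<bar> \<le> B b" by metis
  have "norm (gradient f x) \<le> \<bar>\<Sum>b\<in>Basis. B b\<bar>" for x
  proof -
    have "norm (gradient f x) \<le> (\<Sum>b\<in>Basis. \<bar>gradient f x \<bullet> b\<bar>)" by (rule norm_le_l1)
    also have "\<dots> \<le> (\<Sum>b\<in>Basis. B b)" by (intro sum_mono) (simp add: gradient_inner B)
    finally show ?thesis by linarith
  qed
  then show thesis by (intro that[of "\<bar>\<Sum>b\<in>Basis. B b\<bar>"]) auto
qed

section \<open>Smooth bump functions\<close>

text \<open>
  The family is closed under differentiation up to linear combinations, which makes its
  smoothness a simple induction; the member for \<open>m = 0\<close> is the usual flat function.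
\<close>

definition exp_flat :: "nat \<Rightarrow> real \<Rightarrow> real" where
  "exp_flat m t = (if t > 0 then exp (- 1 / t) / t ^ m else 0)"

lemma exp_flat_over_tendsto_0: "((\<lambda>t. exp_flat m t / t) \<longlongrightarrow> 0) (at 0)"
proof -
  have "((\<lambda>y::real. y ^ Suc m / exp y) \<longlongrightarrow> 0) at_top" by (rule tendsto_power_div_exp_0)
  then have "((\<lambda>t::real. inverse t ^ Suc m / exp (inverse t)) \<longlongrightarrow> 0) (at_right 0)"
    by (rule filterlim_compose[OF _ filterlim_inverse_at_top_right])
  moreover have "\<forall>\<^sub>F t::real in at_right 0. inverse t ^ Suc m / exp (inverse t) = exp_flat m t / t"
    using eventually_at_right_less[of 0]
    by eventually_elim (simp add: exp_flat_def exp_minus field_simps power_inverse)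
  ultimately have "((\<lambda>t. exp_flat m t / t) \<longlongrightarrow> 0) (at_right 0)"
    by (rule Lim_transform_eventually)
  moreover have "((\<lambda>t. exp_flat m t / t) \<longlongrightarrow> 0) (at_left 0)"
    by (rule Lim_transform_eventually[OF tendsto_const])
       (auto simp: eventually_at_filter exp_flat_def)
  ultimately show ?thesis by (simp add: filterlim_split_at_real)
qed

lemma exp_flat_has_derivative:
  "(exp_flat m has_real_derivative exp_flat (m + 2) t - m * exp_flat (m + 1) t) (at t)"
proof -
  consider "t > 0" | "t < 0" | "t = 0" by linarith
  then show ?thesis
  proof cases
    case 1
    have "((\<lambda>t. exp (- 1 / t) / t ^ m) has_real_derivative exp_flat (m + 2) t - m * exp_flat (m + 1) t) (at t)"
      using 1
      by (auto intro!: derivative_eq_intros simp: exp_flat_def field_simps power2_eq_square)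
        (cases m; simp add: field_simps)
    then show ?thesis
      by (rule has_field_derivative_transform_within_open[where S="{0<..}"]) (use 1 in \<open>auto simp: exp_flat_def\<close>)
  next
    case 2
    have "((\<lambda>t. 0) has_real_derivative exp_flat (m + 2) t - m * exp_flat (m + 1) t) (at t)"
      using 2 by (simp add: exp_flat_def)
    then show ?thesis
      by (rule has_field_derivative_transform_within_open[where S="{..<0}"]) (use 2 in \<open>auto simp: exp_flat_def\<close>)
  next
    case 3
    then show ?thesis
      using exp_flat_over_tendsto_0[of m] by (simp add: DERIV_def exp_flat_def)
  qed
qed

lemma C_k_exp_flat: "C_k k (exp_flat m)"
proof (induction k arbitrary: m)
  case 0
  have "isCont (exp_flat m) t" for t using DERIV_isCont[OF exp_flat_has_derivative] .
  then show ?case by (simp add: continuous_at_imp_continuous_on)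
next
  case (Suc k)
  have "C_k k (\<lambda>t. exp_flat (m + 2) t + (- real m) * exp_flat (m + 1) t)"
    by (intro C_k_add C_k_mult C_k_const Suc.IH)
  then show ?case by (intro C_k_real_SucI[OF exp_flat_has_derivative]) simp
qed

lemma exp_flat_bounds: "0 \<le> exp_flat 0 t" "exp_flat 0 t \<le> 1" "t \<le> 0 \<Longrightarrow> exp_flat 0 t = 0"
  by (auto simp: exp_flat_def)

lemma exp_flat_scaled_tendsto:
  assumes "t > 0"
  shows "(\<lambda>n. exp_flat 0 (real n * t)) \<longlonglongrightarrow> 1"
proof -
  have "(\<lambda>n. exp (- ((1 / t) * inverse (real n)))) \<longlonglongrightarrow> exp (- ((1 / t) * 0))"
    by (intro tendsto_intros lim_inverse_n)
  moreover have "\<forall>\<^sub>F n in sequentially. exp (- ((1 / t) * inverse (real n))) = exp_flat 0 (real n * t)"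
    using eventually_gt_at_top[of 0] by eventually_elim (use assms in \<open>simp add: exp_flat_def field_simps\<close>)
  ultimately show ?thesis by (simp add: tendsto_cong)
qed

text \<open>
  Products over the coordinates of flat functions that become steeper as \<open>n\<close> grows, so that the
  indicator of the open box is their pointwise limit.
\<close>

definition box_bump :: "'a::euclidean_space \<Rightarrow> 'a \<Rightarrow> nat \<Rightarrow> 'a \<Rightarrow> real" where
  "box_bump a b n x = (\<Prod>i\<in>Basis. exp_flat 0 (n * (x \<bullet> i - a \<bullet> i)) * exp_flat 0 (n * (b \<bullet> i - x \<bullet> i)))"

lemma box_bump_outside: "x \<notin> box a b \<Longrightarrow> box_bump a b n x = 0"
proof -
  assume "x \<notin> box a b"
  then obtain i where i: "i \<in> Basis" "x \<bullet> i - a \<bullet> i \<le> 0 \<or> b \<bullet> i - x \<bullet> i \<le> 0"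
    by (auto simp: mem_box not_less)
  then have "real n * (x \<bullet> i - a \<bullet> i) \<le> 0 \<or> real n * (b \<bullet> i - x \<bullet> i) \<le> 0"
    using mult_nonneg_nonpos[of "real n"] by auto
  then have "exp_flat 0 (n * (x \<bullet> i - a \<bullet> i)) * exp_flat 0 (n * (b \<bullet> i - x \<bullet> i)) = 0"
    using exp_flat_bounds(3) by auto
  then show ?thesis unfolding box_bump_def using i(1) by (intro prod_zero) auto
qed

lemma box_bump_bounds: "0 \<le> box_bump a b n x" "box_bump a b n x \<le> 1"
  unfolding box_bump_def
  by (auto intro!: prod_nonneg prod_le_1 mult_le_one exp_flat_bounds mult_nonneg_nonneg)

lemma box_bump_tendsto: "(\<lambda>n. box_bump a b n x) \<longlonglongrightarrow> indicator (box a b) x"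
proof (cases "x \<in> box a b")
  case True
  have "(\<lambda>n. box_bump a b n x) \<longlonglongrightarrow> (\<Prod>i\<in>(Basis::'a set). 1 * 1)"
    unfolding box_bump_def
    by (intro tendsto_prod tendsto_mult exp_flat_scaled_tendsto) (use True in \<open>auto simp: mem_box\<close>)
  then show ?thesis using True by simp
next
  case False
  then show ?thesis by (simp add: box_bump_outside)
qed

lemma box_bump_test_function:
  assumes "cbox a b \<subseteq> S"
  shows "box_bump a b n \<in> test_functions S"
proof (rule test_functionsI[OF _ compact_cbox assms])
  have "C_k k (box_bump a b n)" for k
    unfolding box_bump_def[abs_def]
  proof (intro C_k_prod C_k_mult)
    fix i :: 'a
    have "C_k k (\<lambda>x. exp_flat 0 (n * (x \<bullet> i) + - n * (a \<bullet> i)))"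
      by (rule C_k_affine[OF _ C_k_exp_flat])
        (intro bounded_linear_const_mult bounded_linear_inner_left)
    then show "C_k k (\<lambda>x. exp_flat 0 (n * (x \<bullet> i - a \<bullet> i)))" by (simp add: algebra_simps)
    have "C_k k (\<lambda>x. exp_flat 0 (- n * (x \<bullet> i) + n * (b \<bullet> i)))"
      by (rule C_k_affine[OF _ C_k_exp_flat])
        (intro bounded_linear_const_mult bounded_linear_inner_left)
    then show "C_k k (\<lambda>x. exp_flat 0 (n * (b \<bullet> i - x \<bullet> i)))" by (simp add: algebra_simps)
  qed
  then show "box_bump a b n \<in> C_infinity" by (simp add: C_infinity_def)
  show "box_bump a b n x = 0" if "x \<notin> cbox a b" for x
    using that box_subset_cbox[of a b] by (intro box_bump_outside) auto
qed

section \<open>The fundamental lemma of the calculus of variations\<close>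

text \<open>
  The positive and the negative part of \<open>G\<close> are densities of finite measures that agree on boxes,
  hence on all Borel sets, in particular on those where \<open>G\<close> has a fixed sign.
\<close>

lemma AE_zero_if_box_integrals_zero:
  fixes G :: "'a::euclidean_space \<Rightarrow> real"
  assumes G: "integrable lborel G" and zero: "\<And>c d. (\<integral>x. indicator (box c d) x * G x \<partial>lborel) = 0"
  shows "AE x in lborel. G x = 0"
proof -
  have [measurable]: "G \<in> borel_measurable borel" using G by auto
  define P where "P = density lborel (\<lambda>x. ennreal (max (G x) 0))"
  define N where "N = density lborel (\<lambda>x. ennreal (max (- G x) 0))"
  have i: "integrable lborel (\<lambda>x. indicator A x * max (G x) 0)"
      "integrable lborel (\<lambda>x. indicator A x * max (- G x) 0)" if "A \<in> sets borel" for A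
    using integrable_mult_indicator[of A lborel "\<lambda>x. max (G x) 0"]
      integrable_mult_indicator[of A lborel "\<lambda>x. max (- G x) 0"] that G by auto
  have eP: "emeasure P A = ennreal (\<integral>x. indicator A x * max (G x) 0 \<partial>lborel)" if "A \<in> sets borel" for A
    unfolding P_def
    using that i(1)[OF that]
    by (simp add: emeasure_density nn_integral_eq_integral[symmetric] ennreal_mult'' ennreal_indicator mult.commute)
  have eN: "emeasure N A = ennreal (\<integral>x. indicator A x * max (- G x) 0 \<partial>lborel)" if "A \<in> sets borel" for A
    unfolding N_def
    using that i(2)[OF that]
    by (simp add: emeasure_density nn_integral_eq_integral[symmetric] ennreal_mult'' ennreal_indicator mult.commute)
  have PN: "P = N"
  proof (rule measure_eqI_generator_eq)
    let ?E = "range (\<lambda>(a, b). box a b::'a set)"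
    show "Int_stable ?E" by (auto simp: Int_stable_def box_Int_box)
    show "?E \<subseteq> Pow UNIV" "sets P = sigma_sets UNIV ?E" "sets N = sigma_sets UNIV ?E"
      by (simp_all add: borel_eq_box P_def N_def)
    let ?A = "\<lambda>n::nat. box (- (real n *\<^sub>R One)) (real n *\<^sub>R One) :: 'a set"
    show "range ?A \<subseteq> ?E" "(\<Union>i. ?A i) = UNIV" unfolding UN_box_eq_UNIV by auto
    show "emeasure P (?A i) \<noteq> \<infinity>" for i by (simp add: eP)
    show "emeasure P X = emeasure N X" if "X \<in> ?E" for X
    proof -
      from that obtain c d where X: "X = box c d" by auto
      have "(\<integral>x. indicator X x * max (G x) 0 \<partial>lborel) - (\<integral>x. indicator X x * max (- G x) 0 \<partial>lborel)
          = (\<integral>x. indicator X x * max (G x) 0 - indicator X x * max (- G x) 0 \<partial>lborel)"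
        by (intro Bochner_Integration.integral_diff[symmetric] i) (auto simp: X)
      also have "\<dots> = (\<integral>x. indicator X x * G x \<partial>lborel)"
        by (intro Bochner_Integration.integral_cong) (auto simp: max_def indicator_def)
      finally show ?thesis using zero[of c d] by (simp add: eP eN X)
    qed
  qed
  have pos: "{x. G x > 0} \<in> sets borel" and neg: "{x. G x < 0} \<in> sets borel" by measurable
  have "emeasure P {x. G x > 0} = emeasure N {x. G x > 0}" using PN by simp
  also have "\<dots> = 0"
  proof -
    have "(\<integral>x. indicator {x. G x > 0} x * max (- G x) 0 \<partial>lborel) = (\<integral>x. 0 \<partial>(lborel::'a measure))"
      by (intro Bochner_Integration.integral_cong) (auto simp: indicator_def)
    then show ?thesis by (simp add: eN pos)
  qed
  finally have "(\<integral>x. indicator {x. G x > 0} x * max (G x) 0 \<partial>lborel) \<le> 0"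
    by (simp add: eP pos ennreal_eq_0_iff)
  moreover have "(\<integral>x. indicator {x. G x > 0} x * max (G x) 0 \<partial>lborel) \<ge> 0"
    by (intro integral_nonneg_AE) auto
  ultimately have 1: "AE x in lborel. indicator {x. G x > 0} x * max (G x) 0 = 0"
    using integral_nonneg_eq_0_iff_AE[OF i(1)[OF pos]] by auto
  have "emeasure N {x. G x < 0} = emeasure P {x. G x < 0}" using PN by simp
  also have "\<dots> = 0"
  proof -
    have "(\<integral>x. indicator {x. G x < 0} x * max (G x) 0 \<partial>lborel) = (\<integral>x. 0 \<partial>(lborel::'a measure))"
      by (intro Bochner_Integration.integral_cong) (auto simp: indicator_def)
    then show ?thesis by (simp add: eP neg)
  qed
  finally have "(\<integral>x. indicator {x. G x < 0} x * max (- G x) 0 \<partial>lborel) \<le> 0"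
    by (simp add: eN neg ennreal_eq_0_iff)
  moreover have "(\<integral>x. indicator {x. G x < 0} x * max (- G x) 0 \<partial>lborel) \<ge> 0"
    by (intro integral_nonneg_AE) auto
  ultimately have 2: "AE x in lborel. indicator {x. G x < 0} x * max (- G x) 0 = 0"
    using integral_nonneg_eq_0_iff_AE[OF i(2)[OF neg]] by auto
  from 1 2 show ?thesis
    by eventually_elim (auto simp: indicator_def split: if_splits)
qed

lemma AE_zero_on_open_if_cboxes:
  fixes S :: "'a::euclidean_space set"
  assumes "open S" and box: "\<And>a b. cbox a b \<subseteq> S \<Longrightarrow> AE x in lborel. x \<in> cbox a b \<longrightarrow> P x"
  shows "AE x in lborel. x \<in> S \<longrightarrow> P x"
proof -
  obtain \<D> where D: "countable \<D>" "\<D> \<subseteq> Pow S" "\<And>X. X \<in> \<D> \<Longrightarrow> \<exists>a b. X = cbox a b" "\<Union>\<D> = S"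
    using open_countable_Union_open_cbox[OF assms(1)] by metis
  have "AE x in lborel. \<forall>X\<in>\<D>. x \<in> X \<longrightarrow> P x"
    unfolding AE_ball_countable[OF D(1)]
  proof
    fix X assume X: "X \<in> \<D>"
    with D(3) obtain a b where ab: "X = cbox a b" by blast
    show "AE x in lborel. x \<in> X \<longrightarrow> P x" unfolding ab by (rule box) (use X D(2) ab in blast)
  qed
  then show ?thesis using D(4) by (auto elim!: eventually_mono)
qed

text \<open>
  The smooth bumps converge boundedly to indicators of boxes, so the integrals over all boxes in
  \<open>S\<close> vanish; countably many boxes exhaust \<open>S\<close>.
\<close>

lemma fundamental_lemma:
  fixes F :: "'a::euclidean_space \<Rightarrow> real"
  assumes S: "open S" and F: "F \<in> borel_measurable (lebesgue_on S)"
    and loc: "\<And>a b. cbox a b \<subseteq> S \<Longrightarrow> integrable (lebesgue_on (cbox a b)) F"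
    and zero: "\<And>\<phi>. \<phi> \<in> test_functions S \<Longrightarrow> (\<integral>x. \<phi> x * F x \<partial>lebesgue_on S) = 0"
  shows "AE x in lebesgue_on S. F x = 0"
proof -
  have Sb: "S \<in> sets borel" and Sl: "S \<in> sets lebesgue" using S by auto
  obtain F' where F': "F' \<in> borel_measurable borel" "AE x in lborel. x \<in> S \<longrightarrow> F x = F' x"
    using lebesgue_on_borel_representative[OF Sl F] by metis
  have [measurable]: "F' \<in> borel_measurable borel" by (fact F'(1))
  have loc': "integrable lborel (\<lambda>x. indicator (cbox a b) x * F' x)" if "cbox a b \<subseteq> S" for a b
  proof -
    have ae: "AE x in lborel. x \<in> cbox a b \<longrightarrow> F x = F' x"
      using F'(2) by eventually_elim (use that in auto)
    from loc[OF that] borel_measurable_integrable show ?thesis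
      using lebesgue_on_integral(1)[of "cbox a b" F' F, OF _ F'(1) ae] by auto
  qed
  have box: "(\<integral>x. indicator (box a b) x * F' x \<partial>lborel) = 0" if ab: "cbox a b \<subseteq> S" for a b
  proof -
    have z: "(\<integral>x. box_bump a b n x * F' x \<partial>lborel) = 0" for n
    proof -
      have t: "box_bump a b n \<in> test_functions S" by (rule box_bump_test_function[OF ab])
      have m: "box_bump a b n \<in> borel_measurable borel" by (rule test_functions_measurable[OF t])
      have "(\<integral>x. box_bump a b n x * F x \<partial>lebesgue_on S)
          = (\<integral>x. indicator S x *\<^sub>R (box_bump a b n x * F' x) \<partial>lborel)"
      proof (rule lebesgue_on_integral(2)[OF Sb])
        show "(\<lambda>x. box_bump a b n x * F x) \<in> borel_measurable (lebesgue_on S)"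
          by (intro borel_measurable_times F borel_measurable_lebesgue_on m)
      qed (use F'(2) m in auto)
      also have "\<dots> = (\<integral>x. box_bump a b n x * F' x \<partial>lborel)"
        using test_functionsD(4)[OF t] by (intro Bochner_Integration.integral_cong) (auto simp: indicator_def)
      finally show ?thesis using zero[OF t] by simp
    qed
    have "(\<lambda>n. \<integral>x. box_bump a b n x * F' x \<partial>lborel) \<longlonglongrightarrow> (\<integral>x. indicator (box a b) x * F' x \<partial>lborel)"
    proof (rule integral_dominated_convergence[where w="\<lambda>x. \<bar>indicator (cbox a b) x * F' x\<bar>"])
      show "(\<lambda>x. box_bump a b n x * F' x) \<in> borel_measurable lborel" for n
        using test_functions_measurable[OF box_bump_test_function[OF ab]] by measurable
      show "AE x in lborel. (\<lambda>n. box_bump a b n x * F' x) \<longlonglongrightarrow> indicator (box a b) x * F' x"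
        by (intro AE_I2 tendsto_intros box_bump_tendsto)
      show "AE x in lborel. norm (box_bump a b n x * F' x) \<le> \<bar>indicator (cbox a b) x * F' x\<bar>" for n
      proof (intro AE_I2)
        fix x
        show "norm (box_bump a b n x * F' x) \<le> \<bar>indicator (cbox a b) x * F' x\<bar>"
        proof (cases "x \<in> cbox a b")
          case True
          then show ?thesis using box_bump_bounds[of a b n x]
            by (auto simp: abs_mult intro!: mult_left_le_one_le)
        next
          case False
          then have "x \<notin> box a b" using box_subset_cbox[of a b] by blast
          then show ?thesis by (simp add: box_bump_outside)
        qed
      qed
    qed (use loc'[OF ab] in auto)
    then show ?thesis by (simp add: z LIMSEQ_const_iff)
  qed
  have "AE x in lborel. x \<in> cbox a b \<longrightarrow> F' x = 0" if ab: "cbox a b \<subseteq> S" for a b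
  proof -
    have "AE x in lborel. indicator (box a b) x * F' x = 0"
    proof (rule AE_zero_if_box_integrals_zero)
      have "integrable lborel (\<lambda>x. indicator (box a b) x *\<^sub>R (indicator (cbox a b) x * F' x))"
        by (rule integrable_mult_indicator[OF _ loc'[OF ab]]) auto
      also have "(\<lambda>x. indicator (box a b) x *\<^sub>R (indicator (cbox a b) x * F' x)) = (\<lambda>x. indicator (box a b) x * F' x)"
        using box_subset_cbox[of a b] by (auto simp: indicator_def fun_eq_iff)
      finally show "integrable lborel (\<lambda>x. indicator (box a b) x * F' x)" .
      fix c d :: 'a
      obtain l u where lu: "box a b \<inter> box c d = box l u" by (simp add: box_Int_box)
      have "(\<integral>x. indicator (box c d) x * (indicator (box a b) x * F' x) \<partial>lborel)
          = (\<integral>x. indicator (box l u) x * F' x \<partial>lborel)"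
        unfolding lu[symmetric] by (intro Bochner_Integration.integral_cong) (auto simp: indicator_def)
      also have "\<dots> = 0"
      proof (cases "box l u = {}")
        case False
        have "closure (box l u) \<subseteq> closure (box a b)" using lu by (intro closure_mono) auto
        then have "cbox l u \<subseteq> cbox a b" using False lu
          by (metis closure_box Int_empty_left)
        then show ?thesis using ab by (intro box) auto
      qed simp
      finally show "(\<integral>x. indicator (box c d) x * (indicator (box a b) x * F' x) \<partial>lborel) = 0" .
    qed
    moreover have "AE x in lborel. x \<notin> cbox a b - box a b"
      by (rule AE_not_in) (auto intro: null_sets_cbox_Diff_box)
    ultimately show ?thesis by eventually_elim (auto simp: indicator_def)
  qed
  then have "AE x in lborel. x \<in> S \<longrightarrow> F' x = 0" by (rule AE_zero_on_open_if_cboxes[OF S])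
  then show ?thesis unfolding lebesgue_on_AE_iff[OF Sl] using F'(2) by eventually_elim auto
qed

section \<open>Translations and integration by parts\<close>

lemma nn_integral_lborel_translate:
  fixes f :: "'a::euclidean_space \<Rightarrow> ennreal"
  assumes [measurable]: "f \<in> borel_measurable borel"
  shows "(\<integral>\<^sup>+x. f (x + z) \<partial>lborel) = (\<integral>\<^sup>+x. f x \<partial>lborel)"
proof -
  have "(\<integral>\<^sup>+x. f x \<partial>lborel) = (\<integral>\<^sup>+x. f x \<partial>distr lborel borel ((+) z))"
    by (simp add: lborel_distr_plus)
  also have "\<dots> = (\<integral>\<^sup>+x. f (z + x) \<partial>lborel)" by (rule nn_integral_distr) auto
  finally show ?thesis by (simp add: add.commute)
qed

lemma integral_lborel_translate:
  fixes f :: "'a::euclidean_space \<Rightarrow> real"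
  assumes [measurable]: "f \<in> borel_measurable borel"
  shows "(\<integral>x. f (x + z) \<partial>lborel) = (\<integral>x. f x \<partial>lborel)"
proof -
  have "(\<integral>x. f x \<partial>lborel) = (\<integral>x. f x \<partial>distr lborel borel ((+) z))"
    by (simp add: lborel_distr_plus)
  also have "\<dots> = (\<integral>x. f (z + x) \<partial>lborel)" by (rule integral_distr) auto
  finally show ?thesis by (simp add: add.commute)
qed

lemma integrable_lborel_translate:
  fixes f :: "'a::euclidean_space \<Rightarrow> real"
  assumes "integrable lborel f"
  shows "integrable lborel (\<lambda>x. f (x + z))"
proof -
  have "integrable (distr lborel borel ((+) z)) f" using assms by (simp add: lborel_distr_plus)
  then have "integrable lborel (\<lambda>x. f (z + x))" by (rule integrable_distr[rotated]) auto
  then show ?thesis by (simp add: add.commute)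
qed

lemma test_functions_integrable:
  assumes f: "f \<in> test_functions S"
  shows "integrable lborel f"
proof -
  have "integrable lborel (\<lambda>x. indicator (closure {x. f x \<noteq> 0}) x *\<^sub>R f x)"
    by (intro borel_integrable_compact test_functionsD(2)[OF f]
        continuous_on_subset[OF test_functions_continuous[OF f]]) auto
  also have "(\<lambda>x. indicator (closure {x. f x \<noteq> 0}) x *\<^sub>R f x) = f"
    using closure_subset[of "{x. f x \<noteq> 0}"] by (auto simp: indicator_def fun_eq_iff)
  finally show ?thesis .
qed

lemma test_functions_Lipschitz:
  assumes f: "f \<in> test_functions S"
  obtains B where "B \<ge> 0" "\<And>x y. \<bar>f x - f y\<bar> \<le> B * norm (x - y)"
proof -
  obtain B where B: "B \<ge> 0" "\<And>x. norm (gradient f x) \<le> B" by (rule gradient_bounded[OF f]) blast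
  have "norm (f x - f y) \<le> B * norm (x - y)" for x y
  proof (rule differentiable_bound[where S=UNIV and f'="\<lambda>x h. gradient f x \<bullet> h"])
    show "(f has_derivative (\<lambda>h. gradient f x \<bullet> h)) (at x within UNIV)" for x
      using test_functions_has_derivative[OF f] by simp
    show "onorm (\<lambda>h. gradient f x \<bullet> h) \<le> B" for x
      by (rule onorm_le) (metis B(2) Cauchy_Schwarz_ineq2 mult_right_mono norm_ge_zero order_trans real_norm_def)
  qed auto
  then show thesis using B(1) by (intro that) auto
qed

text \<open>
  The integral of a difference quotient vanishes by translation invariance, and difference
  quotients converge boundedly to the derivative.
\<close>

lemma integral_derivative_test_function:
  fixes f :: "'a::euclidean_space \<Rightarrow> real"
  assumes f: "f \<in> test_functions S" and b: "b \<in> Basis"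
  shows "(\<integral>x. frechet_derivative f (at x) b \<partial>lborel) = 0"
proof -
  have [measurable]: "f \<in> borel_measurable borel" by (rule test_functions_measurable[OF f])
  have D: "(f has_derivative frechet_derivative f (at x)) (at x)" for x
    by (rule C_infinity_has_derivative[OF test_functionsD(1)[OF f]])
  have Dm: "(\<lambda>x. frechet_derivative f (at x) b) \<in> borel_measurable borel"
    by (rule test_functions_measurable[OF test_functions_derivative[OF f b]])
  obtain B where B: "B \<ge> 0" "\<And>x y. \<bar>f x - f y\<bar> \<le> B * norm (x - y)"
    by (rule test_functions_Lipschitz[OF f]) blast
  obtain R where R: "\<And>x. x \<in> closure {x. f x \<noteq> 0} \<Longrightarrow> norm x \<le> R"
    using compact_imp_bounded[OF test_functionsD(2)[OF f]] bounded_iff by metis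
  define q where "q n x = real (Suc n) * (f (x + (1 / real (Suc n)) *\<^sub>R b) - f x)" for n x
  have [measurable]: "q n \<in> borel_measurable borel" for n unfolding q_def by measurable
  have q0: "(\<integral>x. q n x \<partial>lborel) = 0" for n
  proof -
    have "(\<integral>x. q n x \<partial>lborel)
        = real (Suc n) * ((\<integral>x. f (x + (1 / real (Suc n)) *\<^sub>R b) \<partial>lborel) - (\<integral>x. f x \<partial>lborel))"
      unfolding q_def
      using integrable_lborel_translate[OF test_functions_integrable[OF f]] test_functions_integrable[OF f]
      by simp
    also have "\<dots> = 0" by (simp add: integral_lborel_translate)
    finally show ?thesis .
  qed
  have "(\<lambda>n. \<integral>x. q n x \<partial>lborel) \<longlonglongrightarrow> (\<integral>x. frechet_derivative f (at x) b \<partial>lborel)"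
  proof (rule integral_dominated_convergence[where w="\<lambda>x. indicator (cball 0 (R + 1)) x * B"])
    show "AE x in lborel. (\<lambda>n. q n x) \<longlonglongrightarrow> frechet_derivative f (at x) b"
    proof (rule AE_I2)
      fix x
      have lim: "((\<lambda>t. (1 / t) *\<^sub>R (f (x + t *\<^sub>R b) - f x)) \<longlongrightarrow> frechet_derivative f (at x) b) (at 0)"
      proof -
        have "((\<lambda>t. f (x + t *\<^sub>R b)) has_derivative (\<lambda>h. frechet_derivative f (at x) (h *\<^sub>R b))) (at 0)"
          by (rule has_derivative_compose[where g=f and f="\<lambda>t. x + t *\<^sub>R b"])
            (use D[of x] in \<open>auto intro!: derivative_eq_intros\<close>)
        then have "((\<lambda>t. f (x + t *\<^sub>R b)) has_real_derivative frechet_derivative f (at x) b) (at 0)"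
          using linear_scale[OF has_derivative_linear[OF D[of x]]]
          by (auto simp: has_field_derivative_def fun_eq_iff elim!: has_derivative_eq_rhs)
        then show ?thesis by (simp add: DERIV_def field_simps)
      qed
      have 1: "filterlim (\<lambda>n. 1 / real (Suc n)) (at 0) sequentially"
        using LIMSEQ_inverse_real_of_nat by (simp add: filterlim_at inverse_eq_divide)
      have "(\<lambda>n. (1 / (1 / real (Suc n))) *\<^sub>R (f (x + (1 / real (Suc n)) *\<^sub>R b) - f x))
          \<longlonglongrightarrow> frechet_derivative f (at x) b"
        by (rule filterlim_compose[OF lim 1])
      then show "(\<lambda>n. q n x) \<longlonglongrightarrow> frechet_derivative f (at x) b" by (simp add: q_def)
    qed
    show "integrable lborel (\<lambda>x. indicator (cball 0 (R + 1)) x * B :: real)"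
      by (intro integrable_mult_left integrable_real_indicator) 
        (use emeasure_bounded_finite[OF bounded_cball, of 0 "R + 1"] in auto)
    show "AE x in lborel. norm (q n x) \<le> indicator (cball 0 (R + 1)) x * B" for n
    proof (rule AE_I2)
      fix x
      let ?y = "x + (1 / real (Suc n)) *\<^sub>R b"
      have nb: "norm (?y - x) = 1 / real (Suc n)" using b by simp
      have "\<bar>q n x\<bar> \<le> real (Suc n) * (B * norm (?y - x))"
        unfolding q_def abs_mult using B(2)[of ?y x] by (intro mult_mono) auto
      then have 1: "\<bar>q n x\<bar> \<le> B" unfolding nb by simp
      show "norm (q n x) \<le> indicator (cball 0 (R + 1)) x * B"
      proof (cases "x \<in> cball 0 (R + 1)")
        case False
        have "norm x \<le> norm ?y + norm (?y - x)"
          using norm_triangle_ineq2[of x ?y] by (simp add: norm_minus_commute)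
        also have "norm (?y - x) \<le> 1" unfolding nb by simp
        finally have "norm ?y > R" "norm x > R" using False by auto
        then have "?y \<notin> closure {x. f x \<noteq> 0}" "x \<notin> closure {x. f x \<noteq> 0}" using R not_le by blast+
        then have "f ?y = 0" "f x = 0" using test_functionsD(5)[OF f] by blast+
        then show ?thesis using False by (simp add: q_def)
      qed (use 1 in simp)
    qed
  qed (use Dm in auto)
  then show ?thesis by (simp add: q0 LIMSEQ_const_iff)
qed

lemma integrable_lebesgue_on_subset:
  fixes f :: "'a::euclidean_space \<Rightarrow> 'b::euclidean_space"
  assumes "S \<in> sets lebesgue" "T \<in> sets lebesgue" "T \<subseteq> S" "integrable (lebesgue_on S) f"
  shows "integrable (lebesgue_on T) f"
proof -
  have "integrable lebesgue (\<lambda>x. indicator S x *\<^sub>R f x)"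
    using assms by (simp add: integrable_restrict_space)
  from integrable_mult_indicator[OF assms(2) this]
  have "integrable lebesgue (\<lambda>x. indicator T x *\<^sub>R (indicator S x *\<^sub>R f x))" .
  moreover have "(\<lambda>x. indicator T x *\<^sub>R (indicator S x *\<^sub>R f x)) = (\<lambda>x. indicator T x *\<^sub>R f x)"
    using assms(3) by (auto simp: indicator_def fun_eq_iff)
  ultimately show ?thesis using assms(2) by (simp add: integrable_restrict_space)
qed

section \<open>Weak gradients on a bounded open set\<close>

locale bounded_open =
  fixes \<Omega> :: "'a::euclidean_space set"
  assumes open_domain: "open \<Omega>" and bounded_domain: "bounded \<Omega>"
begin

lemma domain_borel [simp]: "\<Omega> \<in> sets borel"
  using open_domain by auto

lemma domain_lebesgue [simp]: "\<Omega> \<in> sets lebesgue"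
  using open_domain by auto

lemma finite_measure_domain: "finite_measure (lebesgue_on \<Omega>)"
  by (rule finite_measure_lebesgue_on_bounded[OF bounded_domain]) simp

lemma Lp2_domain_bounded:
  assumes "f \<in> borel_measurable (lebesgue_on \<Omega>)" "AE x in lebesgue_on \<Omega>. norm (f x) \<le> B"
  shows "f \<in> Lp 2 (lebesgue_on \<Omega>)"
  by (rule Lp2_bounded[OF finite_measure_domain assms])

lemma test_functions_Lp2:
  assumes "\<phi> \<in> test_functions S"
  shows "\<phi> \<in> Lp 2 (lebesgue_on \<Omega>)" "gradient \<phi> \<in> Lp 2 (lebesgue_on \<Omega>)"
proof -
  obtain B where B: "B \<ge> 0" "\<And>x. \<bar>\<phi> x\<bar> \<le> B" by (rule test_functions_bounded[OF assms]) blast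
  then show "\<phi> \<in> Lp 2 (lebesgue_on \<Omega>)"
    by (intro Lp2_domain_bounded[where B=B] borel_measurable_lebesgue_on test_functions_measurable[OF assms]) auto
  obtain C where C: "C \<ge> 0" "\<And>x. norm (gradient \<phi> x) \<le> C" by (rule gradient_bounded[OF assms]) blast
  then show "gradient \<phi> \<in> Lp 2 (lebesgue_on \<Omega>)"
    by (intro Lp2_domain_bounded[where B=C] borel_measurable_lebesgue_on gradient_measurable[OF assms]) auto
qed

lemma integrable_scaleR_Lp2:
  fixes f :: "'a \<Rightarrow> real" and G :: "'a \<Rightarrow> 'b::euclidean_space"
  assumes "f \<in> Lp 2 M" "G \<in> Lp 2 M"
  shows "integrable M (\<lambda>x. f x *\<^sub>R G x)"
proof (rule Bochner_Integration.integrable_bound[OF Lp2_integrable_norm_mult[OF assms]])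
  show "(\<lambda>x. f x *\<^sub>R G x) \<in> borel_measurable M" using assms by (auto simp: Lp2_iff)
qed auto

lemma has_weak_gradientD:
  assumes "has_weak_gradient \<Omega> f G"
  shows "f \<in> Lp 2 (lebesgue_on \<Omega>)" "G \<in> Lp 2 (lebesgue_on \<Omega>)"
    "\<phi> \<in> test_functions \<Omega> \<Longrightarrow>
      (\<integral>x. f x *\<^sub>R gradient \<phi> x \<partial>lebesgue_on \<Omega>) = - (\<integral>x. \<phi> x *\<^sub>R G x \<partial>lebesgue_on \<Omega>)"
  using assms by (auto simp: has_weak_gradient_def)

lemma has_weak_gradient_diff:
  assumes f: "has_weak_gradient \<Omega> f F" and g: "has_weak_gradient \<Omega> g G"
  shows "has_weak_gradient \<Omega> (\<lambda>x. f x - g x) (\<lambda>x. F x - G x)"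
  unfolding has_weak_gradient_def
proof (intro conjI ballI)
  show "(\<lambda>x. f x - g x) \<in> Lp 2 (lebesgue_on \<Omega>)" "(\<lambda>x. F x - G x) \<in> Lp 2 (lebesgue_on \<Omega>)"
    by (intro Lp2_diff has_weak_gradientD[OF f] has_weak_gradientD[OF g])+
  fix \<phi> assume \<phi>: "\<phi> \<in> test_functions \<Omega>"
  note i1 = integrable_scaleR_Lp2[OF has_weak_gradientD(1) test_functions_Lp2(2)[OF \<phi>]]
  note i2 = integrable_scaleR_Lp2[OF test_functions_Lp2(1)[OF \<phi>] has_weak_gradientD(2)]
  show "(\<integral>x. (f x - g x) *\<^sub>R gradient \<phi> x \<partial>lebesgue_on \<Omega>) = - (\<integral>x. \<phi> x *\<^sub>R (F x - G x) \<partial>lebesgue_on \<Omega>)"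
    unfolding scaleR_diff_left scaleR_diff_right
    using i1[OF f] i1[OF g] i2[OF f] i2[OF g] has_weak_gradientD(3)[OF f \<phi>] has_weak_gradientD(3)[OF g \<phi>]
    by simp
qed

text \<open>
  By the fundamental lemma, applied to each component of the gradient.
\<close>

lemma has_weak_gradient_zero:
  assumes f: "has_weak_gradient \<Omega> f G" and z: "AE x in lebesgue_on \<Omega>. f x = 0"
  shows "AE x in lebesgue_on \<Omega>. G x = 0"
proof -
  have [measurable]: "G \<in> borel_measurable (lebesgue_on \<Omega>)" "f \<in> borel_measurable (lebesgue_on \<Omega>)"
    using has_weak_gradientD[OF f] by (auto simp: Lp2_iff)
  have iG: "integrable (lebesgue_on \<Omega>) G"
    by (rule Lp2_finite_integrable[OF finite_measure_domain has_weak_gradientD(2)[OF f]])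
  have "AE x in lebesgue_on \<Omega>. G x \<bullet> b = 0" if b: "b \<in> Basis" for b
  proof (rule fundamental_lemma[OF open_domain])
    show "(\<lambda>x. G x \<bullet> b) \<in> borel_measurable (lebesgue_on \<Omega>)" by measurable
    show "integrable (lebesgue_on (cbox c d)) (\<lambda>x. G x \<bullet> b)" if "cbox c d \<subseteq> \<Omega>" for c d
      by (rule integrable_lebesgue_on_subset[OF domain_lebesgue _ that integrable_inner_left[OF iG]]) simp
    fix \<phi> assume \<phi>: "\<phi> \<in> test_functions \<Omega>"
    have "(\<integral>x. f x *\<^sub>R gradient \<phi> x \<partial>lebesgue_on \<Omega>) = (\<integral>x. 0 \<partial>lebesgue_on \<Omega>)"
      using z borel_measurable_lebesgue_on[OF gradient_measurable[OF \<phi>]]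
      by (intro integral_cong_AE) (auto elim!: eventually_mono)
    then have "(\<integral>x. \<phi> x *\<^sub>R G x \<partial>lebesgue_on \<Omega>) = 0" using has_weak_gradientD(3)[OF f \<phi>] by simp
    moreover have "(\<integral>x. (\<phi> x *\<^sub>R G x) \<bullet> b \<partial>lebesgue_on \<Omega>) = (\<integral>x. \<phi> x *\<^sub>R G x \<partial>lebesgue_on \<Omega>) \<bullet> b"
      by (intro integral_inner_left integrable_scaleR_Lp2 test_functions_Lp2(1)[OF \<phi>] has_weak_gradientD(2)[OF f])
    ultimately show "(\<integral>x. \<phi> x * (G x \<bullet> b) \<partial>lebesgue_on \<Omega>) = 0" by simp
  qed
  then have "AE x in lebesgue_on \<Omega>. \<forall>b\<in>Basis. G x \<bullet> b = 0"
    by (intro AE_finite_allI) auto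
  then show ?thesis by eventually_elim (simp add: euclidean_all_zero_iff)
qed

lemma has_weak_gradient_unique:
  assumes f: "has_weak_gradient \<Omega> f F" and g: "has_weak_gradient \<Omega> g G"
    and eq: "AE x in lebesgue_on \<Omega>. f x = g x"
  shows "AE x in lebesgue_on \<Omega>. F x = G x"
proof -
  have "AE x in lebesgue_on \<Omega>. F x - G x = 0"
    by (rule has_weak_gradient_zero[OF has_weak_gradient_diff[OF f g]]) (use eq in auto)
  then show ?thesis by simp
qed

text \<open>Integration by parts: the product of two test functions is a test function.\<close>

lemma has_weak_gradient_test_function:
  assumes \<psi>: "\<psi> \<in> test_functions \<Omega>"
  shows "has_weak_gradient \<Omega> \<psi> (gradient \<psi>)"
  unfolding has_weak_gradient_def
proof (intro conjI ballI test_functions_Lp2[OF \<psi>])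
  fix \<phi> assume \<phi>: "\<phi> \<in> test_functions \<Omega>"
  define f where "f x = \<psi> x * \<phi> x" for x
  have f: "f \<in> test_functions \<Omega>"
    unfolding f_def by (rule test_functions_mult[OF test_functionsD(1)[OF \<psi>] \<phi>])
  note i1 = integrable_scaleR_Lp2[OF test_functions_Lp2(1)[OF \<psi>] test_functions_Lp2(2)[OF \<phi>]]
  note i2 = integrable_scaleR_Lp2[OF test_functions_Lp2(1)[OF \<phi>] test_functions_Lp2(2)[OF \<psi>]]
  have g: "gradient f x = \<psi> x *\<^sub>R gradient \<phi> x + \<phi> x *\<^sub>R gradient \<psi> x" for x
    unfolding f_def by (rule gradient_mult[OF test_functionsD(1)[OF \<psi>] test_functionsD(1)[OF \<phi>]])
  have "integral\<^sup>L (lebesgue_on \<Omega>) (gradient f) = 0"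
  proof (rule euclidean_eqI)
    fix b :: 'a assume b: "b \<in> Basis"
    have D: "(\<lambda>x. frechet_derivative f (at x) b) \<in> test_functions \<Omega>"
      by (rule test_functions_derivative[OF f b])
    have "integral\<^sup>L (lebesgue_on \<Omega>) (gradient f) \<bullet> b = (\<integral>x. gradient f x \<bullet> b \<partial>lebesgue_on \<Omega>)"
      by (rule integral_inner_left[symmetric]) (simp add: g[abs_def] i1 i2)
    also have "\<dots> = (\<integral>x. frechet_derivative f (at x) b \<partial>lebesgue_on \<Omega>)"
      using b by (simp add: gradient_inner)
    also have "\<dots> = (\<integral>x. indicator \<Omega> x *\<^sub>R frechet_derivative f (at x) b \<partial>lborel)"
      by (rule lebesgue_on_integral(2))
        (use test_functions_measurable[OF D] borel_measurable_lebesgue_on in auto)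
    also have "\<dots> = (\<integral>x. frechet_derivative f (at x) b \<partial>lborel)"
      using test_functionsD(4)[OF D] by (intro Bochner_Integration.integral_cong) (auto simp: indicator_def)
    also have "\<dots> = 0" by (rule integral_derivative_test_function[OF f b])
    finally show "integral\<^sup>L (lebesgue_on \<Omega>) (gradient f) \<bullet> b = 0 \<bullet> b" by simp
  qed
  then have "(\<integral>x. \<psi> x *\<^sub>R gradient \<phi> x \<partial>lebesgue_on \<Omega>) + (\<integral>x. \<phi> x *\<^sub>R gradient \<psi> x \<partial>lebesgue_on \<Omega>) = 0"
    unfolding g[abs_def] using i1 i2 by simp
  then show "(\<integral>x. \<psi> x *\<^sub>R gradient \<phi> x \<partial>lebesgue_on \<Omega>) = - (\<integral>x. \<phi> x *\<^sub>R gradient \<psi> x \<partial>lebesgue_on \<Omega>)"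
    by (rule eq_neg_iff_add_eq_0[THEN iffD2])
qed

section \<open>The Sobolev space as a seminormed space\<close>

lemma H1_has_weak_gradient: "f \<in> H1 \<Omega> \<Longrightarrow> has_weak_gradient \<Omega> f (weak_gradient \<Omega> f)"
  using someI_ex[of "has_weak_gradient \<Omega> f"] by (simp add: H1_def weak_gradient_def)

lemma H1_Lp2:
  assumes "f \<in> H1 \<Omega>"
  shows "f \<in> Lp 2 (lebesgue_on \<Omega>)" "weak_gradient \<Omega> f \<in> Lp 2 (lebesgue_on \<Omega>)"
  using has_weak_gradientD[OF H1_has_weak_gradient[OF assms]] by auto

lemma H1_diff: "f \<in> H1 \<Omega> \<Longrightarrow> g \<in> H1 \<Omega> \<Longrightarrow> (\<lambda>x. f x - g x) \<in> H1 \<Omega>"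
  using has_weak_gradient_diff[OF H1_has_weak_gradient H1_has_weak_gradient] by (auto simp: H1_def)

lemma weak_gradient_diff:
  assumes "f \<in> H1 \<Omega>" "g \<in> H1 \<Omega>"
  shows "AE x in lebesgue_on \<Omega>.
    weak_gradient \<Omega> (\<lambda>x. f x - g x) x = weak_gradient \<Omega> f x - weak_gradient \<Omega> g x"
  by (rule has_weak_gradient_unique[OF H1_has_weak_gradient[OF H1_diff[OF assms]]
        has_weak_gradient_diff[OF assms[THEN H1_has_weak_gradient]]]) simp

lemma weak_gradient_test_function:
  assumes "\<phi> \<in> test_functions \<Omega>"
  shows "\<phi> \<in> H1 \<Omega>" "AE x in lebesgue_on \<Omega>. weak_gradient \<Omega> \<phi> x = gradient \<phi> x"
proof -
  show 1: "\<phi> \<in> H1 \<Omega>" using has_weak_gradient_test_function[OF assms] by (auto simp: H1_def)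
  show "AE x in lebesgue_on \<Omega>. weak_gradient \<Omega> \<phi> x = gradient \<phi> x"
    by (rule has_weak_gradient_unique[OF H1_has_weak_gradient[OF 1] has_weak_gradient_test_function[OF assms]]) simp
qed

lemma weak_gradient_norm_diff:
  assumes "f \<in> H1 \<Omega>" "g \<in> H1 \<Omega>"
  shows "Lp_norm 2 (lebesgue_on \<Omega>) (weak_gradient \<Omega> (\<lambda>x. f x - g x))
    = Lp_norm 2 (lebesgue_on \<Omega>) (\<lambda>x. weak_gradient \<Omega> f x - weak_gradient \<Omega> g x)"
  using H1_Lp2[OF assms(1)] H1_Lp2[OF assms(2)] H1_Lp2[OF H1_diff[OF assms]]
  by (intro Lp_norm_cong_AE weak_gradient_diff assms Lp2_measurable Lp2_diff)

lemma H1_norm_ge: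
  "Lp_norm 2 (lebesgue_on \<Omega>) f \<le> H1_norm \<Omega> f"
  "Lp_norm 2 (lebesgue_on \<Omega>) (weak_gradient \<Omega> f) \<le> H1_norm \<Omega> f"
  by (auto simp: H1_norm_def intro!: real_le_rsqrt)

lemma seminormed_space_H1: "seminormed_space (H1 \<Omega>) (H1_norm \<Omega>)"
proof -
  let ?N = "Lp_norm 2 (lebesgue_on \<Omega>)"
  have 0: "has_weak_gradient \<Omega> (\<lambda>_. 0) (\<lambda>_. 0)" by (simp add: has_weak_gradient_def)
  then have z: "(\<lambda>_. 0) \<in> H1 \<Omega>" by (auto simp: H1_def)
  have "AE x in lebesgue_on \<Omega>. weak_gradient \<Omega> (\<lambda>_. 0) x = 0"
    by (rule has_weak_gradient_zero[OF H1_has_weak_gradient[OF z]]) simp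
  then have "?N (weak_gradient \<Omega> (\<lambda>_. 0)) = Lp_norm 2 (lebesgue_on \<Omega>) (\<lambda>_. 0 :: 'a)"
    by (intro Lp_norm_cong_AE Lp2_measurable H1_Lp2 z) auto
  then have "?N (weak_gradient \<Omega> (\<lambda>_. 0)) = 0" by simp
  then have n0: "H1_norm \<Omega> (\<lambda>_. 0) = 0" by (simp add: H1_norm_def)
  have "H1_norm \<Omega> (\<lambda>x. f x - g x) \<le> H1_norm \<Omega> f + H1_norm \<Omega> g" if f: "f \<in> H1 \<Omega>" and g: "g \<in> H1 \<Omega>" for f g
  proof -
    have "?N (\<lambda>x. f x - g x) \<le> ?N f + ?N g" by (intro Lp2_norm_diff_triangle H1_Lp2 f g)
    moreover have "?N (weak_gradient \<Omega> (\<lambda>x. f x - g x)) \<le> ?N (weak_gradient \<Omega> f) + ?N (weak_gradient \<Omega> g)"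
      unfolding weak_gradient_norm_diff[OF f g] by (intro Lp2_norm_diff_triangle H1_Lp2 f g)
    ultimately have "H1_norm \<Omega> (\<lambda>x. f x - g x)
        \<le> sqrt ((?N f + ?N g)\<^sup>2 + (?N (weak_gradient \<Omega> f) + ?N (weak_gradient \<Omega> g))\<^sup>2)"
      unfolding H1_norm_def by (intro real_sqrt_le_mono add_mono power_mono) auto
    also have "\<dots> \<le> H1_norm \<Omega> f + H1_norm \<Omega> g"
      unfolding H1_norm_def by (rule real_sqrt_sum_squares_triangle_ineq)
    finally show ?thesis .
  qed
  then show ?thesis
    unfolding seminormed_space_def using z n0 H1_diff by (auto simp: H1_norm_def)
qed

lemma H10_H1: "f \<in> H10 \<Omega> \<Longrightarrow> f \<in> H1 \<Omega>"
  by (simp add: H10_def)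

lemma H10_diff:
  assumes f: "f \<in> H10 \<Omega>" and g: "g \<in> H10 \<Omega>"
  shows "(\<lambda>x. f x - g x) \<in> H10 \<Omega>"
proof -
  obtain \<phi> where \<phi>: "\<And>n. \<phi> n \<in> test_functions \<Omega>" "(\<lambda>n. H1_norm \<Omega> (\<lambda>x. f x - \<phi> n x)) \<longlonglongrightarrow> 0"
    using f by (auto simp: H10_def)
  obtain \<psi> where \<psi>: "\<And>n. \<psi> n \<in> test_functions \<Omega>" "(\<lambda>n. H1_norm \<Omega> (\<lambda>x. g x - \<psi> n x)) \<longlonglongrightarrow> 0"
    using g by (auto simp: H10_def)
  note S = seminormed_space_H1
  have "(\<lambda>n. H1_norm \<Omega> (\<lambda>x. (f x - g x) - (\<phi> n x - \<psi> n x))) \<longlonglongrightarrow> 0"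
  proof (rule tendsto_sandwich[OF _ _ tendsto_const])
    have 1: "(\<lambda>x. f x - \<phi> n x) \<in> H1 \<Omega>" "(\<lambda>x. g x - \<psi> n x) \<in> H1 \<Omega>" for n
      by (intro H1_diff H10_H1[OF f] H10_H1[OF g] weak_gradient_test_function(1) \<phi> \<psi>)+
    have e: "(\<lambda>x. (f x - g x) - (\<phi> n x - \<psi> n x)) = (\<lambda>x. (f x - \<phi> n x) - (g x - \<psi> n x))" for n
      by auto
    show "\<forall>\<^sub>F n in sequentially. 0 \<le> H1_norm \<Omega> (\<lambda>x. (f x - g x) - (\<phi> n x - \<psi> n x))"
      by (simp add: H1_norm_def)
    show "\<forall>\<^sub>F n in sequentially. H1_norm \<Omega> (\<lambda>x. (f x - g x) - (\<phi> n x - \<psi> n x))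
        \<le> H1_norm \<Omega> (\<lambda>x. f x - \<phi> n x) + H1_norm \<Omega> (\<lambda>x. g x - \<psi> n x)"
      unfolding e by (intro always_eventually allI seminormed_spaceD(2)[OF S] 1)
    show "(\<lambda>n. H1_norm \<Omega> (\<lambda>x. f x - \<phi> n x) + H1_norm \<Omega> (\<lambda>x. g x - \<psi> n x)) \<longlonglongrightarrow> 0"
      using tendsto_add[OF \<phi>(2) \<psi>(2)] by simp
  qed
  moreover have "(\<lambda>x. \<phi> n x - \<psi> n x) \<in> test_functions \<Omega>" for n
    by (rule test_functions_diff[OF \<phi>(1) \<psi>(1)])
  ultimately show ?thesis
    using H1_diff[OF H10_H1[OF f] H10_H1[OF g]] by (auto simp: H10_def intro!: exI[of _ "\<lambda>n x. \<phi> n x - \<psi> n x"])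
qed

lemma test_functions_H10:
  assumes "\<phi> \<in> test_functions \<Omega>"
  shows "\<phi> \<in> H10 \<Omega>"
proof -
  have "H1_norm \<Omega> (\<lambda>x. \<phi> x - \<phi> x) = 0"
    using seminormed_space_H1 by (simp add: seminormed_space_def)
  then have "(\<lambda>n::nat. H1_norm \<Omega> (\<lambda>x. \<phi> x - \<phi> x)) \<longlonglongrightarrow> 0" by simp
  then show ?thesis
    using weak_gradient_test_function(1)[OF assms] assms
    unfolding H10_def by (intro CollectI conjI exI[of _ "\<lambda>_. \<phi>"] allI)
qed

lemma H10_approx:
  assumes "f \<in> H10 \<Omega>" "e > 0"
  shows "\<exists>\<phi>\<in>test_functions \<Omega>. H1_norm \<Omega> (\<lambda>x. f x - \<phi> x) < e"
proof -
  obtain \<phi> where \<phi>: "\<And>n. \<phi> n \<in> test_functions \<Omega>" "(\<lambda>n. H1_norm \<Omega> (\<lambda>x. f x - \<phi> n x)) \<longlonglongrightarrow> 0"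
    using assms by (auto simp: H10_def)
  have "\<forall>\<^sub>F n in sequentially. H1_norm \<Omega> (\<lambda>x. f x - \<phi> n x) < e"
    using order_tendstoD(2)[OF \<phi>(2) assms(2)] .
  then obtain n where "H1_norm \<Omega> (\<lambda>x. f x - \<phi> n x) < e" by (auto dest: eventually_happens)
  then show ?thesis using \<phi>(1) by blast
qed

end

section \<open>Averages of translates\<close>

lemma Lp2_nn_integral:
  "f \<in> Lp 2 M \<Longrightarrow> (\<integral>\<^sup>+x. ennreal ((norm (f x))\<^sup>2) \<partial>M) = ennreal ((Lp_norm 2 M f)\<^sup>2)"
  unfolding Lp2_norm_sq by (intro nn_integral_eq_integral Lp2_integrable) auto

lemma Lp2_nn_integralI:
  assumes "f \<in> borel_measurable M" "(\<integral>\<^sup>+x. ennreal ((norm (f x))\<^sup>2) \<partial>M) \<le> ennreal (C\<^sup>2)" "C \<ge> 0"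
  shows "f \<in> Lp 2 M" "Lp_norm 2 M f \<le> C"
proof -
  have i: "integrable M (\<lambda>x. (norm (f x))\<^sup>2)"
    using assms by (intro integrableI_nonneg) (auto simp: le_less_trans)
  then show f: "f \<in> Lp 2 M" using assms by (simp add: Lp2_iff)
  have "(Lp_norm 2 M f)\<^sup>2 \<le> C\<^sup>2"
    using assms(2) unfolding Lp2_nn_integral[OF f] by (simp add: ennreal_le_iff)
  then show "Lp_norm 2 M f \<le> C" using assms(3) by (rule power2_le_imp_le)
qed

text \<open>
  The class on which all translation averages exist pointwise and which they map to itself, so
  that averages can be iterated without regard to null sets.
\<close>

definition bounded_borel :: "('a::euclidean_space \<Rightarrow> real) \<Rightarrow> bool" where
  "bounded_borel f \<longleftrightarrow> f \<in> borel_measurable borel \<and> (\<exists>B. \<forall>x. \<bar>f x\<bar> \<le> B)"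

lemma bounded_borel_diff:
  assumes "bounded_borel f" "bounded_borel g"
  shows "bounded_borel (\<lambda>x. f x - g x)"
proof -
  obtain B C where "\<And>x. \<bar>f x\<bar> \<le> B" "\<And>x. \<bar>g x\<bar> \<le> C" using assms unfolding bounded_borel_def by blast
  then have "\<bar>f x - g x\<bar> \<le> B + C" for x
    using order_trans[OF abs_triangle_ineq4 add_mono] by blast
  then show ?thesis using assms unfolding bounded_borel_def by (auto intro!: exI[of _ "B + C"])
qed

definition translation_average :: "'a::euclidean_space measure \<Rightarrow> ('a \<Rightarrow> real) \<Rightarrow> 'a \<Rightarrow> real" where
  "translation_average \<mu> f x = (\<integral>z. f (x - z) \<partial>\<mu>)"

locale averaging_measure = finite_measure \<mu> for \<mu> :: "'a::euclidean_space measure" +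
  assumes sets_borel [measurable_cong]: "sets \<mu> = sets borel"
    and total: "emeasure \<mu> UNIV = 1"
begin

sublocale pair: pair_sigma_finite \<mu> lborel ..

lemma space_UNIV [simp]: "space \<mu> = UNIV"
  using sets_eq_imp_space_eq[OF sets_borel] by simp

lemma measure_UNIV: "measure \<mu> UNIV = 1"
  using total by (simp add: measure_def)

lemma translate_bounded:
  assumes "bounded_borel f"
  shows "integrable \<mu> (\<lambda>z. f (x - z))" "(\<lambda>z. f (x - z)) \<in> Lp 2 \<mu>"
proof -
  obtain B where B: "\<And>x. \<bar>f x\<bar> \<le> B" using assms by (auto simp: bounded_borel_def)
  have [measurable]: "f \<in> borel_measurable borel" using assms by (simp add: bounded_borel_def)
  show "integrable \<mu> (\<lambda>z. f (x - z))" by (rule integrable_const_bound[where B=B]) (auto simp: B)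
  show "(\<lambda>z. f (x - z)) \<in> Lp 2 \<mu>"
    by (rule Lp2_bounded[where C=B]) (auto simp: B finite_measure_axioms)
qed

lemma bounded_borel_average:
  assumes "bounded_borel f"
  shows "bounded_borel (translation_average \<mu> f)"
proof -
  obtain B where B: "\<And>x. \<bar>f x\<bar> \<le> B" using assms by (auto simp: bounded_borel_def)
  have [measurable]: "f \<in> borel_measurable borel" using assms by (simp add: bounded_borel_def)
  have "\<bar>translation_average \<mu> f x\<bar> \<le> B" for x
  proof -
    have "\<bar>translation_average \<mu> f x\<bar> \<le> (\<integral>z. B \<partial>\<mu>)"
      unfolding translation_average_def
      by (rule integral_abs_bound[THEN order_trans], rule integral_mono)
        (auto simp: B translate_bounded[OF assms])
    then show ?thesis by (simp add: measure_UNIV)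
  qed
  moreover have "translation_average \<mu> f \<in> borel_measurable borel"
    unfolding translation_average_def[abs_def] by measurable
  ultimately show ?thesis by (auto simp: bounded_borel_def)
qed

lemma average_diff:
  assumes "bounded_borel f" "bounded_borel g"
  shows "translation_average \<mu> (\<lambda>x. f x - g x) x = translation_average \<mu> f x - translation_average \<mu> g x"
  unfolding translation_average_def
  by (intro Bochner_Integration.integral_diff translate_bounded assms)

text \<open>
  Jensen's inequality for the square.
\<close>

lemma average_square_le:
  assumes "bounded_borel f"
  shows "ennreal ((translation_average \<mu> f x)\<^sup>2) \<le> (\<integral>\<^sup>+z. ennreal ((f (x - z))\<^sup>2) \<partial>\<mu>)"
proof -
  note L = translate_bounded(2)[OF assms, of x]
  have 1: "(\<lambda>z. 1::real) \<in> Lp 2 \<mu>" by (rule Lp2_bounded[where C=1]) (auto simp: finite_measure_axioms)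
  have "Lp_norm 2 \<mu> (\<lambda>z. 1::real) = 1" by (simp add: Lp2_norm measure_UNIV)
  then have "\<bar>translation_average \<mu> f x\<bar> \<le> Lp_norm 2 \<mu> (\<lambda>z. f (x - z))"
    using Lp2_integral_mult_le[OF L 1] by (simp add: translation_average_def)
  then have "(translation_average \<mu> f x)\<^sup>2 \<le> (Lp_norm 2 \<mu> (\<lambda>z. f (x - z)))\<^sup>2"
    using Lp_norm_nonneg by (simp add: abs_le_square_iff[symmetric])
  then show ?thesis
    using Lp2_nn_integral[OF L] by (simp add: ennreal_leI)
qed

text \<open>Fubini moves the average from the function to the weight.\<close>

lemma weighted_average_le:
  fixes w :: "'a \<Rightarrow> ennreal"
  assumes f: "bounded_borel f" and w[measurable]: "w \<in> borel_measurable borel"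
    and B: "\<And>y. (\<integral>\<^sup>+z. w (y + z) \<partial>\<mu>) \<le> B"
  shows "(\<integral>\<^sup>+x. w x * ennreal ((translation_average \<mu> f x)\<^sup>2) \<partial>lborel)
    \<le> B * (\<integral>\<^sup>+x. ennreal ((f x)\<^sup>2) \<partial>lborel)"
proof -
  have [measurable]: "f \<in> borel_measurable borel" using f by (simp add: bounded_borel_def)
  have "(\<integral>\<^sup>+x. w x * ennreal ((translation_average \<mu> f x)\<^sup>2) \<partial>lborel)
      \<le> (\<integral>\<^sup>+x. (\<integral>\<^sup>+z. w x * ennreal ((f (x - z))\<^sup>2) \<partial>\<mu>) \<partial>lborel)"
  proof (rule nn_integral_mono)
    fix x
    have "w x * ennreal ((translation_average \<mu> f x)\<^sup>2) \<le> w x * (\<integral>\<^sup>+z. ennreal ((f (x - z))\<^sup>2) \<partial>\<mu>)"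
      by (intro mult_left_mono average_square_le f) auto
    also have "\<dots> = (\<integral>\<^sup>+z. w x * ennreal ((f (x - z))\<^sup>2) \<partial>\<mu>)" by (rule nn_integral_cmult[symmetric]) measurable
    finally show "w x * ennreal ((translation_average \<mu> f x)\<^sup>2) \<le> (\<integral>\<^sup>+z. w x * ennreal ((f (x - z))\<^sup>2) \<partial>\<mu>)" .
  qed
  also have "\<dots> = (\<integral>\<^sup>+z. (\<integral>\<^sup>+x. w x * ennreal ((f (x - z))\<^sup>2) \<partial>lborel) \<partial>\<mu>)"
    using pair.Fubini[of "\<lambda>(z, x). w x * ennreal ((f (x - z))\<^sup>2)"] by (simp add: split_beta')
  also have "\<dots> = (\<integral>\<^sup>+z. (\<integral>\<^sup>+y. w (y + z) * ennreal ((f y)\<^sup>2) \<partial>lborel) \<partial>\<mu>)"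
  proof (rule nn_integral_cong)
    fix z
    show "(\<integral>\<^sup>+x. w x * ennreal ((f (x - z))\<^sup>2) \<partial>lborel) = (\<integral>\<^sup>+y. w (y + z) * ennreal ((f y)\<^sup>2) \<partial>lborel)"
      using nn_integral_lborel_translate[of "\<lambda>x. w x * ennreal ((f (x - z))\<^sup>2)" z] by simp
  qed
  also have "\<dots> = (\<integral>\<^sup>+y. (\<integral>\<^sup>+z. w (y + z) * ennreal ((f y)\<^sup>2) \<partial>\<mu>) \<partial>lborel)"
    using pair.Fubini[of "\<lambda>(z, y). w (y + z) * ennreal ((f y)\<^sup>2)"] by (simp add: split_beta')
  also have "\<dots> = (\<integral>\<^sup>+y. (\<integral>\<^sup>+z. w (y + z) \<partial>\<mu>) * ennreal ((f y)\<^sup>2) \<partial>lborel)"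
    by (intro nn_integral_cong nn_integral_multc) measurable
  also have "\<dots> \<le> (\<integral>\<^sup>+y. B * ennreal ((f y)\<^sup>2) \<partial>lborel)"
    by (intro nn_integral_mono mult_right_mono B) auto
  also have "\<dots> = B * (\<integral>\<^sup>+y. ennreal ((f y)\<^sup>2) \<partial>lborel)" by (rule nn_integral_cmult) measurable
  finally show ?thesis .
qed

lemma average_Lp2:
  assumes f: "bounded_borel f" "f \<in> Lp 2 lborel"
  shows "translation_average \<mu> f \<in> Lp 2 lborel"
    "Lp_norm 2 lborel (translation_average \<mu> f) \<le> Lp_norm 2 lborel f"
proof -
  have m: "translation_average \<mu> f \<in> borel_measurable lborel"
    using bounded_borel_average[OF f(1)] by (simp add: bounded_borel_def)
  have "(\<integral>\<^sup>+x. ennreal ((norm (translation_average \<mu> f x))\<^sup>2) \<partial>lborel) \<le> ennreal ((Lp_norm 2 lborel f)\<^sup>2)"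
    using weighted_average_le[OF f(1), of "\<lambda>_. 1" 1] Lp2_nn_integral[OF f(2)] by (simp add: total)
  from Lp2_nn_integralI[OF m this] show "translation_average \<mu> f \<in> Lp 2 lborel"
    "Lp_norm 2 lborel (translation_average \<mu> f) \<le> Lp_norm 2 lborel f" by auto
qed

lemma average_minus_eq:
  assumes "bounded_borel f"
  shows "translation_average \<mu> f x - f x = (\<integral>z. f (x - z) - f x \<partial>\<mu>)"
  unfolding translation_average_def using translate_bounded(1)[OF assms, of x] by (simp add: measure_UNIV)

lemma average_minus_square_le:
  assumes f: "bounded_borel f"
  shows "ennreal ((translation_average \<mu> f x - f x)\<^sup>2) \<le> (\<integral>\<^sup>+z. ennreal ((f (x - z) - f x)\<^sup>2) \<partial>\<mu>)"
proof -
  have "bounded_borel (\<lambda>y. f y - f x)"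
    by (rule bounded_borel_diff[OF f]) (auto simp: bounded_borel_def)
  from average_square_le[OF this, of x] show ?thesis
    using average_minus_eq[OF f, of x] by (simp add: translation_average_def)
qed

end

text \<open>
  Fubini's theorem; the point is that the difference of two double averages \<open>A A - B B\<close> factors as
  \<open>(A + B) (A - B)\<close>.
\<close>

lemma average_commute:
  assumes \<mu>: "averaging_measure \<mu>" and \<nu>: "averaging_measure \<nu>" and f: "bounded_borel f"
  shows "translation_average \<mu> (translation_average \<nu> f) x = translation_average \<nu> (translation_average \<mu> f) x"
proof -
  interpret \<mu>: averaging_measure \<mu> by fact
  interpret \<nu>: averaging_measure \<nu> by fact
  interpret P: pair_sigma_finite \<mu> \<nu> ..
  interpret F: finite_measure "\<mu> \<Otimes>\<^sub>M \<nu>" by (rule finite_measure_pair_measure) unfold_locales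
  obtain B where B: "\<And>x. \<bar>f x\<bar> \<le> B" using f by (auto simp: bounded_borel_def)
  have [measurable]: "f \<in> borel_measurable borel" using f by (simp add: bounded_borel_def)
  have "integrable (\<mu> \<Otimes>\<^sub>M \<nu>) (\<lambda>(z, y). f (x - z - y))"
    by (rule F.integrable_const_bound[where B=B]) (auto simp: B)
  then have "(\<integral>z. (\<integral>y. f (x - z - y) \<partial>\<nu>) \<partial>\<mu>) = (\<integral>y. (\<integral>z. f (x - z - y) \<partial>\<mu>) \<partial>\<nu>)"
    by (rule P.Fubini_integral[symmetric])
  then show ?thesis by (simp add: translation_average_def algebra_simps)
qed

section \<open>Averages over balls\<close>

definition ball_measure :: "real \<Rightarrow> 'a::euclidean_space measure" where
  "ball_measure r = uniform_measure lborel (ball 0 r)"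

lemma emeasure_lborel_ball:
  assumes "r > 0"
  shows "emeasure lborel (ball (0::'a::euclidean_space) r) = ennreal (unit_ball_vol DIM('a) * r ^ DIM('a))"
    "unit_ball_vol DIM('a) * r ^ DIM('a) > 0"
proof -
  show "emeasure lborel (ball (0::'a) r) = ennreal (unit_ball_vol DIM('a) * r ^ DIM('a))"
    using assms by (intro emeasure_ball) simp
  show "unit_ball_vol DIM('a) * r ^ DIM('a) > 0"
    using assms by (intro mult_pos_pos zero_less_power unit_ball_vol_pos) auto
qed

lemma nn_integral_ball_measure:
  fixes f :: "'a::euclidean_space \<Rightarrow> ennreal"
  assumes "f \<in> borel_measurable borel"
  shows "(\<integral>\<^sup>+z. f z \<partial>ball_measure r) = (\<integral>\<^sup>+z. f z * indicator (ball 0 r) z \<partial>lborel) / emeasure lborel (ball (0::'a) r)"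
  unfolding ball_measure_def using assms by (intro nn_integral_uniform_measure) auto

lemma averaging_measure_ball:
  assumes "r > 0"
  shows "averaging_measure (ball_measure r :: 'a::euclidean_space measure)"
proof -
  let ?\<mu> = "ball_measure r :: 'a measure"
  have e: "emeasure lborel (ball (0::'a) r) \<noteq> 0" "emeasure lborel (ball (0::'a) r) \<noteq> \<infinity>"
    unfolding emeasure_lborel_ball(1)[OF assms]
    using emeasure_lborel_ball(2)[OF assms, where 'a='a] by (metis ennreal_eq_0_iff not_le, simp)
  have t: "emeasure ?\<mu> UNIV = 1"
    unfolding ball_measure_def using e by (simp add: ennreal_divide_self top.not_eq_extremum)
  have s: "sets ?\<mu> = sets borel" by (simp add: ball_measure_def)
  then have "space ?\<mu> = UNIV" using sets_eq_imp_space_eq by fastforce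
  with s t show ?thesis
    by (intro averaging_measure.intro finite_measureI averaging_measure_axioms.intro) simp_all
qed

lemma AE_ball_measure: "AE z in ball_measure r. norm z < r"
proof -
  have "AE z in uniform_measure lborel (ball (0::'a::euclidean_space) r). z \<in> ball 0 r"
    by (rule AE_uniform_measureI) auto
  then show ?thesis unfolding ball_measure_def by auto
qed

text \<open>
  The elementary form of Holder's inequality on which the choice of scales rests:
  \<open>h\<^sup>2\<close> is at most \<open>m\<^sup>2\<close> where \<open>h \<le> m\<close>, and at most \<open>h^(d+2) / m^d\<close> elsewhere.
\<close>

lemma square_le_split:
  fixes h m :: real
  assumes "h \<ge> 0" "m > 0"
  shows "h\<^sup>2 \<le> m\<^sup>2 + h ^ (d + 2) / m ^ d"
proof (cases "h \<le> m")
  case True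
  then have "h\<^sup>2 \<le> m\<^sup>2" using assms by (intro power_mono) auto
  moreover have "0 \<le> h ^ (d + 2) / m ^ d" using assms by auto
  ultimately show ?thesis by linarith
next
  case False
  then have "m ^ d \<le> h ^ d" using assms by (intro power_mono) auto
  then have "h\<^sup>2 * m ^ d \<le> h\<^sup>2 * h ^ d" by (intro mult_left_mono) auto
  moreover have "h ^ (d + 2) = h\<^sup>2 * h ^ d" by (metis add.commute power_add)
  ultimately have "h\<^sup>2 * m ^ d \<le> h ^ (d + 2)" by (simp only:)
  then have "h\<^sup>2 \<le> h ^ (d + 2) / m ^ d" using assms by (simp add: pos_le_divide_eq)
  then show ?thesis by (smt (verit) zero_le_power2)
qed

text \<open>
  For the level \<open>m = s / r\<close> the bound times \<open>r\<^sup>2\<close> is \<open>s\<^sup>2 + A * r\<^sup>2 / (\<omega> * s ^ d)\<close>, where \<open>\<omega>\<close> is the volume of the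
  unit ball; it is small as soon as \<open>s\<close> and \<open>r\<^sup>2 / s ^ d\<close> are.
\<close>

lemma ball_average_weight:
  fixes h :: "'a::euclidean_space \<Rightarrow> real"
  assumes h[measurable]: "h \<in> borel_measurable borel" and h0: "\<And>x. h x \<ge> 0"
    and A: "(\<integral>\<^sup>+x. ennreal (h x ^ (DIM('a) + 2)) \<partial>lborel) \<le> ennreal A" "A \<ge> 0"
    and r: "r > 0" and m: "m > 0"
  shows "(\<integral>\<^sup>+z. ennreal ((h (y + z))\<^sup>2) \<partial>ball_measure r)
    \<le> ennreal (m\<^sup>2 + A / (m ^ DIM('a) * (unit_ball_vol DIM('a) * r ^ DIM('a))))"
proof -
  interpret averaging_measure "ball_measure r :: 'a measure" by (rule averaging_measure_ball[OF r])
  let ?d = "DIM('a)" and ?v = "unit_ball_vol DIM('a) * r ^ DIM('a)"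
  have v: "?v > 0" using emeasure_lborel_ball(2)[OF r, where 'a='a] .
  have "(\<integral>\<^sup>+z. ennreal ((h (y + z))\<^sup>2) \<partial>ball_measure r)
      \<le> (\<integral>\<^sup>+z. ennreal (m\<^sup>2) + ennreal (1 / m ^ ?d) * ennreal (h (y + z) ^ (?d + 2)) \<partial>ball_measure r)"
  proof (rule nn_integral_mono)
    fix z
    have "ennreal ((h (y + z))\<^sup>2) \<le> ennreal (m\<^sup>2 + 1 / m ^ ?d * h (y + z) ^ (?d + 2))"
      using square_le_split[OF h0 m, of "y + z" ?d] by (intro ennreal_leI) simp
    also have "\<dots> = ennreal (m\<^sup>2) + ennreal (1 / m ^ ?d) * ennreal (h (y + z) ^ (?d + 2))"
      using m h0[of "y + z"] by (subst ennreal_mult[symmetric], simp, simp, subst ennreal_plus[symmetric]) auto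
    finally show "ennreal ((h (y + z))\<^sup>2) \<le> ennreal (m\<^sup>2) + ennreal (1 / m ^ ?d) * ennreal (h (y + z) ^ (?d + 2))" .
  qed
  also have "\<dots> = ennreal (m\<^sup>2) + ennreal (1 / m ^ ?d) * (\<integral>\<^sup>+z. ennreal (h (y + z) ^ (?d + 2)) \<partial>ball_measure r)"
    by (subst nn_integral_add) (auto simp: nn_integral_cmult total)
  also have "(\<integral>\<^sup>+z. ennreal (h (y + z) ^ (?d + 2)) \<partial>ball_measure r) \<le> ennreal (A / ?v)"
  proof -
    have "(\<integral>\<^sup>+z. ennreal (h (y + z) ^ (?d + 2)) * indicator (ball 0 r) z \<partial>lborel)
        \<le> (\<integral>\<^sup>+z. ennreal (h (z + y) ^ (?d + 2)) \<partial>lborel)"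
      by (intro nn_integral_mono) (auto simp: indicator_def add.commute)
    also have "\<dots> = (\<integral>\<^sup>+z. ennreal (h z ^ (?d + 2)) \<partial>lborel)"
      by (rule nn_integral_lborel_translate[of "\<lambda>z. ennreal (h z ^ (?d + 2))"]) measurable
    also have "\<dots> \<le> ennreal A" by (fact A(1))
    finally have "(\<integral>\<^sup>+z. ennreal (h (y + z) ^ (?d + 2)) \<partial>ball_measure r) \<le> ennreal A / ennreal ?v"
      by (subst nn_integral_ball_measure) (auto simp: emeasure_lborel_ball[OF r, where 'a='a] intro!: divide_right_mono_ennreal)
    then show ?thesis using v A(2) by (simp add: divide_ennreal)
  qed
  also have "ennreal (m\<^sup>2) + ennreal (1 / m ^ ?d) * ennreal (A / ?v) = ennreal (m\<^sup>2 + A / (m ^ ?d * ?v))"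
    using m v A(2) by (subst ennreal_mult[symmetric], simp, simp, subst ennreal_plus[symmetric]) auto
  finally show ?thesis by (meson add_left_mono mult_left_mono order_trans zero_le)
qed

lemma gradient_chain_line:
  assumes f: "f \<in> test_functions S"
  shows "((\<lambda>s. f (x + s *\<^sub>R z)) has_real_derivative gradient f (x + s *\<^sub>R z) \<bullet> z) (at s)"
proof -
  have "((\<lambda>s. f (x + s *\<^sub>R z)) has_derivative (\<lambda>h. gradient f (x + s *\<^sub>R z) \<bullet> (h *\<^sub>R z))) (at s)"
    by (rule has_derivative_compose[OF _ test_functions_has_derivative[OF f]])
      (auto intro!: derivative_eq_intros)
  then show ?thesis by (auto simp: has_field_derivative_def fun_eq_iff elim!: has_derivative_eq_rhs)
qed

text \<open>
  The fundamental theorem of calculus on the segment from \<open>x\<close> to \<open>x + z\<close> and the Cauchy--Schwarz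
  inequality on it; after integration over \<open>x\<close> each point of the segment contributes the same.
\<close>

lemma translation_difference_le:
  fixes f :: "'a::euclidean_space \<Rightarrow> real"
  assumes f: "f \<in> test_functions S"
  shows "(\<integral>\<^sup>+x. ennreal ((f (x + z) - f x)\<^sup>2) \<partial>lborel)
    \<le> ennreal ((norm z)\<^sup>2) * (\<integral>\<^sup>+x. ennreal ((norm (gradient f x))\<^sup>2) \<partial>lborel)"
proof -
  have [measurable]: "f \<in> borel_measurable borel" "gradient f \<in> borel_measurable borel"
    by (rule test_functions_measurable[OF f], rule gradient_measurable[OF f])
  define I :: "real \<Rightarrow> ennreal" where "I s = indicator {0..1} s" for s
  have [measurable]: "I \<in> borel_measurable borel" unfolding I_def by measurable
  have I1: "(\<integral>\<^sup>+s. I s \<partial>lborel) = 1" unfolding I_def by simp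
  have pw: "ennreal ((f (x + z) - f x)\<^sup>2)
      \<le> ennreal ((norm z)\<^sup>2) * (\<integral>\<^sup>+s. I s * ennreal ((norm (gradient f (x + s *\<^sub>R z)))\<^sup>2) \<partial>lborel)" for x
  proof -
    let ?g = "\<lambda>s. gradient f (x + s *\<^sub>R z) \<bullet> z"
    have cont: "isCont ?g s" for s
      by (intro continuous_intros isCont_o2[OF _ continuous_on_interior[OF gradient_continuous[OF f]]]) auto
    have hb: "has_bochner_integral lborel (\<lambda>s. ?g s * indicator {0..1} s) (f (x + 1 *\<^sub>R z) - f (x + 0 *\<^sub>R z))"
      by (rule has_bochner_integral_FTC_Icc_real[where F="\<lambda>s. f (x + s *\<^sub>R z)"])
        (use gradient_chain_line[OF f] cont in auto)
    have e1: "(I s)\<^sup>2 = I s" for s by (simp add: I_def indicator_def)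
    have e2: "(ennreal (norm z * norm (gradient f (x + s *\<^sub>R z))) * I s)\<^sup>2
        = ennreal ((norm z)\<^sup>2) * (I s * ennreal ((norm (gradient f (x + s *\<^sub>R z)))\<^sup>2))" for s
      by (cases "s \<in> {0..1}") (simp_all add: I_def ennreal_power power_mult_distrib ennreal_mult)
    have cs: "\<bar>?g s\<bar> \<le> norm z * norm (gradient f (x + s *\<^sub>R z))" for s
      using Cauchy_Schwarz_ineq2[of "gradient f (x + s *\<^sub>R z)" z] by (simp add: mult.commute)
    have gm[measurable]: "?g \<in> borel_measurable borel" by measurable
    have "ennreal \<bar>f (x + z) - f x\<bar> \<le> (\<integral>\<^sup>+s. ennreal \<bar>?g s * indicator {0..1} s\<bar> \<partial>lborel)"
      using integral_norm_bound_ennreal[of lborel "\<lambda>s. ?g s * indicator {0..1} s"] hb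
      by (simp add: has_bochner_integral_iff)
    also have "\<dots> \<le> (\<integral>\<^sup>+s. I s * (ennreal (norm z * norm (gradient f (x + s *\<^sub>R z))) * I s) \<partial>lborel)"
      using cs by (intro nn_integral_mono) (auto simp: I_def indicator_def intro!: ennreal_leI)
    finally have "(ennreal \<bar>f (x + z) - f x\<bar>)\<^sup>2
        \<le> (\<integral>\<^sup>+s. I s * (ennreal (norm z * norm (gradient f (x + s *\<^sub>R z))) * I s) \<partial>lborel)\<^sup>2"
      by (intro power_mono) auto
    also have "\<dots> \<le> (\<integral>\<^sup>+s. (I s)\<^sup>2 \<partial>lborel)
        * (\<integral>\<^sup>+s. (ennreal (norm z * norm (gradient f (x + s *\<^sub>R z))) * I s)\<^sup>2 \<partial>lborel)"
      by (rule Cauchy_Schwarz_nn_integral) auto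
    also have "\<dots> = (\<integral>\<^sup>+s. ennreal ((norm z)\<^sup>2) * (I s * ennreal ((norm (gradient f (x + s *\<^sub>R z)))\<^sup>2)) \<partial>lborel)"
      unfolding e1 e2 by (simp add: I1)
    also have "\<dots> = ennreal ((norm z)\<^sup>2) * (\<integral>\<^sup>+s. I s * ennreal ((norm (gradient f (x + s *\<^sub>R z)))\<^sup>2) \<partial>lborel)"
      by (rule nn_integral_cmult) measurable
    finally show ?thesis by (simp add: ennreal_power)
  qed
  have "(\<integral>\<^sup>+x. ennreal ((f (x + z) - f x)\<^sup>2) \<partial>lborel)
      \<le> (\<integral>\<^sup>+x. ennreal ((norm z)\<^sup>2) * (\<integral>\<^sup>+s. I s * ennreal ((norm (gradient f (x + s *\<^sub>R z)))\<^sup>2) \<partial>lborel) \<partial>lborel)"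
    by (rule nn_integral_mono[OF pw])
  also have "\<dots> = ennreal ((norm z)\<^sup>2) * (\<integral>\<^sup>+x. (\<integral>\<^sup>+s. I s * ennreal ((norm (gradient f (x + s *\<^sub>R z)))\<^sup>2) \<partial>lborel) \<partial>lborel)"
    by (rule nn_integral_cmult) measurable
  also have "(\<integral>\<^sup>+x. (\<integral>\<^sup>+s. I s * ennreal ((norm (gradient f (x + s *\<^sub>R z)))\<^sup>2) \<partial>lborel) \<partial>lborel)
      = (\<integral>\<^sup>+s. (\<integral>\<^sup>+x. I s * ennreal ((norm (gradient f (x + s *\<^sub>R z)))\<^sup>2) \<partial>lborel) \<partial>lborel)"
    using lborel_pair.Fubini[of "\<lambda>(s::real, x::'a). I s * ennreal ((norm (gradient f (x + s *\<^sub>R z)))\<^sup>2)"]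
    by (simp add: split_beta')
  also have "\<dots> = (\<integral>\<^sup>+s. I s * (\<integral>\<^sup>+x. ennreal ((norm (gradient f x))\<^sup>2) \<partial>lborel) \<partial>lborel)"
  proof (rule nn_integral_cong)
    fix s :: real
    have "(\<integral>\<^sup>+x. I s * ennreal ((norm (gradient f (x + s *\<^sub>R z)))\<^sup>2) \<partial>lborel)
        = I s * (\<integral>\<^sup>+x. ennreal ((norm (gradient f (x + s *\<^sub>R z)))\<^sup>2) \<partial>lborel)"
      by (rule nn_integral_cmult) measurable
    also have "(\<integral>\<^sup>+x. ennreal ((norm (gradient f (x + s *\<^sub>R z)))\<^sup>2) \<partial>lborel) = (\<integral>\<^sup>+x. ennreal ((norm (gradient f x))\<^sup>2) \<partial>lborel)"
      by (rule nn_integral_lborel_translate[of "\<lambda>x. ennreal ((norm (gradient f x))\<^sup>2)"]) measurable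
    finally show "(\<integral>\<^sup>+x. I s * ennreal ((norm (gradient f (x + s *\<^sub>R z)))\<^sup>2) \<partial>lborel)
        = I s * (\<integral>\<^sup>+x. ennreal ((norm (gradient f x))\<^sup>2) \<partial>lborel)" .
  qed
  also have "\<dots> = (\<integral>\<^sup>+x. ennreal ((norm (gradient f x))\<^sup>2) \<partial>lborel)"
    by (subst nn_integral_multc) (auto simp: I1)
  finally show ?thesis .
qed

lemma test_functions_Lp2_lborel:
  assumes f: "f \<in> test_functions S"
  shows "f \<in> Lp 2 lborel" "gradient f \<in> Lp 2 lborel"
proof -
  have "(\<lambda>x. f x * f x) \<in> test_functions S"
    by (rule test_functions_mult[OF test_functionsD(1)[OF f] f])
  then show "f \<in> Lp 2 lborel"
    using test_functions_integrable test_functions_measurable[OF f]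
    by (fastforce simp: Lp2_iff power2_eq_square)
  have "integrable lborel (\<lambda>x. \<Sum>b\<in>Basis. frechet_derivative f (at x) b * frechet_derivative f (at x) b)"
  proof (rule Bochner_Integration.integrable_sum)
    fix b :: 'a assume b: "b \<in> Basis"
    have D: "(\<lambda>x. frechet_derivative f (at x) b) \<in> test_functions S" by (rule test_functions_derivative[OF f b])
    show "integrable lborel (\<lambda>x. frechet_derivative f (at x) b * frechet_derivative f (at x) b)"
      by (rule test_functions_integrable[OF test_functions_mult[OF test_functionsD(1)[OF D] D]])
  qed
  also have "(\<lambda>x. \<Sum>b\<in>Basis. frechet_derivative f (at x) b * frechet_derivative f (at x) b)
      = (\<lambda>x. (norm (gradient f x))\<^sup>2)"
    unfolding power2_norm_eq_inner by (subst euclidean_inner) (simp add: gradient_inner)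
  finally show "gradient f \<in> Lp 2 lborel"
    using gradient_measurable[OF f] by (simp add: Lp2_iff)
qed

lemma test_functions_bounded_borel: "f \<in> test_functions S \<Longrightarrow> bounded_borel f"
  unfolding bounded_borel_def using test_functions_measurable test_functions_bounded by metis

text \<open>
  By Jensen's inequality it suffices to average the bound for translations over \<open>|z| < r\<close>.
\<close>

lemma ball_average_minus_le:
  fixes f :: "'a::euclidean_space \<Rightarrow> real"
  assumes f: "f \<in> test_functions S" and r: "r > 0"
  shows "Lp_norm 2 lborel (\<lambda>x. translation_average (ball_measure r) f x - f x)
    \<le> r * Lp_norm 2 lborel (gradient f)"
proof -
  let ?\<mu> = "ball_measure r :: 'a measure"
  interpret averaging_measure ?\<mu> by (rule averaging_measure_ball[OF r])
  have bf: "bounded_borel f" by (rule test_functions_bounded_borel[OF f])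
  have [measurable]: "f \<in> borel_measurable borel" by (rule test_functions_measurable[OF f])
  have m: "(\<lambda>x. translation_average ?\<mu> f x - f x) \<in> borel_measurable lborel"
    using bounded_borel_average[OF bf] by (auto simp: bounded_borel_def)
  let ?G = "\<integral>\<^sup>+x. ennreal ((norm (gradient f x))\<^sup>2) \<partial>lborel"
  have "(\<integral>\<^sup>+x. ennreal ((translation_average ?\<mu> f x - f x)\<^sup>2) \<partial>lborel)
      \<le> (\<integral>\<^sup>+x. (\<integral>\<^sup>+z. ennreal ((f (x - z) - f x)\<^sup>2) \<partial>?\<mu>) \<partial>lborel)"
    by (intro nn_integral_mono average_minus_square_le bf)
  also have "\<dots> = (\<integral>\<^sup>+z. (\<integral>\<^sup>+x. ennreal ((f (x - z) - f x)\<^sup>2) \<partial>lborel) \<partial>?\<mu>)"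
    using pair.Fubini[of "\<lambda>(z, x). ennreal ((f (x - z) - f x)\<^sup>2)"] by (simp add: split_beta')
  also have "\<dots> \<le> (\<integral>\<^sup>+z. ennreal (r\<^sup>2) * ?G \<partial>?\<mu>)"
  proof (rule nn_integral_mono_AE, use AE_ball_measure in eventually_elim)
    fix z :: 'a assume z: "norm z < r"
    have "(\<integral>\<^sup>+x. ennreal ((f (x - z) - f x)\<^sup>2) \<partial>lborel) \<le> ennreal ((norm z)\<^sup>2) * ?G"
      using translation_difference_le[OF f, of "- z"] by simp
    also have "\<dots> \<le> ennreal (r\<^sup>2) * ?G"
      using z by (intro mult_right_mono ennreal_leI power_mono) auto
    finally show "(\<integral>\<^sup>+x. ennreal ((f (x - z) - f x)\<^sup>2) \<partial>lborel) \<le> ennreal (r\<^sup>2) * ?G" .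
  qed
  also have "\<dots> = ennreal (r\<^sup>2) * ?G" by (simp add: total)
  also have "\<dots> = ennreal ((r * Lp_norm 2 lborel (gradient f))\<^sup>2)"
    using Lp2_nn_integral[OF test_functions_Lp2_lborel(2)[OF f]] by (simp add: ennreal_mult power_mult_distrib)
  finally show ?thesis using r m by (intro Lp2_nn_integralI(2)) auto
qed

lemma ball_average_minus_bounded:
  fixes f :: "'a::euclidean_space \<Rightarrow> real"
  assumes f: "bounded_borel f" and r: "r > 0" and L: "L \<ge> 0" "\<And>x y. \<bar>f x - f y\<bar> \<le> L * norm (x - y)"
  shows "\<bar>translation_average (ball_measure r) f x - f x\<bar> \<le> L * r"
proof -
  let ?\<mu> = "ball_measure r :: 'a measure"
  interpret averaging_measure ?\<mu> by (rule averaging_measure_ball[OF r])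
  have "\<bar>translation_average ?\<mu> f x - f x\<bar> \<le> (\<integral>z. \<bar>f (x - z) - f x\<bar> \<partial>?\<mu>)"
    unfolding average_minus_eq[OF f] by (rule integral_abs_bound)
  also have "\<dots> \<le> (\<integral>z. L * r \<partial>?\<mu>)"
  proof (rule integral_mono_AE)
    show "integrable ?\<mu> (\<lambda>z. \<bar>f (x - z) - f x\<bar>)" using translate_bounded(1)[OF f, of x] by auto
    show "AE z in ?\<mu>. \<bar>f (x - z) - f x\<bar> \<le> L * r"
      using AE_ball_measure
    proof eventually_elim
      case (elim z)
      have "\<bar>f (x - z) - f x\<bar> \<le> L * norm z" using L(2)[of "x - z" x] by simp
      also have "\<dots> \<le> L * r" using elim L(1) by (intro mult_left_mono) auto
      finally show ?case .
    qed
  qed auto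
  also have "\<dots> = L * r" by (simp add: measure_UNIV)
  finally show ?thesis .
qed

section \<open>The weighted inequality\<close>

text \<open>
  An unbounded weight is harmless for a function that is itself an average: it may be replaced by
  the averages of the weight.
\<close>

lemma weighted_average_norm_le:
  fixes h :: "'a::euclidean_space \<Rightarrow> real"
  assumes \<mu>: "averaging_measure \<mu>" and h[measurable]: "h \<in> borel_measurable borel"
    and B: "\<And>y. (\<integral>\<^sup>+z. ennreal ((h (y + z))\<^sup>2) \<partial>\<mu>) \<le> ennreal B" "B \<ge> 0"
    and g: "bounded_borel g" "g \<in> Lp 2 lborel"
  shows "Lp_norm 2 (density lborel (\<lambda>x. ennreal ((h x)\<^sup>2))) (translation_average \<mu> g)
    \<le> sqrt B * Lp_norm 2 lborel g"
proof -
  interpret averaging_measure \<mu> by fact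
  have [measurable]: "translation_average \<mu> g \<in> borel_measurable borel"
    using bounded_borel_average[OF g(1)] by (simp add: bounded_borel_def)
  have "(\<integral>\<^sup>+x. ennreal ((norm (translation_average \<mu> g x))\<^sup>2) \<partial>density lborel (\<lambda>x. ennreal ((h x)\<^sup>2)))
      = (\<integral>\<^sup>+x. ennreal ((h x)\<^sup>2) * ennreal ((translation_average \<mu> g x)\<^sup>2) \<partial>lborel)"
    by (subst nn_integral_density) auto
  also have "\<dots> \<le> ennreal B * (\<integral>\<^sup>+x. ennreal ((g x)\<^sup>2) \<partial>lborel)"
    by (rule weighted_average_le[OF g(1) _ B(1)]) measurable
  also have "\<dots> = ennreal ((sqrt B * Lp_norm 2 lborel g)\<^sup>2)"
    using Lp2_nn_integral[OF g(2)] B(2) by (simp add: ennreal_mult power_mult_distrib)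
  finally show ?thesis using B(2) by (intro Lp2_nn_integralI(2)) auto
qed

text \<open>
  With \<open>F\<^sub>k = A\<^sub>k (A\<^sub>k f)\<close>, where \<open>A\<^sub>k\<close> averages over the ball of radius \<open>r k\<close>, the increment
  \<open>F\<^sub>k\<^sub>+\<^sub>1 - F\<^sub>k = (A\<^sub>k\<^sub>+\<^sub>1 + A\<^sub>k) (A\<^sub>k\<^sub>+\<^sub>1 f - A\<^sub>k f)\<close> is controlled by \<open>r k\<close> times the norm of the gradient, and
  the outer average turns the weight into its supremum of averages \<open>B k\<close>.  The radii
  \<open>\<rho> * 2^(-d k)\<close> are chosen such that the splitting levels \<open>m k\<close> are integer powers as well and
  that \<open>B k * (r k)\<^sup>2\<close> decays geometrically; \<open>\<rho>\<close> balances the two parts of \<open>B 0\<close>.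
\<close>

lemma weighted_norm_le:
  fixes h f :: "'a::euclidean_space \<Rightarrow> real"
  assumes h[measurable]: "h \<in> borel_measurable borel" and h0: "\<And>x. h x \<ge> 0"
    and A: "(\<integral>\<^sup>+x. ennreal (h x ^ (DIM('a) + 2)) \<partial>lborel) \<le> ennreal A" "A > 0"
    and h2: "(\<integral>\<^sup>+x. ennreal ((h x)\<^sup>2) \<partial>lborel) < \<infinity>"
    and f: "f \<in> test_functions S" and \<theta>: "\<theta> > 0"
  shows "Lp_norm 2 (density lborel (\<lambda>x. ennreal ((h x)\<^sup>2))) f
    \<le> sqrt (2 * A / (unit_ball_vol DIM('a) * \<theta> ^ DIM('a))) * Lp_norm 2 lborel f
      + 16 * (1 + 2 ^ DIM('a)) * \<theta> * Lp_norm 2 lborel (gradient f)"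
proof -
  define d where "d = DIM('a)"
  have d: "d \<ge> 1" unfolding d_def using DIM_positive by (simp add: Suc_leI)
  define \<omega> where "\<omega> = unit_ball_vol d"
  have \<omega>: "\<omega> > 0" by (simp add: \<omega>_def)
  \<comment> \<open>\<open>\<rho>\<close> makes the two summands of \<open>B 0\<close> equal.\<close>
  define \<rho> where "\<rho> = sqrt (\<omega> * \<theta> ^ (d + 2) / A)"
  have \<rho>: "\<rho> > 0" using \<omega> \<theta> A by (simp add: \<rho>_def)
  have \<rho>2: "A * \<rho>\<^sup>2 = \<omega> * \<theta> ^ (d + 2)" using \<omega> \<theta> A by (simp add: \<rho>_def)
  define K :: real where "K = 2 ^ d"
  have K: "K \<ge> 2" unfolding K_def using d power_increasing[of 1 d "2::real"] by simp
  define r where "r k = \<rho> / K ^ k" for k :: nat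
  \<comment> \<open>The product \<open>m k * r k\<close> is \<open>\<theta> / 2 ^ k\<close>, and the power \<open>d - 1 \<ge> 0\<close> is natural.\<close>
  define m where "m k = \<theta> / \<rho> * (2 ^ (d - 1)) ^ k" for k :: nat
  define B where "B k = (m k)\<^sup>2 + A / (m k ^ d * (\<omega> * r k ^ d))" for k
  have r: "r k > 0" for k unfolding r_def using \<rho> K by simp
  have m: "m k > 0" for k unfolding m_def using \<rho> \<theta> by simp
  have B0: "B k \<ge> 0" for k unfolding B_def using m[of k] r[of k] \<omega> A by simp
  have mr: "m k * r k = \<theta> / 2 ^ k" for k
  proof -
    have "K = 2 * 2 ^ (d - 1)" unfolding K_def using d by (metis le_add_diff_inverse plus_1_eq_Suc power_Suc)
    then show ?thesis unfolding m_def r_def using \<rho> by (simp add: power_mult_distrib field_simps)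
  qed
  have Br: "B k * (r k)\<^sup>2 \<le> 2 * \<theta>\<^sup>2 / 2 ^ k" for k
  proof -
    have e: "(2::real) ^ k \<le> (2 ^ k)\<^sup>2" by (simp add: power2_eq_square)
    have "(m k)\<^sup>2 * (r k)\<^sup>2 = \<theta>\<^sup>2 / (2 ^ k)\<^sup>2"
      using mr[of k] by (metis power_divide power_mult_distrib)
    also have "\<dots> \<le> \<theta>\<^sup>2 / 2 ^ k" using e by (intro divide_left_mono) auto
    finally have 1: "(m k)\<^sup>2 * (r k)\<^sup>2 \<le> \<theta>\<^sup>2 / 2 ^ k" .
    have mrd: "m k ^ d * r k ^ d = \<theta> ^ d / K ^ k"
      unfolding power_mult_distrib[symmetric] mr K_def
      by (simp add: power_divide power_mult[symmetric] mult.commute)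
    have "A / (m k ^ d * (\<omega> * r k ^ d)) * (r k)\<^sup>2 = (A * \<rho>\<^sup>2) / (\<omega> * (m k ^ d * r k ^ d) * (K ^ k)\<^sup>2)"
      unfolding r_def by (simp add: power_divide field_simps)
    also have "\<dots> = \<theta>\<^sup>2 / K ^ k"
      unfolding mrd \<rho>2 using \<omega> \<theta> K by (simp add: field_simps power_add power2_eq_square)
    also have "\<dots> \<le> \<theta>\<^sup>2 / 2 ^ k" using K by (intro divide_left_mono power_mono) auto
    finally show ?thesis using 1 unfolding B_def by (simp add: distrib_right)
  qed
  \<comment> \<open>The ratio of the geometric series; the bound \<open>3/4\<close> makes its sum at most 4.\<close>
  define q :: real where "q = sqrt (1/2)"
  have q: "0 \<le> q" "q \<le> 3/4"
  proof -
    have "q \<le> sqrt ((3/4)\<^sup>2)" unfolding q_def by (intro real_sqrt_le_mono) (simp add: power2_eq_square)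
    then show "q \<le> 3/4" by simp
  qed (simp add: q_def)
  have qk: "q ^ k = sqrt (1 / 2 ^ k)" for k unfolding q_def real_sqrt_power[symmetric] by (simp add: power_divide)
  have sB: "sqrt (B k) * r k \<le> 2 * \<theta> * q ^ k" for k
  proof -
    have "sqrt (B k) * r k = sqrt (B k * (r k)\<^sup>2)" using r[of k] by (simp add: real_sqrt_mult)
    also have "\<dots> \<le> sqrt ((2 * \<theta>)\<^sup>2 * (1 / 2 ^ k))"
    proof (rule real_sqrt_le_mono)
      have "(2 * \<theta>)\<^sup>2 * (1 / 2 ^ k) = 2 * (2 * \<theta>\<^sup>2 / 2 ^ k)" by (simp add: power2_eq_square)
      moreover have "0 \<le> 2 * \<theta>\<^sup>2 / 2 ^ k" by simp
      ultimately show "B k * (r k)\<^sup>2 \<le> (2 * \<theta>)\<^sup>2 * (1 / 2 ^ k)" using Br[of k] by linarith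
    qed
    also have "\<dots> = 2 * \<theta> * q ^ k"
      using \<theta> by (simp only: real_sqrt_mult[of "(2 * \<theta>)\<^sup>2"] real_sqrt_abs qk)
    finally show ?thesis .
  qed
  define \<mu> where "\<mu> k = (ball_measure (r k) :: 'a measure)" for k
  have av: "averaging_measure (\<mu> k)" for k unfolding \<mu>_def by (rule averaging_measure_ball[OF r])
  define T where "T k = translation_average (\<mu> k)" for k
  define M where "M = density lborel (\<lambda>x. ennreal ((h x)\<^sup>2))"
  have fin: "finite_measure M"
    using h2 by (intro finite_measureI) (simp add: M_def emeasure_density)
  define NM where "NM = (Lp_norm 2 M :: ('a \<Rightarrow> real) \<Rightarrow> real)"
  have LpM: "g \<in> Lp 2 M" if "bounded_borel g" for g
    using that unfolding bounded_borel_def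
    by (elim conjE exE) (rule Lp2_bounded[OF fin], auto simp: M_def)
  have hT: "NM (T k g) \<le> sqrt (B k) * Lp_norm 2 lborel g" if "bounded_borel g" "g \<in> Lp 2 lborel" for k g
    unfolding NM_def M_def T_def
  proof (rule weighted_average_norm_le[OF av h _ B0 that])
    fix y
    show "(\<integral>\<^sup>+z. ennreal ((h (y + z))\<^sup>2) \<partial>\<mu> k) \<le> ennreal (B k)"
      using ball_average_weight[OF h h0 A(1) less_imp_le[OF A(2)] r[of k] m[of k], of y]
      unfolding B_def \<mu>_def d_def \<omega>_def .
  qed
  have bf: "bounded_borel f" and Lf: "f \<in> Lp 2 lborel"
    using test_functions_bounded_borel[OF f] test_functions_Lp2_lborel(1)[OF f] by auto
  have bT: "bounded_borel (T k g)" if "bounded_borel g" for k g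
    unfolding T_def by (rule averaging_measure.bounded_borel_average[OF av that])
  have LT: "T k g \<in> Lp 2 lborel" "Lp_norm 2 lborel (T k g) \<le> Lp_norm 2 lborel g"
    if "bounded_borel g" "g \<in> Lp 2 lborel" for k g
    unfolding T_def using averaging_measure.average_Lp2[OF av that] by auto
  have Tdiff: "T k (\<lambda>x. g x - g' x) = (\<lambda>x. T k g x - T k g' x)" if "bounded_borel g" "bounded_borel g'" for k g g'
    unfolding T_def using averaging_measure.average_diff[OF av that] by auto
  let ?G = "Lp_norm 2 lborel (gradient f)" and ?F = "Lp_norm 2 lborel f"
  define F where "F k = T k (T k f)" for k
  have bF: "bounded_borel (F k)" for k unfolding F_def by (intro bT bf)
  have step: "NM (\<lambda>x. F (Suc k) x - F k x) \<le> 4 * (1 + K) * \<theta> * ?G * q ^ k" for k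
  proof -
    define g where "g x = T (Suc k) f x - T k f x" for x
    have g: "bounded_borel g" "g \<in> Lp 2 lborel"
      unfolding g_def by (intro bounded_borel_diff bT bf, intro Lp2_diff LT bf Lf)
    have rle: "r (Suc k) \<le> r k" unfolding r_def using \<rho> K by (intro divide_left_mono power_increasing) auto
    have "g = (\<lambda>x. (T (Suc k) f x - f x) - (T k f x - f x))" by (auto simp: g_def)
    then have "Lp_norm 2 lborel g \<le> Lp_norm 2 lborel (\<lambda>x. T (Suc k) f x - f x) + Lp_norm 2 lborel (\<lambda>x. T k f x - f x)"
      using Lp2_norm_diff_triangle[of "\<lambda>x. T (Suc k) f x - f x" lborel "\<lambda>x. T k f x - f x"]
      by (simp add: Lp2_diff LT bf Lf)
    also have "\<dots> \<le> r (Suc k) * ?G + r k * ?G"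
      unfolding T_def \<mu>_def by (intro add_mono ball_average_minus_le[OF f r])
    also have "\<dots> \<le> 2 * r k * ?G" using rle by (simp add: mult_right_mono flip: distrib_right)
    finally have ng: "Lp_norm 2 lborel g \<le> 2 * r k * ?G" .
    have "T (Suc k) (T k f) = T k (T (Suc k) f)"
      unfolding T_def by (rule ext) (rule average_commute[OF av av bf])
    then have "(\<lambda>x. F (Suc k) x - F k x) = (\<lambda>x. T (Suc k) g x + T k g x)"
      unfolding F_def g_def using Tdiff bT bf by (simp add: fun_eq_iff)
    then have "NM (\<lambda>x. F (Suc k) x - F k x) \<le> NM (T (Suc k) g) + NM (T k g)"
      unfolding NM_def by (simp add: Lp2_norm_triangle LpM bT g)
    also have "\<dots> \<le> sqrt (B (Suc k)) * Lp_norm 2 lborel g + sqrt (B k) * Lp_norm 2 lborel g"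
      by (intro add_mono hT g)
    also have "\<dots> = (sqrt (B (Suc k)) + sqrt (B k)) * Lp_norm 2 lborel g" by (simp add: distrib_right)
    also have "\<dots> \<le> (sqrt (B (Suc k)) + sqrt (B k)) * (2 * r k * ?G)"
      using B0 by (intro mult_left_mono ng) auto
    also have "\<dots> = 2 * ?G * (K * (sqrt (B (Suc k)) * r (Suc k)) + sqrt (B k) * r k)"
      unfolding r_def using K by (simp add: field_simps)
    also have "\<dots> \<le> 2 * ?G * (K * (2 * \<theta> * q ^ k) + 2 * \<theta> * q ^ k)"
    proof -
      have "q ^ Suc k \<le> q ^ k" using q by (intro power_decreasing) auto
      then have "2 * \<theta> * q ^ Suc k \<le> 2 * \<theta> * q ^ k" using \<theta> by simp
      then have "sqrt (B (Suc k)) * r (Suc k) \<le> 2 * \<theta> * q ^ k" using sB[of "Suc k"] by linarith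
      then show ?thesis using sB[of k] K by (intro mult_left_mono add_mono) auto
    qed
    also have "\<dots> = 4 * (1 + K) * \<theta> * ?G * q ^ k" by (simp add: algebra_simps)
    finally show ?thesis .
  qed
  have sum: "NM (F n) \<le> NM (F 0) + (\<Sum>k<n. 4 * (1 + K) * \<theta> * ?G * q ^ k)" for n
  proof (induction n)
    case (Suc n)
    have "NM (\<lambda>x. F n x + (F (Suc n) x - F n x)) \<le> NM (F n) + NM (\<lambda>x. F (Suc n) x - F n x)"
      unfolding NM_def by (intro Lp2_norm_triangle LpM bF bounded_borel_diff)
    then show ?case using Suc step[of n] by simp
  qed simp
  have geo: "(\<Sum>k<n. q ^ k) \<le> 4" for n
  proof -
    have "(\<Sum>k<n. q ^ k) \<le> (\<Sum>k<n. (3/4) ^ k)" using q by (intro sum_mono power_mono) auto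
    also have "\<dots> = 4 * (1 - (3/4) ^ n)" by (simp add: geometric_sum)
    also have "\<dots> \<le> 4" by simp
    finally show ?thesis .
  qed
  have F0: "NM (F 0) \<le> sqrt (2 * A / (\<omega> * \<theta> ^ d)) * ?F"
  proof -
    have "B 0 \<le> 2 * \<theta>\<^sup>2 / \<rho>\<^sup>2" using Br[of 0] \<rho> by (simp add: r_def pos_le_divide_eq)
    also have "\<dots> = 2 * A / (\<omega> * \<theta> ^ d)"
      using \<rho>2 \<rho> \<omega> \<theta> A by (simp add: field_simps power_add power2_eq_square)
    finally have "sqrt (B 0) \<le> sqrt (2 * A / (\<omega> * \<theta> ^ d))" by (rule real_sqrt_le_mono)
    moreover have "NM (F 0) \<le> sqrt (B 0) * Lp_norm 2 lborel (T 0 f)"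
      unfolding F_def by (intro hT bT bf LT Lf)
    moreover have "sqrt (B 0) * Lp_norm 2 lborel (T 0 f) \<le> sqrt (2 * A / (\<omega> * \<theta> ^ d)) * ?F"
      using calculation(1) B0[of 0] by (intro mult_mono LT bf Lf) auto
    ultimately show ?thesis by linarith
  qed
  have bound: "NM (F n) \<le> sqrt (2 * A / (\<omega> * \<theta> ^ d)) * ?F + 16 * (1 + K) * \<theta> * ?G" for n
  proof -
    have "(\<Sum>k<n. 4 * (1 + K) * \<theta> * ?G * q ^ k) = 4 * (1 + K) * \<theta> * ?G * (\<Sum>k<n. q ^ k)"
      by (simp add: sum_distrib_left)
    also have "\<dots> \<le> 4 * (1 + K) * \<theta> * ?G * 4"
      using K \<theta> by (intro mult_left_mono geo) auto
    also have "\<dots> = 16 * (1 + K) * \<theta> * ?G" by simp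
    finally show ?thesis using sum[of n] F0 by linarith
  qed
  \<comment> \<open>The double averages converge uniformly to \<open>f\<close>, at a rate that does not enter the final bound.\<close>
  obtain L where L: "L \<ge> 0" "\<And>x y. \<bar>f x - f y\<bar> \<le> L * norm (x - y)"
    by (rule test_functions_Lipschitz[OF f]) blast
  have Tf: "\<bar>T n f x - f x\<bar> \<le> L * r n" for n x
    unfolding T_def \<mu>_def by (rule ball_average_minus_bounded[OF bf r L])
  have Ff: "\<bar>F n x - f x\<bar> \<le> 2 * L * r n" for n x
  proof -
    interpret averaging_measure "\<mu> n" by (rule av)
    have "F n x - T n f x = T n (\<lambda>y. T n f y - f y) x"
      unfolding F_def using Tdiff[OF bT[OF bf] bf] by simp
    also have "\<bar>\<dots>\<bar> \<le> (\<integral>z. L * r n \<partial>\<mu> n)"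
      unfolding T_def translation_average_def
      by (rule integral_abs_bound[THEN order_trans], rule integral_mono)
        (use translate_bounded(1)[OF bounded_borel_diff[OF bT[OF bf] bf]] Tf in
          \<open>auto simp: T_def translation_average_def\<close>)
    finally have "\<bar>F n x - T n f x\<bar> \<le> L * r n" by (simp add: measure_UNIV)
    then show ?thesis using Tf[of n x] by linarith
  qed
  define H where "H = NM (\<lambda>x. 1)"
  have "NM f \<le> NM (F n) + 2 * L * H * r n" for n
  proof -
    have 1: "(\<lambda>x. 1::real) \<in> Lp 2 M" by (rule LpM) (auto simp: bounded_borel_def)
    have 2: "(\<lambda>x. f x - F n x) \<in> borel_measurable M" by (intro Lp2_measurable LpM bounded_borel_diff bf bF)
    have 3: "AE x in M. norm (f x - F n x) \<le> norm ((2 * L * r n) *\<^sub>R (1::real))"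
      using Ff r[of n] L(1) by (intro AE_I2) (simp add: abs_minus_commute abs_mult)
    have "NM (\<lambda>x. f x - F n x) \<le> NM (\<lambda>x. (2 * L * r n) *\<^sub>R 1)"
      unfolding NM_def by (rule Lp2_mono(2)[OF Lp2_scale[OF 1] 2 3])
    also have "\<dots> = 2 * L * r n * H"
      unfolding H_def NM_def using L(1) r[of n]
      by (simp add: Lp2_norm power_mult_distrib real_sqrt_mult)
    finally have 4: "NM (\<lambda>x. f x - F n x) \<le> 2 * L * H * r n" by (simp add: ac_simps)
    have "NM (\<lambda>x. F n x + (f x - F n x)) \<le> NM (F n) + NM (\<lambda>x. f x - F n x)"
      unfolding NM_def by (intro Lp2_norm_triangle LpM bF bf bounded_borel_diff)
    then show ?thesis using 4 by simp
  qed
  then have le: "NM f \<le> sqrt (2 * A / (\<omega> * \<theta> ^ d)) * ?F + 16 * (1 + K) * \<theta> * ?G + 2 * L * H * r n" for n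
    using bound[of n] by (smt (verit))
  have "(\<lambda>n. \<rho> * (1 / K) ^ n) \<longlonglongrightarrow> \<rho> * 0"
    using K by (intro tendsto_intros LIMSEQ_power_zero) auto
  then have "r \<longlonglongrightarrow> 0" by (simp add: r_def[abs_def] power_divide)
  then have "(\<lambda>n. sqrt (2 * A / (\<omega> * \<theta> ^ d)) * ?F + 16 * (1 + K) * \<theta> * ?G + 2 * L * H * r n)
      \<longlonglongrightarrow> sqrt (2 * A / (\<omega> * \<theta> ^ d)) * ?F + 16 * (1 + K) * \<theta> * ?G + 2 * L * H * 0"
    by (intro tendsto_intros)
  then have "NM f \<le> sqrt (2 * A / (\<omega> * \<theta> ^ d)) * ?F + 16 * (1 + K) * \<theta> * ?G + 2 * L * H * 0"
    by (rule LIMSEQ_le_const) (use le in blast)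
  then show ?thesis by (simp add: NM_def M_def d_def K_def \<omega>_def)
qed


context bounded_open
begin

lemma lebesgue_on_Lp2_lborel:
  fixes f g :: "'a \<Rightarrow> 'b::euclidean_space"
  assumes f: "f \<in> borel_measurable (lebesgue_on \<Omega>)" and g: "g \<in> borel_measurable borel"
    and eq: "AE x in lborel. x \<in> \<Omega> \<longrightarrow> f x = g x" and out: "\<And>x. x \<notin> \<Omega> \<Longrightarrow> g x = 0"
  shows "f \<in> Lp 2 (lebesgue_on \<Omega>) \<longleftrightarrow> g \<in> Lp 2 lborel"
    "Lp_norm 2 (lebesgue_on \<Omega>) f = Lp_norm 2 lborel g"
proof -
  have g2: "(\<lambda>x. (norm (g x))\<^sup>2) \<in> borel_measurable borel" using g by measurable
  have f2: "(\<lambda>x. (norm (f x))\<^sup>2) \<in> borel_measurable (lebesgue_on \<Omega>)" using f by measurable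
  have eq2: "AE x in lborel. x \<in> \<Omega> \<longrightarrow> (norm (f x))\<^sup>2 = (norm (g x))\<^sup>2" using eq by eventually_elim auto
  have i: "(\<lambda>x. indicator \<Omega> x *\<^sub>R (norm (g x))\<^sup>2) = (\<lambda>x. (norm (g x))\<^sup>2)"
    using out by (auto simp: indicator_def fun_eq_iff)
  show "f \<in> Lp 2 (lebesgue_on \<Omega>) \<longleftrightarrow> g \<in> Lp 2 lborel"
    using lebesgue_on_integral(1)[OF domain_borel g2 eq2 f2, unfolded i] f g by (simp add: Lp2_iff)
  show "Lp_norm 2 (lebesgue_on \<Omega>) f = Lp_norm 2 lborel g"
    using lebesgue_on_integral(2)[OF domain_borel g2 eq2 f2, unfolded i] by (simp add: Lp2_norm)
qed

text \<open>
  The weight is extended by zero to the whole space.  The constant 1 is added to its integral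
  because the choice of the largest radius divides by that quantity.
\<close>

lemma weighted_test_function:
  fixes h :: "'a \<Rightarrow> real"
  assumes h: "h \<in> borel_measurable (lebesgue_on \<Omega>)"
    and i: "integrable (lebesgue_on \<Omega>) (\<lambda>x. \<bar>h x\<bar> ^ (DIM('a) + 2))"
    and \<phi>: "\<phi> \<in> test_functions \<Omega>" and \<theta>: "\<theta> > 0"
  shows "(\<lambda>x. h x * \<phi> x) \<in> Lp 2 (lebesgue_on \<Omega>)"
    "Lp_norm 2 (lebesgue_on \<Omega>) (\<lambda>x. h x * \<phi> x)
    \<le> sqrt (2 * (1 + (\<integral>x. \<bar>h x\<bar> ^ (DIM('a) + 2) \<partial>lebesgue_on \<Omega>)) / (unit_ball_vol DIM('a) * \<theta> ^ DIM('a)))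
        * Lp_norm 2 (lebesgue_on \<Omega>) \<phi>
      + 16 * (1 + 2 ^ DIM('a)) * \<theta> * Lp_norm 2 (lebesgue_on \<Omega>) (gradient \<phi>)"
proof -
  let ?p = "DIM('a) + 2"
  define A where "A = 1 + (\<integral>x. \<bar>h x\<bar> ^ ?p \<partial>lebesgue_on \<Omega>)"
  have "0 \<le> (\<integral>x. \<bar>h x\<bar> ^ ?p \<partial>lebesgue_on \<Omega>)" by (intro integral_nonneg_AE AE_I2) simp
  then have A: "A > 0" unfolding A_def by linarith
  obtain h' where h': "h' \<in> borel_measurable borel" "AE x in lborel. x \<in> \<Omega> \<longrightarrow> h x = h' x"
    using lebesgue_on_borel_representative[OF domain_lebesgue h] by metis
  define k where "k x = indicator \<Omega> x * \<bar>h' x\<bar>" for x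
  have k[measurable]: "k \<in> borel_measurable borel" unfolding k_def[abs_def] using h'(1) domain_borel by measurable
  have k0: "k x \<ge> 0" for x by (simp add: k_def)
  have kp: "(\<lambda>x. k x ^ ?p) \<in> borel_measurable borel" by measurable
  have hp: "(\<lambda>x. \<bar>h x\<bar> ^ ?p) \<in> borel_measurable (lebesgue_on \<Omega>)" using h by measurable
  have eqp: "AE x in lborel. x \<in> \<Omega> \<longrightarrow> \<bar>h x\<bar> ^ ?p = k x ^ ?p"
    using h'(2) by eventually_elim (auto simp: k_def)
  have ik: "(\<lambda>x. indicator \<Omega> x *\<^sub>R k x ^ ?p) = (\<lambda>x. k x ^ ?p)"
    by (auto simp: k_def indicator_def fun_eq_iff)
  have k_int: "integrable lborel (\<lambda>x. k x ^ ?p)" "(\<integral>x. k x ^ ?p \<partial>lborel) = A - 1"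
    using lebesgue_on_integral[OF domain_borel kp eqp hp] i unfolding ik A_def by auto
  have kA: "(\<integral>\<^sup>+x. ennreal (k x ^ ?p) \<partial>lborel) \<le> ennreal A"
    using nn_integral_eq_integral[OF k_int(1)] k0 k_int(2) by (simp add: ennreal_leI)
  have k2: "(\<integral>\<^sup>+x. ennreal ((k x)\<^sup>2) \<partial>lborel) < \<infinity>"
  proof -
    have "(\<integral>\<^sup>+x. ennreal ((k x)\<^sup>2) \<partial>lborel) \<le> (\<integral>\<^sup>+x. indicator \<Omega> x + ennreal (k x ^ ?p) \<partial>lborel)"
    proof (rule nn_integral_mono)
      fix x
      show "ennreal ((k x)\<^sup>2) \<le> indicator \<Omega> x + ennreal (k x ^ ?p)"
      proof (cases "x \<in> \<Omega>")
        case True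
        have "ennreal ((k x)\<^sup>2) \<le> ennreal (1 + k x ^ ?p)"
          using square_le_split[OF k0, of 1 x "DIM('a)"] by (intro ennreal_leI) simp
        also have "\<dots> = 1 + ennreal (k x ^ ?p)" using k0[of x] by (subst ennreal_plus) auto
        finally show ?thesis using True by simp
      qed (simp add: k_def)
    qed
    also have "\<dots> = emeasure lborel \<Omega> + (\<integral>\<^sup>+x. ennreal (k x ^ ?p) \<partial>lborel)"
      by (subst nn_integral_add) (auto intro!: borel_measurable_indicator)
    also have "\<dots> < \<infinity>"
      using kA emeasure_bounded_finite[OF bounded_domain] by (auto simp: le_less_trans)
    finally show ?thesis .
  qed
  let ?M = "density lborel (\<lambda>x. ennreal ((k x)\<^sup>2))"
  have \<phi>m[measurable]: "\<phi> \<in> borel_measurable borel" by (rule test_functions_measurable[OF \<phi>])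
  have fin: "finite_measure ?M" using k2 by (intro finite_measureI) (simp add: emeasure_density)
  obtain C where C: "\<And>x. \<bar>\<phi> x\<bar> \<le> C" by (rule test_functions_bounded[OF \<phi>]) blast
  have M2: "\<phi> \<in> Lp 2 ?M" by (rule Lp2_bounded[OF fin, where C=C]) (auto simp: C)
  have le: "Lp_norm 2 ?M \<phi> \<le> sqrt (2 * A / (unit_ball_vol DIM('a) * \<theta> ^ DIM('a))) * Lp_norm 2 lborel \<phi>
      + 16 * (1 + 2 ^ DIM('a)) * \<theta> * Lp_norm 2 lborel (gradient \<phi>)"
    by (rule weighted_norm_le[OF k k0 kA A k2 \<phi> \<theta>])
  have "(\<integral>\<^sup>+x. ennreal ((norm (k x * \<phi> x))\<^sup>2) \<partial>lborel) = (\<integral>\<^sup>+x. ennreal ((norm (\<phi> x))\<^sup>2) \<partial>?M)"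
    by (subst nn_integral_density) (auto simp: power_mult_distrib ennreal_mult)
  also have "\<dots> = ennreal ((Lp_norm 2 ?M \<phi>)\<^sup>2)" by (rule Lp2_nn_integral[OF M2])
  finally have kn: "(\<lambda>x. k x * \<phi> x) \<in> Lp 2 lborel" "Lp_norm 2 lborel (\<lambda>x. k x * \<phi> x) \<le> Lp_norm 2 ?M \<phi>"
    by (auto intro!: Lp2_nn_integralI)
  have hm: "(\<lambda>x. \<bar>h x\<bar> * \<phi> x) \<in> borel_measurable (lebesgue_on \<Omega>)"
    using h borel_measurable_lebesgue_on[OF \<phi>m] by measurable
  have eqh: "AE x in lborel. x \<in> \<Omega> \<longrightarrow> \<bar>h x\<bar> * \<phi> x = k x * \<phi> x"
    using h'(2) by eventually_elim (auto simp: k_def)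
  have oh: "k x * \<phi> x = 0" if "x \<notin> \<Omega>" for x using that by (simp add: k_def)
  have km: "(\<lambda>x. k x * \<phi> x) \<in> borel_measurable borel" by measurable
  note hk = lebesgue_on_Lp2_lborel[OF hm km eqh oh]
  have hm': "(\<lambda>x. h x * \<phi> x) \<in> borel_measurable (lebesgue_on \<Omega>)"
    using h borel_measurable_lebesgue_on[OF \<phi>m] by measurable
  show "(\<lambda>x. h x * \<phi> x) \<in> Lp 2 (lebesgue_on \<Omega>)"
    using hk(1) kn(1) hm' by (simp add: Lp2_iff abs_mult power_mult_distrib)
  have n1: "Lp_norm 2 (lebesgue_on \<Omega>) (\<lambda>x. h x * \<phi> x) = Lp_norm 2 lborel (\<lambda>x. k x * \<phi> x)"
  proof -
    have "Lp_norm 2 (lebesgue_on \<Omega>) (\<lambda>x. h x * \<phi> x) = Lp_norm 2 (lebesgue_on \<Omega>) (\<lambda>x. \<bar>h x\<bar> * \<phi> x)"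
      by (simp add: Lp2_norm power_mult_distrib abs_mult)
    also have "\<dots> = Lp_norm 2 lborel (\<lambda>x. k x * \<phi> x)" by (rule hk(2))
    finally show ?thesis .
  qed
  have n2: "Lp_norm 2 (lebesgue_on \<Omega>) \<phi> = Lp_norm 2 lborel \<phi>"
    by (rule lebesgue_on_Lp2_lborel(2)[OF borel_measurable_lebesgue_on[OF \<phi>m] \<phi>m])
      (use test_functionsD(4)[OF \<phi>] in auto)
  have n3: "Lp_norm 2 (lebesgue_on \<Omega>) (gradient \<phi>) = Lp_norm 2 lborel (gradient \<phi>)"
    by (rule lebesgue_on_Lp2_lborel(2)[OF borel_measurable_lebesgue_on[OF gradient_measurable[OF \<phi>]] gradient_measurable[OF \<phi>]])
      (use gradient_outside[OF \<phi>] in auto)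
  show "Lp_norm 2 (lebesgue_on \<Omega>) (\<lambda>x. h x * \<phi> x)
    \<le> sqrt (2 * (1 + (\<integral>x. \<bar>h x\<bar> ^ ?p \<partial>lebesgue_on \<Omega>)) / (unit_ball_vol DIM('a) * \<theta> ^ DIM('a)))
        * Lp_norm 2 (lebesgue_on \<Omega>) \<phi>
      + 16 * (1 + 2 ^ DIM('a)) * \<theta> * Lp_norm 2 (lebesgue_on \<Omega>) (gradient \<phi>)"
    using le kn(2) unfolding n1 n2 n3 A_def[symmetric] by linarith
qed

text \<open>Density of the test functions and Fatou's lemma carry the inequality to the Sobolev space.\<close>

lemma weighted_H10:
  fixes h :: "'a \<Rightarrow> real"
  assumes h: "h \<in> borel_measurable (lebesgue_on \<Omega>)"
    and i: "integrable (lebesgue_on \<Omega>) (\<lambda>x. \<bar>h x\<bar> ^ (DIM('a) + 2))"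
    and f: "f \<in> H10 \<Omega>" and \<theta>: "\<theta> > 0"
  shows "(\<lambda>x. h x * f x) \<in> Lp 2 (lebesgue_on \<Omega>)"
    "Lp_norm 2 (lebesgue_on \<Omega>) (\<lambda>x. h x * f x)
    \<le> sqrt (2 * (1 + (\<integral>x. \<bar>h x\<bar> ^ (DIM('a) + 2) \<partial>lebesgue_on \<Omega>)) / (unit_ball_vol DIM('a) * \<theta> ^ DIM('a)))
        * Lp_norm 2 (lebesgue_on \<Omega>) f
      + 16 * (1 + 2 ^ DIM('a)) * \<theta> * Lp_norm 2 (lebesgue_on \<Omega>) (weak_gradient \<Omega> f)"
proof -
  let ?N = "Lp_norm 2 (lebesgue_on \<Omega>)"
  define a where "a = sqrt (2 * (1 + (\<integral>x. \<bar>h x\<bar> ^ (DIM('a) + 2) \<partial>lebesgue_on \<Omega>)) / (unit_ball_vol DIM('a) * \<theta> ^ DIM('a)))"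
  define b where "b = 16 * (1 + 2 ^ DIM('a)) * \<theta>"
  have a: "a \<ge> 0" unfolding a_def using \<theta> by (auto intro!: integral_nonneg_AE add_nonneg_nonneg divide_nonneg_nonneg)
  have b: "b \<ge> 0" unfolding b_def using \<theta> by simp
  obtain \<phi> where \<phi>: "\<And>n. \<phi> n \<in> test_functions \<Omega>" "(\<lambda>n. H1_norm \<Omega> (\<lambda>x. f x - \<phi> n x)) \<longlonglongrightarrow> 0"
    using f by (auto simp: H10_def)
  have f1: "f \<in> H1 \<Omega>" and \<phi>1: "\<phi> n \<in> H1 \<Omega>" for n
    using H10_H1[OF f] weak_gradient_test_function(1)[OF \<phi>(1)] by auto
  have d1: "\<bar>?N (\<phi> n) - ?N f\<bar> \<le> H1_norm \<Omega> (\<lambda>x. f x - \<phi> n x)" for n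
    using seminormed_space_abs_diff[OF seminormed_space_Lp2 H1_Lp2(1)[OF f1] H1_Lp2(1)[OF \<phi>1[of n]]]
      H1_norm_ge(1)[of "\<lambda>x. f x - \<phi> n x"] by linarith
  have d2: "\<bar>?N (gradient (\<phi> n)) - ?N (weak_gradient \<Omega> f)\<bar> \<le> H1_norm \<Omega> (\<lambda>x. f x - \<phi> n x)" for n
  proof -
    have "?N (gradient (\<phi> n)) = ?N (weak_gradient \<Omega> (\<phi> n))"
      using weak_gradient_test_function(2)[OF \<phi>(1)[of n]]
      by (intro Lp_norm_cong_AE Lp2_measurable H1_Lp2 \<phi>1 test_functions_Lp2[OF \<phi>(1)[of n]]) auto
    then show ?thesis
      using seminormed_space_abs_diff[OF seminormed_space_Lp2 H1_Lp2(2)[OF f1] H1_Lp2(2)[OF \<phi>1[of n]]]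
        H1_norm_ge(2)[of "\<lambda>x. f x - \<phi> n x"] weak_gradient_norm_diff[OF f1 \<phi>1[of n]] by linarith
  qed
  have l1: "(\<lambda>n. ?N (\<phi> n)) \<longlonglongrightarrow> ?N f" and l2: "(\<lambda>n. ?N (gradient (\<phi> n))) \<longlonglongrightarrow> ?N (weak_gradient \<Omega> f)"
    by (rule Lim_transform_bound[where g="\<lambda>n. H1_norm \<Omega> (\<lambda>x. f x - \<phi> n x)", THEN Lim_null[THEN iffD2]],
        use d1 d2 \<phi>(2) in \<open>auto intro!: always_eventually simp: abs_minus_commute H1_norm_def\<close>)+
  have l: "(\<lambda>n. a * ?N (\<phi> n) + b * ?N (gradient (\<phi> n))) \<longlonglongrightarrow> a * ?N f + b * ?N (weak_gradient \<Omega> f)"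
    by (intro tendsto_intros l1 l2)
  have "(\<lambda>n. ?N (\<lambda>x. \<phi> n x - f x)) \<longlonglongrightarrow> 0"
  proof (rule tendsto_sandwich[OF _ _ tendsto_const \<phi>(2)])
    show "\<forall>\<^sub>F n in sequentially. ?N (\<lambda>x. \<phi> n x - f x) \<le> H1_norm \<Omega> (\<lambda>x. f x - \<phi> n x)"
      using H1_norm_ge(1) seminormed_spaceD(6)[OF seminormed_space_Lp2 H1_Lp2(1)[OF f1] H1_Lp2(1)[OF \<phi>1]]
      by (intro always_eventually allI) metis
  qed simp
  from Lp2_tendsto_AE_subseq[where f=\<phi>, OF H1_Lp2(1)[OF \<phi>1] H1_Lp2(1)[OF f1] this]
  obtain r where r: "strict_mono r" "AE x in lebesgue_on \<Omega>. (\<lambda>n. \<phi> (r n) x) \<longlonglongrightarrow> f x" by blast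
  have 1: "(\<lambda>x. h x * \<phi> (r n) x) \<in> Lp 2 (lebesgue_on \<Omega>)" for n
    by (rule weighted_test_function(1)[OF h i \<phi>(1) \<theta>])
  have 2: "AE x in lebesgue_on \<Omega>. (\<lambda>n. h x * \<phi> (r n) x) \<longlonglongrightarrow> h x * f x"
    using r(2) by eventually_elim (intro tendsto_intros)
  have 3: "(\<lambda>x. h x * f x) \<in> borel_measurable (lebesgue_on \<Omega>)"
    using h Lp2_measurable[OF H1_Lp2(1)[OF f1]] by measurable
  have 4: "\<forall>\<^sub>F n in sequentially. ?N (\<lambda>x. h x * \<phi> (r n) x) \<le> a * ?N f + b * ?N (weak_gradient \<Omega> f) + e" if "e > 0" for e
  proof -
    have "\<forall>\<^sub>F n in sequentially. a * ?N (\<phi> n) + b * ?N (gradient (\<phi> n)) < a * ?N f + b * ?N (weak_gradient \<Omega> f) + e"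
      using that by (intro order_tendstoD(2)[OF l]) simp
    then have "\<forall>\<^sub>F n in sequentially. a * ?N (\<phi> (r n)) + b * ?N (gradient (\<phi> (r n)))
        < a * ?N f + b * ?N (weak_gradient \<Omega> f) + e"
      by (rule eventually_subseq[OF r(1)])
    then show ?thesis
    proof eventually_elim
      case (elim n)
      then show ?case
        using weighted_test_function(2)[OF h i \<phi>(1)[of "r n"] \<theta>] unfolding a_def[symmetric] b_def[symmetric] by linarith
    qed
  qed
  show "(\<lambda>x. h x * f x) \<in> Lp 2 (lebesgue_on \<Omega>)" by (rule Lp2_Fatou(1)[OF 1 2 3 4[OF zero_less_one]])
  have "?N (\<lambda>x. h x * f x) \<le> a * ?N f + b * ?N (weak_gradient \<Omega> f)"
    by (rule field_le_epsilon) (rule Lp2_Fatou(2)[OF 1 2 3 4])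
  then show "?N (\<lambda>x. h x * f x)
    \<le> sqrt (2 * (1 + (\<integral>x. \<bar>h x\<bar> ^ (DIM('a) + 2) \<partial>lebesgue_on \<Omega>)) / (unit_ball_vol DIM('a) * \<theta> ^ DIM('a))) * ?N f
      + 16 * (1 + 2 ^ DIM('a)) * \<theta> * ?N (weak_gradient \<Omega> f)"
    unfolding a_def b_def .
qed

text \<open>The free scale \<open>\<theta>\<close> makes the share of the gradient small, at the expense of the constant.\<close>

lemma weighted_H10_square:
  assumes \<delta>: "\<delta> > 0"
  shows "\<exists>C\<ge>0. \<forall>h f. h \<in> borel_measurable (lebesgue_on \<Omega>) \<longrightarrow>
    integrable (lebesgue_on \<Omega>) (\<lambda>x. \<bar>h x :: real\<bar> ^ (DIM('a) + 2)) \<longrightarrow> f \<in> H10 \<Omega> \<longrightarrow>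
    (\<lambda>x. h x * f x) \<in> Lp 2 (lebesgue_on \<Omega>) \<and>
    (Lp_norm 2 (lebesgue_on \<Omega>) (\<lambda>x. h x * f x))\<^sup>2
      \<le> \<delta> * (Lp_norm 2 (lebesgue_on \<Omega>) (weak_gradient \<Omega> f))\<^sup>2
        + C * (1 + (\<integral>x. \<bar>h x\<bar> ^ (DIM('a) + 2) \<partial>lebesgue_on \<Omega>)) * (Lp_norm 2 (lebesgue_on \<Omega>) f)\<^sup>2"
proof -
  let ?N = "Lp_norm 2 (lebesgue_on \<Omega>)"
  \<comment> \<open>The square of the coefficient of the gradient is \<open>\<delta> / 2\<close>; squaring the sum of two terms doubles it.\<close>
  define \<theta> where "\<theta> = sqrt (\<delta> / 2) / (16 * (1 + 2 ^ DIM('a)))"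
  define v where "v = unit_ball_vol DIM('a) * \<theta> ^ DIM('a)"
  have pos: "16 * (1 + 2 ^ DIM('a)) > (0::real)" by (simp add: add_pos_pos)
  have \<theta>: "\<theta> > 0" unfolding \<theta>_def using \<delta> pos by simp
  have b: "(16 * (1 + 2 ^ DIM('a)) * \<theta>)\<^sup>2 = \<delta> / 2"
  proof -
    have "16 * (1 + 2 ^ DIM('a)) * \<theta> = sqrt (\<delta> / 2)" using pos unfolding \<theta>_def by (simp only: nonzero_mult_div_cancel_left times_divide_eq_right)
    then show ?thesis using \<delta> by simp
  qed
  have v: "v > 0" unfolding v_def using \<theta> by (intro mult_pos_pos zero_less_power unit_ball_vol_pos) auto
  have sq: "(x + y)\<^sup>2 \<le> 2 * x\<^sup>2 + 2 * y\<^sup>2" for x y :: real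
    using sum_squares_bound[of x y] by (simp add: power2_sum)
  show ?thesis
  proof (intro exI[of _ "4 / v"] conjI allI impI)
    show "0 \<le> 4 / v" using v by simp
    fix h :: "'a \<Rightarrow> real" and f
    assume h: "h \<in> borel_measurable (lebesgue_on \<Omega>)"
      and i: "integrable (lebesgue_on \<Omega>) (\<lambda>x. \<bar>h x\<bar> ^ (DIM('a) + 2))" and f: "f \<in> H10 \<Omega>"
    show "(\<lambda>x. h x * f x) \<in> Lp 2 (lebesgue_on \<Omega>)" by (rule weighted_H10(1)[OF h i f \<theta>])
    define A where "A = 1 + (\<integral>x. \<bar>h x\<bar> ^ (DIM('a) + 2) \<partial>lebesgue_on \<Omega>)"
    have A: "A \<ge> 0" unfolding A_def by (auto intro!: integral_nonneg_AE add_nonneg_nonneg)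
    have "?N (\<lambda>x. h x * f x) \<le> sqrt (2 * A / v) * ?N f + 16 * (1 + 2 ^ DIM('a)) * \<theta> * ?N (weak_gradient \<Omega> f)"
      using weighted_H10(2)[OF h i f \<theta>] unfolding A_def v_def .
    then have "(?N (\<lambda>x. h x * f x))\<^sup>2
        \<le> (sqrt (2 * A / v) * ?N f + 16 * (1 + 2 ^ DIM('a)) * \<theta> * ?N (weak_gradient \<Omega> f))\<^sup>2"
      by (intro power_mono) auto
    also have "\<dots> \<le> 2 * (sqrt (2 * A / v) * ?N f)\<^sup>2 + 2 * (16 * (1 + 2 ^ DIM('a)) * \<theta> * ?N (weak_gradient \<Omega> f))\<^sup>2"
      by (rule sq)
    also have "(sqrt (2 * A / v) * ?N f)\<^sup>2 = 2 * A / v * (?N f)\<^sup>2"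
      using A v by (simp add: power_mult_distrib)
    also have "(16 * (1 + 2 ^ DIM('a)) * \<theta> * ?N (weak_gradient \<Omega> f))\<^sup>2 = \<delta> / 2 * (?N (weak_gradient \<Omega> f))\<^sup>2"
      unfolding power_mult_distrib[of _ "?N (weak_gradient \<Omega> f)"] b ..
    also have "2 * (2 * A / v * (?N f)\<^sup>2) + 2 * (\<delta> / 2 * (?N (weak_gradient \<Omega> f))\<^sup>2)
        = \<delta> * (?N (weak_gradient \<Omega> f))\<^sup>2 + 4 / v * A * (?N f)\<^sup>2" by simp
    finally show "(?N (\<lambda>x. h x * f x))\<^sup>2 \<le> \<delta> * (?N (weak_gradient \<Omega> f))\<^sup>2
        + 4 / v * (1 + (\<integral>x. \<bar>h x\<bar> ^ (DIM('a) + 2) \<partial>lebesgue_on \<Omega>)) * (?N f)\<^sup>2"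
      unfolding A_def .
  qed
qed

end

section \<open>Strongly measurable functions of time\<close>

lemma borel_measurable_lebesgue_on_AE:
  fixes f g :: "'a::euclidean_space \<Rightarrow> real"
  assumes S: "S \<in> sets lebesgue" and f: "f \<in> borel_measurable (lebesgue_on S)"
    and eq: "AE x in lebesgue_on S. f x = g x"
  shows "g \<in> borel_measurable (lebesgue_on S)"
proof -
  have "(\<lambda>x. if x \<in> S then g x else 0) \<in> borel_measurable lebesgue"
  proof (rule borel_measurable_AE)
    show "(\<lambda>x. if x \<in> S then f x else 0) \<in> borel_measurable lebesgue"
      by (rule borel_measurable_if_I[OF f S])
    have "AE x in lebesgue. x \<in> S \<longrightarrow> f x = g x"
      using eq S by (subst (asm) AE_restrict_space_iff) auto
    then show "AE x in lebesgue. (if x \<in> S then f x else 0) = (if x \<in> S then g x else 0)"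
      by eventually_elim auto
  qed
  then show ?thesis using S by (simp add: borel_measurable_if)
qed

lemma borel_measurable_lebesgue_on_AE_limit:
  fixes f :: "nat \<Rightarrow> 'a::euclidean_space \<Rightarrow> real"
  assumes S: "S \<in> sets lebesgue" and f[measurable]: "\<And>n. f n \<in> borel_measurable (lebesgue_on S)"
    and lim: "AE x in lebesgue_on S. (\<lambda>n. f n x) \<longlonglongrightarrow> g x"
  shows "g \<in> borel_measurable (lebesgue_on S)"
proof (rule borel_measurable_lebesgue_on_AE[OF S])
  show "(\<lambda>x. lim (\<lambda>n. f n x)) \<in> borel_measurable (lebesgue_on S)" by measurable
  show "AE x in lebesgue_on S. lim (\<lambda>n. f n x) = g x" using lim by eventually_elim (rule limI)
qed

text \<open>
  Any quantity that depends continuously on the value is a limit of the same quantity for the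
  simple approximations, for which it is a finite sum over their values.
\<close>

lemma strongly_measurable_functional:
  fixes \<Phi> :: "real \<Rightarrow> ('a \<Rightarrow> 'b::euclidean_space) \<Rightarrow> real"
  assumes S: "S \<in> sets lebesgue" and u: "strongly_measurable (lebesgue_on S) X N u"
    and meas: "\<And>y. y \<in> X \<Longrightarrow> (\<lambda>t. \<Phi> t y) \<in> borel_measurable (lebesgue_on S)"
    and cont: "AE t in lebesgue_on S. \<forall>s. (\<forall>n. s n \<in> X) \<longrightarrow> u t \<in> X \<longrightarrow>
      (\<lambda>n. N (\<lambda>x. u t x - s n x)) \<longlonglongrightarrow> 0 \<longrightarrow> (\<lambda>n. \<Phi> t (s n)) \<longlonglongrightarrow> \<Phi> t (u t)"
  shows "(\<lambda>t. \<Phi> t (u t)) \<in> borel_measurable (lebesgue_on S)"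
proof -
  let ?M = "lebesgue_on S"
  obtain s where s: "\<And>n. simple_function ?M (s n)" "\<And>n. s n ` space ?M \<subseteq> X"
    and lim: "AE t in ?M. u t \<in> X \<and> (\<lambda>n. N (\<lambda>x. u t x - s n t x)) \<longlonglongrightarrow> 0"
    using u unfolding strongly_measurable_def by blast
  have "(\<lambda>t. \<Phi> t (s n t)) \<in> borel_measurable ?M" for n
  proof -
    have fin: "finite (s n ` space ?M)" and sets: "\<And>y. s n -` {y} \<inter> space ?M \<in> sets ?M"
      by (rule simple_functionD(1)[OF s(1)], rule simple_functionD(2)[OF s(1)])
    have "(\<lambda>t. \<Sum>y\<in>s n ` space ?M. indicator (s n -` {y} \<inter> space ?M) t * \<Phi> t y) \<in> borel_measurable ?M"
      using s(2)[of n] sets by (intro borel_measurable_sum borel_measurable_times borel_measurable_indicator meas) auto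
    moreover have "\<Phi> t (s n t) = (\<Sum>y\<in>s n ` space ?M. indicator (s n -` {y} \<inter> space ?M) t * \<Phi> t y)"
      if "t \<in> space ?M" for t
    proof -
      have "(\<Sum>y\<in>s n ` space ?M. indicator (s n -` {y} \<inter> space ?M) t * \<Phi> t y)
          = (\<Sum>y\<in>s n ` space ?M. if y = s n t then \<Phi> t y else 0)"
        using that by (intro sum.cong) (auto simp: indicator_def)
      also have "\<dots> = \<Phi> t (s n t)" using fin that by (simp add: sum.delta)
      finally show ?thesis by simp
    qed
    ultimately show ?thesis by (subst measurable_cong) auto
  qed
  moreover have "AE t in ?M. (\<lambda>n. \<Phi> t (s n t)) \<longlonglongrightarrow> \<Phi> t (u t)"
    using lim cont AE_space
  proof eventually_elim
    case (elim t)
    then show ?case using s(2) by (auto simp: image_subset_iff)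
  qed
  ultimately show ?thesis by (rule borel_measurable_lebesgue_on_AE_limit[OF S])
qed

lemma strongly_measurable_norm:
  fixes u :: "real \<Rightarrow> 'a \<Rightarrow> 'b::euclidean_space"
  assumes "S \<in> sets lebesgue" "strongly_measurable (lebesgue_on S) X N u" "seminormed_space X N"
  shows "(\<lambda>t. N (u t)) \<in> borel_measurable (lebesgue_on S)"
proof (rule strongly_measurable_functional[OF assms(1,2), where \<Phi>="\<lambda>t. N"])
  show "AE t in lebesgue_on S. \<forall>s. (\<forall>n. s n \<in> X) \<longrightarrow> u t \<in> X \<longrightarrow>
      (\<lambda>n. N (\<lambda>x. u t x - s n x)) \<longlonglongrightarrow> 0 \<longrightarrow> (\<lambda>n. N (s n)) \<longlonglongrightarrow> N (u t)"
  proof (intro AE_I2 allI impI)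
    fix t and s :: "nat \<Rightarrow> _" assume s: "\<forall>n. s n \<in> X" "u t \<in> X" "(\<lambda>n. N (\<lambda>x. u t x - s n x)) \<longlonglongrightarrow> 0"
    have "\<bar>N (s n) - N (u t)\<bar> \<le> N (\<lambda>x. u t x - s n x)" for n
      using seminormed_space_abs_diff[OF assms(3) s(2), of "s n"] s(1) by (simp add: abs_minus_commute)
    then have "\<forall>\<^sub>F n in sequentially. norm (N (s n) - N (u t)) \<le> N (\<lambda>x. u t x - s n x)"
      by (intro always_eventually allI) simp
    then have "(\<lambda>n. N (s n) - N (u t)) \<longlonglongrightarrow> 0" by (rule Lim_null_comparison[OF _ s(3)])
    then show "(\<lambda>n. N (s n)) \<longlonglongrightarrow> N (u t)" by (rule LIM_zero_cancel)
  qed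
qed auto

lemma strongly_measurable_in: "strongly_measurable M X N u \<Longrightarrow> AE t in M. u t \<in> X"
  by (auto simp: strongly_measurable_def)

text \<open>
  The approximating simple functions have countably many values in total.
\<close>

lemma strongly_measurable_separable:
  assumes "strongly_measurable M X N u"
  shows "\<exists>Y. countable Y \<and> Y \<subseteq> X \<and> (AE t in M. u t \<in> X \<and> (\<forall>e>0. \<exists>y\<in>Y. N (\<lambda>x. u t x - y x) < e))"
proof -
  obtain s where s: "\<And>n. simple_function M (s n)" "\<And>n. s n ` space M \<subseteq> X"
    and lim: "AE t in M. u t \<in> X \<and> (\<lambda>n. N (\<lambda>x. u t x - s n t x)) \<longlonglongrightarrow> 0"
    using assms unfolding strongly_measurable_def by blast
  show ?thesis
  proof (intro exI[of _ "\<Union>n. s n ` space M"] conjI)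
    show "countable (\<Union>n. s n ` space M)"
      by (rule countable_UN[OF countableI_type]) (rule countable_finite[OF simple_functionD(1)[OF s(1)]])
    show "(\<Union>n. s n ` space M) \<subseteq> X" using s(2) by auto
    show "AE t in M. u t \<in> X \<and> (\<forall>e>0. \<exists>y\<in>\<Union>n. s n ` space M. N (\<lambda>x. u t x - y x) < e)"
      using lim AE_space
    proof eventually_elim
      case (elim t)
      have "\<exists>y\<in>\<Union>n. s n ` space M. N (\<lambda>x. u t x - y x) < e" if "e > 0" for e
      proof -
        have "\<forall>\<^sub>F n in sequentially. N (\<lambda>x. u t x - s n t x) < e"
          using elim(1) that by (intro order_tendstoD(2)) auto
        then obtain n where "N (\<lambda>x. u t x - s n t x) < e" by (auto dest: eventually_happens)
        then show ?thesis using elim(2) by blast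
      qed
      then show ?case using elim(1) by blast
    qed
  qed
qed

lemma Lp2_mult_tendsto:
  fixes f z :: "'a \<Rightarrow> real"
  assumes "f \<in> Lp 2 M" "z \<in> Lp 2 M" "\<And>n. s n \<in> Lp 2 M" "(\<lambda>n. Lp_norm 2 M (\<lambda>x. f x - s n x)) \<longlonglongrightarrow> 0"
  shows "(\<lambda>n. \<integral>x. s n x * z x \<partial>M) \<longlonglongrightarrow> (\<integral>x. f x * z x \<partial>M)"
proof (rule LIM_zero_cancel, rule Lim_null_comparison)
  show "\<forall>\<^sub>F n in sequentially. norm ((\<integral>x. s n x * z x \<partial>M) - (\<integral>x. f x * z x \<partial>M))
      \<le> Lp_norm 2 M (\<lambda>x. f x - s n x) * Lp_norm 2 M z"
  proof (intro always_eventually allI)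
    fix n
    have "(\<integral>x. f x * z x \<partial>M) - (\<integral>x. s n x * z x \<partial>M) = (\<integral>x. (f x - s n x) * z x \<partial>M)"
      using assms by (simp add: left_diff_distrib Lp2_integrable_mult)
    then show "norm ((\<integral>x. s n x * z x \<partial>M) - (\<integral>x. f x * z x \<partial>M))
      \<le> Lp_norm 2 M (\<lambda>x. f x - s n x) * Lp_norm 2 M z"
      using Lp2_integral_mult_le[OF Lp2_diff[OF assms(1,3)] assms(2), of n] by (simp add: abs_minus_commute)
  qed
  show "(\<lambda>n. Lp_norm 2 M (\<lambda>x. f x - s n x) * Lp_norm 2 M z) \<longlonglongrightarrow> 0"
    using tendsto_mult_right[OF assms(4), of "Lp_norm 2 M z"] by simp
qed

lemma strongly_measurable_Lp2_mult:
  fixes u :: "real \<Rightarrow> 'a \<Rightarrow> real"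
  assumes "S \<in> sets lebesgue" "strongly_measurable (lebesgue_on S) (Lp 2 M) (Lp_norm 2 M) u" "z \<in> Lp 2 M"
  shows "(\<lambda>t. \<integral>x. u t x * z x \<partial>M) \<in> borel_measurable (lebesgue_on S)"
  by (rule strongly_measurable_functional[OF assms(1,2), where \<Phi>="\<lambda>t y. \<integral>x. y x * z x \<partial>M"])
    (auto intro!: Lp2_mult_tendsto assms(3))

lemma nn_integral_cmult_le:
  assumes "c \<ge> 0"
  shows "(\<integral>\<^sup>+t. ennreal c * f t \<partial>M) \<le> ennreal c * (\<integral>\<^sup>+t. f t \<partial>M)"
proof (cases "c = 0")
  case False
  then have c: "c > 0" using assms by simp
  have "(\<integral>\<^sup>+t. ennreal c * f t \<partial>M) = (SUP g\<in>{g. simple_function M g \<and> g \<le> (\<lambda>t. ennreal c * f t)}. integral\<^sup>S M g)"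
    by (simp add: nn_integral_def)
  also have "\<dots> \<le> ennreal c * (\<integral>\<^sup>+t. f t \<partial>M)"
  proof (rule SUP_least, clarsimp)
    fix g assume g: "simple_function M g" "g \<le> (\<lambda>t. ennreal c * f t)"
    have gm: "g \<in> borel_measurable M" by (rule borel_measurable_simple_function[OF g(1)])
    have "ennreal (1 / c) * g t \<le> f t" for t
    proof -
      have "ennreal (1 / c) * g t \<le> ennreal (1 / c) * (ennreal c * f t)"
        using g(2) by (intro mult_left_mono) (auto simp: le_fun_def)
      also have "\<dots> = f t" using c by (simp add: mult.assoc[symmetric] ennreal_mult[symmetric])
      finally show ?thesis .
    qed
    then have "(\<integral>\<^sup>+t. ennreal (1 / c) * g t \<partial>M) \<le> (\<integral>\<^sup>+t. f t \<partial>M)" by (rule nn_integral_mono)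
    then have "ennreal c * (ennreal (1 / c) * (\<integral>\<^sup>+t. g t \<partial>M)) \<le> ennreal c * (\<integral>\<^sup>+t. f t \<partial>M)"
      using nn_integral_cmult[OF gm] by (intro mult_left_mono) auto
    also have "ennreal c * (ennreal (1 / c) * (\<integral>\<^sup>+t. g t \<partial>M)) = integral\<^sup>S M g"
      using c by (simp add: mult.assoc[symmetric] ennreal_mult[symmetric] nn_integral_eq_simple_integral[OF g(1)])
    finally show "integral\<^sup>S M g \<le> ennreal c * (\<integral>\<^sup>+t. f t \<partial>M)" .
  qed
  finally show ?thesis .
qed simp

text \<open>The inner product with a fixed function is continuous, so it passes from the simple
  approximations to the limit.\<close>

lemma has_Bochner_integral_in_Lp2_mult:
  fixes u :: "real \<Rightarrow> 'a \<Rightarrow> real"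
  assumes S: "S \<in> sets lebesgue"
    and u: "has_Bochner_integral_in (lebesgue_on S) (Lp 2 M) (Lp_norm 2 M) u w" and z: "z \<in> Lp 2 M"
  shows "(\<integral>t. (\<integral>x. u t x * z x \<partial>M) \<partial>lebesgue_on S) = (\<integral>x. w x * z x \<partial>M)"
proof -
  let ?T = "lebesgue_on S" and ?N = "Lp_norm 2 M"
  have sm: "strongly_measurable ?T (Lp 2 M) ?N u" and w: "w \<in> Lp 2 M"
    using u by (auto simp: has_Bochner_integral_in_def)
  obtain s where s: "\<And>n. simple_function ?T (s n)" "\<And>n. s n ` space ?T \<subseteq> Lp 2 M"
      "\<And>n. emeasure ?T {t \<in> space ?T. s n t \<noteq> (\<lambda>_. 0)} < \<infinity>"
    and lim: "(\<lambda>n. \<integral>\<^sup>+t. ennreal (?N (\<lambda>x. u t x - s n t x)) \<partial>?T) \<longlonglongrightarrow> 0"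
    and limw: "(\<lambda>n. ?N (\<lambda>x. (\<Sum>y\<in>s n ` space ?T. measure ?T {t \<in> space ?T. s n t = y} *\<^sub>R y x) - w x)) \<longlonglongrightarrow> 0"
    using u unfolding has_Bochner_integral_in_def by blast
  define g where "g t = (\<integral>x. u t x * z x \<partial>M)" for t
  define h where "h n t = (\<integral>x. s n t x * z x \<partial>M)" for n t
  define W where "W n x = (\<Sum>y\<in>s n ` space ?T. measure ?T {t \<in> space ?T. s n t = y} *\<^sub>R y x)" for n x
  have gm: "g \<in> borel_measurable ?T"
    unfolding g_def by (rule strongly_measurable_Lp2_mult[OF S sm z])
  have W: "W n \<in> Lp 2 M" for n
    unfolding W_def using s(2) by (intro Lp2_norm_sum[THEN conjunct1] Lp2_scale) auto
  have h: "has_bochner_integral ?T (h n) (\<integral>x. W n x * z x \<partial>M)" for n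
  proof -
    have fin: "finite (s n ` space ?T)" and sets: "\<And>y. s n -` {y} \<inter> space ?T \<in> sets ?T"
      by (rule simple_functionD(1)[OF s(1)], rule simple_functionD(2)[OF s(1)])
    have sets': "{t \<in> space ?T. s n t = y} \<in> sets ?T" for y
      using sets[of y] by (simp add: vimage_def Int_def conj_commute)
    have "has_bochner_integral ?T (\<lambda>t. \<Sum>y\<in>s n ` space ?T. indicator {t \<in> space ?T. s n t = y} t *\<^sub>R (\<integral>x. y x * z x \<partial>M))
        (\<Sum>y\<in>s n ` space ?T. measure ?T {t \<in> space ?T. s n t = y} *\<^sub>R (\<integral>x. y x * z x \<partial>M))"
    proof (rule has_bochner_integral_sum)
      fix y assume y: "y \<in> s n ` space ?T"
      show "has_bochner_integral ?T (\<lambda>t. indicator {t \<in> space ?T. s n t = y} t *\<^sub>R (\<integral>x. y x * z x \<partial>M))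
         (measure ?T {t \<in> space ?T. s n t = y} *\<^sub>R (\<integral>x. y x * z x \<partial>M))"
      proof (cases "y = (\<lambda>_. 0)")
        case True
        then show ?thesis by (simp add: has_bochner_integral_zero)
      next
        case False
        have "emeasure ?T {t \<in> space ?T. s n t = y} \<le> emeasure ?T {t \<in> space ?T. s n t \<noteq> (\<lambda>_. 0)}"
        proof (rule emeasure_mono)
          have "{t \<in> space ?T. s n t \<noteq> (\<lambda>_. 0)} = space ?T - {t \<in> space ?T. s n t = (\<lambda>_. 0)}" by auto
          then show "{t \<in> space ?T. s n t \<noteq> (\<lambda>_. 0)} \<in> sets ?T" using sets' by auto
        qed (use False in auto)
        also have "\<dots> < \<infinity>" by (rule s(3))
        finally show ?thesis using sets' by (intro has_bochner_integral_scaleR_left has_bochner_integral_real_indicator) auto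
      qed
    qed
    also have "(\<Sum>y\<in>s n ` space ?T. measure ?T {t \<in> space ?T. s n t = y} *\<^sub>R (\<integral>x. y x * z x \<partial>M)) = (\<integral>x. W n x * z x \<partial>M)"
    proof -
      have "(\<integral>x. W n x * z x \<partial>M) = (\<integral>x. (\<Sum>y\<in>s n ` space ?T. measure ?T {t \<in> space ?T. s n t = y} * (y x * z x)) \<partial>M)"
        unfolding W_def by (simp add: sum_distrib_right mult.assoc)
      also have "\<dots> = (\<Sum>y\<in>s n ` space ?T. (\<integral>x. measure ?T {t \<in> space ?T. s n t = y} * (y x * z x) \<partial>M))"
        using s(2)[of n] by (intro Bochner_Integration.integral_sum integrable_mult_right Lp2_integrable_mult z) auto
      finally show ?thesis by simp
    qed
    finally show ?thesis
    proof (rule has_bochner_integral_cong[THEN iffD1, rotated -1])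
      fix t assume t: "t \<in> space ?T"
      have "(\<Sum>y\<in>s n ` space ?T. indicator {t \<in> space ?T. s n t = y} t *\<^sub>R (\<integral>x. y x * z x \<partial>M))
          = (\<Sum>y\<in>s n ` space ?T. if y = s n t then (\<integral>x. y x * z x \<partial>M) else 0)"
        using t by (intro sum.cong) (auto simp: indicator_def)
      also have "\<dots> = h n t" unfolding h_def using fin t by (simp add: sum.delta)
      finally show "(\<Sum>y\<in>s n ` space ?T. indicator {t \<in> space ?T. s n t = y} t *\<^sub>R (\<integral>x. y x * z x \<partial>M)) = h n t" .
    qed auto
  qed
  have hi: "integrable ?T (h n)" and hI: "integral\<^sup>L ?T (h n) = (\<integral>x. W n x * z x \<partial>M)" for n
    using h[of n] by (auto simp: has_bochner_integral_iff)
  define c where "c = ?N z"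
  have le: "(\<integral>\<^sup>+t. ennreal (norm (g t - h n t)) \<partial>?T) \<le> ennreal c * (\<integral>\<^sup>+t. ennreal (?N (\<lambda>x. u t x - s n t x)) \<partial>?T)" for n
  proof -
    have "(\<integral>\<^sup>+t. ennreal (norm (g t - h n t)) \<partial>?T) \<le> (\<integral>\<^sup>+t. ennreal c * ennreal (?N (\<lambda>x. u t x - s n t x)) \<partial>?T)"
    proof (rule nn_integral_mono_AE, use strongly_measurable_in[OF sm] AE_space in eventually_elim)
      fix t assume t: "u t \<in> Lp 2 M" "t \<in> space ?T"
      then have st: "s n t \<in> Lp 2 M" using s(2) by auto
      have "g t - h n t = (\<integral>x. (u t x - s n t x) * z x \<partial>M)"
        unfolding g_def h_def using t st z by (simp add: left_diff_distrib Lp2_integrable_mult)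
      then have "norm (g t - h n t) \<le> c * ?N (\<lambda>x. u t x - s n t x)"
        using Lp2_integral_mult_le[OF Lp2_diff[OF t(1) st] z] by (simp add: c_def mult.commute)
      then show "ennreal (norm (g t - h n t)) \<le> ennreal c * ennreal (?N (\<lambda>x. u t x - s n t x))"
        by (simp add: c_def ennreal_mult[symmetric] ennreal_leI)
    qed
    also have "\<dots> \<le> ennreal c * (\<integral>\<^sup>+t. ennreal (?N (\<lambda>x. u t x - s n t x)) \<partial>?T)"
      by (rule nn_integral_cmult_le) (simp add: c_def)
    finally show ?thesis .
  qed
  have lim': "(\<lambda>n. \<integral>\<^sup>+t. ennreal (norm (g t - h n t)) \<partial>?T) \<longlonglongrightarrow> 0"
  proof (rule tendsto_sandwich[OF _ _ tendsto_const])
    show "(\<lambda>n. ennreal c * (\<integral>\<^sup>+t. ennreal (?N (\<lambda>x. u t x - s n t x)) \<partial>?T)) \<longlonglongrightarrow> 0"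
      using ennreal_tendsto_cmult[OF _ lim, of "ennreal c"] by simp
  qed (use le in \<open>auto intro!: always_eventually\<close>)
  have "(\<lambda>n. integral\<^sup>L ?T (h n)) \<longlonglongrightarrow> integral\<^sup>L ?T g"
  proof (rule tendsto_L1_int[OF hi])
    have "\<forall>\<^sub>F n in sequentially. (\<integral>\<^sup>+t. ennreal (norm (g t - h n t)) \<partial>?T) < 1"
      using lim' by (intro order_tendstoD(2)) auto
    then obtain n where "(\<integral>\<^sup>+t. ennreal (norm (g t - h n t)) \<partial>?T) < 1" by (auto dest: eventually_happens)
    then have "(\<integral>\<^sup>+t. ennreal (norm (g t - h n t)) \<partial>?T) < \<infinity>" by (rule less_trans) simp
    then have "integrable ?T (\<lambda>t. g t - h n t)"
      using gm borel_measurable_integrable[OF hi[of n]] by (intro integrableI_bounded) auto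
    then have "integrable ?T (\<lambda>t. (g t - h n t) + h n t)" using hi[of n] by (rule Bochner_Integration.integrable_add)
    then show "integrable ?T g" by simp
    show "(\<lambda>n. \<integral>\<^sup>+t. ennreal (norm (h n t - g t)) \<partial>?T) \<longlonglongrightarrow> 0"
      using lim' by (subst norm_minus_commute)
  qed
  moreover have "(\<lambda>n. \<integral>x. W n x * z x \<partial>M) \<longlonglongrightarrow> (\<integral>x. w x * z x \<partial>M)"
  proof (rule Lp2_mult_tendsto[OF w z W])
    have "?N (\<lambda>x. w x - W n x) = ?N (\<lambda>x. W n x - w x)" for n
      using seminormed_spaceD(6)[OF seminormed_space_Lp2 w W] .
    then show "(\<lambda>n. ?N (\<lambda>x. w x - W n x)) \<longlonglongrightarrow> 0" using limw by (simp add: W_def)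
  qed
  ultimately show ?thesis unfolding hI g_def by (rule LIMSEQ_unique)
qed

section \<open>Weak derivatives on the half-line\<close>

lemma absolutely_integrable_iff_lebesgue_on:
  fixes f :: "real \<Rightarrow> real"
  shows "f absolutely_integrable_on {a..b} \<longleftrightarrow> integrable (lebesgue_on {a<..<b}) f"
  unfolding absolutely_integrable_on_Icc_iff_Ioo
  by (simp add: set_integrable_def integrable_restrict_space)

lemma absolutely_integrable_lebesgue_on_Icc:
  fixes f :: "real \<Rightarrow> real"
  shows "f absolutely_integrable_on {a..b} \<longleftrightarrow> integrable (lebesgue_on {a..b}) f"
  by (simp add: set_integrable_def integrable_restrict_space)

lemma test_function_real_derivative:
  fixes \<psi> :: "real \<Rightarrow> real"
  assumes "\<psi> \<in> test_functions S"
  shows "(\<psi> has_real_derivative deriv \<psi> t) (at t)" "deriv \<psi> \<in> test_functions S"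
proof -
  have D: "(\<psi> has_derivative frechet_derivative \<psi> (at t)) (at t)" for t
    by (rule C_infinity_has_derivative[OF test_functionsD(1)[OF assms]])
  have "frechet_derivative \<psi> (at t) h = frechet_derivative \<psi> (at t) 1 * h" for t h
    using linear_scale[OF has_derivative_linear[OF D[of t]], of h 1] by simp
  then have "frechet_derivative \<psi> (at t) = (*) (frechet_derivative \<psi> (at t) 1)" for t by (rule ext)
  from has_derivative_eq_rhs[OF D this]
  have d: "(\<psi> has_real_derivative frechet_derivative \<psi> (at t) 1) (at t)" for t
    unfolding has_field_derivative_def .
  then have e: "deriv \<psi> = (\<lambda>t. frechet_derivative \<psi> (at t) 1)"
    by (simp add: fun_eq_iff DERIV_imp_deriv)
  show "(\<psi> has_real_derivative deriv \<psi> t) (at t)" unfolding e by (rule d)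
  show "deriv \<psi> \<in> test_functions S" unfolding e by (rule test_functions_derivative[OF assms]) simp
qed

lemma test_function_half_line_support:
  assumes "\<psi> \<in> test_functions {0::real<..}"
  obtains l r where "0 < l" "l < r" "\<And>t. t < l \<or> t > r \<Longrightarrow> \<psi> t = 0"
proof -
  let ?K = "closure {t. \<psi> t \<noteq> 0}"
  have K: "compact ?K" "?K \<subseteq> {0<..}" 
    by (rule test_functionsD(2)[OF assms], rule test_functionsD(3)[OF assms])
  obtain r where r: "\<And>t. t \<in> ?K \<Longrightarrow> \<bar>t\<bar> \<le> r" 
    using compact_imp_bounded[OF K(1)] unfolding bounded_iff real_norm_def by blast
  obtain l where l: "l > 0" "\<And>t. t \<in> ?K \<Longrightarrow> l \<le> t"
  proof (cases "?K = {}")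
    case True
    then show ?thesis using that[of 1] by auto
  next
    case False
    then obtain l where "l \<in> ?K" "\<And>t. t \<in> ?K \<Longrightarrow> l \<le> t" 
      using compact_attains_inf[OF K(1) False] by blast
    then show ?thesis using that[of l] K(2) by auto
  qed
  have "\<psi> t = 0" if "t < l \<or> t > l + \<bar>r\<bar> + 1" for t
  proof -
    have "t \<notin> ?K" using that l r[of t] by fastforce
    then show ?thesis by (rule test_functionsD(5)[OF assms])
  qed
  then show thesis using that[of l "l + \<bar>r\<bar> + 1"] l(1) by auto
qed

lemma test_function_primitive:
  assumes \<kappa>: "\<kappa> \<in> test_functions {0::real<..}" and zero: "(\<integral>t. \<kappa> t \<partial>lborel) = 0"
  shows "\<exists>\<psi>\<in>test_functions {0<..}. deriv \<psi> = \<kappa>"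
proof -
  obtain l r where lr: "0 < l" "l < r" and out: "\<And>t. t < l \<or> t > r \<Longrightarrow> \<kappa> t = 0"
    using test_function_half_line_support[OF \<kappa>] by metis
  define \<psi> where "\<psi> t = integral {0..t} \<kappa>" for t
  have cont: "continuous_on S \<kappa>" for S
    using test_functions_continuous[OF \<kappa>] continuous_on_subset by blast
  have int: "\<kappa> integrable_on {a..b}" for a b by (intro integrable_continuous_real cont)
  have left: "\<psi> t = 0" if "t < l" for t
  proof -
    have "integral {0..t} \<kappa> = integral {0..t} (\<lambda>_. 0)"
      using that by (intro Henstock_Kurzweil_Integration.integral_cong out) auto
    then show ?thesis by (simp add: \<psi>_def)
  qed
  have d: "(\<psi> has_real_derivative \<kappa> t) (at t)" for t
  proof (cases "t < l")
    case True
    have "((\<lambda>_. 0) has_real_derivative \<kappa> t) (at t)" using out[of t] True by simp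
    then show ?thesis
      by (rule has_field_derivative_transform_within_open[where S="{..<l}"]) (use True left in auto)
  next
    case False
    then have t: "0 < t" using lr by simp
    have "(\<psi> has_real_derivative \<kappa> t) (at t within {0..t + 1})"
      unfolding \<psi>_def by (rule integral_has_real_derivative[OF cont]) (use t in auto)
    moreover have "at t within {0..t + 1} = at t" using t by (intro at_within_interior) auto
    ultimately show ?thesis by simp
  qed
  have right: "\<psi> t = 0" if "t > r" for t
  proof -
    have "(\<integral>s. \<kappa> s \<partial>lborel) = (\<integral>s. indicator {0..t} s *\<^sub>R \<kappa> s \<partial>lborel)"
    proof (intro Bochner_Integration.integral_cong refl)
      fix s
      show "\<kappa> s = indicator {0..t} s *\<^sub>R \<kappa> s"
        using out[of s] that lr by (cases "s < l \<or> s > r") (auto simp: indicator_def)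
    qed
    also have "\<dots> = integral {0..t} \<kappa>"
      using set_borel_integral_eq_integral(2)[OF borel_integrable_atLeastAtMost'[OF cont]]
      by (simp add: set_lebesgue_integral_def)
    finally show ?thesis using zero by (simp add: \<psi>_def)
  qed
  have "C_k k \<psi>" for k
  proof (cases k)
    case 0
    then show ?thesis using d DERIV_isCont by (auto intro!: continuous_at_imp_continuous_on)
  next
    case (Suc n)
    have "C_k n \<kappa>" using test_functionsD(1)[OF \<kappa>] by (simp add: C_infinity_def)
    then show ?thesis unfolding Suc by (rule C_k_real_SucI[OF d])
  qed
  then have "\<psi> \<in> C_infinity" by (simp add: C_infinity_def)
  then have "\<psi> \<in> test_functions {0<..}"
    by (rule test_functionsI[where K="{l..r}"]) (use lr left right in \<open>auto simp: not_le\<close>)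
  moreover have "deriv \<psi> = \<kappa>" using d by (simp add: fun_eq_iff DERIV_imp_deriv)
  ultimately show ?thesis by blast
qed

text \<open>
  A primitive of an integrable function is in general not differentiable everywhere, so the
  order of integration over the region \<open>s \<le> t\<close> is exchanged instead of integrating by parts.
\<close>

lemma integral_primitive_by_parts:
  fixes f' :: "real \<Rightarrow> real"
  assumes f': "\<And>T. T > 0 \<Longrightarrow> f' absolutely_integrable_on {0..T}" and \<psi>: "\<psi> \<in> test_functions {0<..}"
  shows "(\<integral>t. deriv \<psi> t * integral {0..t} f' \<partial>lebesgue_on {0<..}) = - (\<integral>t. \<psi> t * f' t \<partial>lebesgue_on {0<..})"
proof -
  obtain l R where lR: "0 < l" "l < R" and out: "\<And>t. t < l \<or> t > R \<Longrightarrow> \<psi> t = 0"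
    using test_function_half_line_support[OF \<psi>] by metis
  obtain l' R' where lR': "0 < l'" "l' < R'" and out': "\<And>t. t < l' \<or> t > R' \<Longrightarrow> deriv \<psi> t = 0"
    using test_function_half_line_support[OF test_function_real_derivative(2)[OF \<psi>]] by metis
  define B where "B = max R R' + 1"
  have B: "B > 0" "B > R" "B \<ge> R'" using lR lR' by (auto simp: B_def)
  have [measurable]: "\<psi> \<in> borel_measurable borel" "deriv \<psi> \<in> borel_measurable borel"
    using test_functions_measurable[OF \<psi>] test_functions_measurable[OF test_function_real_derivative(2)[OF \<psi>]] by auto
  have fi: "integrable (lebesgue_on {0..B}) f'"
    using f'[OF B(1)] by (simp add: absolutely_integrable_lebesgue_on_Icc)
  have Bl: "{0..B} \<in> sets lebesgue" by simp
  obtain g0 where g0[measurable]: "g0 \<in> borel_measurable borel" and eq0: "AE t in lborel. t \<in> {0..B} \<longrightarrow> f' t = g0 t"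
    using lebesgue_on_borel_representative[OF Bl borel_measurable_integrable[OF fi]] by metis
  define g where "g t = indicator {0..B} t * g0 t" for t
  have [measurable]: "g \<in> borel_measurable borel" unfolding g_def[abs_def] by measurable
  have eq: "AE t in lborel. t \<in> {0..B} \<longrightarrow> f' t = g t" using eq0 by eventually_elim (auto simp: g_def)
  have gi: "integrable lborel g"
    using lebesgue_on_integral(1)[OF _ g0 eq0 borel_measurable_integrable[OF fi]] fi by (simp add: g_def[abs_def])
  have G: "integral {0..t} f' = (\<integral>s. indicator {s. s \<le> t} s * g s \<partial>lborel)" if "0 \<le> t" "t \<le> B" for t
  proof -
    have sub: "{0..t} \<subseteq> {0..B}" using that by auto
    have fit: "integrable (lebesgue_on {0..t}) f'"
      by (rule integrable_lebesgue_on_subset[OF Bl _ sub fi]) simp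
    have eqt: "AE s in lborel. s \<in> {0..t} \<longrightarrow> f' s = g s" using eq by eventually_elim (use sub in auto)
    have "integral {0..t} f' = integral\<^sup>L (lebesgue_on {0..t}) f'"
      by (rule lebesgue_integral_eq_integral[symmetric, OF fit]) simp
    also have "\<dots> = (\<integral>s. indicator {0..t} s *\<^sub>R g s \<partial>lborel)"
      by (rule lebesgue_on_integral(2)[OF _ _ eqt borel_measurable_integrable[OF fit]]) auto
    also have "\<dots> = (\<integral>s. indicator {s. s \<le> t} s * g s \<partial>lborel)"
      by (intro Bochner_Integration.integral_cong) (auto simp: g_def indicator_def)
    finally show ?thesis .
  qed
  define F where "F = (\<lambda>(t, s). deriv \<psi> t * (indicator {s. s \<le> t} s * g s))"
  have F[measurable]: "F \<in> borel_measurable (lborel \<Otimes>\<^sub>M lborel)"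
  proof -
    have "(\<lambda>(t::real, s::real). deriv \<psi> t * ((if s \<le> t then 1 else 0) * g s)) \<in> borel_measurable (lborel \<Otimes>\<^sub>M lborel)"
      by measurable
    then show ?thesis by (simp add: F_def indicator_def cong: if_cong)
  qed
  have Fi: "integrable (lborel \<Otimes>\<^sub>M lborel) F"
  proof (rule lborel_pair.Fubini_integrable[OF F])
    have gs: "integrable lborel (\<lambda>s. indicator {s. s \<le> t} s * g s)" for t
      using integrable_mult_indicator[of "{s. s \<le> t}" lborel g] gi by auto
    show "AE t in lborel. integrable lborel (\<lambda>s. F (t, s))" unfolding F_def using gs by (auto intro!: AE_I2)
    show "integrable lborel (\<lambda>t. \<integral>s. norm (F (t, s)) \<partial>lborel)"
    proof (rule Bochner_Integration.integrable_bound)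
      show "integrable lborel (\<lambda>t. deriv \<psi> t * (\<integral>s. \<bar>g s\<bar> \<partial>lborel))"
        by (intro integrable_mult_left test_functions_integrable[OF test_function_real_derivative(2)[OF \<psi>]])
      show "AE t in lborel. norm (\<integral>s. norm (F (t, s)) \<partial>lborel) \<le> norm (deriv \<psi> t * (\<integral>s. \<bar>g s\<bar> \<partial>lborel))"
      proof (rule AE_I2)
        fix t
        have "(\<integral>s. norm (F (t, s)) \<partial>lborel) = \<bar>deriv \<psi> t\<bar> * (\<integral>s. \<bar>indicator {s. s \<le> t} s * g s\<bar> \<partial>lborel)"
          by (simp add: F_def abs_mult)
        also have "\<dots> \<le> \<bar>deriv \<psi> t\<bar> * (\<integral>s. \<bar>g s\<bar> \<partial>lborel)"
          using gs gi by (intro mult_left_mono integral_mono) (auto simp: indicator_def)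
        finally show "norm (\<integral>s. norm (F (t, s)) \<partial>lborel) \<le> norm (deriv \<psi> t * (\<integral>s. \<bar>g s\<bar> \<partial>lborel))"
          by (simp add: abs_mult integral_nonneg_AE)
      qed
    qed measurable
  qed
  let ?I = "\<lambda>t. deriv \<psi> t * (\<integral>s. indicator {s. s \<le> t} s * g s \<partial>lborel)"
  have Fin: "(\<integral>s. F (t, s) \<partial>lborel) = ?I t" for t by (simp add: F_def)
  have Im: "?I \<in> borel_measurable borel" unfolding Fin[symmetric] by measurable
  have eqI: "deriv \<psi> t * integral {0..t} f' = ?I t" if "t \<in> {0<..}" for t
    using that G[of t] out'[of t] B by (cases "t \<le> B") auto
  have mI: "(\<lambda>t. deriv \<psi> t * integral {0..t} f') \<in> borel_measurable (lebesgue_on {0<..})"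
    by (subst measurable_cong[of _ _ ?I]) (use eqI borel_measurable_lebesgue_on[OF Im] in auto)
  have "(\<integral>t. deriv \<psi> t * integral {0..t} f' \<partial>lebesgue_on {0<..}) = (\<integral>t. indicator {0<..} t *\<^sub>R ?I t \<partial>lborel)"
    by (rule lebesgue_on_integral(2)[OF _ Im _ mI]) (use eqI in auto)
  also have "\<dots> = (\<integral>t. ?I t \<partial>lborel)"
    using out' lR' by (intro Bochner_Integration.integral_cong) (auto simp: indicator_def not_less)
  also have "\<dots> = (\<integral>t. (\<integral>s. F (t, s) \<partial>lborel) \<partial>lborel)" by (simp add: Fin)
  also have "\<dots> = (\<integral>s. (\<integral>t. F (t, s) \<partial>lborel) \<partial>lborel)"
    using lborel_pair.Fubini_integral[of "\<lambda>t s. F (t, s)"] Fi by simp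
  also have "\<dots> = (\<integral>s. - (\<psi> s * g s) \<partial>lborel)"
  proof (intro Bochner_Integration.integral_cong refl)
    fix s :: real
    let ?b = "max s B"
    have cd: "isCont (deriv \<psi>) t" for t
      using test_functions_continuous[OF test_function_real_derivative(2)[OF \<psi>]]
      by (simp add: continuous_on_eq_continuous_at)
    have "(\<integral>t. deriv \<psi> t * indicator {s..?b} t \<partial>lborel) = \<psi> ?b - \<psi> s"
      by (rule integral_FTC_Icc_real)
        (use test_function_real_derivative(1)[OF \<psi>] cd in auto)
    moreover have "\<psi> ?b - \<psi> s = - \<psi> s"
      using out[of ?b] B by (simp add: less_max_iff_disj)
    moreover have "(\<integral>t. F (t, s) \<partial>lborel) = (\<integral>t. (deriv \<psi> t * indicator {s..?b} t) * g s \<partial>lborel)"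
    proof (intro Bochner_Integration.integral_cong refl)
      fix t
      show "F (t, s) = (deriv \<psi> t * indicator {s..?b} t) * g s"
        using out'[of t] B by (cases "t > R'") (auto simp: F_def indicator_def)
    qed
    ultimately show "(\<integral>t. F (t, s) \<partial>lborel) = - (\<psi> s * g s)" by simp
  qed
  also have "\<dots> = - (\<integral>s. \<psi> s * g s \<partial>lborel)" by simp
  also have "(\<integral>s. \<psi> s * g s \<partial>lborel) = (\<integral>s. indicator {0..B} s *\<^sub>R (\<psi> s * g s) \<partial>lborel)"
    by (intro Bochner_Integration.integral_cong) (auto simp: g_def indicator_def)
  also have "\<dots> = (\<integral>s. \<psi> s * f' s \<partial>lebesgue_on {0..B})"
  proof (rule lebesgue_on_integral(2)[symmetric])
    show "(\<lambda>s. \<psi> s * f' s) \<in> borel_measurable (lebesgue_on {0..B})"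
      using borel_measurable_integrable[OF fi] borel_measurable_lebesgue_on[of \<psi>] by auto
  qed (use eq in auto)
  also have "\<dots> = (\<integral>s. indicator {0..B} s *\<^sub>R (\<psi> s * f' s) \<partial>lebesgue)"
    by (rule integral_restrict_space) simp
  also have "\<dots> = (\<integral>s. indicator {0<..} s *\<^sub>R (\<psi> s * f' s) \<partial>lebesgue)"
    using out lR B by (intro Bochner_Integration.integral_cong) (auto simp: indicator_def not_le not_less)
  also have "\<dots> = (\<integral>s. \<psi> s * f' s \<partial>lebesgue_on {0<..})"
    by (rule integral_restrict_space[symmetric]) simp
  finally show ?thesis .
qed

lemma half_line_integrable_cbox:
  fixes k :: "real \<Rightarrow> real"
  assumes k: "\<And>T. T > 0 \<Longrightarrow> k absolutely_integrable_on {0..T}" and ab: "cbox a b \<subseteq> {0<..}"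
  shows "integrable (lebesgue_on (cbox a b)) k"
proof -
  have sub: "cbox a b \<subseteq> {0..\<bar>b\<bar> + 1}" using ab by auto
  have "integrable (lebesgue_on {0..\<bar>b\<bar> + 1}) k"
    using k[of "\<bar>b\<bar> + 1"] by (simp add: absolutely_integrable_lebesgue_on_Icc)
  then show ?thesis by (intro integrable_lebesgue_on_subset[OF _ _ sub]) auto
qed

lemma half_line_measurable:
  fixes k :: "real \<Rightarrow> real"
  assumes k: "\<And>T. T > 0 \<Longrightarrow> k absolutely_integrable_on {0..T}"
  shows "k \<in> borel_measurable (lebesgue_on {0<..})"
proof (rule borel_measurable_lebesgue_on_AE_limit)
  let ?L = "lebesgue_on {0::real<..}"
    show "(\<lambda>t. indicator {0..real (Suc n)} t * k t) \<in> borel_measurable ?L" for n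
    proof -
      have "(\<lambda>t. indicator {0..real (Suc n)} t *\<^sub>R k t) \<in> borel_measurable lebesgue"
        using k[of "real (Suc n)"] unfolding set_integrable_def by (intro borel_measurable_integrable) simp
      then show ?thesis by (intro measurable_restrict_space1) simp
    qed
    show "AE t in ?L. (\<lambda>n. indicator {0..real (Suc n)} t * k t) \<longlonglongrightarrow> k t"
    proof (rule AE_I2)
      fix t :: real assume t: "t \<in> space ?L"
      obtain N :: nat where N: "t \<le> real N" using real_arch_simple by blast
      have "\<forall>\<^sub>F n in sequentially. indicator {0..real (Suc n)} t * k t = k t"
        using eventually_ge_at_top[of N] by eventually_elim (use t N in \<open>auto simp: indicator_def\<close>)
      then show "(\<lambda>n. indicator {0..real (Suc n)} t * k t) \<longlonglongrightarrow> k t" by (rule tendsto_eventually)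
    qed
  qed simp

text \<open>
  Du Bois-Reymond: by the fundamental lemma applied to the difference of the function and the
  primitive of its weak derivative, tested with derivatives of test functions, which are exactly
  the test functions of mean zero.
\<close>

lemma weak_derivative_primitive:
  fixes f f' :: "real \<Rightarrow> real"
  assumes f: "\<And>T. T > 0 \<Longrightarrow> f absolutely_integrable_on {0..T}"
    and f': "\<And>T. T > 0 \<Longrightarrow> f' absolutely_integrable_on {0..T}"
    and weak: "\<And>\<psi>. \<psi> \<in> test_functions {0<..} \<Longrightarrow>
      (\<integral>t. deriv \<psi> t * f t \<partial>lebesgue_on {0<..}) = - (\<integral>t. \<psi> t * f' t \<partial>lebesgue_on {0<..})"
  shows "\<exists>c. AE t in lebesgue_on {0<..}. f t = c + integral {0..t} f'"
proof -
  let ?L = "lebesgue_on {0::real<..}"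
  define h where "h t = f t - integral {0..t} f'" for t
  have hT: "h absolutely_integrable_on {0..T}" if "T > 0" for T
  proof -
    have "f' integrable_on {0..T}" using f'[OF that] set_lebesgue_integral_eq_integral(1) by blast
    then have "continuous_on {0..T} (\<lambda>t. integral {0..t} f')" by (rule indefinite_integral_continuous_1)
    then have "(\<lambda>t. integral {0..t} f') absolutely_integrable_on {0..T}"
      by (rule absolutely_integrable_continuous_real)
    then show ?thesis unfolding h_def[abs_def] by (intro set_integral_diff f that)
  qed
  have mult_int: "integrable ?L (\<lambda>t. \<theta> t * k t)"
    if \<theta>: "\<theta> \<in> test_functions {0<..}" and k: "\<And>T. T > 0 \<Longrightarrow> k absolutely_integrable_on {0..T}" for \<theta> k
  proof -
    obtain l r where lr: "0 < l" "l < r" and out: "\<And>t. t < l \<or> t > r \<Longrightarrow> \<theta> t = 0"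
      using test_function_half_line_support[OF \<theta>] by metis
    obtain C where C: "C \<ge> 0" "\<And>t. \<bar>\<theta> t\<bar> \<le> C" by (rule test_functions_bounded[OF \<theta>]) blast
    have "integrable lebesgue (\<lambda>t. indicator {0..r} t *\<^sub>R k t)"
      using k[of r] lr by (simp add: set_integrable_def)
    then have "integrable lebesgue (\<lambda>t. C * (indicator {0..r} t *\<^sub>R k t))" by simp
    then have "integrable lebesgue (\<lambda>t. indicator {0<..} t *\<^sub>R (\<theta> t * k t))"
    proof (rule Bochner_Integration.integrable_bound)
      show "(\<lambda>t. indicator {0<..} t *\<^sub>R (\<theta> t * k t)) \<in> borel_measurable lebesgue"
      proof -
        have "(\<lambda>t. \<theta> t * k t) \<in> borel_measurable ?L"
          by (intro borel_measurable_times borel_measurable_lebesgue_on test_functions_measurable[OF \<theta>] half_line_measurable k)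
        then show ?thesis by (simp add: borel_measurable_restrict_space_iff)
      qed
      show "AE t in lebesgue. norm (indicator {0<..} t *\<^sub>R (\<theta> t * k t)) \<le> norm (C * (indicator {0..r} t *\<^sub>R k t))"
        using C out by (intro AE_I2) (auto simp: indicator_def abs_mult mult_right_mono not_le)
    qed
    then show ?thesis by (simp add: integrable_restrict_space)
  qed
  have orth: "(\<integral>t. deriv \<psi> t * h t \<partial>?L) = 0" if \<psi>: "\<psi> \<in> test_functions {0<..}" for \<psi>
  proof -
    note d = test_function_real_derivative(2)[OF \<psi>]
    have "(\<lambda>t. f t - h t) absolutely_integrable_on {0..T}" if "T > 0" for T
      by (intro set_integral_diff f hT that)
    then have "(\<integral>t. deriv \<psi> t * f t \<partial>?L) - (\<integral>t. deriv \<psi> t * (f t - h t) \<partial>?L)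
        = (\<integral>t. deriv \<psi> t * f t - deriv \<psi> t * (f t - h t) \<partial>?L)"
      by (intro Bochner_Integration.integral_diff[symmetric] mult_int d f) auto
    then show ?thesis
      using weak[OF \<psi>] integral_primitive_by_parts[OF f' \<psi>] by (simp add: h_def algebra_simps)
  qed
  \<comment> \<open>A test function of integral one subtracts the mean from arbitrary test functions.\<close>
  define \<rho>0 where "\<rho>0 = box_bump (1::real) 2 1"
  have \<rho>0: "\<rho>0 \<in> test_functions {0<..}" unfolding \<rho>0_def by (rule box_bump_test_function) auto
  define I where "I = (\<integral>t. \<rho>0 t \<partial>lborel)"
  have "I \<noteq> 0"
  proof
    assume "I = 0"
    have "AE t in lborel. 0 \<le> \<rho>0 t" by (simp add: \<rho>0_def box_bump_bounds)
    from integral_nonneg_eq_0_iff_AE[OF test_functions_integrable[OF \<rho>0] this] \<open>I = 0\<close>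
    have "AE t in lborel. \<rho>0 t = 0" by (simp add: I_def)
    moreover have "\<rho>0 t \<noteq> 0" if "t \<in> {1<..<2}" for t
      using that by (auto simp: \<rho>0_def box_bump_def exp_flat_def)
    ultimately have "AE t in lborel. t \<notin> {1::real<..<2}" by (auto elim!: eventually_mono)
    then have "emeasure lborel {1::real<..<2} = 0"
      by (subst (asm) AE_iff_measurable[of "{1<..<2}"]) auto
    then show False using emeasure_lborel_Ioo[of "1::real" 2] by (simp only:) simp
  qed
  define \<rho> where "\<rho> t = 1 / I * \<rho>0 t" for t
  have \<rho>: "\<rho> \<in> test_functions {0<..}" unfolding \<rho>_def by (rule test_functions_scale[OF \<rho>0])
  have \<rho>1: "(\<integral>t. \<rho> t \<partial>lborel) = 1" using \<open>I \<noteq> 0\<close> by (simp add: \<rho>_def I_def)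
  define c where "c = (\<integral>t. \<rho> t * h t \<partial>?L)"
  have const: "(\<lambda>t. c) absolutely_integrable_on {0..T}" for T :: real
    by (intro absolutely_integrable_continuous_real continuous_intros)
  have hc: "(\<lambda>t. h t - c) absolutely_integrable_on {0..T}" if "T > 0" for T
    by (intro set_integral_diff hT that const)
  have "AE t in ?L. h t - c = 0"
  proof (rule fundamental_lemma)
    show "(\<lambda>t. h t - c) \<in> borel_measurable ?L" by (rule half_line_measurable[OF hc])
    show "integrable (lebesgue_on (cbox a b)) (\<lambda>t. h t - c)" if "cbox a b \<subseteq> {0<..}" for a b
      by (rule half_line_integrable_cbox[OF hc that])
    fix \<theta> assume \<theta>: "\<theta> \<in> test_functions {0::real<..}"
    define a where "a = (\<integral>t. \<theta> t \<partial>lborel)"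
    define \<kappa> where "\<kappa> t = \<theta> t - a * \<rho> t" for t
    have \<kappa>: "\<kappa> \<in> test_functions {0<..}" unfolding \<kappa>_def by (intro test_functions_diff test_functions_scale \<theta> \<rho>)
    have "(\<integral>t. \<kappa> t \<partial>lborel) = 0"
      unfolding \<kappa>_def using test_functions_integrable[OF \<theta>] test_functions_integrable[OF \<rho>] \<rho>1 by (simp add: a_def)
    then obtain \<psi> where \<psi>: "\<psi> \<in> test_functions {0<..}" "deriv \<psi> = \<kappa>" using test_function_primitive[OF \<kappa>] by blast
    have "(\<integral>t. \<kappa> t * h t \<partial>?L) = 0" using orth[OF \<psi>(1)] \<psi>(2) by simp
    moreover have "(\<integral>t. \<kappa> t * h t \<partial>?L) = (\<integral>t. \<theta> t * h t \<partial>?L) - a * c"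
      unfolding \<kappa>_def c_def using mult_int[OF \<theta> hT] mult_int[OF \<rho> hT] by (simp add: left_diff_distrib mult.assoc)
    moreover have "(\<integral>t. \<theta> t * c \<partial>?L) = a * c"
    proof -
      have "(\<integral>t. \<theta> t \<partial>?L) = (\<integral>t. indicator {0<..} t *\<^sub>R \<theta> t \<partial>lborel)"
        by (rule lebesgue_on_integral(2))
          (use test_functions_measurable[OF \<theta>] borel_measurable_lebesgue_on in auto)
      also have "\<dots> = a"
        unfolding a_def using test_functionsD(4)[OF \<theta>]
        by (intro Bochner_Integration.integral_cong) (auto simp: indicator_def)
      finally show ?thesis by simp
    qed
    ultimately show "(\<integral>t. \<theta> t * (h t - c) \<partial>?L) = 0"
      using mult_int[OF \<theta> hT] mult_int[OF \<theta> const] by (auto simp: right_diff_distrib)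
  qed simp
  then have "AE t in ?L. f t = c + integral {0..t} f'"
    by eventually_elim (simp add: h_def)
  then show ?thesis by blast
qed

section \<open>Continuous representatives\<close>

lemma AE_half_line:
  assumes "\<And>n. AE t in lebesgue_on {0<..<real (Suc n)}. P t"
  shows "AE t in lebesgue_on {0<..}. P t"
proof -
  have "AE t in lborel. \<forall>n. t \<in> {0<..<real (Suc n)} \<longrightarrow> P t"
    using assms by (subst AE_all_countable) (simp add: lebesgue_on_AE_iff)
  then have "AE t in lborel. t \<in> {0<..} \<longrightarrow> P t"
  proof eventually_elim
    case (elim t)
    obtain n where "t < real n" using reals_Archimedean2 by blast
    then have "t < real (Suc n)" by simp
    then show ?case using elim by auto
  qed
  then show ?thesis by (simp add: lebesgue_on_AE_iff)
qed

lemma AE_half_line_subset: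
  assumes "AE t in lebesgue_on {0::real<..}. P t"
  shows "AE t in lebesgue_on {0..T}. P t" "AE t in lebesgue_on {0<..<T}. P t"
proof -
  have 1: "AE t in lborel. t \<in> {0<..} \<longrightarrow> P t" using assms by (simp add: lebesgue_on_AE_iff)
  have "AE t in lborel. t \<noteq> (0::real)" by (rule AE_lborel_singleton)
  then have "AE t in lborel. t \<in> {0..T} \<longrightarrow> P t" using 1 by eventually_elim auto
  then show "AE t in lebesgue_on {0..T}. P t" by (simp add: lebesgue_on_AE_iff)
  show "AE t in lebesgue_on {0<..<T}. P t" using 1 by (simp add: lebesgue_on_AE_iff) (auto elim: eventually_mono)
qed

lemma conull_sequence:
  assumes "AE t in lebesgue_on {0::real<..}. P t" "t \<ge> 0"
  shows "\<exists>\<tau>. (\<forall>n. P (\<tau> n) \<and> \<tau> n > 0) \<and> \<tau> \<longlonglongrightarrow> t"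
proof -
  have ae: "AE s in lborel. s \<in> {0<..} \<longrightarrow> P s" using assms(1) by (simp add: lebesgue_on_AE_iff)
  have "\<exists>s. P s \<and> t < s \<and> s < t + inverse (real (Suc n))" for n
  proof (rule ccontr)
    assume no: "\<not> ?thesis"
    have "AE s in lborel. s \<notin> {t<..<t + inverse (real (Suc n))}"
      by (rule eventually_mono[OF ae]) (use no assms(2) in auto)
    then have "emeasure lborel {t<..<t + inverse (real (Suc n))} = 0"
      by (subst (asm) AE_iff_measurable[of "{t<..<t + inverse (real (Suc n))}"]) auto
    then show False using emeasure_lborel_Ioo[of t "t + inverse (real (Suc n))"] by (simp only:) simp
  qed
  then obtain \<tau> where \<tau>: "\<And>n. P (\<tau> n) \<and> t < \<tau> n \<and> \<tau> n < t + inverse (real (Suc n))" by metis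
  have "(\<lambda>n. t + inverse (real (Suc n))) \<longlonglongrightarrow> t + 0"
    by (intro tendsto_intros LIMSEQ_inverse_real_of_nat)
  then have "\<tau> \<longlonglongrightarrow> t"
    by (intro tendsto_sandwich[of "\<lambda>_. t" \<tau> sequentially "\<lambda>n. t + inverse (real (Suc n))"])
      (use \<tau> less_imp_le in \<open>auto intro!: always_eventually\<close>)
  then show ?thesis using \<tau> assms(2) by (intro exI[of _ \<tau>]) (auto intro: le_less_trans)
qed

lemma continuous_AE_zero:
  fixes f :: "real \<Rightarrow> real"
  assumes f: "continuous_on {0..} f" and ae: "AE t in lebesgue_on {0<..}. f t = 0" and t: "t \<ge> 0"
  shows "f t = 0"
proof -
  obtain \<tau> where \<tau>: "\<And>n. f (\<tau> n) = 0 \<and> \<tau> n > 0" "\<tau> \<longlonglongrightarrow> t" using conull_sequence[OF ae t] by blast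
  have "(\<lambda>n. f (\<tau> n)) \<longlonglongrightarrow> f t"
    by (rule continuous_on_tendsto_compose[OF f \<tau>(2)]) (use t \<tau>(1) less_imp_le in \<open>auto intro!: always_eventually\<close>)
  then show ?thesis using \<tau>(1) by (simp add: LIMSEQ_const_iff)
qed

lemma primitive_continuous:
  fixes f :: "real \<Rightarrow> real"
  assumes f: "\<And>T. T > 0 \<Longrightarrow> f absolutely_integrable_on {0..T}"
  shows "continuous_on {0..} (\<lambda>t. integral {0..t} f)"
  unfolding continuous_on_eq_continuous_within
proof
  fix t :: real assume t: "t \<in> {0..}"
  have "f integrable_on {0..t + 1}" using f[of "t + 1"] t set_lebesgue_integral_eq_integral(1) by auto
  then have "continuous_on {0..t + 1} (\<lambda>t. integral {0..t} f)" by (rule indefinite_integral_continuous_1)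
  then have "continuous (at t within {0..t + 1}) (\<lambda>t. integral {0..t} f)"
    using t by (simp add: continuous_on_eq_continuous_within)
  moreover have "at t within {0..t + 1} = at t within {0..}"
    by (rule at_within_nhd[of t "{..<t + 1}"]) auto
  ultimately show "continuous (at t within {0..}) (\<lambda>t. integral {0..t} f)" by simp
qed

lemma absolutely_integrable_between:
  fixes f :: "real \<Rightarrow> real"
  assumes f: "\<And>T. T > 0 \<Longrightarrow> f absolutely_integrable_on {0..T}" and s: "0 \<le> s"
  shows "f absolutely_integrable_on {s..t}" "f integrable_on {s..t}"
proof -
  have "{s..t} \<subseteq> {0..\<bar>t\<bar> + 1}" using s by auto
  from absolutely_integrable_on_subinterval[OF f this]
  show "f absolutely_integrable_on {s..t}" by simp
  then show "f integrable_on {s..t}" using set_lebesgue_integral_eq_integral(1) by blast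
qed

lemma primitive_diff:
  fixes f :: "real \<Rightarrow> real"
  assumes f: "\<And>T. T > 0 \<Longrightarrow> f absolutely_integrable_on {0..T}" and s: "0 \<le> s" "s \<le> t"
  shows "integral {0..t} f - integral {0..s} f = integral {s..t} f"
  using Henstock_Kurzweil_Integration.integral_combine[OF s absolutely_integrable_between(2)[OF f order_refl]] by simp

lemma integral_abs_bound_AE:
  fixes f g :: "real \<Rightarrow> real"
  assumes f: "f absolutely_integrable_on {a..b}" and g: "g absolutely_integrable_on {a..b}"
    and le: "AE r in lebesgue_on {a..b}. \<bar>f r\<bar> \<le> g r"
  shows "\<bar>integral {a..b} f\<bar> \<le> integral {a..b} g"
proof -
  have fi: "integrable (lebesgue_on {a..b}) f" and gi: "integrable (lebesgue_on {a..b}) g"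
    using f g by (auto simp: absolutely_integrable_lebesgue_on_Icc)
  have "\<bar>integral\<^sup>L (lebesgue_on {a..b}) f\<bar> \<le> (\<integral>r. \<bar>f r\<bar> \<partial>lebesgue_on {a..b})" by (rule integral_abs_bound)
  also have "\<dots> \<le> integral\<^sup>L (lebesgue_on {a..b}) g" by (rule integral_mono_AE) (use fi gi le in auto)
  finally show ?thesis using fi gi by (simp add: lebesgue_integral_eq_integral)
qed

lemma integral_mono_AE_Icc:
  fixes f g :: "real \<Rightarrow> real"
  assumes f: "f absolutely_integrable_on {a..b}" and g: "g absolutely_integrable_on {a..b}"
    and le: "AE r in lebesgue_on {a..b}. f r \<le> g r"
  shows "integral {a..b} f \<le> integral {a..b} g"
proof -
  have fi: "integrable (lebesgue_on {a..b}) f" and gi: "integrable (lebesgue_on {a..b}) g"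
    using f g by (auto simp: absolutely_integrable_lebesgue_on_Icc)
  have "integral\<^sup>L (lebesgue_on {a..b}) f \<le> integral\<^sup>L (lebesgue_on {a..b}) g"
    by (rule integral_mono_AE) (use fi gi le in auto)
  then show ?thesis using fi gi by (simp add: lebesgue_integral_eq_integral)
qed

lemma L2_loc_strongly_measurable:
  "u \<in> L2_loc X N \<Longrightarrow> strongly_measurable (lebesgue_on {0<..<real (Suc n)}) X N u"
  by (simp add: L2_loc_def Bochner_Lp_def)

lemma L2_loc_in: "u \<in> L2_loc X N \<Longrightarrow> AE t in lebesgue_on {0<..}. u t \<in> X"
  by (intro AE_half_line strongly_measurable_in[OF L2_loc_strongly_measurable])

lemma finite_measure_lebesgue_on_Ioo: "finite_measure (lebesgue_on {a<..<b::real})"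
  by (rule finite_measure_lebesgue_on_bounded) auto

lemma L2_loc_norm_integrable:
  fixes u :: "real \<Rightarrow> 'a \<Rightarrow> 'b::euclidean_space"
  assumes X: "seminormed_space X N" and u: "u \<in> L2_loc X N" and T: "T > 0"
  shows "(\<lambda>t. N (u t)) absolutely_integrable_on {0..T}" "(\<lambda>t. (N (u t))\<^sup>2) absolutely_integrable_on {0..T}"
proof -
  let ?T = "lebesgue_on {0<..<T}"
  interpret finite_measure ?T by (rule finite_measure_lebesgue_on_Ioo)
  have sm: "strongly_measurable ?T X N u" and i: "integrable ?T (\<lambda>t. N (u t) powr 2)"
    using u T by (auto simp: L2_loc_def Bochner_Lp_def)
  have m[measurable]: "(\<lambda>t. N (u t)) \<in> borel_measurable ?T" by (rule strongly_measurable_norm[OF _ sm X]) simp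
  have nn: "AE t in ?T. 0 \<le> N (u t)"
    using strongly_measurable_in[OF sm] by eventually_elim (use X in \<open>auto simp: seminormed_space_def\<close>)
  have "integrable ?T (\<lambda>t. (N (u t))\<^sup>2)"
    by (rule integrable_cong_AE_imp[OF i]) (use nn in \<open>auto elim!: eventually_mono\<close>)
  then show "(\<lambda>t. (N (u t))\<^sup>2) absolutely_integrable_on {0..T}"
    by (simp add: absolutely_integrable_iff_lebesgue_on)
  have "integrable ?T (\<lambda>t. N (u t))"
  proof (rule Bochner_Integration.integrable_bound)
    show "integrable ?T (\<lambda>t. 1 + (N (u t))\<^sup>2)" using \<open>integrable ?T (\<lambda>t. (N (u t))\<^sup>2)\<close> by simp
    show "AE t in ?T. norm (N (u t)) \<le> norm (1 + (N (u t))\<^sup>2)"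
      using mult_norm_le_squares[of 1] by (intro AE_I2) (simp add: abs_of_nonneg)
  qed simp
  then show "(\<lambda>t. N (u t)) absolutely_integrable_on {0..T}"
    by (simp add: absolutely_integrable_iff_lebesgue_on)
qed

context
  fixes M :: "'a measure" and X :: "('a \<Rightarrow> real) set" and N :: "('a \<Rightarrow> real) \<Rightarrow> real"
  defines X_def: "X \<equiv> Lp 2 M" and N_def: "N \<equiv> Lp_norm 2 M"
begin

lemma seminormed_X: "seminormed_space X N"
  unfolding X_def N_def by (rule seminormed_space_Lp2)

lemma L2_loc_mult_integrable:
  assumes u: "u \<in> L2_loc X N" and z: "z \<in> X" and T: "T > 0"
  shows "(\<lambda>t. \<integral>x. u t x * z x \<partial>M) absolutely_integrable_on {0..T}"
proof -
  let ?T = "lebesgue_on {0<..<T}"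
  have sm: "strongly_measurable ?T X N u" using u T by (auto simp: L2_loc_def Bochner_Lp_def)
  have "integrable ?T (\<lambda>t. \<integral>x. u t x * z x \<partial>M)"
  proof (rule Bochner_Integration.integrable_bound)
    show "integrable ?T (\<lambda>t. N (u t) * N z)"
      using L2_loc_norm_integrable(1)[OF seminormed_X u T]
      by (simp add: absolutely_integrable_iff_lebesgue_on)
    show "(\<lambda>t. \<integral>x. u t x * z x \<partial>M) \<in> borel_measurable ?T"
      using sm z unfolding X_def N_def by (intro strongly_measurable_Lp2_mult) auto
    show "AE t in ?T. norm (\<integral>x. u t x * z x \<partial>M) \<le> norm (N (u t) * N z)"
      using strongly_measurable_in[OF sm]
    proof eventually_elim
      case (elim t)
      then show ?case using Lp2_integral_mult_le[of "u t" M z] z by (simp add: X_def N_def abs_mult)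
    qed
  qed
  then show ?thesis by (simp add: absolutely_integrable_iff_lebesgue_on)
qed

text \<open>
  Against a fixed \<open>z\<close> the weak time derivative becomes a scalar one, to which Du Bois-Reymond's
  lemma applies.
\<close>

lemma weak_time_derivative_mult:
  assumes u: "has_weak_time_derivative X N u u'" and z: "z \<in> X"
  shows "\<exists>c. AE t in lebesgue_on {0<..}. (\<integral>x. u t x * z x \<partial>M) = c + integral {0..t} (\<lambda>s. \<integral>x. u' s x * z x \<partial>M)"
proof (rule weak_derivative_primitive)
  have uL: "u \<in> L2_loc X N" "u' \<in> L2_loc X N" using u by (auto simp: has_weak_time_derivative_def)
  show "(\<lambda>t. \<integral>x. u t x * z x \<partial>M) absolutely_integrable_on {0..T}"
    "(\<lambda>s. \<integral>x. u' s x * z x \<partial>M) absolutely_integrable_on {0..T}" if "T > 0" for T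
    by (intro L2_loc_mult_integrable uL z that)+
  fix \<psi> assume "\<psi> \<in> test_functions {0::real<..}"
  then obtain w where w: "has_Bochner_integral_in (lebesgue_on {0<..}) X N (\<lambda>t x. deriv \<psi> t *\<^sub>R u t x) w"
      "has_Bochner_integral_in (lebesgue_on {0<..}) X N (\<lambda>t x. \<psi> t *\<^sub>R u' t x) (\<lambda>x. - w x)"
    using u unfolding has_weak_time_derivative_def by blast
  have "(\<integral>t. (\<integral>x. (deriv \<psi> t *\<^sub>R u t x) * z x \<partial>M) \<partial>lebesgue_on {0<..}) = (\<integral>x. w x * z x \<partial>M)"
    using w(1) z unfolding X_def N_def by (intro has_Bochner_integral_in_Lp2_mult) auto
  moreover have "(\<integral>t. (\<integral>x. (\<psi> t *\<^sub>R u' t x) * z x \<partial>M) \<partial>lebesgue_on {0<..}) = (\<integral>x. - w x * z x \<partial>M)"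
    using w(2) z unfolding X_def N_def by (intro has_Bochner_integral_in_Lp2_mult) auto
  ultimately show "(\<integral>t. deriv \<psi> t * (\<integral>x. u t x * z x \<partial>M) \<partial>lebesgue_on {0<..})
      = - (\<integral>t. \<psi> t * (\<integral>x. u' t x * z x \<partial>M) \<partial>lebesgue_on {0<..})"
    by (simp add: mult.assoc)
qed

lemma increment_bound:
  assumes u': "u' \<in> L2_loc X N" and z: "z \<in> X" and st: "0 \<le> s" "s \<le> t"
  shows "\<bar>integral {s..t} (\<lambda>r. \<integral>x. u' r x * z x \<partial>M)\<bar> \<le> integral {s..t} (\<lambda>r. N (u' r)) * N z"
proof -
  note S = seminormed_X
  have "\<bar>integral {s..t} (\<lambda>r. \<integral>x. u' r x * z x \<partial>M)\<bar> \<le> integral {s..t} (\<lambda>r. N (u' r) * N z)"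
  proof (rule integral_abs_bound_AE)
    show "(\<lambda>r. \<integral>x. u' r x * z x \<partial>M) absolutely_integrable_on {s..t}"
      by (rule absolutely_integrable_between(1)[OF L2_loc_mult_integrable[OF u' z] st(1)])
    show "(\<lambda>r. N (u' r) * N z) absolutely_integrable_on {s..t}"
      by (intro set_integrable_mult_left absolutely_integrable_between(1)[OF L2_loc_norm_integrable(1)[OF S u'] st(1)]) auto
    have "AE r in lebesgue_on {s..t}. u' r \<in> X"
      using AE_half_line_subset(1)[OF L2_loc_in[OF u'], of t] st
      by (simp add: lebesgue_on_AE_iff) (auto elim!: eventually_mono)
    then show "AE r in lebesgue_on {s..t}. \<bar>\<integral>x. u' r x * z x \<partial>M\<bar> \<le> N (u' r) * N z"
      by eventually_elim (use Lp2_integral_mult_le z in \<open>auto simp: X_def N_def\<close>)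
  qed
  then show ?thesis by simp
qed

text \<open>
  Testing against countably many functions that are dense among the increments of \<open>u\<close> bounds
  these increments outside a single null set of times.
\<close>

lemma weak_time_derivative_increments:
  assumes u: "has_weak_time_derivative X N u u'"
  shows "AE t in lebesgue_on {0<..}. u t \<in> X"
    "\<exists>P. (AE t in lebesgue_on {0<..}. P t) \<and> (\<forall>t. P t \<longrightarrow> t > 0 \<and> u t \<in> X) \<and>
      (\<forall>s t. P s \<longrightarrow> P t \<longrightarrow> N (\<lambda>x. u t x - u s x) \<le> \<bar>integral {0..t} (\<lambda>r. N (u' r)) - integral {0..s} (\<lambda>r. N (u' r))\<bar>)"
proof -
  note S = seminormed_X
  have uL: "u \<in> L2_loc X N" "u' \<in> L2_loc X N" using u by (auto simp: has_weak_time_derivative_def)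
  show "AE t in lebesgue_on {0<..}. u t \<in> X" by (rule L2_loc_in[OF uL(1)])
  have "\<forall>n. \<exists>Y. countable Y \<and> Y \<subseteq> X \<and> (AE t in lebesgue_on {0<..<real (Suc n)}. u t \<in> X \<and> (\<forall>e>0. \<exists>y\<in>Y. N (\<lambda>x. u t x - y x) < e))"
    using strongly_measurable_separable[OF L2_loc_strongly_measurable[OF uL(1)]] by blast
  from choice[OF this] obtain Y where Y0: "\<forall>n. countable (Y n) \<and> Y n \<subseteq> X \<and>
      (AE t in lebesgue_on {0<..<real (Suc n)}. u t \<in> X \<and> (\<forall>e>0. \<exists>y\<in>Y n. N (\<lambda>x. u t x - y x) < e))" ..
  note Y = Y0[rule_format, THEN conjunct1] Y0[rule_format, THEN conjunct2, THEN conjunct1]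
    Y0[rule_format, THEN conjunct2, THEN conjunct2]
  define Z where "Z = (\<Union>n. Y n)"
  have Z: "countable Z" "Z \<subseteq> X" unfolding Z_def using Y by auto
  have aeZ: "AE t in lebesgue_on {0<..}. u t \<in> X \<and> (\<forall>e>0. \<exists>y\<in>Z. N (\<lambda>x. u t x - y x) < e)"
  proof (rule AE_half_line)
    fix n
    show "AE t in lebesgue_on {0<..<real (Suc n)}. u t \<in> X \<and> (\<forall>e>0. \<exists>y\<in>Z. N (\<lambda>x. u t x - y x) < e)"
      using Y(3)[of n] unfolding Z_def by eventually_elim blast
  qed
  define D where "D = (\<lambda>(y, y') x. y x - y' x) ` (Z \<times> Z)"
  have D: "countable D" "D \<subseteq> X"
    unfolding D_def using Z seminormed_spaceD(1)[OF S] by auto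
  let ?k = "\<lambda>t. integral {0..t} (\<lambda>r. N (u' r))"
  have "\<exists>c. \<forall>z\<in>D. AE t in lebesgue_on {0<..}. (\<integral>x. u t x * z x \<partial>M) = c z + integral {0..t} (\<lambda>s. \<integral>x. u' s x * z x \<partial>M)"
    using weak_time_derivative_mult[OF u] D(2) by (intro bchoice) blast
  then obtain c where c: "\<And>z. z \<in> D \<Longrightarrow> AE t in lebesgue_on {0<..}. (\<integral>x. u t x * z x \<partial>M) = c z + integral {0..t} (\<lambda>s. \<integral>x. u' s x * z x \<partial>M)"
    by blast
  have aeD: "AE t in lebesgue_on {0<..}. \<forall>z\<in>D. (\<integral>x. u t x * z x \<partial>M) = c z + integral {0..t} (\<lambda>s. \<integral>x. u' s x * z x \<partial>M)"
    unfolding AE_ball_countable[OF D(1)] using c by blast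
  define P where "P t \<longleftrightarrow> t > 0 \<and> u t \<in> X \<and> (\<forall>e>0. \<exists>y\<in>Z. N (\<lambda>x. u t x - y x) < e) \<and>
    (\<forall>z\<in>D. (\<integral>x. u t x * z x \<partial>M) = c z + integral {0..t} (\<lambda>s. \<integral>x. u' s x * z x \<partial>M))" for t
  have "AE t in lebesgue_on {0<..}. P t"
    using aeZ aeD AE_space by eventually_elim (auto simp: P_def)
  moreover have main: "N (\<lambda>x. u t x - u s x) \<le> ?k t - ?k s" if st: "P s" "P t" "s \<le> t" for s t
  proof -
    define v where "v x = u t x - u s x" for x
    define K where "K = ?k t - ?k s"
    have uX: "u s \<in> X" "u t \<in> X" "0 < s" using st by (auto simp: P_def)
    have v: "v \<in> X" unfolding v_def using seminormed_spaceD(1)[OF S] uX by auto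
    have Keq: "K = integral {s..t} (\<lambda>r. N (u' r))"
      unfolding K_def using st uX by (intro primitive_diff L2_loc_norm_integrable(1)[OF S uL(2)]) auto
    have K0: "K \<ge> 0" unfolding Keq
      by (rule integral_nonneg[OF absolutely_integrable_between(2)[OF L2_loc_norm_integrable(1)[OF S uL(2)]]])
        (use uX in \<open>auto simp: N_def\<close>)
    have z: "\<bar>\<integral>x. v x * z x \<partial>M\<bar> \<le> K * N z" if "z \<in> D" for z
    proof -
      have zX: "z \<in> X" using that D by auto
      have "(\<integral>x. v x * z x \<partial>M) = (\<integral>x. u t x * z x \<partial>M) - (\<integral>x. u s x * z x \<partial>M)"
        unfolding v_def using uX zX by (simp add: X_def left_diff_distrib Lp2_integrable_mult)
      also have "\<dots> = integral {0..t} (\<lambda>s. \<integral>x. u' s x * z x \<partial>M) - integral {0..s} (\<lambda>s. \<integral>x. u' s x * z x \<partial>M)"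
        using st that by (simp add: P_def)
      also have "\<dots> = integral {s..t} (\<lambda>s. \<integral>x. u' s x * z x \<partial>M)"
        using st uX by (intro primitive_diff L2_loc_mult_integrable uL zX) auto
      finally show ?thesis using increment_bound[OF uL(2) zX _ st(3)] uX by (simp add: Keq)
    qed
    \<comment> \<open>\<open>v\<close> itself is not among the countably many functions, but it has approximations there.\<close>
    have ineq: "(N v)\<^sup>2 \<le> K * N v + e * (K + N v)" if e: "e > 0" for e
    proof -
      have "e / 2 > 0" using e by simp
      then obtain y y' where y: "y \<in> Z" "N (\<lambda>x. u t x - y x) < e / 2" "y' \<in> Z" "N (\<lambda>x. u s x - y' x) < e / 2"
        using st unfolding P_def by meson
      define z where "z x = y x - y' x" for x
      have zD: "z \<in> D" unfolding D_def z_def using y by (auto intro!: image_eqI[of _ _ "(y, y')"])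
      then have zX: "z \<in> X" using D by auto
      have yX: "y \<in> X" "y' \<in> X" using y Z by auto
      have "(\<lambda>x. v x - z x) = (\<lambda>x. (u t x - y x) - (u s x - y' x))" by (auto simp: v_def z_def)
      then have "N (\<lambda>x. v x - z x) \<le> N (\<lambda>x. u t x - y x) + N (\<lambda>x. u s x - y' x)"
        using seminormed_spaceD(2)[OF S seminormed_spaceD(1)[OF S uX(2) yX(1)] seminormed_spaceD(1)[OF S uX(1) yX(2)]] by simp
      then have vz: "N (\<lambda>x. v x - z x) \<le> e" using y by linarith
      have Nz: "N z \<le> N v + e"
        using seminormed_space_abs_diff[OF S v zX] vz by linarith
      have "(N v)\<^sup>2 = (\<integral>x. v x * v x \<partial>M)" 
        unfolding N_def Lp2_norm_sq by (simp add: power2_eq_square)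
      also have "\<dots> = (\<integral>x. v x * z x \<partial>M) + (\<integral>x. v x * (v x - z x) \<partial>M)"
        using v zX by (simp add: X_def right_diff_distrib Lp2_integrable_mult)
      also have "\<dots> \<le> K * N z + N v * N (\<lambda>x. v x - z x)"
        using z[OF zD] Lp2_integral_mult_le[of v M "\<lambda>x. v x - z x"] v zX
        by (intro add_mono) (auto simp: X_def N_def Lp2_diff)
      also have "\<dots> \<le> K * (N v + e) + N v * e"
        using K0 Nz vz by (intro add_mono mult_left_mono) (auto simp: N_def)
      finally show ?thesis by (simp add: algebra_simps)
    qed
    have "(N v)\<^sup>2 \<le> K * N v"
    proof (rule field_le_epsilon)
      fix e :: real assume e: "e > 0"
      have p: "K + N v + 1 > 0" using K0 by (simp add: N_def add_nonneg_pos)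
      have "e / (K + N v + 1) * (K + N v) \<le> e"
        using e p by (simp add: field_simps)
      then show "(N v)\<^sup>2 \<le> K * N v + e" using ineq[of "e / (K + N v + 1)"] e p by auto
    qed
    then have sq: "N v * N v \<le> K * N v" by (simp add: power2_eq_square)
    have "N v \<le> K"
    proof (cases "N v = 0")
      case False
      then have "N v > 0" by (simp add: N_def less_le)
      with sq show ?thesis by (rule mult_right_le_imp_le)
    qed (use K0 in simp)
    then show ?thesis by (simp add: v_def[abs_def] K_def)
  qed
  moreover have "N (\<lambda>x. u t x - u s x) \<le> \<bar>?k t - ?k s\<bar>" if "P s" "P t" for s t
  proof (cases "s \<le> t")
    case True
    then show ?thesis using main[OF that] by linarith
  next
    case False
    then have "N (\<lambda>x. u s x - u t x) \<le> ?k s - ?k t" using main[OF that(2,1)] by simp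
    then show ?thesis using seminormed_spaceD(6)[OF S, of "u t" "u s"] that by (simp add: P_def)
  qed
  ultimately show "\<exists>P. (AE t in lebesgue_on {0<..}. P t) \<and> (\<forall>t. P t \<longrightarrow> t > 0 \<and> u t \<in> X) \<and>
      (\<forall>s t. P s \<longrightarrow> P t \<longrightarrow> N (\<lambda>x. u t x - u s x) \<le> \<bar>?k t - ?k s\<bar>)"
    by (intro exI[of _ P]) (auto simp: P_def)
qed

text \<open>
  The increments of \<open>u\<close> over a set of times of full measure, hence dense, are bounded by those of a
  continuous function.  So \<open>u\<close> extends to all times by completeness of \<open>L\<^sup>2\<close>.
\<close>

lemma continuous_representative_exists:
  assumes u: "has_weak_time_derivative X N u u'"
  shows "\<exists>w. continuous_representative X N u w"
proof -
  note S = seminormed_X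
  have u': "u' \<in> L2_loc X N" using u by (auto simp: has_weak_time_derivative_def)
  define k where "k t = integral {0..t} (\<lambda>r. N (u' r))" for t
  obtain P where P: "AE t in lebesgue_on {0<..}. P t" "\<And>t. P t \<Longrightarrow> t > 0 \<and> u t \<in> X"
      "\<And>s t. P s \<Longrightarrow> P t \<Longrightarrow> N (\<lambda>x. u t x - u s x) \<le> \<bar>k t - k s\<bar>"
    using weak_time_derivative_increments(2)[OF u] unfolding k_def by blast
  have kc: "continuous_on {0..} k"
    unfolding k_def[abs_def] by (rule primitive_continuous[OF L2_loc_norm_integrable(1)[OF S u']])
  have "\<forall>t. \<exists>\<tau>. t \<ge> 0 \<longrightarrow> (\<forall>n. P (\<tau> n) \<and> \<tau> n > 0) \<and> \<tau> \<longlonglongrightarrow> t"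
    using conull_sequence[OF P(1)] by blast
  from choice[OF this] obtain \<tau>
    where \<tau>: "\<And>t n. t \<ge> 0 \<Longrightarrow> P (\<tau> t n) \<and> \<tau> t n > 0" "\<And>t. t \<ge> 0 \<Longrightarrow> \<tau> t \<longlonglongrightarrow> t"
    by blast
  have k\<tau>: "(\<lambda>n. k (\<tau> t n)) \<longlonglongrightarrow> k t" if t: "t \<ge> 0" for t
    by (rule continuous_on_tendsto_compose[OF kc \<tau>(2)[OF t]])
      (use t \<tau>(1) less_imp_le in \<open>auto intro!: always_eventually\<close>)
  have ex: "\<exists>g\<in>X. (\<lambda>n. N (\<lambda>x. u (\<tau> t n) x - g x)) \<longlonglongrightarrow> 0" if t: "t \<ge> 0" for t
    unfolding X_def N_def
  proof (rule Lp2_complete)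
    show "u (\<tau> t n) \<in> Lp 2 M" for n using P(2) \<tau>(1)[OF t] unfolding X_def by blast
    fix e :: real assume e: "e > 0"
    have "Cauchy (\<lambda>n. k (\<tau> t n))" using k\<tau>[OF t] by (rule LIMSEQ_imp_Cauchy)
    then obtain n0 where n0: "\<And>m n. m \<ge> n0 \<Longrightarrow> n \<ge> n0 \<Longrightarrow> \<bar>k (\<tau> t m) - k (\<tau> t n)\<bar> < e"
      using e unfolding Cauchy_def dist_real_def by blast
    show "\<exists>n0. \<forall>m\<ge>n0. \<forall>n\<ge>n0. Lp_norm 2 M (\<lambda>x. u (\<tau> t m) x - u (\<tau> t n) x) < e"
    proof (intro exI[of _ n0] allI impI)
      fix m n assume "m \<ge> n0" "n \<ge> n0"
      then show "Lp_norm 2 M (\<lambda>x. u (\<tau> t m) x - u (\<tau> t n) x) < e"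
        using P(3)[of "\<tau> t n" "\<tau> t m"] n0[of m n] \<tau>(1)[OF t] by (simp add: N_def le_less_trans)
    qed
  qed
  have "\<forall>t. \<exists>g. t \<ge> 0 \<longrightarrow> g \<in> X \<and> (\<lambda>n. N (\<lambda>x. u (\<tau> t n) x - g x)) \<longlonglongrightarrow> 0" using ex by blast
  from choice[OF this] obtain w where w: "\<And>t. t \<ge> 0 \<Longrightarrow> w t \<in> X" "\<And>t. t \<ge> 0 \<Longrightarrow> (\<lambda>n. N (\<lambda>x. u (\<tau> t n) x - w t x)) \<longlonglongrightarrow> 0"
    by blast
  have uw: "N (\<lambda>x. u s x - w t x) \<le> \<bar>k s - k t\<bar>" if s: "P s" and t: "t \<ge> 0" for s t
  proof -
    have sX: "u s \<in> X" using P(2)[OF s] by blast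
    have "N (\<lambda>x. u s x - w t x) \<le> \<bar>k s - k (\<tau> t n)\<bar> + N (\<lambda>x. u (\<tau> t n) x - w t x)" for n
    proof -
      have \<tau>P: "P (\<tau> t n)" using \<tau>(1)[OF t] by blast
      then have "u (\<tau> t n) \<in> X" using P(2) by blast
      from seminormed_space_triangle[OF S sX this w(1)[OF t]]
      show ?thesis using P(3)[OF \<tau>P s] by linarith
    qed
    moreover have "(\<lambda>n. \<bar>k s - k (\<tau> t n)\<bar> + N (\<lambda>x. u (\<tau> t n) x - w t x)) \<longlonglongrightarrow> \<bar>k s - k t\<bar> + 0"
      by (intro tendsto_intros k\<tau> w(2) t)
    ultimately have "N (\<lambda>x. u s x - w t x) \<le> \<bar>k s - k t\<bar> + 0" by (intro LIMSEQ_le_const) auto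
    then show ?thesis by simp
  qed
  have ww: "N (\<lambda>x. w s x - w t x) \<le> \<bar>k s - k t\<bar>" if s: "s \<ge> 0" and t: "t \<ge> 0" for s t
  proof -
    have "N (\<lambda>x. w s x - w t x) \<le> N (\<lambda>x. u (\<tau> s n) x - w s x) + \<bar>k (\<tau> s n) - k t\<bar>" for n
    proof -
      have \<tau>P: "P (\<tau> s n)" using \<tau>(1)[OF s] by blast
      then have uX: "u (\<tau> s n) \<in> X" using P(2) by blast
      from seminormed_space_triangle[OF S w(1)[OF s] uX w(1)[OF t]]
      show ?thesis using uw[OF \<tau>P t] seminormed_spaceD(6)[OF S w(1)[OF s] uX] by linarith
    qed
    moreover have "(\<lambda>n. N (\<lambda>x. u (\<tau> s n) x - w s x) + \<bar>k (\<tau> s n) - k t\<bar>) \<longlonglongrightarrow> 0 + \<bar>k s - k t\<bar>"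
      by (intro tendsto_intros k\<tau> w(2) s)
    ultimately have "N (\<lambda>x. w s x - w t x) \<le> 0 + \<bar>k s - k t\<bar>" by (intro LIMSEQ_le_const) auto
    then show ?thesis by simp
  qed
  have "continuous_representative X N u w"
    unfolding continuous_representative_def
  proof (intro conjI allI impI w(1))
    fix t :: real assume t: "t \<ge> 0"
    have "(k \<longlongrightarrow> k t) (at t within {0..})" using kc t by (simp add: continuous_on_def)
    then have lim: "((\<lambda>s. \<bar>k s - k t\<bar>) \<longlongrightarrow> 0) (at t within {0..})"
      using tendsto_rabs_zero LIM_zero by blast
    show "((\<lambda>s. N (\<lambda>x. w s x - w t x)) \<longlongrightarrow> 0) (at t within {0..})"
    proof (rule tendsto_sandwich[OF _ _ tendsto_const lim])
      show "\<forall>\<^sub>F s in at t within {0..}. 0 \<le> N (\<lambda>x. w s x - w t x)" by (simp add: N_def)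
      show "\<forall>\<^sub>F s in at t within {0..}. N (\<lambda>x. w s x - w t x) \<le> \<bar>k s - k t\<bar>"
        unfolding eventually_at_filter using ww[OF _ t] by (auto intro!: always_eventually)
    qed
  next
    show "AE t in lebesgue_on {0<..}. u t \<in> X \<and> N (\<lambda>x. u t x - w t x) = 0"
      using P(1)
    proof eventually_elim
      case (elim t)
      then have "N (\<lambda>x. u t x - w t x) \<le> 0" using uw[OF elim, of t] P(2)[OF elim] by simp
      moreover have "0 \<le> N (\<lambda>x. u t x - w t x)" by (simp add: N_def)
      ultimately show ?case using P(2)[OF elim] by simp
    qed
  qed
  then show ?thesis by blast
qed

lemma continuous_representative_mult:
  assumes w: "continuous_representative X N u w" and z: "z \<in> X"
  shows "continuous_on {0..} (\<lambda>t. \<integral>x. w t x * z x \<partial>M)"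
  unfolding continuous_on_def
proof
  note S = seminormed_X
  fix t :: real assume t: "t \<in> {0..}"
  have wX: "w s \<in> X" if "s \<ge> 0" for s using w that by (simp add: continuous_representative_def)
  have lim: "((\<lambda>s. N (\<lambda>x. w s x - w t x)) \<longlongrightarrow> 0) (at t within {0..})"
    using w t by (simp add: continuous_representative_def)
  have "\<forall>\<^sub>F s in at t within {0..}. norm ((\<integral>x. w s x * z x \<partial>M) - (\<integral>x. w t x * z x \<partial>M)) \<le> N (\<lambda>x. w s x - w t x) * N z"
    unfolding eventually_at_filter
  proof (intro always_eventually allI impI)
    fix s :: real assume s: "s \<in> {0..}"
    have "(\<integral>x. w s x * z x \<partial>M) - (\<integral>x. w t x * z x \<partial>M) = (\<integral>x. (w s x - w t x) * z x \<partial>M)"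
      using wX[of s] wX[of t] s t z by (simp add: X_def left_diff_distrib Lp2_integrable_mult)
    then show "norm ((\<integral>x. w s x * z x \<partial>M) - (\<integral>x. w t x * z x \<partial>M)) \<le> N (\<lambda>x. w s x - w t x) * N z"
      using Lp2_integral_mult_le[OF Lp2_diff, of "w s" M "w t" z] wX[of s] wX[of t] s t z by (simp add: X_def N_def)
  qed
  moreover have "((\<lambda>s. N (\<lambda>x. w s x - w t x) * N z) \<longlongrightarrow> 0) (at t within {0..})"
    using tendsto_mult_right[OF lim, of "N z"] by simp
  ultimately have "((\<lambda>s. (\<integral>x. w s x * z x \<partial>M) - (\<integral>x. w t x * z x \<partial>M)) \<longlongrightarrow> 0) (at t within {0..})"
    by (rule Lim_null_comparison)
  then show "((\<lambda>s. \<integral>x. w s x * z x \<partial>M) \<longlongrightarrow> (\<integral>x. w t x * z x \<partial>M)) (at t within {0..})"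
    by (rule LIM_zero_cancel)
qed

text \<open>
  Both sides are continuous in time and agree almost everywhere, hence everywhere; this removes
  the unknown constant of the primitive.
\<close>

lemma continuous_representative_increment:
  assumes u: "has_weak_time_derivative X N u u'" and w: "continuous_representative X N u w"
    and z: "z \<in> X" and st: "0 \<le> s" "s \<le> t"
  shows "(\<integral>x. (w t x - w s x) * z x \<partial>M) = integral {s..t} (\<lambda>r. \<integral>x. u' r x * z x \<partial>M)"
proof -
  note S = seminormed_X
  have u': "u' \<in> L2_loc X N" using u by (auto simp: has_weak_time_derivative_def)
  have wX: "w s \<in> X" if "s \<ge> 0" for s using w that by (simp add: continuous_representative_def)
  obtain c where c: "AE t in lebesgue_on {0<..}. (\<integral>x. u t x * z x \<partial>M) = c + integral {0..t} (\<lambda>s. \<integral>x. u' s x * z x \<partial>M)"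
    using weak_time_derivative_mult[OF u z] by blast
  let ?G = "\<lambda>t. integral {0..t} (\<lambda>s. \<integral>x. u' s x * z x \<partial>M)"
  have eq: "(\<integral>x. w t x * z x \<partial>M) - c - ?G t = 0" if "t \<ge> 0" for t
  proof (rule continuous_AE_zero[OF _ _ that])
    show "continuous_on {0..} (\<lambda>t. (\<integral>x. w t x * z x \<partial>M) - c - ?G t)"
      by (intro continuous_intros continuous_representative_mult[OF w z]
          primitive_continuous[OF L2_loc_mult_integrable[OF u' z]])
    have "AE t in lebesgue_on {0<..}. u t \<in> X \<and> N (\<lambda>x. u t x - w t x) = 0"
      using w by (simp add: continuous_representative_def)
    then show "AE t in lebesgue_on {0<..}. (\<integral>x. w t x * z x \<partial>M) - c - ?G t = 0"
      using c AE_space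
    proof eventually_elim
      case (elim t)
      have t: "w t \<in> X" using elim wX by simp
      have "\<bar>\<integral>x. (u t x - w t x) * z x \<partial>M\<bar> \<le> 0"
        using Lp2_integral_mult_le[OF Lp2_diff, of "u t" M "w t" z] elim t z by (simp add: X_def N_def)
      moreover have "(\<integral>x. (u t x - w t x) * z x \<partial>M) = (\<integral>x. u t x * z x \<partial>M) - (\<integral>x. w t x * z x \<partial>M)"
        using elim t z by (simp add: X_def left_diff_distrib Lp2_integrable_mult)
      ultimately show ?case using elim by simp
    qed
  qed
  have "(\<integral>x. (w t x - w s x) * z x \<partial>M) = (\<integral>x. w t x * z x \<partial>M) - (\<integral>x. w s x * z x \<partial>M)"
    using wX[of s] wX[of t] st z by (simp add: X_def left_diff_distrib Lp2_integrable_mult)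
  also have "\<dots> = ?G t - ?G s" using eq[of t] eq[of s] st by simp
  also have "\<dots> = integral {s..t} (\<lambda>r. \<integral>x. u' r x * z x \<partial>M)"
    by (intro primitive_diff L2_loc_mult_integrable u' z st)
  finally show ?thesis .
qed

end

section \<open>The energy identity\<close>

lemma uniform_partition:
  fixes K :: "real \<Rightarrow> real"
  assumes K: "continuous_on {0..T} K" and T: "T > 0" and e: "e > 0"
  obtains n :: nat where "n > 0" "\<And>i. i < n \<Longrightarrow> \<bar>K (real (Suc i) * T / real n) - K (real i * T / real n)\<bar> < e"
proof -
  have "uniformly_continuous_on {0..T} K" using K by (intro compact_uniformly_continuous) auto
  then obtain \<delta> where \<delta>: "\<delta> > 0"
      "\<And>s t. s \<in> {0..T} \<Longrightarrow> t \<in> {0..T} \<Longrightarrow> \<bar>t - s\<bar> < \<delta> \<Longrightarrow> \<bar>K t - K s\<bar> < e"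
    unfolding uniformly_continuous_on_def dist_real_def using e by metis
  obtain n :: nat where n: "n > 0" "T / \<delta> < real n"
    using reals_Archimedean2[of "max 1 (T / \<delta>)"] by (metis max_less_iff_conj of_nat_0_less_iff less_trans zero_less_one)
  have d: "T / real n < \<delta>" using n \<delta>(1) by (simp add: field_simps)
  have in': "real i * T / real n \<in> {0..T}" if "i \<le> n" for i
    using that n T by (auto simp: field_simps)
  have gap: "real (Suc i) * T / real n = real i * T / real n + T / real n" for i
    by (simp add: distrib_right add_divide_distrib)
  have 2: "\<bar>K s - K (real i * T / real n)\<bar> < e"
    if "i < n" "real i * T / real n \<le> s" "s \<le> real (Suc i) * T / real n" for i s
  proof (rule \<delta>(2))
    show "real i * T / real n \<in> {0..T}" using in'[of i] that by simp
    then show "s \<in> {0..T}" using in'[of "Suc i"] that by auto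
    have b: "s \<le> real i * T / real n + T / real n" using that(3) unfolding gap .
    have *: "\<bar>s - a\<bar> < \<delta>" if "a \<le> s" "s \<le> a + T / real n" for a using that d by linarith
    show "\<bar>s - real i * T / real n\<bar> < \<delta>" by (rule *[OF that(2) b])
  qed
  have 1: "\<bar>K (real (Suc i) * T / real n) - K (real i * T / real n)\<bar> < e" if "i < n" for i
    by (rule 2[OF that]) (use gap[of i] T n in auto)
  show thesis by (rule that[OF n(1) 1])
qed

text \<open>
  A function whose increments are bounded by squares of increments of a continuous monotone
  function is constant, as one sees by telescoping over a fine partition.
\<close>

lemma quadratic_increments_constant:
  fixes f K :: "real \<Rightarrow> real"
  assumes K: "continuous_on {0..T} K" and mono: "\<And>s t. 0 \<le> s \<Longrightarrow> s \<le> t \<Longrightarrow> t \<le> T \<Longrightarrow> K s \<le> K t"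
    and le: "\<And>s t. 0 \<le> s \<Longrightarrow> s \<le> t \<Longrightarrow> t \<le> T \<Longrightarrow> \<bar>f t - f s\<bar> \<le> 2 * (K t - K s)\<^sup>2" and T: "T \<ge> 0"
  shows "f T = f 0"
proof (cases "T = 0")
  case False
  then have T: "T > 0" using T by simp
  have bound: "\<bar>f T - f 0\<bar> \<le> 2 * e * (K T - K 0)" if e: "e > 0" for e
  proof -
    obtain n :: nat where n: "n > 0"
      and small: "\<And>i. i < n \<Longrightarrow> \<bar>K (real (Suc i) * T / real n) - K (real i * T / real n)\<bar> < e"
      using uniform_partition[OF K T e] by metis
    define \<tau> where "\<tau> i = real i * T / real n" for i :: nat
    have \<tau>0: "\<tau> 0 = 0" and \<tau>n: "\<tau> n = T" using n by (auto simp: \<tau>_def)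
    have \<tau>: "0 \<le> \<tau> i" "\<tau> i \<le> \<tau> (Suc i)" for i
      using n T by (auto simp: \<tau>_def divide_right_mono mult_right_mono)
    have \<tau>T: "\<tau> (Suc i) \<le> T" if "i < n" for i
    proof -
      have "real (Suc i) * T \<le> real n * T" using that T by (intro mult_right_mono) auto
      then show ?thesis using n by (simp only: \<tau>_def pos_divide_le_eq of_nat_0_less_iff mult.commute[of T])
    qed
    have "f T - f 0 = (\<Sum>i<n. f (\<tau> (Suc i)) - f (\<tau> i))"
      using sum_lessThan_telescope[of "\<lambda>i. f (\<tau> i)" n] \<tau>0 \<tau>n by simp
    also have "\<bar>\<dots>\<bar> \<le> (\<Sum>i<n. \<bar>f (\<tau> (Suc i)) - f (\<tau> i)\<bar>)" by (rule sum_abs)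
    also have "\<dots> \<le> (\<Sum>i<n. 2 * e * (K (\<tau> (Suc i)) - K (\<tau> i)))"
    proof (rule sum_mono)
      fix i assume i: "i \<in> {..<n}"
      have m: "0 \<le> K (\<tau> (Suc i)) - K (\<tau> i)" using mono[OF \<tau>(1) \<tau>(2) \<tau>T] i by simp
      have "K (\<tau> (Suc i)) - K (\<tau> i) \<le> e" using small[of i] i by (simp add: \<tau>_def)
      then have "(K (\<tau> (Suc i)) - K (\<tau> i))\<^sup>2 \<le> e * (K (\<tau> (Suc i)) - K (\<tau> i))"
        unfolding power2_eq_square using m by (rule mult_right_mono)
      then show "\<bar>f (\<tau> (Suc i)) - f (\<tau> i)\<bar> \<le> 2 * e * (K (\<tau> (Suc i)) - K (\<tau> i))"
        using le[OF \<tau>(1) \<tau>(2) \<tau>T, of i] i by simp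
    qed
    also have "\<dots> = 2 * e * (\<Sum>i<n. K (\<tau> (Suc i)) - K (\<tau> i))" by (simp add: sum_distrib_left)
    also have "\<dots> = 2 * e * (K T - K 0)"
      using sum_lessThan_telescope[of "\<lambda>i. K (\<tau> i)" n] \<tau>0 \<tau>n by simp
    finally show ?thesis .
  qed
  have "\<bar>f T - f 0\<bar> \<le> 0"
  proof (rule field_le_epsilon)
    fix e :: real assume e: "e > 0"
    have k: "K T - K 0 \<ge> 0" using mono[of 0 T] T by simp
    then have p: "2 * (K T - K 0) + 1 > 0" by simp
    have "\<bar>f T - f 0\<bar> \<le> 2 * (e / (2 * (K T - K 0) + 1)) * (K T - K 0)" using e p by (intro bound) simp
    also have "\<dots> \<le> e" using e p k by (simp add: field_simps)
    finally show "\<bar>f T - f 0\<bar> \<le> 0 + e" by simp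
  qed
  then show ?thesis by simp
qed simp

lemma integral_cong_AE_Icc:
  fixes f g :: "real \<Rightarrow> real"
  assumes f: "f absolutely_integrable_on {a..b}" and eq: "AE r in lebesgue_on {a..b}. f r = g r"
  shows "g absolutely_integrable_on {a..b}" "integral {a..b} g = integral {a..b} f"
proof -
  have fi: "integrable (lebesgue_on {a..b}) f" using f by (simp add: absolutely_integrable_lebesgue_on_Icc)
  have gm: "g \<in> borel_measurable (lebesgue_on {a..b})"
    by (rule borel_measurable_lebesgue_on_AE[OF _ borel_measurable_integrable[OF fi] eq]) simp
  have gi: "integrable (lebesgue_on {a..b}) g" by (rule integrable_cong_AE_imp[OF fi gm]) (use eq in auto)
  then show "g absolutely_integrable_on {a..b}" by (simp add: absolutely_integrable_lebesgue_on_Icc)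
  have "integral\<^sup>L (lebesgue_on {a..b}) g = integral\<^sup>L (lebesgue_on {a..b}) f"
    by (rule integral_cong_AE) (use fi gm eq in auto)
  then show "integral {a..b} g = integral {a..b} f" using fi gi by (simp add: lebesgue_integral_eq_integral)
qed

lemma AE_half_line_between:
  assumes "AE t in lebesgue_on {0::real<..}. P t" "0 \<le> s"
  shows "AE t in lebesgue_on {s..t}. P t"
  using AE_half_line_subset(1)[OF assms(1), of t] assms(2)
  by (simp add: lebesgue_on_AE_iff) (auto elim!: eventually_mono)

context
  fixes M :: "'a measure" and X :: "('a \<Rightarrow> real) set" and N :: "('a \<Rightarrow> real) \<Rightarrow> real"
    and u1 u2 u1' u2' w1 w2 :: "real \<Rightarrow> 'a \<Rightarrow> real"
  defines X_def: "X \<equiv> Lp 2 M" and N_def: "N \<equiv> Lp_norm 2 M"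
  assumes u1: "has_weak_time_derivative X N u1 u1'" and u2: "has_weak_time_derivative X N u2 u2'"
    and w1: "continuous_representative X N u1 w1" and w2: "continuous_representative X N u2 w2"
begin

text \<open>
  With \<open>W = w1 - w2\<close> and \<open>D = u1' - u2'\<close>, the difference of \<open>\<parallel>W\<parallel>\<^sup>2\<close> between \<open>s\<close> and \<open>t\<close> is the integral of
  the inner products of \<open>D r\<close> with \<open>W t + W s\<close>, whereas the identity claims those with \<open>2 * W r\<close>.
  The distance of \<open>W t + W s\<close> and \<open>2 * W r\<close> is at most \<open>2 * (K t - K s)\<close> for a primitive \<open>K\<close> of a bound \<open>k\<close>
  for the norm of \<open>D\<close>, so the error is quadratic in \<open>K t - K s\<close> and adds up to zero.
\<close>

lemma energy_difference:
  "continuous_on {0..} (\<lambda>t. N (\<lambda>x. w1 t x - w2 t x))"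
  "T > 0 \<Longrightarrow> (\<lambda>r. \<integral>x. (u1' r x - u2' r x) * (w1 r x - w2 r x) \<partial>M) absolutely_integrable_on {0..T}"
  "T \<ge> 0 \<Longrightarrow> (N (\<lambda>x. w1 T x - w2 T x))\<^sup>2 = (N (\<lambda>x. w1 0 x - w2 0 x))\<^sup>2
     + 2 * integral {0..T} (\<lambda>r. \<integral>x. (u1' r x - u2' r x) * (w1 r x - w2 r x) \<partial>M)"
proof -
  have S: "seminormed_space X N" unfolding X_def N_def by (rule seminormed_space_Lp2)
  have L: "u1' \<in> L2_loc X N" "u2' \<in> L2_loc X N" using u1 u2 by (auto simp: has_weak_time_derivative_def)
  have wX: "w1 t \<in> X" "w2 t \<in> X" if "t \<ge> 0" for t
    using w1 w2 that by (auto simp: continuous_representative_def)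
  have mi: "integrable M (\<lambda>x. f x * g x)" if "f \<in> X" "g \<in> X" for f g
    using that Lp2_integrable_mult by (simp add: X_def)
  have cs: "\<bar>\<integral>x. f x * g x \<partial>M\<bar> \<le> N f * N g" if "f \<in> X" "g \<in> X" for f g
    using that Lp2_integral_mult_le by (simp add: X_def N_def)
  have N0: "N f \<ge> 0" for f by (simp add: N_def)
  have dX: "(\<lambda>x. f x - g x) \<in> X" "(\<lambda>x. f x + g x) \<in> X" if "f \<in> X" "g \<in> X" for f g
    using seminormed_spaceD(1,4)[OF S that] by auto
  define W where "W t x = w1 t x - w2 t x" for t x
  define D where "D t x = u1' t x - u2' t x" for t x
  define k where "k t = N (u1' t) + N (u2' t)" for t
  define K where "K t = integral {0..t} k" for t
  have W: "W t \<in> X" if "t \<ge> 0" for t unfolding W_def using wX[OF that] by (rule dX(1))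
  have ae: "AE r in lebesgue_on {0<..}. u1' r \<in> X \<and> u2' r \<in> X"
    using L2_loc_in[OF L(1)] L2_loc_in[OF L(2)] by eventually_elim simp
  have ki: "k absolutely_integrable_on {0..T}" if "T > 0" for T
    unfolding k_def[abs_def] by (intro set_integral_add L2_loc_norm_integrable(1)[OF S] L that)
  have k0: "k t \<ge> 0" for t unfolding k_def using N0 by simp
  have Kd: "K t - K s = integral {s..t} k" if "0 \<le> s" "s \<le> t" for s t
    unfolding K_def using ki that by (rule primitive_diff)
  have Kmono: "K s \<le> K t" if "0 \<le> s" "s \<le> t" for s t
    using Kd[OF that] integral_nonneg[OF absolutely_integrable_between(2)[OF ki that(1)], of t] k0 by simp
  have Kc: "continuous_on {0..} K" unfolding K_def[abs_def] by (rule primitive_continuous[OF ki])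
  have Dm: "AE r in lebesgue_on {0<..}. (\<integral>x. u1' r x * z x \<partial>M) - (\<integral>x. u2' r x * z x \<partial>M) = (\<integral>x. D r x * z x \<partial>M)"
    if "z \<in> X" for z
    using ae by eventually_elim (simp add: D_def left_diff_distrib mi that)
  have DX: "AE r in lebesgue_on {0<..}. D r \<in> X \<and> N (D r) \<le> k r"
    using ae by eventually_elim (simp add: D_def[abs_def] k_def dX seminormed_spaceD(2)[OF S])
  have Dint: "(\<lambda>r. \<integral>x. D r x * z x \<partial>M) absolutely_integrable_on {s..t}"
    "(\<integral>x. (W t x - W s x) * z x \<partial>M) = integral {s..t} (\<lambda>r. \<integral>x. D r x * z x \<partial>M)"
    if z: "z \<in> X" and st: "0 \<le> s" "s \<le> t" for z s t
  proof -
    have a: "(\<lambda>r. \<integral>x. u1' r x * z x \<partial>M) absolutely_integrable_on {s..t}"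
        "(\<lambda>r. \<integral>x. u2' r x * z x \<partial>M) absolutely_integrable_on {s..t}"
      using L z unfolding X_def N_def
      by (intro absolutely_integrable_between(1)[OF L2_loc_mult_integrable st(1)]; simp)+
    have b: "(\<lambda>r. (\<integral>x. u1' r x * z x \<partial>M) - (\<integral>x. u2' r x * z x \<partial>M)) absolutely_integrable_on {s..t}"
      using a by (rule set_integral_diff)
    note c = integral_cong_AE_Icc[OF b AE_half_line_between[OF Dm[OF z] st(1)]]
    show "(\<lambda>r. \<integral>x. D r x * z x \<partial>M) absolutely_integrable_on {s..t}" by (rule c(1))
    have "(\<integral>x. (W t x - W s x) * z x \<partial>M) = (\<integral>x. (w1 t x - w1 s x) * z x - (w2 t x - w2 s x) * z x \<partial>M)"
      by (simp add: W_def algebra_simps)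
    also have "\<dots> = (\<integral>x. (w1 t x - w1 s x) * z x \<partial>M) - (\<integral>x. (w2 t x - w2 s x) * z x \<partial>M)"
      using st z by (intro Bochner_Integration.integral_diff mi dX wX) auto
    also have "(\<integral>x. (w1 t x - w1 s x) * z x \<partial>M) = integral {s..t} (\<lambda>r. \<integral>x. u1' r x * z x \<partial>M)"
      using u1 w1 z st unfolding X_def N_def by (rule continuous_representative_increment)
    also have "(\<integral>x. (w2 t x - w2 s x) * z x \<partial>M) = integral {s..t} (\<lambda>r. \<integral>x. u2' r x * z x \<partial>M)"
      using u2 w2 z st unfolding X_def N_def by (rule continuous_representative_increment)
    also have "integral {s..t} (\<lambda>r. \<integral>x. u1' r x * z x \<partial>M) - integral {s..t} (\<lambda>r. \<integral>x. u2' r x * z x \<partial>M)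
        = integral {s..t} (\<lambda>r. (\<integral>x. u1' r x * z x \<partial>M) - (\<integral>x. u2' r x * z x \<partial>M))"
      by (rule Henstock_Kurzweil_Integration.integral_diff[symmetric])
        (use a set_lebesgue_integral_eq_integral(1) in blast)+
    finally show "(\<integral>x. (W t x - W s x) * z x \<partial>M) = integral {s..t} (\<lambda>r. \<integral>x. D r x * z x \<partial>M)"
      using c(2) by simp
  qed
  have WK: "N (\<lambda>x. W t x - W s x) \<le> K t - K s" if st: "0 \<le> s" "s \<le> t" for s t
  proof -
    define z where "z x = W t x - W s x" for x
    have z: "z \<in> X" unfolding z_def[abs_def] using st by (intro dX W) auto
    have "N z * N z = (\<integral>x. z x * z x \<partial>M)"
      using Lp2_norm_sq[of M z] by (simp add: N_def power2_eq_square)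
    also have "\<dots> = integral {s..t} (\<lambda>r. \<integral>x. D r x * z x \<partial>M)" using Dint(2)[OF z st] by (simp add: z_def)
    also have "\<dots> \<le> integral {s..t} (\<lambda>r. k r * N z)"
    proof (rule integral_mono_AE_Icc[OF Dint(1)[OF z st]])
      show "(\<lambda>r. k r * N z) absolutely_integrable_on {s..t}"
        by (intro set_integrable_mult_left absolutely_integrable_between(1)[OF ki st(1)]) auto
      show "AE r in lebesgue_on {s..t}. (\<integral>x. D r x * z x \<partial>M) \<le> k r * N z"
        using AE_half_line_between[OF DX st(1)]
      proof eventually_elim
        case (elim r)
        have "(\<integral>x. D r x * z x \<partial>M) \<le> N (D r) * N z" using cs[of "D r" z] elim z by simp
        also have "\<dots> \<le> k r * N z" using elim N0 by (intro mult_right_mono) auto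
        finally show ?case .
      qed
    qed
    also have "\<dots> = (K t - K s) * N z" using Kd[OF st] by simp
    finally have sq: "N z * N z \<le> (K t - K s) * N z" .
    have "N z \<le> K t - K s"
    proof (cases "N z = 0")
      case True
      then show ?thesis using Kmono[OF st] by simp
    next
      case False
      then have "N z > 0" using N0[of z] by simp
      with sq show ?thesis by (rule mult_right_le_imp_le)
    qed
    then show ?thesis by (simp add: z_def[abs_def])
  qed
  have WK': "N (\<lambda>x. W t x - W s x) \<le> \<bar>K t - K s\<bar>" if st: "0 \<le> s" "0 \<le> t" for s t
  proof (cases "s \<le> t")
    case True
    then show ?thesis using WK[OF st(1) True] by linarith
  next
    case False
    then show ?thesis using WK[OF st(2), of s] seminormed_spaceD(6)[OF S W[OF st(1)] W[OF st(2)]] by simp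
  qed
  have NW: "continuous_on {0..} (\<lambda>t. N (W t))"
    unfolding continuous_on_def
  proof
    fix t :: real assume t: "t \<in> {0..}"
    have "(K \<longlongrightarrow> K t) (at t within {0..})" using Kc t by (simp add: continuous_on_def)
    then have lim: "((\<lambda>s. \<bar>K t - K s\<bar>) \<longlongrightarrow> 0) (at t within {0..})"
      using tendsto_rabs_zero[OF LIM_zero] by (subst abs_minus_commute) blast
    have "\<forall>\<^sub>F s in at t within {0..}. norm (N (W s) - N (W t)) \<le> \<bar>K t - K s\<bar>"
      unfolding eventually_at_filter
    proof (intro always_eventually allI impI)
      fix s :: real assume s: "s \<in> {0..}"
      show "norm (N (W s) - N (W t)) \<le> \<bar>K t - K s\<bar>"
        using seminormed_space_abs_diff[OF S W W, of s t] WK'[of t s] s t by (simp add: abs_minus_commute)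
    qed
    then have "((\<lambda>s. N (W s) - N (W t)) \<longlongrightarrow> 0) (at t within {0..})" by (rule Lim_null_comparison[OF _ lim])
    then show "((\<lambda>s. N (W s)) \<longlongrightarrow> N (W t)) (at t within {0..})" by (rule LIM_zero_cancel)
  qed
  then show "continuous_on {0..} (\<lambda>t. N (\<lambda>x. w1 t x - w2 t x))" by (simp add: W_def[abs_def])
  define e where "e r = (\<integral>x. D r x * W r x \<partial>M)" for r
  have Wm: "(\<lambda>r. \<integral>x. y x * W r x \<partial>M) \<in> borel_measurable (lebesgue_on {0<..<T})" if y: "y \<in> X" for y T
  proof (rule continuous_imp_measurable_on_sets_lebesgue)
    have "continuous_on {0..} (\<lambda>r. (\<integral>x. w1 r x * y x \<partial>M) - (\<integral>x. w2 r x * y x \<partial>M))"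
      using w1 w2 y unfolding X_def N_def by (intro continuous_intros continuous_representative_mult)
    then have "continuous_on {0..} (\<lambda>r. \<integral>x. y x * W r x \<partial>M)"
    proof (rule continuous_on_eq)
      fix r :: real assume "r \<in> {0..}"
      then show "(\<integral>x. w1 r x * y x \<partial>M) - (\<integral>x. w2 r x * y x \<partial>M) = (\<integral>x. y x * W r x \<partial>M)"
        using mi[OF wX(1) y, of r] mi[OF wX(2) y, of r] by (simp add: W_def right_diff_distrib mult.commute)
    qed
    then show "continuous_on {0<..<T} (\<lambda>r. \<integral>x. y x * W r x \<partial>M)" by (rule continuous_on_subset) auto
  qed simp
  have uW: "(\<lambda>r. \<integral>x. v r x * W r x \<partial>M) absolutely_integrable_on {0..T}" if v: "v \<in> L2_loc X N" and T: "T > 0" for v T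
  proof -
    let ?T = "lebesgue_on {0<..<T}"
    have sm: "strongly_measurable ?T X N v" using v T by (auto simp: L2_loc_def Bochner_Lp_def)
    have "compact ((\<lambda>t. N (W t)) ` {0..T})"
      by (intro compact_continuous_image continuous_on_subset[OF NW]) auto
    then obtain C where C: "\<And>t. t \<in> {0..T} \<Longrightarrow> N (W t) \<le> C"
      using compact_imp_bounded bounded_iff by (metis abs_le_D1 image_eqI real_norm_def)
    have "integrable ?T (\<lambda>r. \<integral>x. v r x * W r x \<partial>M)"
    proof (rule Bochner_Integration.integrable_bound)
      show "integrable ?T (\<lambda>r. N (v r) * C)"
        using L2_loc_norm_integrable(1)[OF S v T] by (simp add: absolutely_integrable_iff_lebesgue_on)
      show "(\<lambda>r. \<integral>x. v r x * W r x \<partial>M) \<in> borel_measurable ?T"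
      proof (rule strongly_measurable_functional[OF _ sm, where \<Phi>="\<lambda>r y. \<integral>x. y x * W r x \<partial>M"])
        show "AE t in ?T. \<forall>s. (\<forall>n. s n \<in> X) \<longrightarrow> v t \<in> X \<longrightarrow> (\<lambda>n. N (\<lambda>x. v t x - s n x)) \<longlonglongrightarrow> 0 \<longrightarrow>
            (\<lambda>n. \<integral>x. s n x * W t x \<partial>M) \<longlonglongrightarrow> (\<integral>x. v t x * W t x \<partial>M)"
          using AE_space
        proof eventually_elim
          case (elim t)
          then have "W t \<in> X" by (intro W) simp
          then show ?case unfolding X_def N_def by (auto intro!: Lp2_mult_tendsto)
        qed
      qed (use Wm in auto)
      show "AE r in ?T. norm (\<integral>x. v r x * W r x \<partial>M) \<le> norm (N (v r) * C)"
        using strongly_measurable_in[OF sm] AE_space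
      proof eventually_elim
        case (elim r)
        then have "\<bar>\<integral>x. v r x * W r x \<partial>M\<bar> \<le> N (v r) * N (W r)" by (intro cs W) auto
        also have "\<dots> \<le> N (v r) * C" using C[of r] elim N0 by (intro mult_left_mono) auto
        also have "\<dots> \<le> \<bar>N (v r) * C\<bar>" by (rule abs_ge_self)
        finally show ?case by simp
      qed
    qed
    then show ?thesis by (simp add: absolutely_integrable_iff_lebesgue_on)
  qed
  have ei: "e absolutely_integrable_on {0..T}" if T: "T > 0" for T
  proof -
    have "AE r in lebesgue_on {0<..}. (\<integral>x. u1' r x * W r x \<partial>M) - (\<integral>x. u2' r x * W r x \<partial>M) = e r"
      using ae AE_space by eventually_elim (simp add: e_def D_def left_diff_distrib mi W)
    from integral_cong_AE_Icc(1)[OF set_integral_diff(1)[OF uW[OF L(1) T] uW[OF L(2) T]] AE_half_line_between[OF this order_refl]]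
    show ?thesis .
  qed
  then show "T > 0 \<Longrightarrow> (\<lambda>r. \<integral>x. (u1' r x - u2' r x) * (w1 r x - w2 r x) \<partial>M) absolutely_integrable_on {0..T}"
    by (simp add: e_def[abs_def] D_def W_def)
  define F where "F t = (N (W t))\<^sup>2 - 2 * integral {0..t} e" for t
  have Fle: "\<bar>F t - F s\<bar> \<le> 2 * (K t - K s)\<^sup>2" if st: "0 \<le> s" "s \<le> t" for s t
  proof -
    have Ws: "W s \<in> X" and Wt: "W t \<in> X" using st W by auto
    define z where "z x = W t x + W s x" for x
    have z: "z \<in> X" unfolding z_def[abs_def] by (rule dX(2)[OF Wt Ws])
    have "(N (W t))\<^sup>2 - (N (W s))\<^sup>2 = (\<integral>x. W t x * W t x \<partial>M) - (\<integral>x. W s x * W s x \<partial>M)"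
      using Lp2_norm_sq[of M "W t"] Lp2_norm_sq[of M "W s"] by (simp add: N_def power2_eq_square)
    also have "\<dots> = (\<integral>x. W t x * W t x - W s x * W s x \<partial>M)" using mi Ws Wt by simp
    also have "\<dots> = (\<integral>x. (W t x - W s x) * z x \<partial>M)" by (simp add: z_def algebra_simps)
    also have "\<dots> = integral {s..t} (\<lambda>r. \<integral>x. D r x * z x \<partial>M)" by (rule Dint(2)[OF z st])
    finally have 1: "(N (W t))\<^sup>2 - (N (W s))\<^sup>2 = integral {s..t} (\<lambda>r. \<integral>x. D r x * z x \<partial>M)" .
    have 2: "2 * integral {0..t} e - 2 * integral {0..s} e = integral {s..t} (\<lambda>r. 2 * e r)"
      using primitive_diff[OF ei st] by simp
    have e2: "(\<lambda>r. 2 * e r) absolutely_integrable_on {s..t}"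
      by (intro set_integrable_mult_right absolutely_integrable_between(1)[OF ei st(1)])
    have "F t - F s = integral {s..t} (\<lambda>r. \<integral>x. D r x * z x \<partial>M) - integral {s..t} (\<lambda>r. 2 * e r)"
      using 1 2 by (simp add: F_def)
    also have "\<dots> = integral {s..t} (\<lambda>r. (\<integral>x. D r x * z x \<partial>M) - 2 * e r)"
      by (rule Henstock_Kurzweil_Integration.integral_diff[symmetric])
        (use Dint(1)[OF z st] e2 set_lebesgue_integral_eq_integral(1) in blast)+
    also have "\<bar>\<dots>\<bar> \<le> integral {s..t} (\<lambda>r. k r * (2 * (K t - K s)))"
    proof (rule integral_abs_bound_AE)
      show "(\<lambda>r. (\<integral>x. D r x * z x \<partial>M) - 2 * e r) absolutely_integrable_on {s..t}"
        by (rule set_integral_diff(1)[OF Dint(1)[OF z st] e2])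
      show "(\<lambda>r. k r * (2 * (K t - K s))) absolutely_integrable_on {s..t}"
        by (intro set_integrable_mult_left absolutely_integrable_between(1)[OF ki st(1)]) auto
      show "AE r in lebesgue_on {s..t}. \<bar>(\<integral>x. D r x * z x \<partial>M) - 2 * e r\<bar> \<le> k r * (2 * (K t - K s))"
        using AE_half_line_between[OF DX st(1)] AE_space
      proof eventually_elim
        case (elim r)
        then have r: "s \<le> r" "r \<le> t" "0 \<le> r" using st by auto
        have Wr: "W r \<in> X" by (rule W[OF r(3)])
        define y where "y x = (W t x - W r x) - (W r x - W s x)" for x
        have y: "y \<in> X" "N y \<le> N (\<lambda>x. W t x - W r x) + N (\<lambda>x. W r x - W s x)"
          using dX(1)[OF dX(1)[OF Wt Wr] dX(1)[OF Wr Ws]]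
            seminormed_spaceD(2)[OF S dX(1)[OF Wt Wr] dX(1)[OF Wr Ws]]
          by (simp_all add: y_def[abs_def])
        have Ny: "N y \<le> 2 * (K t - K s)"
        proof -
          have "N y \<le> (K t - K r) + (K r - K s)"
            by (rule order_trans[OF y(2) add_mono[OF WK[OF r(3,2)] WK[OF st(1) r(1)]]])
          then show ?thesis using Kmono[OF st] by simp
        qed
        have "(\<integral>x. D r x * z x \<partial>M) - 2 * e r = (\<integral>x. D r x * z x - 2 * (D r x * W r x) \<partial>M)"
          using mi[of "D r" z] mi[of "D r" "W r"] elim z Wr by (simp add: e_def)
        also have "\<dots> = (\<integral>x. D r x * y x \<partial>M)" by (simp add: y_def z_def algebra_simps)
        also have "\<bar>\<dots>\<bar> \<le> N (D r) * N y" using elim y(1) by (intro cs) auto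
        also have "\<dots> \<le> k r * (2 * (K t - K s))" using elim Ny N0 k0 by (intro mult_mono) auto
        finally show ?case .
      qed
    qed
    also have "\<dots> = 2 * (K t - K s)\<^sup>2" using Kd[OF st] by (simp add: power2_eq_square)
    finally show ?thesis .
  qed
  show "(N (\<lambda>x. w1 T x - w2 T x))\<^sup>2 = (N (\<lambda>x. w1 0 x - w2 0 x))\<^sup>2
     + 2 * integral {0..T} (\<lambda>r. \<integral>x. (u1' r x - u2' r x) * (w1 r x - w2 r x) \<partial>M)" if T: "T \<ge> 0"
  proof -
    have "F T = F 0"
      by (rule quadratic_increments_constant[where K=K])
        (use Fle Kmono T continuous_on_subset[OF Kc] in auto)
    then show ?thesis by (simp add: F_def e_def[abs_def] D_def W_def[abs_def])
  qed
qed

end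

section \<open>A Gronwall lemma\<close>

text \<open>
  On an interval over which the integral of \<open>k\<close> is less than \<open>1/2\<close>, and to the left of which \<open>y\<close>
  vanishes, the maximum of \<open>y\<close> is at most half of itself.  Finitely many such intervals reach \<open>T\<close>.
\<close>

lemma Gronwall_zero:
  fixes y k :: "real \<Rightarrow> real"
  assumes y: "continuous_on {0..} y" "\<And>t. t \<ge> 0 \<Longrightarrow> y t \<ge> 0"
    and k: "\<And>T. T > 0 \<Longrightarrow> k absolutely_integrable_on {0..T}" "\<And>t. k t \<ge> 0"
    and le: "\<And>t. t \<ge> 0 \<Longrightarrow> y t \<le> integral {0..t} (\<lambda>r. k r * y r)"
    and T: "T \<ge> 0"
  shows "y T = 0"
proof (cases "T = 0")
  case True
  then show ?thesis using le[of 0] y(2)[of 0] by simp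
next
  case False
  then have T: "T > 0" using T by simp
  define K where "K t = integral {0..t} k" for t
  have Kc: "continuous_on {0..} K" unfolding K_def[abs_def] by (rule primitive_continuous[OF k(1)])
  have Kd: "K t - K s = integral {s..t} k" if "0 \<le> s" "s \<le> t" for s t
    unfolding K_def using k(1) that by (rule primitive_diff)
  have Kmono: "K s \<le> K t" if "0 \<le> s" "s \<le> t" for s t
    using Kd[OF that] integral_nonneg[OF absolutely_integrable_between(2)[OF k(1) that(1)], of t] k(2) by simp
  have kyi: "(\<lambda>r. k r * y r) absolutely_integrable_on {0..S}" if "S > 0" for S
  proof -
    have cy: "continuous_on {0..S} y" using y(1) by (rule continuous_on_subset) auto
    have "(\<lambda>r. y r * k r) absolutely_integrable_on {0..S}"
    proof (rule absolutely_integrable_bounded_measurable_product_real)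
      show "y \<in> borel_measurable (lebesgue_on {0..S})"
        by (rule continuous_imp_measurable_on_sets_lebesgue[OF cy]) simp
      show "bounded (y ` {0..S})" by (intro compact_imp_bounded compact_continuous_image cy) simp
    qed (use k(1)[OF that] in auto)
    then show ?thesis by (simp add: mult.commute)
  qed
  have KT: "continuous_on {0..T} K" by (rule continuous_on_subset[OF Kc]) auto
  have half: "(0::real) < 1/2" by simp
  obtain n :: nat where n: "n > 0"
    and small: "\<And>i. i < n \<Longrightarrow> \<bar>K (real (Suc i) * T / real n) - K (real i * T / real n)\<bar> < 1/2"
    by (rule uniform_partition[OF KT T half]) blast
  have "\<forall>t. 0 \<le> t \<longrightarrow> t \<le> real i * T / real n \<longrightarrow> y t = 0" if "i \<le> n" for i
    using that
  proof (induction i)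
    case 0
    then show ?case using le[of 0] y(2)[of 0] by auto
  next
    case (Suc i)
    define a b where "a = real i * T / real n" and "b = real (Suc i) * T / real n"
    have ab: "0 \<le> a" "a \<le> b" using T n by (auto simp: a_def b_def divide_right_mono mult_right_mono)
    have zero: "y t = 0" if "0 \<le> t" "t \<le> a" for t using Suc that by (simp add: a_def)
    obtain m where m: "m \<in> {a..b}" "\<And>t. t \<in> {a..b} \<Longrightarrow> y t \<le> y m"
      using continuous_attains_sup[of "{a..b}" y] continuous_on_subset[OF y(1), of "{a..b}"] ab by auto
    have m0: "0 \<le> m" using m ab by auto
    have "y m \<le> integral {0..m} (\<lambda>r. k r * y r)" by (rule le[OF m0])
    also have "\<dots> = integral {0..a} (\<lambda>r. k r * y r) + integral {a..m} (\<lambda>r. k r * y r)"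
      using primitive_diff[OF kyi ab(1), of m] m by simp
    also have "integral {0..a} (\<lambda>r. k r * y r) = integral {0..a} (\<lambda>r. 0)"
      using zero by (intro Henstock_Kurzweil_Integration.integral_cong) auto
    also have "integral {a..m} (\<lambda>r. k r * y r) \<le> integral {a..m} (\<lambda>r. k r * y m)"
    proof (rule integral_le)
      show "(\<lambda>r. k r * y r) integrable_on {a..m}" by (rule absolutely_integrable_between(2)[OF kyi ab(1)])
      show "(\<lambda>r. k r * y m) integrable_on {a..m}"
        by (intro integrable_on_mult_left absolutely_integrable_between(2)[OF k(1) ab(1)])
      show "k r * y r \<le> k r * y m" if "r \<in> {a..m}" for r
        using that m(1) k(2) by (intro mult_left_mono m(2)) auto
    qed
    also have "\<dots> = (K m - K a) * y m" using Kd[of a m] m ab by simp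
    also have "\<dots> \<le> 1/2 * y m"
    proof (rule mult_right_mono)
      have "K m \<le> K b" using m m0 by (intro Kmono) auto
      moreover have "\<bar>K b - K a\<bar> < 1/2" unfolding a_def b_def using Suc.prems by (intro small) simp
      ultimately show "K m - K a \<le> 1/2" by linarith
    qed (use y(2)[OF m0] in simp)
    finally have "y m \<le> 0" by simp
    then have "y t = 0" if "0 \<le> t" "t \<le> b" for t
      using zero[of t] m(2)[of t] y(2)[of t] that by (cases "t \<le> a") auto
    then show ?case by (simp add: b_def)
  qed
  from this[of n] show ?thesis using T n by simp
qed

section \<open>Functions of space and time\<close>

context bounded_open
begin

text \<open>
  Truncation turns the essential bound into one that holds everywhere.
\<close>

lemma space_time_representative:
  assumes f: "f \<in> L_inf_space_time \<Omega>"
  obtains g C where "g \<in> borel_measurable borel" "C \<ge> 0" "\<And>p. \<bar>g p\<bar> \<le> C"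
    "AE t in lborel. AE x in lborel. t \<ge> 0 \<longrightarrow> x \<in> \<Omega> \<longrightarrow> f t x = g (t, x)"
proof -
  let ?S = "{0::real..} \<times> \<Omega>"
  have S: "?S \<in> sets lebesgue" by (auto intro!: sets_completionI_sets borel_Times)
  obtain C where m: "(\<lambda>(t, x). f t x) \<in> borel_measurable (lebesgue_on ?S)"
    and C: "AE p in lebesgue_on ?S. \<bar>(\<lambda>(t, x). f t x) p\<bar> \<le> C"
    using f by (auto simp: L_inf_space_time_def L_inf_def)
  obtain g0 where g0: "g0 \<in> borel_measurable borel" "AE p in lborel. p \<in> ?S \<longrightarrow> (\<lambda>(t, x). f t x) p = g0 p"
    using lebesgue_on_borel_representative[OF S m] by metis
  define g where "g p = max (- \<bar>C\<bar>) (min \<bar>C\<bar> (g0 p))" for p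
  have gm: "g \<in> borel_measurable borel" unfolding g_def[abs_def] using g0(1) by measurable
  have gb: "\<bar>g p\<bar> \<le> \<bar>C\<bar>" for p by (auto simp: g_def)
  have "AE p in lborel. p \<in> ?S \<longrightarrow> f (fst p) (snd p) = g p"
    using g0(2) C unfolding lebesgue_on_AE_iff[OF S]
    by eventually_elim (auto simp: g_def split_beta)
  then have "AE p in lborel \<Otimes>\<^sub>M lborel. p \<in> ?S \<longrightarrow> f (fst p) (snd p) = g p"
    unfolding lborel_prod .
  from lborel_pair.AE_pair[OF this]
  have "AE t in lborel. AE x in lborel. t \<ge> 0 \<longrightarrow> x \<in> \<Omega> \<longrightarrow> f t x = g (t, x)"
    by (simp only: mem_Times_iff fst_conv snd_conv atLeast_iff imp_conjL)
  then show thesis by (rule that[OF gm abs_ge_zero gb])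
qed

lemma AE_space_time_slice:
  fixes P :: "real \<Rightarrow> 'a \<Rightarrow> bool"
  assumes "AE t in lborel. AE x in lborel. t \<ge> 0 \<longrightarrow> x \<in> \<Omega> \<longrightarrow> P t x"
  shows "AE t in lebesgue_on {0<..}. AE x in lebesgue_on \<Omega>. P t x"
proof -
  have "AE t in lborel. t \<in> {0<..} \<longrightarrow> (AE x in lebesgue_on \<Omega>. P t x)"
    using assms
  proof eventually_elim
    case (elim t)
    show ?case
    proof
      assume "t \<in> {0<..}"
      then show "AE x in lebesgue_on \<Omega>. P t x"
        using elim less_imp_le[of 0 t] by (auto simp: lebesgue_on_AE_iff)
    qed
  qed
  then show ?thesis by (simp add: lebesgue_on_AE_iff)
qed

text \<open>
  Equality on almost all slices implies equality almost everywhere only for measurable sets,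
  whence the Borel representatives.
\<close>

lemma AE_space_time_eq:
  assumes f: "f \<in> L_inf_space_time \<Omega>" and g: "g \<in> L_inf_space_time \<Omega>"
    and eq: "AE t in lebesgue_on {0<..}. AE x in lebesgue_on \<Omega>. f t x = g t x"
  shows "AE (t, x) in lebesgue_on ({0<..} \<times> \<Omega>). f t x = g t x"
proof -
  have S: "{0::real<..} \<times> \<Omega> \<in> sets lebesgue" by (auto intro!: sets_completionI_sets borel_Times)
  have S': "{0::real..} \<times> \<Omega> \<in> sets lebesgue" by (auto intro!: sets_completionI_sets borel_Times)
  have rep: "\<exists>h'. h' \<in> borel_measurable borel \<and> (AE p in lborel. p \<in> {0..} \<times> \<Omega> \<longrightarrow> h (fst p) (snd p) = h' p)"
    if "h \<in> L_inf_space_time \<Omega>" for h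
  proof -
    have "(\<lambda>(t, x). h t x) \<in> borel_measurable (lebesgue_on ({0..} \<times> \<Omega>))"
      using that by (auto simp: L_inf_space_time_def L_inf_def)
    from lebesgue_on_borel_representative[OF S' this] show ?thesis by (auto simp: split_beta)
  qed
  obtain f' where f'[measurable]: "f' \<in> borel_measurable borel" and ef: "AE p in lborel. p \<in> {0..} \<times> \<Omega> \<longrightarrow> f (fst p) (snd p) = f' p"
    using rep[OF f] by blast
  obtain g' where g'[measurable]: "g' \<in> borel_measurable borel" and eg: "AE p in lborel. p \<in> {0..} \<times> \<Omega> \<longrightarrow> g (fst p) (snd p) = g' p"
    using rep[OF g] by blast
  have slice: "AE t in lborel. AE x in lborel. (t, x) \<in> {0..} \<times> \<Omega> \<longrightarrow> h t x = h' (t, x)"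
    if "AE p in lborel. p \<in> {0..} \<times> \<Omega> \<longrightarrow> h (fst p) (snd p) = h' p" for h and h' :: "real \<times> 'a \<Rightarrow> real"
  proof -
    have "AE p in lborel \<Otimes>\<^sub>M lborel. p \<in> {0..} \<times> \<Omega> \<longrightarrow> h (fst p) (snd p) = h' p"
      using that unfolding lborel_prod .
    from lborel_pair.AE_pair[OF this] show ?thesis by simp
  qed
  have eq': "AE t in lborel. t \<in> {0<..} \<longrightarrow> (AE x in lborel. x \<in> \<Omega> \<longrightarrow> f t x = g t x)"
    using eq by (simp add: lebesgue_on_AE_iff)
  have "AE t in lborel. AE x in lborel. (t, x) \<in> {0<..} \<times> \<Omega> \<longrightarrow> f' (t, x) = g' (t, x)"
    using slice[OF ef] slice[OF eg] eq'
  proof eventually_elim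
    case (elim t)
    show ?case
    proof (cases "t \<in> {0<..}")
      case True
      then have "AE x in lborel. x \<in> \<Omega> \<longrightarrow> f t x = g t x" using elim by blast
      with elim(1,2) show ?thesis by eventually_elim auto
    qed simp
  qed
  moreover have "{p \<in> space (lborel \<Otimes>\<^sub>M lborel). p \<in> {0<..} \<times> \<Omega> \<longrightarrow> f' p = g' p} \<in> sets (lborel \<Otimes>\<^sub>M lborel)"
  proof -
    have [measurable]: "{0::real<..} \<times> \<Omega> \<in> sets borel" by (intro borel_Times) auto
    have "Measurable.pred borel (\<lambda>p. p \<in> {0::real<..} \<times> \<Omega> \<longrightarrow> f' p = g' p)" by measurable
    then show ?thesis unfolding lborel_prod by (simp add: pred_def)
  qed
  ultimately have "AE p in lborel \<Otimes>\<^sub>M lborel. p \<in> {0<..} \<times> \<Omega> \<longrightarrow> f' p = g' p"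
    by (intro lborel_pair.AE_pair_measure)
  then have "AE p in lborel. p \<in> {0<..} \<times> \<Omega> \<longrightarrow> f' p = g' p" unfolding lborel_prod .
  with ef eg have "AE p in lborel. p \<in> {0<..} \<times> \<Omega> \<longrightarrow> f (fst p) (snd p) = g (fst p) (snd p)"
    by eventually_elim auto
  then show ?thesis unfolding lebesgue_on_AE_iff[OF S] by (simp add: split_beta')
qed

lemma slice_borel_measurable:
  fixes a :: "real \<times> 'a \<Rightarrow> real"
  assumes [measurable]: "a \<in> borel_measurable borel"
  shows "(\<lambda>x. a (t, x)) \<in> borel_measurable borel"
  by measurable

lemma slice_integral_measurable:
  fixes a :: "real \<times> 'a \<Rightarrow> real"
  assumes a: "a \<in> borel_measurable borel" and w: "w \<in> borel_measurable (lebesgue_on \<Omega>)"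
  shows "(\<lambda>t. \<integral>x. a (t, x) * w x \<partial>lebesgue_on \<Omega>) \<in> borel_measurable borel"
proof -
  obtain w' where w': "w' \<in> borel_measurable borel" "AE x in lborel. x \<in> \<Omega> \<longrightarrow> w x = w' x"
    using lebesgue_on_borel_representative[OF domain_lebesgue w] by metis
  note [measurable] = a w'(1) domain_borel
  have at: "(\<lambda>x. a (t, x)) \<in> borel_measurable borel" for t by (rule slice_borel_measurable[OF a])
  have "(\<integral>x. a (t, x) * w x \<partial>lebesgue_on \<Omega>) = (\<integral>x. indicator \<Omega> x *\<^sub>R (a (t, x) * w' x) \<partial>lborel)" for t
    by (rule lebesgue_on_integral(2))
      (use at w w' borel_measurable_lebesgue_on[OF at] in \<open>auto intro!: borel_measurable_times elim!: eventually_mono\<close>)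
  moreover have "(\<lambda>t. \<integral>x. indicator \<Omega> x *\<^sub>R (a (t, x) * w' x) \<partial>lborel) \<in> borel_measurable borel"
    by measurable
  ultimately show ?thesis by simp
qed

lemma Lp2_inner_tendsto:
  fixes f z :: "'b \<Rightarrow> 'c::euclidean_space"
  assumes "f \<in> Lp 2 M" "z \<in> Lp 2 M" "\<And>n. s n \<in> Lp 2 M" "(\<lambda>n. Lp_norm 2 M (\<lambda>x. f x - s n x)) \<longlonglongrightarrow> 0"
  shows "(\<lambda>n. \<integral>x. s n x \<bullet> z x \<partial>M) \<longlonglongrightarrow> (\<integral>x. f x \<bullet> z x \<partial>M)"
proof (rule LIM_zero_cancel, rule Lim_null_comparison)
  show "\<forall>\<^sub>F n in sequentially. norm ((\<integral>x. s n x \<bullet> z x \<partial>M) - (\<integral>x. f x \<bullet> z x \<partial>M))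
      \<le> Lp_norm 2 M (\<lambda>x. f x - s n x) * Lp_norm 2 M z"
  proof (intro always_eventually allI)
    fix n
    have "(\<integral>x. f x \<bullet> z x \<partial>M) - (\<integral>x. s n x \<bullet> z x \<partial>M) = (\<integral>x. (f x - s n x) \<bullet> z x \<partial>M)"
      using assms by (simp add: inner_diff_left Lp2_integrable_inner)
    then show "norm ((\<integral>x. s n x \<bullet> z x \<partial>M) - (\<integral>x. f x \<bullet> z x \<partial>M))
      \<le> Lp_norm 2 M (\<lambda>x. f x - s n x) * Lp_norm 2 M z"
      using Lp2_integral_inner_le[OF Lp2_diff[OF assms(1,3)] assms(2), of n] by (simp add: abs_minus_commute)
  qed
  show "(\<lambda>n. Lp_norm 2 M (\<lambda>x. f x - s n x) * Lp_norm 2 M z) \<longlonglongrightarrow> 0"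
    using tendsto_mult_right[OF assms(4), of "Lp_norm 2 M z"] by simp
qed

text \<open>
  The square of \<open>s n\<close> is that of the error \<open>f - s n\<close>, which tends to zero, plus a term that is affine in
  \<open>s n\<close>.
\<close>

lemma Lp2_weighted_square_tendsto:
  fixes f :: "'b \<Rightarrow> 'c::euclidean_space" and b :: "'b \<Rightarrow> real"
  assumes f: "f \<in> Lp 2 M" and s: "\<And>n. s n \<in> Lp 2 M" and lim: "(\<lambda>n. Lp_norm 2 M (\<lambda>x. f x - s n x)) \<longlonglongrightarrow> 0"
    and b: "b \<in> borel_measurable M" "\<And>x. \<bar>b x\<bar> \<le> B"
  shows "(\<lambda>n. \<integral>x. b x * (norm (s n x))\<^sup>2 \<partial>M) \<longlonglongrightarrow> (\<integral>x. b x * (norm (f x))\<^sup>2 \<partial>M)"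
proof -
  have bb: "AE x in M. \<bar>b x\<bar> \<le> B" using b(2) by simp
  note bf = Lp2_bounded_mult[OF f b(1) bb]
  note bd = Lp2_bounded_mult[OF Lp2_diff[OF f s] b(1) bb]
  have l1: "(\<lambda>n. \<integral>x. s n x \<bullet> (b x *\<^sub>R f x) \<partial>M) \<longlonglongrightarrow> (\<integral>x. f x \<bullet> (b x *\<^sub>R f x) \<partial>M)"
    by (rule Lp2_inner_tendsto[OF f bf(1) s lim])
  have l2: "(\<lambda>n. \<integral>x. (f x - s n x) \<bullet> (b x *\<^sub>R (f x - s n x)) \<partial>M) \<longlonglongrightarrow> 0"
  proof (rule Lim_null_comparison)
    show "\<forall>\<^sub>F n in sequentially. norm (\<integral>x. (f x - s n x) \<bullet> (b x *\<^sub>R (f x - s n x)) \<partial>M)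
        \<le> Lp_norm 2 M (\<lambda>x. f x - s n x) * (\<bar>B\<bar> * Lp_norm 2 M (\<lambda>x. f x - s n x))"
    proof (intro always_eventually allI)
      fix n
      have "norm (\<integral>x. (f x - s n x) \<bullet> (b x *\<^sub>R (f x - s n x)) \<partial>M)
          \<le> Lp_norm 2 M (\<lambda>x. f x - s n x) * Lp_norm 2 M (\<lambda>x. b x *\<^sub>R (f x - s n x))"
        using Lp2_integral_inner_le[OF Lp2_diff[OF f s] bd(1), of n n] by simp
      also have "\<dots> \<le> Lp_norm 2 M (\<lambda>x. f x - s n x) * (\<bar>B\<bar> * Lp_norm 2 M (\<lambda>x. f x - s n x))"
        by (intro mult_left_mono bd(2)) simp
      finally show "norm (\<integral>x. (f x - s n x) \<bullet> (b x *\<^sub>R (f x - s n x)) \<partial>M)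
        \<le> Lp_norm 2 M (\<lambda>x. f x - s n x) * (\<bar>B\<bar> * Lp_norm 2 M (\<lambda>x. f x - s n x))" .
    qed
    show "(\<lambda>n. Lp_norm 2 M (\<lambda>x. f x - s n x) * (\<bar>B\<bar> * Lp_norm 2 M (\<lambda>x. f x - s n x))) \<longlonglongrightarrow> 0"
      using tendsto_mult[OF lim tendsto_mult_left[OF lim, of "\<bar>B\<bar>"]] by simp
  qed
  have eq: "(\<integral>x. b x * (norm (s n x))\<^sup>2 \<partial>M) = (\<integral>x. (f x - s n x) \<bullet> (b x *\<^sub>R (f x - s n x)) \<partial>M)
      + (2 * (\<integral>x. s n x \<bullet> (b x *\<^sub>R f x) \<partial>M) - (\<integral>x. f x \<bullet> (b x *\<^sub>R f x) \<partial>M))" for n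
  proof -
    have "b x * (norm (s n x))\<^sup>2 = (f x - s n x) \<bullet> (b x *\<^sub>R (f x - s n x))
        + (2 * (s n x \<bullet> (b x *\<^sub>R f x)) - f x \<bullet> (b x *\<^sub>R f x))" for x
      by (simp add: power2_norm_eq_inner inner_diff_left inner_diff_right inner_commute algebra_simps)
    then show ?thesis
      using Lp2_integrable_inner[OF Lp2_diff[OF f s] bd(1)] Lp2_integrable_inner[OF s bf(1)] Lp2_integrable_inner[OF f bf(1)]
      by simp
  qed
  have "(\<lambda>n. \<integral>x. b x * (norm (s n x))\<^sup>2 \<partial>M) \<longlonglongrightarrow> 0 + (2 * (\<integral>x. f x \<bullet> (b x *\<^sub>R f x) \<partial>M) - (\<integral>x. f x \<bullet> (b x *\<^sub>R f x) \<partial>M))"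
    unfolding eq by (intro tendsto_intros l1 l2)
  then show ?thesis by (simp add: power2_norm_eq_inner)
qed

lemma H1_tendsto_weak_gradient:
  assumes "f \<in> H1 \<Omega>" "\<And>n. s n \<in> H1 \<Omega>" "(\<lambda>n. H1_norm \<Omega> (\<lambda>x. f x - s n x)) \<longlonglongrightarrow> 0"
  shows "(\<lambda>n. Lp_norm 2 (lebesgue_on \<Omega>) (\<lambda>x. weak_gradient \<Omega> f x - weak_gradient \<Omega> (s n) x)) \<longlonglongrightarrow> 0"
proof (rule tendsto_sandwich[OF _ _ tendsto_const assms(3)])
  show "\<forall>\<^sub>F n in sequentially. Lp_norm 2 (lebesgue_on \<Omega>) (\<lambda>x. weak_gradient \<Omega> f x - weak_gradient \<Omega> (s n) x)
      \<le> H1_norm \<Omega> (\<lambda>x. f x - s n x)"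
    using H1_norm_ge(2) weak_gradient_norm_diff[OF assms(1,2)] by (intro always_eventually allI) metis
qed simp

text \<open>
  Quantities that are continuous in the \<open>H\<^sup>1\<close> norm and grow at most quadratically are integrable
  in time along \<open>u\<close>.  The flux and the density of the gradient energy are of this form.
\<close>

lemma H1_functional_integrable:
  fixes \<Phi> :: "real \<Rightarrow> ('a \<Rightarrow> real) \<Rightarrow> real"
  assumes u: "u \<in> L2_loc (H1 \<Omega>) (H1_norm \<Omega>)" and T: "T > 0"
    and meas: "\<And>y. y \<in> H1 \<Omega> \<Longrightarrow> (\<lambda>t. \<Phi> t y) \<in> borel_measurable borel"
    and cont: "\<And>t f s. f \<in> H1 \<Omega> \<Longrightarrow> (\<And>n. s n \<in> H1 \<Omega>) \<Longrightarrow> (\<lambda>n. H1_norm \<Omega> (\<lambda>x. f x - s n x)) \<longlonglongrightarrow> 0 \<Longrightarrow>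
      (\<lambda>n. \<Phi> t (s n)) \<longlonglongrightarrow> \<Phi> t f"
    and bound: "\<And>t f. f \<in> H1 \<Omega> \<Longrightarrow> \<bar>\<Phi> t f\<bar> \<le> c * (1 + (H1_norm \<Omega> f)\<^sup>2)"
  shows "(\<lambda>t. \<Phi> t (u t)) absolutely_integrable_on {0..T}"
proof -
  let ?T = "lebesgue_on {0<..<T}"
  interpret finite_measure ?T by (rule finite_measure_lebesgue_on_Ioo)
  have sm: "strongly_measurable ?T (H1 \<Omega>) (H1_norm \<Omega>) u" using u T by (auto simp: L2_loc_def Bochner_Lp_def)
  have "integrable ?T (\<lambda>t. \<Phi> t (u t))"
  proof (rule Bochner_Integration.integrable_bound)
    show "integrable ?T (\<lambda>t. c * (1 + (H1_norm \<Omega> (u t))\<^sup>2))"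
      using L2_loc_norm_integrable(2)[OF seminormed_space_H1 u T]
      by (intro integrable_mult_right Bochner_Integration.integrable_add) (auto simp: absolutely_integrable_iff_lebesgue_on)
    show "(\<lambda>t. \<Phi> t (u t)) \<in> borel_measurable ?T"
    proof (rule strongly_measurable_functional[OF _ sm, where \<Phi>=\<Phi>])
      show "(\<lambda>t. \<Phi> t y) \<in> borel_measurable ?T" if "y \<in> H1 \<Omega>" for y
        by (rule borel_measurable_lebesgue_on[OF meas[OF that]])
    qed (use cont in \<open>auto intro!: AE_I2\<close>)
    show "AE t in ?T. norm (\<Phi> t (u t)) \<le> norm (c * (1 + (H1_norm \<Omega> (u t))\<^sup>2))"
      using strongly_measurable_in[OF sm] by eventually_elim (use bound in \<open>fastforce intro: order_trans[OF _ abs_ge_self]\<close>)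
  qed
  then show ?thesis by (simp add: absolutely_integrable_iff_lebesgue_on)
qed

lemma flux_integrable:
  fixes a :: "real \<times> 'a \<Rightarrow> real"
  assumes u: "u \<in> L2_loc (H1 \<Omega>) (H1_norm \<Omega>)" and T: "T > 0"
    and a: "a \<in> borel_measurable borel" "\<And>p. \<bar>a p\<bar> \<le> C" and z: "z \<in> Lp 2 (lebesgue_on \<Omega>)"
  shows "(\<lambda>t. \<integral>x. a (t, x) * (weak_gradient \<Omega> (u t) x \<bullet> z x) \<partial>lebesgue_on \<Omega>) absolutely_integrable_on {0..T}"
proof -
  let ?M = "lebesgue_on \<Omega>"
  have at: "(\<lambda>x. a (t, x)) \<in> borel_measurable ?M" for t
    by (rule borel_measurable_lebesgue_on[OF slice_borel_measurable[OF a(1)]])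
  have az: "(\<lambda>x. a (t, x) *\<^sub>R z x) \<in> Lp 2 ?M" "Lp_norm 2 ?M (\<lambda>x. a (t, x) *\<^sub>R z x) \<le> \<bar>C\<bar> * Lp_norm 2 ?M z" for t
    using a(2) by (auto intro!: Lp2_bounded_mult[OF z at] AE_I2)
  have eq: "a (t, x) * (g \<bullet> z x) = g \<bullet> (a (t, x) *\<^sub>R z x)" for t x g by simp
  show ?thesis
  proof (rule H1_functional_integrable[OF u T, where \<Phi>="\<lambda>t f. \<integral>x. a (t, x) * (weak_gradient \<Omega> f x \<bullet> z x) \<partial>?M"
        and c="\<bar>C\<bar> * Lp_norm 2 ?M z"])
    fix y assume y: "y \<in> H1 \<Omega>"
    show "(\<lambda>t. \<integral>x. a (t, x) * (weak_gradient \<Omega> y x \<bullet> z x) \<partial>?M) \<in> borel_measurable borel"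
      by (rule slice_integral_measurable[OF a(1)])
        (intro borel_measurable_inner Lp2_measurable H1_Lp2 y z)
  next
    fix t f and s :: "nat \<Rightarrow> 'a \<Rightarrow> real"
    assume fs: "f \<in> H1 \<Omega>" "\<And>n. s n \<in> H1 \<Omega>" "(\<lambda>n. H1_norm \<Omega> (\<lambda>x. f x - s n x)) \<longlonglongrightarrow> 0"
    show "(\<lambda>n. \<integral>x. a (t, x) * (weak_gradient \<Omega> (s n) x \<bullet> z x) \<partial>?M) \<longlonglongrightarrow> (\<integral>x. a (t, x) * (weak_gradient \<Omega> f x \<bullet> z x) \<partial>?M)"
      unfolding eq by (rule Lp2_inner_tendsto[OF H1_Lp2(2)[OF fs(1)] az(1) H1_Lp2(2)[OF fs(2)] H1_tendsto_weak_gradient[OF fs]])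
  next
    fix t f assume f: "f \<in> H1 \<Omega>"
    have "\<bar>\<integral>x. a (t, x) * (weak_gradient \<Omega> f x \<bullet> z x) \<partial>?M\<bar>
        \<le> Lp_norm 2 ?M (weak_gradient \<Omega> f) * Lp_norm 2 ?M (\<lambda>x. a (t, x) *\<^sub>R z x)"
      unfolding eq by (rule Lp2_integral_inner_le[OF H1_Lp2(2)[OF f] az(1)])
    also have "\<dots> \<le> H1_norm \<Omega> f * (\<bar>C\<bar> * Lp_norm 2 ?M z)"
      by (intro mult_mono H1_norm_ge az(2)) (auto simp: H1_norm_def)
    also have "\<dots> \<le> (1 + (H1_norm \<Omega> f)\<^sup>2) * (\<bar>C\<bar> * Lp_norm 2 ?M z)"
      using mult_norm_le_squares[of 1 "H1_norm \<Omega> f"] by (intro mult_right_mono) auto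
    finally show "\<bar>\<integral>x. a (t, x) * (weak_gradient \<Omega> f x \<bullet> z x) \<partial>?M\<bar> \<le> \<bar>C\<bar> * Lp_norm 2 ?M z * (1 + (H1_norm \<Omega> f)\<^sup>2)"
      by (simp add: mult.commute)
  qed
qed

lemma energy_density_integrable:
  fixes a :: "real \<times> 'a \<Rightarrow> real"
  assumes u: "u \<in> L2_loc (H1 \<Omega>) (H1_norm \<Omega>)" and T: "T > 0"
    and a: "a \<in> borel_measurable borel" "\<And>p. \<bar>a p\<bar> \<le> C"
  shows "(\<lambda>t. \<integral>x. a (t, x) * (norm (weak_gradient \<Omega> (u t) x))\<^sup>2 \<partial>lebesgue_on \<Omega>) absolutely_integrable_on {0..T}"
proof -
  let ?M = "lebesgue_on \<Omega>"
  have at: "(\<lambda>x. a (t, x)) \<in> borel_measurable ?M" for t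
    by (rule borel_measurable_lebesgue_on[OF slice_borel_measurable[OF a(1)]])
  have C: "C \<ge> 0" using a(2)[of undefined] by linarith
  show ?thesis
  proof (rule H1_functional_integrable[OF u T, where \<Phi>="\<lambda>t f. \<integral>x. a (t, x) * (norm (weak_gradient \<Omega> f x))\<^sup>2 \<partial>?M" and c=C])
    fix y assume y: "y \<in> H1 \<Omega>"
    show "(\<lambda>t. \<integral>x. a (t, x) * (norm (weak_gradient \<Omega> y x))\<^sup>2 \<partial>?M) \<in> borel_measurable borel"
      using Lp2_measurable[OF H1_Lp2(2)[OF y]] by (intro slice_integral_measurable[OF a(1)]) measurable
  next
    fix t f and s :: "nat \<Rightarrow> 'a \<Rightarrow> real"
    assume fs: "f \<in> H1 \<Omega>" "\<And>n. s n \<in> H1 \<Omega>" "(\<lambda>n. H1_norm \<Omega> (\<lambda>x. f x - s n x)) \<longlonglongrightarrow> 0"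
    show "(\<lambda>n. \<integral>x. a (t, x) * (norm (weak_gradient \<Omega> (s n) x))\<^sup>2 \<partial>?M) \<longlonglongrightarrow> (\<integral>x. a (t, x) * (norm (weak_gradient \<Omega> f x))\<^sup>2 \<partial>?M)"
      by (rule Lp2_weighted_square_tendsto[OF H1_Lp2(2)[OF fs(1)] H1_Lp2(2)[OF fs(2)] H1_tendsto_weak_gradient[OF fs] at a(2)])
  next
    fix t f assume f: "f \<in> H1 \<Omega>"
    note g = Lp2_integrable[OF H1_Lp2(2)[OF f]]
    have "\<bar>\<integral>x. a (t, x) * (norm (weak_gradient \<Omega> f x))\<^sup>2 \<partial>?M\<bar> \<le> (\<integral>x. C * (norm (weak_gradient \<Omega> f x))\<^sup>2 \<partial>?M)"
    proof (rule integral_abs_bound[THEN order_trans], rule integral_mono')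
      show "\<bar>a (t, x) * (norm (weak_gradient \<Omega> f x))\<^sup>2\<bar> \<le> C * (norm (weak_gradient \<Omega> f x))\<^sup>2" for x
        using a(2)[of "(t, x)"] by (auto simp: abs_mult intro!: mult_right_mono)
    qed (use g C in auto)
    also have "\<dots> = C * (Lp_norm 2 ?M (weak_gradient \<Omega> f))\<^sup>2" by (simp add: Lp2_norm_sq)
    also have "\<dots> \<le> C * (1 + (H1_norm \<Omega> f)\<^sup>2)"
      using power_mono[OF H1_norm_ge(2)[of f], of 2] C by (intro mult_left_mono) auto
    finally show "\<bar>\<integral>x. a (t, x) * (norm (weak_gradient \<Omega> f x))\<^sup>2 \<partial>?M\<bar> \<le> C * (1 + (H1_norm \<Omega> f)\<^sup>2)" .
  qed
qed

section \<open>From space-time test functions to almost every time\<close>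

lemma gradient_scale:
  assumes "\<zeta> \<in> test_functions S"
  shows "gradient (\<lambda>y. c * \<zeta> y) x = c *\<^sub>R gradient \<zeta> x"
proof (rule gradient_eqI)
  show "((\<lambda>y. c * \<zeta> y) has_derivative (\<lambda>h. (c *\<^sub>R gradient \<zeta> x) \<bullet> h)) (at x)"
    using has_derivative_mult_right[OF test_functions_has_derivative[OF assms], of c x] by simp
qed

lemma test_functions_product:
  fixes \<psi> :: "real \<Rightarrow> real" and \<zeta> :: "'a \<Rightarrow> real"
  assumes \<psi>: "\<psi> \<in> test_functions A" and \<zeta>: "\<zeta> \<in> test_functions B"
  shows "(\<lambda>p. \<psi> (fst p) * \<zeta> (snd p)) \<in> test_functions (A \<times> B)"
proof (rule test_functionsI[where K="closure {t. \<psi> t \<noteq> 0} \<times> closure {x. \<zeta> x \<noteq> 0}"])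
  have "(\<lambda>p::real \<times> 'a. \<psi> (fst p + 0)) \<in> C_infinity" "(\<lambda>p::real \<times> 'a. \<zeta> (snd p + 0)) \<in> C_infinity"
    by (intro C_infinity_affine bounded_linear_fst bounded_linear_snd test_functionsD(1)[OF \<psi>] test_functionsD(1)[OF \<zeta>])+
  then show "(\<lambda>p. \<psi> (fst p) * \<zeta> (snd p)) \<in> C_infinity"
    using C_infinity_mult[of "\<lambda>p::real \<times> 'a. \<psi> (fst p)" "\<lambda>p. \<zeta> (snd p)"] by simp
  show "compact (closure {t. \<psi> t \<noteq> 0} \<times> closure {x. \<zeta> x \<noteq> 0})"
    by (intro compact_Times test_functionsD(2)[OF \<psi>] test_functionsD(2)[OF \<zeta>])
  show "closure {t. \<psi> t \<noteq> 0} \<times> closure {x. \<zeta> x \<noteq> 0} \<subseteq> A \<times> B"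
    using test_functionsD(3)[OF \<psi>] test_functionsD(3)[OF \<zeta>] by (rule Sigma_mono)
  fix p assume "p \<notin> closure {t. \<psi> t \<noteq> 0} \<times> closure {x. \<zeta> x \<noteq> 0}"
  then have "fst p \<notin> closure {t. \<psi> t \<noteq> 0} \<or> snd p \<notin> closure {x. \<zeta> x \<noteq> 0}" by (metis mem_Times_iff)
  then have "\<psi> (fst p) = 0 \<or> \<zeta> (snd p) = 0"
    using test_functionsD(5)[OF \<psi>] test_functionsD(5)[OF \<zeta>] by blast
  then show "\<psi> (fst p) * \<zeta> (snd p) = 0" by simp
qed

text \<open>
  Tested with products \<open>\<psi> t * \<zeta> x\<close>, the weak form says that the spatial integral is orthogonal to all
  \<open>\<psi>\<close>.  The exceptional null set of times depends on \<open>\<zeta>\<close>.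
\<close>

lemma weak_form_AE:
  fixes P :: "real \<Rightarrow> 'a \<Rightarrow> real" and Q :: "real \<Rightarrow> 'a \<Rightarrow> 'a"
  assumes weak: "\<And>\<phi>. \<phi> \<in> test_functions ({0<..} \<times> \<Omega>) \<Longrightarrow>
      (\<integral>t. (\<integral>x. P t x * \<phi> (t, x) + Q t x \<bullet> gradient (\<lambda>y. \<phi> (t, y)) x \<partial>lebesgue_on \<Omega>) \<partial>lebesgue_on {0<..}) = 0"
    and \<zeta>: "\<zeta> \<in> test_functions \<Omega>"
    and int: "\<And>T. T > 0 \<Longrightarrow> (\<lambda>t. \<integral>x. P t x * \<zeta> x + Q t x \<bullet> gradient \<zeta> x \<partial>lebesgue_on \<Omega>) absolutely_integrable_on {0..T}"
  shows "AE t in lebesgue_on {0<..}. (\<integral>x. P t x * \<zeta> x + Q t x \<bullet> gradient \<zeta> x \<partial>lebesgue_on \<Omega>) = 0"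
proof (rule fundamental_lemma)
  let ?F = "\<lambda>t. \<integral>x. P t x * \<zeta> x + Q t x \<bullet> gradient \<zeta> x \<partial>lebesgue_on \<Omega>"
  show "?F \<in> borel_measurable (lebesgue_on {0<..})" by (rule half_line_measurable[OF int])
  show "integrable (lebesgue_on (cbox a b)) ?F" if "cbox a b \<subseteq> {0<..}" for a b
    by (rule half_line_integrable_cbox[OF int that])
  fix \<psi> assume \<psi>: "\<psi> \<in> test_functions {0::real<..}"
  have "\<psi> t * ?F t = (\<integral>x. P t x * (\<psi> t * \<zeta> x) + Q t x \<bullet> gradient (\<lambda>y. \<psi> t * \<zeta> y) x \<partial>lebesgue_on \<Omega>)" for t
  proof -
    have "\<psi> t * ?F t = (\<integral>x. \<psi> t * (P t x * \<zeta> x + Q t x \<bullet> gradient \<zeta> x) \<partial>lebesgue_on \<Omega>)" by simp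
    also have "\<dots> = (\<integral>x. P t x * (\<psi> t * \<zeta> x) + Q t x \<bullet> gradient (\<lambda>y. \<psi> t * \<zeta> y) x \<partial>lebesgue_on \<Omega>)"
      by (intro Bochner_Integration.integral_cong refl) (simp add: gradient_scale[OF \<zeta>] algebra_simps)
    finally show ?thesis .
  qed
  then show "(\<integral>t. \<psi> t * ?F t \<partial>lebesgue_on {0<..}) = 0"
    using weak[OF test_functions_product[OF \<psi> \<zeta>]] by simp
qed simp

text \<open>
  The values of a strongly measurable function are almost all limits of countably many functions;
  wherever these come close to test functions, countably many test functions suffice.
\<close>

lemma countable_test_functions:
  assumes u1: "u1 \<in> L2_loc (H1 \<Omega>) (H1_norm \<Omega>)" and u2: "u2 \<in> L2_loc (H1 \<Omega>) (H1_norm \<Omega>)"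
    and H10: "AE t in lebesgue_on {0<..}. (\<lambda>x. u1 t x - u2 t x) \<in> H10 \<Omega>"
  shows "\<exists>Z. countable Z \<and> Z \<subseteq> test_functions \<Omega> \<and>
    (AE t in lebesgue_on {0<..}. \<forall>e>0. \<exists>\<zeta>\<in>Z. H1_norm \<Omega> (\<lambda>x. (u1 t x - u2 t x) - \<zeta> x) < e)"
proof -
  let ?N = "H1_norm \<Omega>"
  note S = seminormed_space_H1
  have sep: "\<exists>Y. countable Y \<and> Y \<subseteq> H1 \<Omega> \<and> (AE t in lebesgue_on {0<..}. u t \<in> H1 \<Omega> \<and> (\<forall>e>0. \<exists>y\<in>Y. ?N (\<lambda>x. u t x - y x) < e))"
    if u: "u \<in> L2_loc (H1 \<Omega>) ?N" for u
  proof -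
    have "\<forall>n. \<exists>Y. countable Y \<and> Y \<subseteq> H1 \<Omega> \<and> (AE t in lebesgue_on {0<..<real (Suc n)}. u t \<in> H1 \<Omega> \<and> (\<forall>e>0. \<exists>y\<in>Y. ?N (\<lambda>x. u t x - y x) < e))"
      using strongly_measurable_separable[OF L2_loc_strongly_measurable[OF u]] by blast
    from choice[OF this] obtain Y where Y0: "\<forall>n. countable (Y n) \<and> Y n \<subseteq> H1 \<Omega> \<and>
        (AE t in lebesgue_on {0<..<real (Suc n)}. u t \<in> H1 \<Omega> \<and> (\<forall>e>0. \<exists>y\<in>Y n. ?N (\<lambda>x. u t x - y x) < e))" ..
    note Y = Y0[rule_format, THEN conjunct1] Y0[rule_format, THEN conjunct2, THEN conjunct1]
      Y0[rule_format, THEN conjunct2, THEN conjunct2]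
    have "AE t in lebesgue_on {0<..}. u t \<in> H1 \<Omega> \<and> (\<forall>e>0. \<exists>y\<in>\<Union>n. Y n. ?N (\<lambda>x. u t x - y x) < e)"
    proof (rule AE_half_line)
      fix n
      show "AE t in lebesgue_on {0<..<real (Suc n)}. u t \<in> H1 \<Omega> \<and> (\<forall>e>0. \<exists>y\<in>\<Union>n. Y n. ?N (\<lambda>x. u t x - y x) < e)"
        using Y(3)[of n] by eventually_elim blast
    qed
    moreover have "countable (\<Union>n. Y n)" using Y(1) by auto
    moreover have "(\<Union>n. Y n) \<subseteq> H1 \<Omega>" using Y(2) by auto
    ultimately show ?thesis by blast
  qed
  obtain Y1 where Y1: "countable Y1" "Y1 \<subseteq> H1 \<Omega>"
      "AE t in lebesgue_on {0<..}. u1 t \<in> H1 \<Omega> \<and> (\<forall>e>0. \<exists>y\<in>Y1. ?N (\<lambda>x. u1 t x - y x) < e)" using sep[OF u1] by blast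
  obtain Y2 where Y2: "countable Y2" "Y2 \<subseteq> H1 \<Omega>"
      "AE t in lebesgue_on {0<..}. u2 t \<in> H1 \<Omega> \<and> (\<forall>e>0. \<exists>y\<in>Y2. ?N (\<lambda>x. u2 t x - y x) < e)" using sep[OF u2] by blast
  define near where "near y1 y2 k \<zeta> \<longleftrightarrow> \<zeta> \<in> test_functions \<Omega> \<and> ?N (\<lambda>x. (y1 x - y2 x) - \<zeta> x) < inverse (real (Suc k))" for y1 y2 k \<zeta>
  define I where "I = {(y1, y2, k). y1 \<in> Y1 \<and> y2 \<in> Y2 \<and> (\<exists>\<zeta>. near y1 y2 k \<zeta>)}"
  define Z where "Z = (\<lambda>(y1, y2, k). SOME \<zeta>. near y1 y2 k \<zeta>) ` I"
  have pick: "near y1 y2 k (SOME \<zeta>. near y1 y2 k \<zeta>)" if "(y1, y2, k) \<in> I" for y1 y2 k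
    using that some_eq_ex[of "near y1 y2 k"] by (simp add: I_def)
  have "countable (Y1 \<times> Y2 \<times> (UNIV :: nat set))" using Y1(1) Y2(1) by auto
  then have "countable I" by (rule countable_subset[rotated]) (auto simp: I_def)
  then have Zc: "countable Z" unfolding Z_def by (rule countable_image)
  have Zt: "Z \<subseteq> test_functions \<Omega>" unfolding Z_def using pick by (fastforce simp: near_def)
  have "AE t in lebesgue_on {0<..}. \<forall>e>0. \<exists>\<zeta>\<in>Z. ?N (\<lambda>x. (u1 t x - u2 t x) - \<zeta> x) < e"
    using Y1(3) Y2(3) H10
  proof eventually_elim
    case (elim t)
    define U where "U x = u1 t x - u2 t x" for x
    have U: "U \<in> H10 \<Omega>" "U \<in> H1 \<Omega>" using elim H10_H1 by (auto simp: U_def[abs_def])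
    have "\<exists>\<zeta>\<in>Z. ?N (\<lambda>x. U x - \<zeta> x) < e" if e: "e > 0" for e
    proof -
      obtain k where k: "inverse (real (Suc k)) < e / 2" using reals_Archimedean[of "e/2"] e by auto
      define d where "d = inverse (real (Suc k))"
      have d: "d > 0" by (simp add: d_def)
      then have d3: "d / 3 > 0" by simp
      obtain y1 where y1: "y1 \<in> Y1" "?N (\<lambda>x. u1 t x - y1 x) < d / 3" using elim(1) d3 by blast
      obtain y2 where y2: "y2 \<in> Y2" "?N (\<lambda>x. u2 t x - y2 x) < d / 3" using elim(2) d3 by blast
      obtain \<phi> where \<phi>: "\<phi> \<in> test_functions \<Omega>" "?N (\<lambda>x. U x - \<phi> x) < d / 3" using H10_approx[OF U(1) d3] by blast
      have H: "u1 t \<in> H1 \<Omega>" "u2 t \<in> H1 \<Omega>" "y1 \<in> H1 \<Omega>" "y2 \<in> H1 \<Omega>" "\<phi> \<in> H1 \<Omega>"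
        using elim y1 y2 Y1(2) Y2(2) weak_gradient_test_function(1)[OF \<phi>(1)] by auto
      define y where "y x = y1 x - y2 x" for x
      have y: "y \<in> H1 \<Omega>" unfolding y_def[abs_def] by (rule H1_diff[OF H(3,4)])
      have "(\<lambda>x. U x - y x) = (\<lambda>x. (u1 t x - y1 x) - (u2 t x - y2 x))" by (auto simp: U_def y_def)
      then have "?N (\<lambda>x. U x - y x) \<le> ?N (\<lambda>x. u1 t x - y1 x) + ?N (\<lambda>x. u2 t x - y2 x)"
        using seminormed_spaceD(2)[OF S H1_diff[OF H(1,3)] H1_diff[OF H(2,4)]] by simp
      then have Uy: "?N (\<lambda>x. U x - y x) < 2 * d / 3" using y1(2) y2(2) by simp
      have "?N (\<lambda>x. y x - \<phi> x) \<le> ?N (\<lambda>x. y x - U x) + ?N (\<lambda>x. U x - \<phi> x)"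
        by (rule seminormed_space_triangle[OF S y U(2) H(5)])
      also have "\<dots> < d" using Uy \<phi>(2) seminormed_spaceD(6)[OF S y U(2)] by simp
      finally have "near y1 y2 k \<phi>" using \<phi>(1) by (simp add: near_def y_def d_def)
      then have yI: "(y1, y2, k) \<in> I" using y1 y2 by (auto simp: I_def)
      define \<zeta> where "\<zeta> = (SOME \<zeta>. near y1 y2 k \<zeta>)"
      have \<zeta>Z: "\<zeta> \<in> Z" unfolding Z_def \<zeta>_def using yI by (auto intro!: image_eqI[of _ _ "(y1, y2, k)"])
      have \<zeta>: "near y1 y2 k \<zeta>" unfolding \<zeta>_def by (rule pick[OF yI])
      then have \<zeta>H: "\<zeta> \<in> H1 \<Omega>" using weak_gradient_test_function(1) by (simp add: near_def)
      have "?N (\<lambda>x. U x - \<zeta> x) \<le> ?N (\<lambda>x. U x - y x) + ?N (\<lambda>x. y x - \<zeta> x)"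
        by (rule seminormed_space_triangle[OF S U(2) y \<zeta>H])
      also have "\<dots> < 2 * d"
      proof -
        have "?N (\<lambda>x. y x - \<zeta> x) < d" using \<zeta> by (simp add: near_def y_def d_def)
        then show ?thesis using Uy d by linarith
      qed
      also have "\<dots> < e" using k by (simp add: d_def)
      finally show ?thesis using \<zeta>Z by blast
    qed
    then show ?case by (simp add: U_def[abs_def])
  qed
  then show ?thesis using Zc Zt by blast
qed

end

section \<open>The estimate at a fixed time\<close>

text \<open>
  Here \<open>G1\<close>, \<open>G2\<close> are the gradients of the first components.  The differences of the coefficients
  produce terms \<open>C * |V| * |G\<^sub>i| * |G1 - G2|\<close>, and Young's inequality trades the last factor for the good term
  \<open>\<eta> * |G1 - G2|\<^sup>2\<close>.
\<close>

lemma difference_pointwise_bound: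
  fixes G1 G2 :: "'a::real_inner" and v1 v2 \<eta> \<epsilon> C :: real
  assumes \<eta>: "\<eta> > 0" and \<epsilon>: "\<epsilon> > 0" and v: "\<bar>v1\<bar> \<le> C" "\<bar>v2\<bar> \<le> C"
  shows "- (((\<eta> + v1\<^sup>2) *\<^sub>R G1 - (\<eta> + v2\<^sup>2) *\<^sub>R G2) \<bullet> (G1 - G2)) - (v1 - v2)\<^sup>2 / (4 * \<epsilon>)
      - (v1 * (norm G1)\<^sup>2 - v2 * (norm G2)\<^sup>2) * (v1 - v2)
    \<le> 5 * C\<^sup>2 / \<eta> * ((norm G1 * (v1 - v2))\<^sup>2 + (norm G2 * (v1 - v2))\<^sup>2)"
proof -
  define V where "V = v1 - v2"
  define g where "g = G1 - G2"
  define a where "a = norm g"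
  define b where "b = \<bar>V\<bar> * (norm G1 + 3 * norm G2)"
  have C: "C \<ge> 0" using v by linarith
  have "((\<eta> + v1\<^sup>2) *\<^sub>R G1 - (\<eta> + v2\<^sup>2) *\<^sub>R G2) \<bullet> g = \<eta> * a\<^sup>2 + v1\<^sup>2 * a\<^sup>2 + (v1 + v2) * V * (G2 \<bullet> g)"
    unfolding a_def V_def g_def power2_norm_eq_inner
    by (simp add: inner_diff_left inner_diff_right inner_commute power2_eq_square algebra_simps)
  moreover have "\<bar>(v1 + v2) * V * (G2 \<bullet> g)\<bar> \<le> (2 * C) * \<bar>V\<bar> * (norm G2 * a)"
    unfolding abs_mult a_def using v C by (intro mult_mono Cauchy_Schwarz_ineq2) auto
  moreover have "0 \<le> v1\<^sup>2 * a\<^sup>2" by simp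
  ultimately have 1: "- (((\<eta> + v1\<^sup>2) *\<^sub>R G1 - (\<eta> + v2\<^sup>2) *\<^sub>R G2) \<bullet> g) \<le> - \<eta> * a\<^sup>2 + 2 * C * \<bar>V\<bar> * (norm G2 * a)"
    by linarith
  have "(v1 * (norm G1)\<^sup>2 - v2 * (norm G2)\<^sup>2) * V = (V * norm G1)\<^sup>2 + v2 * V * (g \<bullet> (G1 + G2))"
    unfolding V_def g_def power_mult_distrib power2_norm_eq_inner
    by (simp add: inner_diff_left inner_add_right inner_commute power2_eq_square algebra_simps)
  moreover have "\<bar>v2 * V * (g \<bullet> (G1 + G2))\<bar> \<le> C * \<bar>V\<bar> * (a * (norm G1 + norm G2))"
  proof -
    have "\<bar>g \<bullet> (G1 + G2)\<bar> \<le> a * (norm G1 + norm G2)"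
      unfolding a_def by (rule order_trans[OF Cauchy_Schwarz_ineq2]) (intro mult_left_mono norm_triangle_ineq, simp)
    then show ?thesis unfolding abs_mult using v C by (intro mult_mono) auto
  qed
  moreover have "0 \<le> (V * norm G1)\<^sup>2" by simp
  ultimately have 2: "- ((v1 * (norm G1)\<^sup>2 - v2 * (norm G2)\<^sup>2) * V) \<le> C * \<bar>V\<bar> * (a * (norm G1 + norm G2))"
    by linarith
  have sum: "2 * C * \<bar>V\<bar> * (norm G2 * a) + C * \<bar>V\<bar> * (a * (norm G1 + norm G2)) = C * a * b"
    by (simp add: b_def algebra_simps)
  have 3: "C * a * b \<le> \<eta> * a\<^sup>2 + C\<^sup>2 * b\<^sup>2 / (4 * \<eta>)"
  proof -
    have "0 \<le> \<eta> * (a - C * b / (2 * \<eta>))\<^sup>2" using \<eta> by simp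
    also have "\<dots> = \<eta> * a\<^sup>2 - C * a * b + C\<^sup>2 * b\<^sup>2 / (4 * \<eta>)"
      using \<eta> by (simp add: power2_eq_square field_simps)
    finally show ?thesis by simp
  qed
  have "b\<^sup>2 = V\<^sup>2 * (norm G1 + 3 * norm G2)\<^sup>2" by (simp add: b_def power_mult_distrib)
  also have "\<dots> \<le> V\<^sup>2 * (20 * ((norm G1)\<^sup>2 + (norm G2)\<^sup>2))"
  proof (rule mult_left_mono)
    have "(p + 3 * q)\<^sup>2 \<le> 20 * (p\<^sup>2 + q\<^sup>2)" for p q :: real
    proof -
      have "0 \<le> 9 * (p - q)\<^sup>2" "0 \<le> (3 * p + q)\<^sup>2" "0 \<le> p\<^sup>2" "0 \<le> q\<^sup>2" "0 \<le> (p - 3 * q)\<^sup>2" by auto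
      then show ?thesis by (auto simp: power2_eq_square algebra_simps)
    qed
    then show "(norm G1 + 3 * norm G2)\<^sup>2 \<le> 20 * ((norm G1)\<^sup>2 + (norm G2)\<^sup>2)" .
  qed simp
  finally have "C\<^sup>2 * b\<^sup>2 / (4 * \<eta>) \<le> C\<^sup>2 * (V\<^sup>2 * (20 * ((norm G1)\<^sup>2 + (norm G2)\<^sup>2))) / (4 * \<eta>)"
    using \<eta> by (intro divide_right_mono mult_left_mono) auto
  also have "\<dots> = 5 * C\<^sup>2 / \<eta> * ((norm G1 * V)\<^sup>2 + (norm G2 * V)\<^sup>2)"
    using \<eta> by (simp add: power_mult_distrib field_simps)
  finally have 4: "C\<^sup>2 * b\<^sup>2 / (4 * \<eta>) \<le> 5 * C\<^sup>2 / \<eta> * ((norm G1 * V)\<^sup>2 + (norm G2 * V)\<^sup>2)" .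
  have "0 \<le> V\<^sup>2 / (4 * \<epsilon>)" using \<epsilon> by simp
  then show ?thesis
    using 1 2 3 4 sum unfolding V_def[symmetric] g_def[symmetric] by linarith
qed

context bounded_open
begin

text \<open>
  The left-hand side is a linear functional of \<open>U\<close> that is bounded in the norm of \<open>H\<^sup>1\<close> and vanishes
  on a set of functions with \<open>U\<close> in its closure.
\<close>

lemma weak_identity_extends:
  assumes Q: "Q \<in> Lp 2 (lebesgue_on \<Omega>)"
    and P: "\<And>f. f \<in> H10 \<Omega> \<Longrightarrow> integrable (lebesgue_on \<Omega>) (\<lambda>x. P x * f x)"
      "\<And>f. f \<in> H10 \<Omega> \<Longrightarrow> \<bar>\<integral>x. P x * f x \<partial>lebesgue_on \<Omega>\<bar> \<le> K * H1_norm \<Omega> f"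
    and U: "U \<in> H10 \<Omega>" and Z: "Z \<subseteq> test_functions \<Omega>"
    and dense: "\<And>e. e > 0 \<Longrightarrow> \<exists>\<zeta>\<in>Z. H1_norm \<Omega> (\<lambda>x. U x - \<zeta> x) < e"
    and eq: "\<And>\<zeta>. \<zeta> \<in> Z \<Longrightarrow> (\<integral>x. P x * \<zeta> x + Q x \<bullet> gradient \<zeta> x \<partial>lebesgue_on \<Omega>) = 0"
  shows "(\<integral>x. P x * U x \<partial>lebesgue_on \<Omega>) + (\<integral>x. Q x \<bullet> weak_gradient \<Omega> U x \<partial>lebesgue_on \<Omega>) = 0"
proof -
  let ?M = "lebesgue_on \<Omega>"
  define I where "I f = (\<integral>x. P x * f x \<partial>?M) + (\<integral>x. Q x \<bullet> weak_gradient \<Omega> f x \<partial>?M)" for f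
  define c where "c = K + Lp_norm 2 ?M Q"
  have bound: "\<bar>I f\<bar> \<le> c * H1_norm \<Omega> f" if f: "f \<in> H10 \<Omega>" for f
  proof -
    have "\<bar>\<integral>x. Q x \<bullet> weak_gradient \<Omega> f x \<partial>?M\<bar> \<le> Lp_norm 2 ?M Q * Lp_norm 2 ?M (weak_gradient \<Omega> f)"
      by (rule Lp2_integral_inner_le[OF Q H1_Lp2(2)[OF H10_H1[OF f]]])
    also have "\<dots> \<le> Lp_norm 2 ?M Q * H1_norm \<Omega> f" by (intro mult_left_mono H1_norm_ge) simp
    finally show ?thesis using P(2)[OF f] by (simp add: I_def c_def distrib_right)
  qed
  have test: "I \<zeta> = 0" if "\<zeta> \<in> Z" for \<zeta>
  proof -
    have \<zeta>: "\<zeta> \<in> test_functions \<Omega>" using that Z by auto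
    have "(\<integral>x. Q x \<bullet> weak_gradient \<Omega> \<zeta> x \<partial>?M) = (\<integral>x. Q x \<bullet> gradient \<zeta> x \<partial>?M)"
      using weak_gradient_test_function[OF \<zeta>] test_functions_Lp2(2)[OF \<zeta>] H1_Lp2(2) Q
      by (intro integral_cong_AE borel_measurable_inner) (auto simp: Lp2_measurable elim: eventually_mono)
    then show ?thesis
      using eq[OF that] P(1)[OF test_functions_H10[OF \<zeta>]] Lp2_integrable_inner[OF Q test_functions_Lp2(2)[OF \<zeta>]]
      by (simp add: I_def)
  qed
  have diff: "I (\<lambda>x. U x - \<zeta> x) = I U - I \<zeta>" if "\<zeta> \<in> Z" for \<zeta>
  proof -
    have \<zeta>: "\<zeta> \<in> test_functions \<Omega>" using that Z by auto
    have h: "\<zeta> \<in> H10 \<Omega>" "\<zeta> \<in> H1 \<Omega>" "U \<in> H1 \<Omega>" using test_functions_H10[OF \<zeta>] H10_H1 U by auto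
    have "(\<integral>x. Q x \<bullet> weak_gradient \<Omega> (\<lambda>x. U x - \<zeta> x) x \<partial>?M)
        = (\<integral>x. Q x \<bullet> weak_gradient \<Omega> U x - Q x \<bullet> weak_gradient \<Omega> \<zeta> x \<partial>?M)"
    proof (rule integral_cong_AE)
      show "AE x in ?M. Q x \<bullet> weak_gradient \<Omega> (\<lambda>x. U x - \<zeta> x) x = Q x \<bullet> weak_gradient \<Omega> U x - Q x \<bullet> weak_gradient \<Omega> \<zeta> x"
        using weak_gradient_diff[OF h(3,2)] by eventually_elim (simp add: inner_diff_right)
    qed (intro borel_measurable_inner borel_measurable_diff Lp2_measurable Q H1_Lp2 H1_diff h)+
    also have "\<dots> = (\<integral>x. Q x \<bullet> weak_gradient \<Omega> U x \<partial>?M) - (\<integral>x. Q x \<bullet> weak_gradient \<Omega> \<zeta> x \<partial>?M)"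
      by (intro Bochner_Integration.integral_diff Lp2_integrable_inner Q H1_Lp2 h)
    finally show ?thesis using P(1)[OF U] P(1)[OF h(1)] by (simp add: I_def right_diff_distrib)
  qed
  have "\<bar>I U\<bar> \<le> 0"
  proof (rule field_le_epsilon)
    fix e :: real assume e: "e > 0"
    have p: "\<bar>c\<bar> + 1 > 0" by simp
    then obtain \<zeta> where \<zeta>: "\<zeta> \<in> Z" "H1_norm \<Omega> (\<lambda>x. U x - \<zeta> x) < e / (\<bar>c\<bar> + 1)"
      using dense[of "e / (\<bar>c\<bar> + 1)"] e by auto
    have \<zeta>10: "\<zeta> \<in> H10 \<Omega>" using \<zeta> Z test_functions_H10 by auto
    have "\<bar>I U\<bar> \<le> c * H1_norm \<Omega> (\<lambda>x. U x - \<zeta> x)"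
      using bound[OF H10_diff[OF U \<zeta>10]] diff[OF \<zeta>(1)] test[OF \<zeta>(1)] by simp
    also have "\<dots> \<le> (\<bar>c\<bar> + 1) * H1_norm \<Omega> (\<lambda>x. U x - \<zeta> x)"
      by (intro mult_right_mono) (auto simp: H1_norm_def)
    also have "\<dots> \<le> e" using \<zeta>(2) p by (simp add: pos_less_divide_eq mult.commute)
    finally show "\<bar>I U\<bar> \<le> 0 + e" by simp
  qed
  then show ?thesis by (simp add: I_def)
qed

lemma Lp2_functional_bound:
  assumes p: "p \<in> Lp 2 (lebesgue_on \<Omega>)" and f: "f \<in> H1 \<Omega>"
  shows "integrable (lebesgue_on \<Omega>) (\<lambda>x. p x * f x)"
    "\<bar>\<integral>x. p x * f x \<partial>lebesgue_on \<Omega>\<bar> \<le> Lp_norm 2 (lebesgue_on \<Omega>) p * H1_norm \<Omega> f"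
proof -
  show "integrable (lebesgue_on \<Omega>) (\<lambda>x. p x * f x)" by (rule Lp2_integrable_mult[OF p H1_Lp2(1)[OF f]])
  have "\<bar>\<integral>x. p x * f x \<partial>lebesgue_on \<Omega>\<bar> \<le> Lp_norm 2 (lebesgue_on \<Omega>) p * Lp_norm 2 (lebesgue_on \<Omega>) f"
    by (rule Lp2_integral_mult_le[OF p H1_Lp2(1)[OF f]])
  also have "\<dots> \<le> Lp_norm 2 (lebesgue_on \<Omega>) p * H1_norm \<Omega> f" by (intro mult_left_mono H1_norm_ge) simp
  finally show "\<bar>\<integral>x. p x * f x \<partial>lebesgue_on \<Omega>\<bar> \<le> Lp_norm 2 (lebesgue_on \<Omega>) p * H1_norm \<Omega> f" .
qed

text \<open>
  The quadratic gradient term acts continuously on the Sobolev space, although its density is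
  only integrable: one factor of the gradient is absorbed by the weighted inequality.
\<close>

lemma energy_density_functional:
  fixes G :: "'a \<Rightarrow> 'a"
  assumes G: "G \<in> Lp 2 (lebesgue_on \<Omega>)" and i: "integrable (lebesgue_on \<Omega>) (\<lambda>x. norm (G x) ^ (DIM('a) + 2))"
    and a: "a \<in> borel_measurable (lebesgue_on \<Omega>)" "AE x in lebesgue_on \<Omega>. \<bar>a x\<bar> \<le> C"
  shows "\<exists>K. \<forall>f\<in>H10 \<Omega>. integrable (lebesgue_on \<Omega>) (\<lambda>x. (a x * (norm (G x))\<^sup>2) * f x) \<and>
    \<bar>\<integral>x. (a x * (norm (G x))\<^sup>2) * f x \<partial>lebesgue_on \<Omega>\<bar> \<le> K * H1_norm \<Omega> f"
proof -
  let ?M = "lebesgue_on \<Omega>" and ?N = "Lp_norm 2 (lebesgue_on \<Omega>)"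
  define h where "h x = norm (G x)" for x
  have hm: "h \<in> borel_measurable ?M" unfolding h_def[abs_def] using Lp2_measurable[OF G] by measurable
  have hi: "integrable ?M (\<lambda>x. \<bar>h x\<bar> ^ (DIM('a) + 2))" using i by (simp add: h_def)
  have ah: "(\<lambda>x. a x *\<^sub>R h x) \<in> Lp 2 ?M"
    by (rule Lp2_bounded_mult(1)[OF _ a]) (use G hm in \<open>auto simp: Lp2_iff h_def\<close>)
  obtain c where c: "c \<ge> 0" "\<And>h f. h \<in> borel_measurable ?M \<Longrightarrow> integrable ?M (\<lambda>x. \<bar>h x :: real\<bar> ^ (DIM('a) + 2)) \<Longrightarrow>
      f \<in> H10 \<Omega> \<Longrightarrow> (\<lambda>x. h x * f x) \<in> Lp 2 ?M \<and> (?N (\<lambda>x. h x * f x))\<^sup>2 \<le> 1 * (?N (weak_gradient \<Omega> f))\<^sup>2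
        + c * (1 + (\<integral>x. \<bar>h x\<bar> ^ (DIM('a) + 2) \<partial>?M)) * (?N f)\<^sup>2"
    using weighted_H10_square[OF zero_less_one] by blast
  define B where "B = c * (1 + (\<integral>x. \<bar>h x\<bar> ^ (DIM('a) + 2) \<partial>?M))"
  have B: "B \<ge> 0" unfolding B_def using c(1) by (auto intro!: mult_nonneg_nonneg add_nonneg_nonneg integral_nonneg_AE)
  show ?thesis
  proof (intro exI ballI)
    fix f assume f: "f \<in> H10 \<Omega>"
    have hf: "(\<lambda>x. h x * f x) \<in> Lp 2 ?M"
      and le: "(?N (\<lambda>x. h x * f x))\<^sup>2 \<le> (?N (weak_gradient \<Omega> f))\<^sup>2 + B * (?N f)\<^sup>2"
      using c(2)[OF hm hi f] by (auto simp: B_def)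
    have "(?N (\<lambda>x. h x * f x))\<^sup>2 \<le> (H1_norm \<Omega> f)\<^sup>2 + B * (H1_norm \<Omega> f)\<^sup>2"
      by (rule order_trans[OF le]) (use B in \<open>intro add_mono mult_left_mono power_mono H1_norm_ge; simp\<close>)
    also have "\<dots> = (sqrt (1 + B) * H1_norm \<Omega> f)\<^sup>2" using B by (simp add: power_mult_distrib distrib_right)
    finally have n: "?N (\<lambda>x. h x * f x) \<le> sqrt (1 + B) * H1_norm \<Omega> f"
      by (rule power2_le_imp_le) (use B in \<open>auto simp: H1_norm_def\<close>)
    have e: "(a x * (norm (G x))\<^sup>2) * f x = (a x *\<^sub>R h x) * (h x * f x)" for x
      by (simp add: h_def power2_eq_square)
    have "\<bar>\<integral>x. (a x *\<^sub>R h x) * (h x * f x) \<partial>?M\<bar> \<le> ?N (\<lambda>x. a x *\<^sub>R h x) * ?N (\<lambda>x. h x * f x)"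
      by (rule Lp2_integral_mult_le[OF ah hf])
    also have "\<dots> \<le> ?N (\<lambda>x. a x *\<^sub>R h x) * (sqrt (1 + B) * H1_norm \<Omega> f)" by (intro mult_left_mono n) simp
    finally show "integrable ?M (\<lambda>x. (a x * (norm (G x))\<^sup>2) * f x) \<and>
        \<bar>\<integral>x. (a x * (norm (G x))\<^sup>2) * f x \<partial>?M\<bar> \<le> ?N (\<lambda>x. a x *\<^sub>R h x) * sqrt (1 + B) * H1_norm \<Omega> f"
      unfolding e using Lp2_integrable_mult[OF ah hf] by (simp add: mult.assoc)
  qed
qed

text \<open>
  The values \<open>u\<close>, \<open>v\<close> at a fixed time and those of their time derivatives, here \<open>a\<close>, \<open>b\<close>, satisfy
  the spatial weak equations for all test functions in \<open>Z\<close>.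
\<close>

definition slice_solution ::
  "real \<Rightarrow> real \<Rightarrow> real \<Rightarrow> ('a \<Rightarrow> real) set \<Rightarrow> ('a \<Rightarrow> real) \<Rightarrow> ('a \<Rightarrow> real) \<Rightarrow> ('a \<Rightarrow> real) \<Rightarrow> ('a \<Rightarrow> real) \<Rightarrow> bool" where
  "slice_solution \<epsilon> \<eta> C Z u v a b \<longleftrightarrow> u \<in> H1 \<Omega> \<and> v \<in> H1 \<Omega> \<and>
    a \<in> Lp 2 (lebesgue_on \<Omega>) \<and> b \<in> Lp 2 (lebesgue_on \<Omega>) \<and> (AE x in lebesgue_on \<Omega>. \<bar>v x\<bar> \<le> C) \<and>
    integrable (lebesgue_on \<Omega>) (\<lambda>x. norm (weak_gradient \<Omega> u x) ^ (DIM('a) + 2)) \<and>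
    (\<forall>\<zeta>\<in>Z. (\<integral>x. a x * \<zeta> x + ((\<eta> + (v x)\<^sup>2) *\<^sub>R weak_gradient \<Omega> u x) \<bullet> gradient \<zeta> x \<partial>lebesgue_on \<Omega>) = 0 \<and>
      (\<integral>x. (b x + (v x - 1) / (4 * \<epsilon>) + v x * (norm (weak_gradient \<Omega> u x))\<^sup>2) * \<zeta> x
        + (\<epsilon> *\<^sub>R weak_gradient \<Omega> v x) \<bullet> gradient \<zeta> x \<partial>lebesgue_on \<Omega>) = 0)"

text \<open>
  The identities for smooth functions extend to Sobolev functions near which \<open>Z\<close> is dense; for the
  quadratic gradient term this rests on its continuity, established above.
\<close>

lemma slice_solution_tested:
  assumes s: "slice_solution \<epsilon> \<eta> C Z u v a b" and Z: "Z \<subseteq> test_functions \<Omega>"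
    and f: "f \<in> H10 \<Omega>" and dense: "\<And>e. e > 0 \<Longrightarrow> \<exists>\<zeta>\<in>Z. H1_norm \<Omega> (\<lambda>x. f x - \<zeta> x) < e"
  shows "(\<lambda>x. (\<eta> + (v x)\<^sup>2) *\<^sub>R weak_gradient \<Omega> u x) \<in> Lp 2 (lebesgue_on \<Omega>)"
    "(\<integral>x. a x * f x \<partial>lebesgue_on \<Omega>)
      + (\<integral>x. ((\<eta> + (v x)\<^sup>2) *\<^sub>R weak_gradient \<Omega> u x) \<bullet> weak_gradient \<Omega> f x \<partial>lebesgue_on \<Omega>) = 0"
    "integrable (lebesgue_on \<Omega>) (\<lambda>x. (v x * (norm (weak_gradient \<Omega> u x))\<^sup>2) * f x)"
    "(\<integral>x. b x * f x \<partial>lebesgue_on \<Omega>) + (\<integral>x. (v x - 1) / (4 * \<epsilon>) * f x \<partial>lebesgue_on \<Omega>)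
      + (\<integral>x. (v x * (norm (weak_gradient \<Omega> u x))\<^sup>2) * f x \<partial>lebesgue_on \<Omega>)
      + \<epsilon> * (\<integral>x. weak_gradient \<Omega> v x \<bullet> weak_gradient \<Omega> f x \<partial>lebesgue_on \<Omega>) = 0"
proof -
  let ?M = "lebesgue_on \<Omega>"
  have u: "u \<in> H1 \<Omega>" and v: "v \<in> H1 \<Omega>" and ab: "a \<in> Lp 2 ?M" "b \<in> Lp 2 ?M"
    and C: "AE x in ?M. \<bar>v x\<bar> \<le> C" and i: "integrable ?M (\<lambda>x. norm (weak_gradient \<Omega> u x) ^ (DIM('a) + 2))"
    and eq: "\<And>\<zeta>. \<zeta> \<in> Z \<Longrightarrow> (\<integral>x. a x * \<zeta> x + ((\<eta> + (v x)\<^sup>2) *\<^sub>R weak_gradient \<Omega> u x) \<bullet> gradient \<zeta> x \<partial>?M) = 0"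
      "\<And>\<zeta>. \<zeta> \<in> Z \<Longrightarrow> (\<integral>x. (b x + (v x - 1) / (4 * \<epsilon>) + v x * (norm (weak_gradient \<Omega> u x))\<^sup>2) * \<zeta> x
        + (\<epsilon> *\<^sub>R weak_gradient \<Omega> v x) \<bullet> gradient \<zeta> x \<partial>?M) = 0"
    using s by (auto simp: slice_solution_def)
  have vm: "v \<in> borel_measurable ?M" by (rule Lp2_measurable[OF H1_Lp2(1)[OF v]])
  have bound: "AE x in ?M. \<bar>\<eta> + (v x)\<^sup>2\<bar> \<le> \<bar>\<eta>\<bar> + C\<^sup>2"
    using C
  proof eventually_elim
    case (elim x)
    then have "(v x)\<^sup>2 \<le> C\<^sup>2" by (metis abs_ge_zero power2_abs power_mono)
    then show ?case using abs_triangle_ineq[of \<eta> "(v x)\<^sup>2"] by simp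
  qed
  show flux: "(\<lambda>x. (\<eta> + (v x)\<^sup>2) *\<^sub>R weak_gradient \<Omega> u x) \<in> Lp 2 ?M"
    by (rule Lp2_bounded_mult(1)[OF H1_Lp2(2)[OF u] _ bound]) (use vm in measurable)
  show "(\<integral>x. a x * f x \<partial>?M) + (\<integral>x. ((\<eta> + (v x)\<^sup>2) *\<^sub>R weak_gradient \<Omega> u x) \<bullet> weak_gradient \<Omega> f x \<partial>?M) = 0"
    by (rule weak_identity_extends[OF flux _ _ f Z dense eq(1)])
      (use Lp2_functional_bound[OF ab(1) H10_H1] in auto)
  obtain K where K: "\<And>f. f \<in> H10 \<Omega> \<Longrightarrow> integrable ?M (\<lambda>x. (v x * (norm (weak_gradient \<Omega> u x))\<^sup>2) * f x)"
      "\<And>f. f \<in> H10 \<Omega> \<Longrightarrow> \<bar>\<integral>x. (v x * (norm (weak_gradient \<Omega> u x))\<^sup>2) * f x \<partial>?M\<bar> \<le> K * H1_norm \<Omega> f"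
    using energy_density_functional[OF H1_Lp2(2)[OF u] i vm C] by blast
  show "integrable ?M (\<lambda>x. (v x * (norm (weak_gradient \<Omega> u x))\<^sup>2) * f x)" by (rule K(1)[OF f])
  define p where "p x = b x + (v x - 1) / (4 * \<epsilon>)" for x
  have v1: "(\<lambda>x. (v x - 1) / (4 * \<epsilon>)) \<in> Lp 2 ?M"
  proof -
    have "(\<lambda>x. 1::real) \<in> Lp 2 ?M" by (rule Lp2_domain_bounded[where B=1]) auto
    from Lp2_scale[OF Lp2_diff[OF H1_Lp2(1)[OF v] this], of "1 / (4 * \<epsilon>)"] show ?thesis by simp
  qed
  have p: "p \<in> Lp 2 ?M" unfolding p_def[abs_def] by (rule Lp2_add[OF ab(2) v1])
  have dist: "(p x + v x * (norm (weak_gradient \<Omega> u x))\<^sup>2) * g x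
      = p x * g x + (v x * (norm (weak_gradient \<Omega> u x))\<^sup>2) * g x" for x g by (simp add: distrib_right)
  have "(\<integral>x. (p x + v x * (norm (weak_gradient \<Omega> u x))\<^sup>2) * f x \<partial>?M)
      + (\<integral>x. (\<epsilon> *\<^sub>R weak_gradient \<Omega> v x) \<bullet> weak_gradient \<Omega> f x \<partial>?M) = 0"
  proof (rule weak_identity_extends[OF Lp2_scale[OF H1_Lp2(2)[OF v]] _ _ f Z dense])
    fix g assume g: "g \<in> H10 \<Omega>"
    note pg = Lp2_functional_bound[OF p H10_H1[OF g]]
    show "integrable ?M (\<lambda>x. (p x + v x * (norm (weak_gradient \<Omega> u x))\<^sup>2) * g x)"
      unfolding dist by (intro Bochner_Integration.integrable_add pg(1) K(1) g)
    show "\<bar>\<integral>x. (p x + v x * (norm (weak_gradient \<Omega> u x))\<^sup>2) * g x \<partial>?M\<bar> \<le> (Lp_norm 2 ?M p + K) * H1_norm \<Omega> g"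
      unfolding dist using pg K[OF g] by (simp add: distrib_right)
  qed (use eq(2) in \<open>auto simp: p_def\<close>)
  moreover have "(\<integral>x. (p x + v x * (norm (weak_gradient \<Omega> u x))\<^sup>2) * f x \<partial>?M)
      = (\<integral>x. p x * f x \<partial>?M) + (\<integral>x. (v x * (norm (weak_gradient \<Omega> u x))\<^sup>2) * f x \<partial>?M)"
    unfolding dist by (rule Bochner_Integration.integral_add[OF Lp2_functional_bound(1)[OF p H10_H1[OF f]] K(1)[OF f]])
  moreover have "(\<integral>x. p x * f x \<partial>?M) = (\<integral>x. b x * f x \<partial>?M) + (\<integral>x. (v x - 1) / (4 * \<epsilon>) * f x \<partial>?M)"
    unfolding p_def distrib_right
    by (rule Bochner_Integration.integral_add[OF Lp2_functional_bound(1)[OF ab(2) H10_H1[OF f]] Lp2_functional_bound(1)[OF v1 H10_H1[OF f]]])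
  ultimately show "(\<integral>x. b x * f x \<partial>?M) + (\<integral>x. (v x - 1) / (4 * \<epsilon>) * f x \<partial>?M)
      + (\<integral>x. (v x * (norm (weak_gradient \<Omega> u x))\<^sup>2) * f x \<partial>?M)
      + \<epsilon> * (\<integral>x. weak_gradient \<Omega> v x \<bullet> weak_gradient \<Omega> f x \<partial>?M) = 0"
    by simp
qed

text \<open>
  The equations of both solutions are tested with their differences and subtracted.  The pointwise
  bound leaves the square of \<open>V\<close> weighted with those of the two gradients of \<open>u1\<close> and \<open>u2\<close>; the
  gradient terms that the weighted inequality then produces are absorbed by the diffusion of \<open>V\<close>.
\<close>

lemma slice_energy_estimate:
  assumes \<epsilon>: "\<epsilon> > 0" and \<eta>: "\<eta> > 0"
  shows "\<exists>K\<ge>0. \<forall>Z u1 v1 a1 b1 u2 v2 a2 b2. slice_solution \<epsilon> \<eta> C Z u1 v1 a1 b1 \<longrightarrow> slice_solution \<epsilon> \<eta> C Z u2 v2 a2 b2 \<longrightarrow>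
    Z \<subseteq> test_functions \<Omega> \<longrightarrow> (\<lambda>x. u1 x - u2 x) \<in> H10 \<Omega> \<longrightarrow> (\<lambda>x. v1 x - v2 x) \<in> H10 \<Omega> \<longrightarrow>
    (\<forall>e>0. \<exists>\<zeta>\<in>Z. H1_norm \<Omega> (\<lambda>x. (u1 x - u2 x) - \<zeta> x) < e) \<longrightarrow>
    (\<forall>e>0. \<exists>\<zeta>\<in>Z. H1_norm \<Omega> (\<lambda>x. (v1 x - v2 x) - \<zeta> x) < e) \<longrightarrow>
    (\<integral>x. (a1 x - a2 x) * (u1 x - u2 x) \<partial>lebesgue_on \<Omega>) + (\<integral>x. (b1 x - b2 x) * (v1 x - v2 x) \<partial>lebesgue_on \<Omega>)
      \<le> K * (1 + (\<integral>x. norm (weak_gradient \<Omega> u1 x) ^ (DIM('a) + 2) \<partial>lebesgue_on \<Omega>)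
          + (\<integral>x. norm (weak_gradient \<Omega> u2 x) ^ (DIM('a) + 2) \<partial>lebesgue_on \<Omega>))
        * (Lp_norm 2 (lebesgue_on \<Omega>) (\<lambda>x. v1 x - v2 x))\<^sup>2"
proof -
  let ?M = "lebesgue_on \<Omega>" and ?N = "Lp_norm 2 (lebesgue_on \<Omega>)"
  define c where "c = 5 * C\<^sup>2 / \<eta>"
  have c: "c \<ge> 0" using \<eta> by (simp add: c_def)
  \<comment> \<open>Both weighted terms, with the factor \<open>c\<close>, may use up the gradient term of \<open>V\<close> at most once.\<close>
  define \<delta> where "\<delta> = \<epsilon> / (2 * c + 1)"
  have \<delta>: "\<delta> > 0" using \<epsilon> c by (simp add: \<delta>_def)
  have c\<delta>: "2 * c * \<delta> \<le> \<epsilon>" using \<epsilon> c by (simp add: \<delta>_def field_simps)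
  obtain k where k: "k \<ge> 0" "\<And>h f. h \<in> borel_measurable ?M \<Longrightarrow> integrable ?M (\<lambda>x. \<bar>h x :: real\<bar> ^ (DIM('a) + 2)) \<Longrightarrow>
      f \<in> H10 \<Omega> \<Longrightarrow> (\<lambda>x. h x * f x) \<in> Lp 2 ?M \<and> (?N (\<lambda>x. h x * f x))\<^sup>2 \<le> \<delta> * (?N (weak_gradient \<Omega> f))\<^sup>2
        + k * (1 + (\<integral>x. \<bar>h x\<bar> ^ (DIM('a) + 2) \<partial>?M)) * (?N f)\<^sup>2"
    using weighted_H10_square[OF \<delta>] by blast
  show ?thesis
  proof (intro exI[of _ "2 * c * k"] conjI allI impI)
    show "0 \<le> 2 * c * k" using c k by simp
    fix Z u1 v1 a1 b1 u2 v2 a2 b2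
    assume s1: "slice_solution \<epsilon> \<eta> C Z u1 v1 a1 b1" and s2: "slice_solution \<epsilon> \<eta> C Z u2 v2 a2 b2"
      and Z: "Z \<subseteq> test_functions \<Omega>" and U: "(\<lambda>x. u1 x - u2 x) \<in> H10 \<Omega>" and V: "(\<lambda>x. v1 x - v2 x) \<in> H10 \<Omega>"
      and dU: "\<forall>e>0. \<exists>\<zeta>\<in>Z. H1_norm \<Omega> (\<lambda>x. (u1 x - u2 x) - \<zeta> x) < e"
      and dV: "\<forall>e>0. \<exists>\<zeta>\<in>Z. H1_norm \<Omega> (\<lambda>x. (v1 x - v2 x) - \<zeta> x) < e"
    have h1: "u1 \<in> H1 \<Omega>" "u2 \<in> H1 \<Omega>" "v1 \<in> H1 \<Omega>" "v2 \<in> H1 \<Omega>"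
      and ab: "a1 \<in> Lp 2 ?M" "a2 \<in> Lp 2 ?M" "b1 \<in> Lp 2 ?M" "b2 \<in> Lp 2 ?M"
      and C1: "AE x in ?M. \<bar>v1 x\<bar> \<le> C" and C2: "AE x in ?M. \<bar>v2 x\<bar> \<le> C"
      and i1: "integrable ?M (\<lambda>x. norm (weak_gradient \<Omega> u1 x) ^ (DIM('a) + 2))"
      and i2: "integrable ?M (\<lambda>x. norm (weak_gradient \<Omega> u2 x) ^ (DIM('a) + 2))"
      using s1 s2 by (auto simp: slice_solution_def)
    define G1 where "G1 = weak_gradient \<Omega> u1"
    define G2 where "G2 = weak_gradient \<Omega> u2"
    define X where "X x = v1 x - v2 x" for x
    define Y where "Y x = u1 x - u2 x" for x
    have X: "X \<in> H10 \<Omega>" "X \<in> H1 \<Omega>" and Y: "Y \<in> H10 \<Omega>" "Y \<in> H1 \<Omega>"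
      using U V H10_H1 by (auto simp: X_def[abs_def] Y_def[abs_def])
    have dX: "\<exists>\<zeta>\<in>Z. H1_norm \<Omega> (\<lambda>x. X x - \<zeta> x) < e" and dY: "\<exists>\<zeta>\<in>Z. H1_norm \<Omega> (\<lambda>x. Y x - \<zeta> x) < e" if "e > 0" for e
      using dU dV that by (auto simp: X_def Y_def)
    note u1t = slice_solution_tested(1,2)[OF s1 Z Y(1) dY, folded G1_def]
    note u2t = slice_solution_tested(1,2)[OF s2 Z Y(1) dY, folded G2_def]
    note v1t = slice_solution_tested(3,4)[OF s1 Z X(1) dX, folded G1_def]
    note v2t = slice_solution_tested(3,4)[OF s2 Z X(1) dX, folded G2_def]
    have gL: "weak_gradient \<Omega> Y \<in> Lp 2 ?M" "weak_gradient \<Omega> X \<in> Lp 2 ?M" using H1_Lp2(2) X Y by auto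
    have XL: "X \<in> Lp 2 ?M" "Y \<in> Lp 2 ?M" using H1_Lp2(1) X Y by auto
    define F where "F x = (\<eta> + (v1 x)\<^sup>2) *\<^sub>R G1 x - (\<eta> + (v2 x)\<^sup>2) *\<^sub>R G2 x" for x
    have FL: "F \<in> Lp 2 ?M" unfolding F_def[abs_def] by (rule Lp2_diff[OF u1t(1) u2t(1)])
    define R where "R x = (v1 x * (norm (G1 x))\<^sup>2 - v2 x * (norm (G2 x))\<^sup>2) * X x" for x
    have Ri: "integrable ?M R" "(\<integral>x. R x \<partial>?M) = (\<integral>x. (v1 x * (norm (G1 x))\<^sup>2) * X x \<partial>?M) - (\<integral>x. (v2 x * (norm (G2 x))\<^sup>2) * X x \<partial>?M)"
      unfolding R_def[abs_def] left_diff_distrib using v1t(1) v2t(1) by auto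
    have aY: "(\<integral>x. (a1 x - a2 x) * Y x \<partial>?M) = - (\<integral>x. F x \<bullet> weak_gradient \<Omega> Y x \<partial>?M)"
    proof -
      have "(\<integral>x. (a1 x - a2 x) * Y x \<partial>?M) = (\<integral>x. a1 x * Y x \<partial>?M) - (\<integral>x. a2 x * Y x \<partial>?M)"
        unfolding left_diff_distrib by (intro Bochner_Integration.integral_diff Lp2_integrable_mult ab XL)
      moreover have "(\<integral>x. F x \<bullet> weak_gradient \<Omega> Y x \<partial>?M)
          = (\<integral>x. ((\<eta> + (v1 x)\<^sup>2) *\<^sub>R G1 x) \<bullet> weak_gradient \<Omega> Y x \<partial>?M) - (\<integral>x. ((\<eta> + (v2 x)\<^sup>2) *\<^sub>R G2 x) \<bullet> weak_gradient \<Omega> Y x \<partial>?M)"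
        unfolding F_def inner_diff_left
        by (intro Bochner_Integration.integral_diff Lp2_integrable_inner u1t(1) u2t(1) gL)
      ultimately show ?thesis using u1t(2) u2t(2) by linarith
    qed
    have one: "(\<lambda>x. 1::real) \<in> Lp 2 ?M" by (rule Lp2_domain_bounded[where B=1]) auto
    have bX: "(\<integral>x. (b1 x - b2 x) * X x \<partial>?M) = - (\<integral>x. (X x)\<^sup>2 / (4 * \<epsilon>) \<partial>?M) - (\<integral>x. R x \<partial>?M)
        - \<epsilon> * (?N (weak_gradient \<Omega> X))\<^sup>2"
    proof -
      have 1: "(\<integral>x. (b1 x - b2 x) * X x \<partial>?M) = (\<integral>x. b1 x * X x \<partial>?M) - (\<integral>x. b2 x * X x \<partial>?M)"
        unfolding left_diff_distrib by (intro Bochner_Integration.integral_diff Lp2_integrable_mult ab XL)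
      have vi: "integrable ?M (\<lambda>x. (v x - 1) / (4 * \<epsilon>) * X x)" if "v \<in> H1 \<Omega>" for v
        using Lp2_integrable_mult[OF Lp2_scale[OF Lp2_diff[OF H1_Lp2(1)[OF that] one], of "1 / (4 * \<epsilon>)"] XL(1)] by simp
      have "(\<integral>x. (v1 x - 1) / (4 * \<epsilon>) * X x \<partial>?M) - (\<integral>x. (v2 x - 1) / (4 * \<epsilon>) * X x \<partial>?M)
          = (\<integral>x. (v1 x - 1) / (4 * \<epsilon>) * X x - (v2 x - 1) / (4 * \<epsilon>) * X x \<partial>?M)"
        by (rule Bochner_Integration.integral_diff[symmetric, OF vi[OF h1(3)] vi[OF h1(4)]])
      also have "\<dots> = (\<integral>x. (X x)\<^sup>2 / (4 * \<epsilon>) \<partial>?M)"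
        using \<epsilon> by (intro Bochner_Integration.integral_cong refl) (simp add: X_def power2_eq_square field_simps)
      finally have 2: "(\<integral>x. (v1 x - 1) / (4 * \<epsilon>) * X x \<partial>?M) - (\<integral>x. (v2 x - 1) / (4 * \<epsilon>) * X x \<partial>?M) = (\<integral>x. (X x)\<^sup>2 / (4 * \<epsilon>) \<partial>?M)" .
      have "(\<integral>x. weak_gradient \<Omega> v1 x \<bullet> weak_gradient \<Omega> X x \<partial>?M) - (\<integral>x. weak_gradient \<Omega> v2 x \<bullet> weak_gradient \<Omega> X x \<partial>?M)
          = (\<integral>x. (weak_gradient \<Omega> v1 x - weak_gradient \<Omega> v2 x) \<bullet> weak_gradient \<Omega> X x \<partial>?M)"
        unfolding inner_diff_left
        by (intro Bochner_Integration.integral_diff[symmetric] Lp2_integrable_inner H1_Lp2 h1 gL)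
      also have "\<dots> = (\<integral>x. (norm (weak_gradient \<Omega> X x))\<^sup>2 \<partial>?M)"
      proof (rule integral_cong_AE)
        show "AE x in ?M. (weak_gradient \<Omega> v1 x - weak_gradient \<Omega> v2 x) \<bullet> weak_gradient \<Omega> X x = (norm (weak_gradient \<Omega> X x))\<^sup>2"
          using weak_gradient_diff[OF h1(3,4), folded X_def]
          by eventually_elim (simp add: power2_norm_eq_inner)
        show "(\<lambda>x. (weak_gradient \<Omega> v1 x - weak_gradient \<Omega> v2 x) \<bullet> weak_gradient \<Omega> X x) \<in> borel_measurable ?M"
          by (intro borel_measurable_inner borel_measurable_diff Lp2_measurable H1_Lp2 h1 gL)
        show "(\<lambda>x. (norm (weak_gradient \<Omega> X x))\<^sup>2) \<in> borel_measurable ?M"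
          using Lp2_measurable[OF gL(2)] by measurable
      qed
      finally have 3: "(\<integral>x. weak_gradient \<Omega> v1 x \<bullet> weak_gradient \<Omega> X x \<partial>?M) - (\<integral>x. weak_gradient \<Omega> v2 x \<bullet> weak_gradient \<Omega> X x \<partial>?M)
          = (?N (weak_gradient \<Omega> X))\<^sup>2" by (simp add: Lp2_norm_sq)
      then have "\<epsilon> * (\<integral>x. weak_gradient \<Omega> v1 x \<bullet> weak_gradient \<Omega> X x \<partial>?M) - \<epsilon> * (\<integral>x. weak_gradient \<Omega> v2 x \<bullet> weak_gradient \<Omega> X x \<partial>?M)
          = \<epsilon> * (?N (weak_gradient \<Omega> X))\<^sup>2" by (simp flip: right_diff_distrib)
      then show ?thesis using 1 2 Ri(2) v1t(2) v2t(2) by linarith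
    qed
    have m: "(\<lambda>x. norm (G1 x)) \<in> borel_measurable ?M" "(\<lambda>x. norm (G2 x)) \<in> borel_measurable ?M"
      unfolding G1_def G2_def using H1_Lp2(2)[OF h1(1)] H1_Lp2(2)[OF h1(2)] by (auto dest!: Lp2_measurable)
    define A1 where "A1 = (\<integral>x. norm (G1 x) ^ (DIM('a) + 2) \<partial>?M)"
    define A2 where "A2 = (\<integral>x. norm (G2 x) ^ (DIM('a) + 2) \<partial>?M)"
    have A: "A1 \<ge> 0" "A2 \<ge> 0" unfolding A1_def A2_def by (auto intro!: integral_nonneg_AE)
    have w1: "(\<lambda>x. norm (G1 x) * X x) \<in> Lp 2 ?M"
        "(?N (\<lambda>x. norm (G1 x) * X x))\<^sup>2 \<le> \<delta> * (?N (weak_gradient \<Omega> X))\<^sup>2 + k * (1 + A1) * (?N X)\<^sup>2"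
      using k(2)[OF m(1) _ X(1)] i1 by (auto simp: G1_def A1_def)
    have w2: "(\<lambda>x. norm (G2 x) * X x) \<in> Lp 2 ?M"
        "(?N (\<lambda>x. norm (G2 x) * X x))\<^sup>2 \<le> \<delta> * (?N (weak_gradient \<Omega> X))\<^sup>2 + k * (1 + A2) * (?N X)\<^sup>2"
      using k(2)[OF m(2) _ X(1)] i2 by (auto simp: G2_def A2_def)
    have wi: "integrable ?M (\<lambda>x. (norm (G1 x) * X x)\<^sup>2)" "integrable ?M (\<lambda>x. (norm (G2 x) * X x)\<^sup>2)"
      using Lp2_integrable[OF w1(1)] Lp2_integrable[OF w2(1)] by auto
    have Fi: "integrable ?M (\<lambda>x. F x \<bullet> weak_gradient \<Omega> Y x)" by (rule Lp2_integrable_inner[OF FL gL(1)])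
    have X2: "integrable ?M (\<lambda>x. (X x)\<^sup>2 / (4 * \<epsilon>))" using Lp2_integrable[OF XL(1)] by simp
    have "- (\<integral>x. F x \<bullet> weak_gradient \<Omega> Y x \<partial>?M) - (\<integral>x. (X x)\<^sup>2 / (4 * \<epsilon>) \<partial>?M) - (\<integral>x. R x \<partial>?M)
        = (\<integral>x. - (F x \<bullet> weak_gradient \<Omega> Y x) - (X x)\<^sup>2 / (4 * \<epsilon>) - R x \<partial>?M)"
      using Fi X2 Ri(1) by simp
    also have "\<dots> \<le> (\<integral>x. c * ((norm (G1 x) * X x)\<^sup>2 + (norm (G2 x) * X x)\<^sup>2) \<partial>?M)"
    proof (rule integral_mono_AE)
      show "integrable ?M (\<lambda>x. - (F x \<bullet> weak_gradient \<Omega> Y x) - (X x)\<^sup>2 / (4 * \<epsilon>) - R x)"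
        using Fi X2 Ri(1) by simp
      show "integrable ?M (\<lambda>x. c * ((norm (G1 x) * X x)\<^sup>2 + (norm (G2 x) * X x)\<^sup>2))"
        using wi by simp
      show "AE x in ?M. - (F x \<bullet> weak_gradient \<Omega> Y x) - (X x)\<^sup>2 / (4 * \<epsilon>) - R x
          \<le> c * ((norm (G1 x) * X x)\<^sup>2 + (norm (G2 x) * X x)\<^sup>2)"
        using C1 C2 weak_gradient_diff[OF h1(1,2), folded Y_def G1_def G2_def]
      proof eventually_elim
        case (elim x)
        show ?case
          unfolding elim(3) F_def R_def X_def c_def
          by (rule difference_pointwise_bound[OF \<eta> \<epsilon> elim(1,2)])
      qed
    qed
    also have "\<dots> = c * ((?N (\<lambda>x. norm (G1 x) * X x))\<^sup>2 + (?N (\<lambda>x. norm (G2 x) * X x))\<^sup>2)"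
      using wi by (simp add: Lp2_norm_sq)
    also have "\<dots> \<le> c * ((\<delta> * (?N (weak_gradient \<Omega> X))\<^sup>2 + k * (1 + A1) * (?N X)\<^sup>2)
        + (\<delta> * (?N (weak_gradient \<Omega> X))\<^sup>2 + k * (1 + A2) * (?N X)\<^sup>2))"
      by (intro mult_left_mono add_mono w1(2) w2(2) c)
    also have "\<dots> = 2 * c * \<delta> * (?N (weak_gradient \<Omega> X))\<^sup>2 + c * k * (2 + A1 + A2) * (?N X)\<^sup>2"
      by (simp add: algebra_simps)
    also have "\<dots> \<le> \<epsilon> * (?N (weak_gradient \<Omega> X))\<^sup>2 + 2 * c * k * (1 + A1 + A2) * (?N X)\<^sup>2"
    proof (rule add_mono)
      show "2 * c * \<delta> * (?N (weak_gradient \<Omega> X))\<^sup>2 \<le> \<epsilon> * (?N (weak_gradient \<Omega> X))\<^sup>2"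
        by (intro mult_right_mono c\<delta>) simp
      have "c * k * (2 + A1 + A2) \<le> c * k * (2 * (1 + A1 + A2))"
        using A c k by (intro mult_left_mono) auto
      then have "c * k * (2 + A1 + A2) \<le> 2 * c * k * (1 + A1 + A2)" by (simp add: ac_simps)
      then show "c * k * (2 + A1 + A2) * (?N X)\<^sup>2 \<le> 2 * c * k * (1 + A1 + A2) * (?N X)\<^sup>2"
        by (rule mult_right_mono) simp
    qed
    finally have "(\<integral>x. (a1 x - a2 x) * Y x \<partial>?M) + (\<integral>x. (b1 x - b2 x) * X x \<partial>?M)
        \<le> 2 * c * k * (1 + A1 + A2) * (?N X)\<^sup>2"
      using aY bX by linarith
    then show "(\<integral>x. (a1 x - a2 x) * (u1 x - u2 x) \<partial>?M) + (\<integral>x. (b1 x - b2 x) * (v1 x - v2 x) \<partial>?M)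
      \<le> 2 * c * k * (1 + (\<integral>x. norm (weak_gradient \<Omega> u1 x) ^ (DIM('a) + 2) \<partial>?M)
          + (\<integral>x. norm (weak_gradient \<Omega> u2 x) ^ (DIM('a) + 2) \<partial>?M)) * (?N (\<lambda>x. v1 x - v2 x))\<^sup>2"
      by (simp add: X_def[abs_def] Y_def A1_def A2_def G1_def G2_def)
  qed
qed

end

section \<open>Weak solutions at almost every time\<close>

context bounded_open
begin

lemma gradient_power_integrable:
  fixes G :: "real \<Rightarrow> 'a \<Rightarrow> 'a"
  assumes G: "\<And>T. T > 0 \<Longrightarrow> G \<in> Bochner_Lp (real DIM('a) + 2) (lebesgue_on {0<..<T})
    (Lp (real DIM('a) + 2) (lebesgue_on \<Omega>)) (Lp_norm (real DIM('a) + 2) (lebesgue_on \<Omega>))"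
  shows "AE t in lebesgue_on {0<..}. integrable (lebesgue_on \<Omega>) (\<lambda>x. norm (G t x) ^ (DIM('a) + 2))"
    "T > 0 \<Longrightarrow> (\<lambda>t. \<integral>x. norm (G t x) ^ (DIM('a) + 2) \<partial>lebesgue_on \<Omega>) absolutely_integrable_on {0..T}"
proof -
  let ?M = "lebesgue_on \<Omega>"
  define p where "p = real DIM('a) + 2"
  have p: "p > 0" by (simp add: p_def)
  have pw: "a powr p = a ^ (DIM('a) + 2)" if "a \<ge> 0" for a :: real
  proof (cases "a = 0")
    case False
    then have "a powr real (DIM('a) + 2) = a ^ (DIM('a) + 2)" using that by (intro powr_realpow) simp
    then show ?thesis by (simp add: p_def add.commute)
  qed simp
  note G = G[folded p_def]
  show "AE t in lebesgue_on {0<..}. integrable ?M (\<lambda>x. norm (G t x) ^ (DIM('a) + 2))"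
  proof (rule AE_half_line)
    fix n
    have "strongly_measurable (lebesgue_on {0<..<real (Suc n)}) (Lp p ?M) (Lp_norm p ?M) G"
      using G[of "real (Suc n)"] by (simp add: Bochner_Lp_def)
    from strongly_measurable_in[OF this]
    show "AE t in lebesgue_on {0<..<real (Suc n)}. integrable ?M (\<lambda>x. norm (G t x) ^ (DIM('a) + 2))"
      by eventually_elim (simp add: Lp_def pw)
  qed
  have "Lp_norm p ?M f powr p = (\<integral>x. norm (f x) ^ (DIM('a) + 2) \<partial>?M)" for f :: "'a \<Rightarrow> 'a"
    using p by (simp add: Lp_norm_def powr_powr pw integral_nonneg_AE)
  moreover assume "T > 0"
  ultimately have "integrable (lebesgue_on {0<..<T}) (\<lambda>t. \<integral>x. norm (G t x) ^ (DIM('a) + 2) \<partial>?M)"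
    using G[of T] by (simp add: Bochner_Lp_def)
  then show "(\<lambda>t. \<integral>x. norm (G t x) ^ (DIM('a) + 2) \<partial>?M) absolutely_integrable_on {0..T}"
    by (simp add: absolutely_integrable_iff_lebesgue_on)
qed

lemma solution_spaceD:
  assumes "u \<in> solution_space \<Omega>"
  shows "u \<in> L2_loc (H1 \<Omega>) (H1_norm \<Omega>)" "u \<in> L_inf_space_time \<Omega>"
    "has_weak_time_derivative (L2 \<Omega>) (L2_norm \<Omega>) u (weak_time_derivative (L2 \<Omega>) (L2_norm \<Omega>) u)"
    "u \<in> L2_loc (L2 \<Omega>) (L2_norm \<Omega>)" "weak_time_derivative (L2 \<Omega>) (L2_norm \<Omega>) u \<in> L2_loc (L2 \<Omega>) (L2_norm \<Omega>)"
proof -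
  show "u \<in> L2_loc (H1 \<Omega>) (H1_norm \<Omega>)" "u \<in> L_inf_space_time \<Omega>"
    using assms by (auto simp: solution_space_def)
  have "\<exists>u'. has_weak_time_derivative (L2 \<Omega>) (L2_norm \<Omega>) u u'"
    using assms by (auto simp: solution_space_def H1_loc_def)
  then show "has_weak_time_derivative (L2 \<Omega>) (L2_norm \<Omega>) u (weak_time_derivative (L2 \<Omega>) (L2_norm \<Omega>) u)"
    unfolding weak_time_derivative_def by (rule someI_ex)
  then show "u \<in> L2_loc (L2 \<Omega>) (L2_norm \<Omega>)" "weak_time_derivative (L2 \<Omega>) (L2_norm \<Omega>) u \<in> L2_loc (L2 \<Omega>) (L2_norm \<Omega>)"
    by (auto simp: has_weak_time_derivative_def)
qed

text \<open>
  At almost every time \<open>v\<close> may be replaced by a bounded Borel function \<open>h\<close>, which makes the flux a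
  continuous functional of the gradient of \<open>u\<close> and thus integrable in time.
\<close>

lemma weak_solution_slice_u:
  assumes sol: "weak_solution \<Omega> \<epsilon> \<eta> g u0 v0 u v" and \<zeta>: "\<zeta> \<in> test_functions \<Omega>"
  shows "AE t in lebesgue_on {0<..}. (\<integral>x. weak_time_derivative (L2 \<Omega>) (L2_norm \<Omega>) u t x * \<zeta> x
    + ((\<eta> + (v t x)\<^sup>2) *\<^sub>R weak_gradient \<Omega> (u t) x) \<bullet> gradient \<zeta> x \<partial>lebesgue_on \<Omega>) = 0"
proof (rule weak_form_AE[OF _ \<zeta>])
  let ?M = "lebesgue_on \<Omega>"
  let ?u = "weak_time_derivative (L2 \<Omega>) (L2_norm \<Omega>) u"
  have u: "u \<in> solution_space \<Omega>" and v: "v \<in> solution_space \<Omega>" using sol by (auto simp: weak_solution_def)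
  fix \<phi> :: "real \<times> 'a \<Rightarrow> real" assume "\<phi> \<in> test_functions ({0<..} \<times> \<Omega>)"
  then show "(\<integral>t. (\<integral>x. ?u t x * \<phi> (t, x) + ((\<eta> + (v t x)\<^sup>2) *\<^sub>R weak_gradient \<Omega> (u t) x) \<bullet> gradient (\<lambda>y. \<phi> (t, y)) x \<partial>?M)
      \<partial>lebesgue_on {0<..}) = 0"
    using sol by (simp add: weak_solution_def)
next
  let ?M = "lebesgue_on \<Omega>"
  let ?u = "weak_time_derivative (L2 \<Omega>) (L2_norm \<Omega>) u"
  have u: "u \<in> solution_space \<Omega>" and v: "v \<in> solution_space \<Omega>" using sol by (auto simp: weak_solution_def)
  note us = solution_spaceD[OF u]
  note z = test_functions_Lp2[OF \<zeta>]
  fix T :: real assume T: "T > 0"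
  obtain h C where h[measurable]: "h \<in> borel_measurable borel" and C: "C \<ge> 0" "\<And>p. \<bar>h p\<bar> \<le> C"
    and vh: "AE t in lborel. AE x in lborel. t \<ge> 0 \<longrightarrow> x \<in> \<Omega> \<longrightarrow> v t x = h (t, x)"
    by (rule space_time_representative[OF solution_spaceD(2)[OF v]]) blast
  define a where "a p = \<eta> + (h p)\<^sup>2" for p
  have am: "a \<in> borel_measurable borel" unfolding a_def[abs_def] by measurable
  have ab: "\<bar>a p\<bar> \<le> \<bar>\<eta>\<bar> + C\<^sup>2" for p
    using abs_triangle_ineq[of \<eta> "(h p)\<^sup>2"] power_mono[OF C(2)[of p], of 2] by (simp add: a_def)
  have at: "(\<lambda>x. a (t, x)) \<in> borel_measurable ?M" for t
    by (rule borel_measurable_lebesgue_on[OF slice_borel_measurable[OF am]])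
  have "AE t in lebesgue_on {0<..}. (\<integral>x. ?u t x * \<zeta> x \<partial>?M) + (\<integral>x. a (t, x) * (weak_gradient \<Omega> (u t) x \<bullet> gradient \<zeta> x) \<partial>?M)
      = (\<integral>x. ?u t x * \<zeta> x + ((\<eta> + (v t x)\<^sup>2) *\<^sub>R weak_gradient \<Omega> (u t) x) \<bullet> gradient \<zeta> x \<partial>?M)"
    using AE_space_time_slice[OF vh] L2_loc_in[OF us(1)] L2_loc_in[OF us(5)] L2_loc_in[OF solution_spaceD(4)[OF v]]
  proof eventually_elim
    case (elim t)
    note Gu = H1_Lp2(2)[OF elim(2)]
    have aG: "(\<lambda>x. a (t, x) *\<^sub>R weak_gradient \<Omega> (u t) x) \<in> Lp 2 ?M"
      by (rule Lp2_bounded_mult(1)[OF Gu at]) (use ab in auto)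
    have vm: "v t \<in> borel_measurable ?M" by (rule Lp2_measurable[OF elim(4)])
    have "(\<integral>x. ?u t x * \<zeta> x \<partial>?M) + (\<integral>x. a (t, x) * (weak_gradient \<Omega> (u t) x \<bullet> gradient \<zeta> x) \<partial>?M)
        = (\<integral>x. ?u t x * \<zeta> x + (a (t, x) *\<^sub>R weak_gradient \<Omega> (u t) x) \<bullet> gradient \<zeta> x \<partial>?M)"
      using Lp2_integrable_mult[OF elim(3) z(1)] Lp2_integrable_inner[OF aG z(2)] by simp
    also have "\<dots> = (\<integral>x. ?u t x * \<zeta> x + ((\<eta> + (v t x)\<^sup>2) *\<^sub>R weak_gradient \<Omega> (u t) x) \<bullet> gradient \<zeta> x \<partial>?M)"
    proof (rule integral_cong_AE)
      show "AE x in ?M. ?u t x * \<zeta> x + (a (t, x) *\<^sub>R weak_gradient \<Omega> (u t) x) \<bullet> gradient \<zeta> x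
          = ?u t x * \<zeta> x + ((\<eta> + (v t x)\<^sup>2) *\<^sub>R weak_gradient \<Omega> (u t) x) \<bullet> gradient \<zeta> x"
        using elim(1) by eventually_elim (simp add: a_def)
    qed (intro borel_measurable_add borel_measurable_times borel_measurable_inner borel_measurable_scaleR
        borel_measurable_power borel_measurable_const at vm Lp2_measurable[OF elim(3)] Lp2_measurable[OF z(1)]
        Lp2_measurable[OF z(2)] Lp2_measurable[OF Gu])+
    finally show ?case .
  qed
  from integral_cong_AE_Icc(1)[OF set_integral_add(1)[OF L2_loc_mult_integrable[OF us(5) z(1) T]
      flux_integrable[OF us(1) T am ab z(2)]] AE_half_line_between[OF this order_refl]]
  show "(\<lambda>t. \<integral>x. ?u t x * \<zeta> x + ((\<eta> + (v t x)\<^sup>2) *\<^sub>R weak_gradient \<Omega> (u t) x) \<bullet> gradient \<zeta> x \<partial>?M)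
      absolutely_integrable_on {0..T}" .
qed

text \<open>
  As for \<open>u\<close>; the term that is quadratic in the gradient has the bounded Borel weight
  \<open>h (t, x) * \<zeta> x\<close>.
\<close>

lemma weak_solution_slice_v:
  assumes sol: "weak_solution \<Omega> \<epsilon> \<eta> g u0 v0 u v" and \<zeta>: "\<zeta> \<in> test_functions \<Omega>"
  shows "AE t in lebesgue_on {0<..}. (\<integral>x. (weak_time_derivative (L2 \<Omega>) (L2_norm \<Omega>) v t x + (v t x - 1) / (4 * \<epsilon>)
        + v t x * (norm (weak_gradient \<Omega> (u t) x))\<^sup>2) * \<zeta> x
      + (\<epsilon> *\<^sub>R weak_gradient \<Omega> (v t) x) \<bullet> gradient \<zeta> x \<partial>lebesgue_on \<Omega>) = 0"
proof (rule weak_form_AE[OF _ \<zeta>])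
  let ?M = "lebesgue_on \<Omega>"
  let ?v = "weak_time_derivative (L2 \<Omega>) (L2_norm \<Omega>) v"
  fix \<phi> :: "real \<times> 'a \<Rightarrow> real" assume "\<phi> \<in> test_functions ({0<..} \<times> \<Omega>)"
  then have "(\<integral>t. (\<integral>x. ?v t x * \<phi> (t, x) + \<epsilon> * (weak_gradient \<Omega> (v t) x \<bullet> gradient (\<lambda>y. \<phi> (t, y)) x)
        + (v t x - 1) / (4 * \<epsilon>) * \<phi> (t, x) + v t x * (norm (weak_gradient \<Omega> (u t) x))\<^sup>2 * \<phi> (t, x)
      \<partial>?M) \<partial>lebesgue_on {0<..}) = 0"
    using sol by (simp add: weak_solution_def)
  moreover have "(b + e + f) * z + (\<epsilon> *\<^sub>R G) \<bullet> H = b * z + \<epsilon> * (G \<bullet> H) + e * z + f * z"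
    for b e f z :: real and G H :: 'a by (simp add: distrib_right)
  ultimately show "(\<integral>t. (\<integral>x. (?v t x + (v t x - 1) / (4 * \<epsilon>) + v t x * (norm (weak_gradient \<Omega> (u t) x))\<^sup>2) * \<phi> (t, x)
      + (\<epsilon> *\<^sub>R weak_gradient \<Omega> (v t) x) \<bullet> gradient (\<lambda>y. \<phi> (t, y)) x \<partial>?M) \<partial>lebesgue_on {0<..}) = 0"
    by presburger
next
  let ?M = "lebesgue_on \<Omega>"
  let ?v = "weak_time_derivative (L2 \<Omega>) (L2_norm \<Omega>) v"
  have u: "u \<in> solution_space \<Omega>" and v: "v \<in> solution_space \<Omega>" using sol by (auto simp: weak_solution_def)
  note us = solution_spaceD[OF u] and vs = solution_spaceD[OF v]
  note z = test_functions_Lp2[OF \<zeta>]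
  fix T :: real assume T: "T > 0"
  obtain h C where h[measurable]: "h \<in> borel_measurable borel" and C: "C \<ge> 0" "\<And>p. \<bar>h p\<bar> \<le> C"
    and vh: "AE t in lborel. AE x in lborel. t \<ge> 0 \<longrightarrow> x \<in> \<Omega> \<longrightarrow> v t x = h (t, x)"
    by (rule space_time_representative[OF solution_spaceD(2)[OF v]]) blast
  obtain B where B: "B \<ge> 0" "\<And>x. \<bar>\<zeta> x\<bar> \<le> B" by (rule test_functions_bounded[OF \<zeta>]) blast
  have \<zeta>m[measurable]: "\<zeta> \<in> borel_measurable borel" by (rule test_functions_measurable[OF \<zeta>])
  define a where "a p = h p * \<zeta> (snd p)" for p
  have am: "a \<in> borel_measurable borel"
    unfolding a_def[abs_def] borel_prod[symmetric] using h \<zeta>m unfolding borel_prod[symmetric] by measurable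
  have ab: "\<bar>a p\<bar> \<le> C * B" for p
    unfolding a_def abs_mult by (rule mult_mono[OF C(2) B(2) C(1)]) simp
  have at: "(\<lambda>x. a (t, x)) \<in> borel_measurable ?M" for t
    by (rule borel_measurable_lebesgue_on[OF slice_borel_measurable[OF am]])
  define c where "c = 1 / (4 * \<epsilon>)"
  have one: "(\<lambda>x. 1::real) \<in> Lp 2 ?M" by (rule Lp2_domain_bounded[where B=1]) auto
  let ?F = "\<lambda>t x. ?v t x * \<zeta> x + c * (v t x * \<zeta> x) - c * \<zeta> x + a (t, x) * (norm (weak_gradient \<Omega> (u t) x))\<^sup>2
    + \<epsilon> * (weak_gradient \<Omega> (v t) x \<bullet> gradient \<zeta> x)"
  have "AE t in lebesgue_on {0<..}. (\<integral>x. ?v t x * \<zeta> x \<partial>?M) + c * (\<integral>x. v t x * \<zeta> x \<partial>?M) - c * (\<integral>x. \<zeta> x \<partial>?M)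
      + (\<integral>x. a (t, x) * (norm (weak_gradient \<Omega> (u t) x))\<^sup>2 \<partial>?M) + (\<integral>x. \<epsilon> * (weak_gradient \<Omega> (v t) x \<bullet> gradient \<zeta> x) \<partial>?M)
      = (\<integral>x. (?v t x + (v t x - 1) / (4 * \<epsilon>) + v t x * (norm (weak_gradient \<Omega> (u t) x))\<^sup>2) * \<zeta> x
      + (\<epsilon> *\<^sub>R weak_gradient \<Omega> (v t) x) \<bullet> gradient \<zeta> x \<partial>?M)"
    using AE_space_time_slice[OF vh] L2_loc_in[OF us(1)] L2_loc_in[OF vs(1)] L2_loc_in[OF vs(5)]
  proof eventually_elim
    case (elim t)
    note Gu = H1_Lp2(2)[OF elim(2)] and Gv = H1_Lp2(2)[OF elim(3)] and vL = H1_Lp2(1)[OF elim(3)]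
    have vm: "v t \<in> borel_measurable ?M" by (rule Lp2_measurable[OF vL])
    have aG: "(\<lambda>x. a (t, x) *\<^sub>R weak_gradient \<Omega> (u t) x) \<in> Lp 2 ?M"
      by (rule Lp2_bounded_mult(1)[OF Gu at]) (use ab in auto)
    have i4: "integrable ?M (\<lambda>x. a (t, x) * (norm (weak_gradient \<Omega> (u t) x))\<^sup>2)"
      using Lp2_integrable_inner[OF aG Gu] by (simp add: power2_norm_eq_inner)
    note i = Lp2_integrable_mult[OF elim(4) z(1)] Lp2_integrable_mult[OF vL z(1)] Lp2_integrable_mult[OF one z(1)]
      i4 Lp2_integrable_inner[OF Gv z(2)]
    have "(\<integral>x. ?v t x * \<zeta> x \<partial>?M) + c * (\<integral>x. v t x * \<zeta> x \<partial>?M) - c * (\<integral>x. \<zeta> x \<partial>?M)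
      + (\<integral>x. a (t, x) * (norm (weak_gradient \<Omega> (u t) x))\<^sup>2 \<partial>?M) + (\<integral>x. \<epsilon> * (weak_gradient \<Omega> (v t) x \<bullet> gradient \<zeta> x) \<partial>?M)
      = (\<integral>x. ?F t x \<partial>?M)"
      using i by simp
    also have "\<dots> = (\<integral>x. (?v t x + (v t x - 1) / (4 * \<epsilon>) + v t x * (norm (weak_gradient \<Omega> (u t) x))\<^sup>2) * \<zeta> x
      + (\<epsilon> *\<^sub>R weak_gradient \<Omega> (v t) x) \<bullet> gradient \<zeta> x \<partial>?M)"
    proof (rule integral_cong_AE)
      have e: "b * z + c * (w * z) - c * z + (w * z) * n + r = (b + (w - 1) / (4 * \<epsilon>) + w * n) * z + r"
        for b z w n r :: real by (simp add: c_def diff_divide_distrib algebra_simps)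
      show "AE x in ?M. ?F t x = (?v t x + (v t x - 1) / (4 * \<epsilon>) + v t x * (norm (weak_gradient \<Omega> (u t) x))\<^sup>2) * \<zeta> x
          + (\<epsilon> *\<^sub>R weak_gradient \<Omega> (v t) x) \<bullet> gradient \<zeta> x"
        using elim(1)
      proof eventually_elim
        case (elim x)
        then have "a (t, x) = v t x * \<zeta> x" by (simp add: a_def)
        then show ?case unfolding e[symmetric] by simp
      qed
      show "(\<lambda>x. ?F t x) \<in> borel_measurable ?M" using i by (intro borel_measurable_integrable) simp
      note [measurable] = Lp2_measurable[OF elim(4)] Lp2_measurable[OF z(1)] Lp2_measurable[OF z(2)]
        Lp2_measurable[OF Gu] Lp2_measurable[OF Gv] vm
      show "(\<lambda>x. (?v t x + (v t x - 1) / (4 * \<epsilon>) + v t x * (norm (weak_gradient \<Omega> (u t) x))\<^sup>2) * \<zeta> x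
          + (\<epsilon> *\<^sub>R weak_gradient \<Omega> (v t) x) \<bullet> gradient \<zeta> x) \<in> borel_measurable ?M"
        by measurable
    qed
    finally show ?case .
  qed
  note eq = AE_half_line_between[OF this order_refl]
  have const: "(\<lambda>t. c * (\<integral>x. \<zeta> x \<partial>?M)) absolutely_integrable_on {0..T}" by (intro absolutely_integrable_continuous_real continuous_intros)
  have flux: "(\<lambda>t. \<integral>x. \<epsilon> * (weak_gradient \<Omega> (v t) x \<bullet> gradient \<zeta> x) \<partial>?M) absolutely_integrable_on {0..T}"
    by (rule flux_integrable[where a="\<lambda>p. \<epsilon>" and C="\<bar>\<epsilon>\<bar>", OF vs(1) T _ _ z(2)]) auto
  show "(\<lambda>t. \<integral>x. (?v t x + (v t x - 1) / (4 * \<epsilon>) + v t x * (norm (weak_gradient \<Omega> (u t) x))\<^sup>2) * \<zeta> x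
      + (\<epsilon> *\<^sub>R weak_gradient \<Omega> (v t) x) \<bullet> gradient \<zeta> x \<partial>?M) absolutely_integrable_on {0..T}"
    by (rule integral_cong_AE_Icc(1)[OF _ eq])
      (intro set_integral_add(1) set_integral_diff(1) set_integrable_mult_right const flux
        L2_loc_mult_integrable[OF vs(5) z(1) T] L2_loc_mult_integrable[OF vs(4) z(1) T] energy_density_integrable[OF us(1) T am ab])
qed

lemma solution_slice_bounded:
  assumes "u \<in> solution_space \<Omega>"
  obtains C where "AE t in lebesgue_on {0<..}. AE x in lebesgue_on \<Omega>. \<bar>u t x\<bar> \<le> C"
proof -
  obtain h C where C: "\<And>p. \<bar>h p\<bar> \<le> C"
    and uh: "AE t in lborel. AE x in lborel. t \<ge> 0 \<longrightarrow> x \<in> \<Omega> \<longrightarrow> u t x = h (t, x)"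
    by (rule space_time_representative[OF solution_spaceD(2)[OF assms]]) blast
  have "AE t in lebesgue_on {0<..}. AE x in lebesgue_on \<Omega>. \<bar>u t x\<bar> \<le> C"
    using AE_space_time_slice[OF uh]
  proof eventually_elim
    case (elim t)
    then show ?case by eventually_elim (simp add: C)
  qed
  then show thesis by (rule that)
qed

lemma weak_solution_slices:
  assumes sol: "weak_solution \<Omega> \<epsilon> \<eta> g u0 v0 u v" and Z: "countable Z" "Z \<subseteq> test_functions \<Omega>"
    and C: "AE t in lebesgue_on {0<..}. AE x in lebesgue_on \<Omega>. \<bar>v t x\<bar> \<le> C"
    and int: "AE t in lebesgue_on {0<..}. integrable (lebesgue_on \<Omega>) (\<lambda>x. norm (weak_gradient \<Omega> (u t) x) ^ (DIM('a) + 2))"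
  shows "AE t in lebesgue_on {0<..}. slice_solution \<epsilon> \<eta> C Z (u t) (v t)
    (weak_time_derivative (L2 \<Omega>) (L2_norm \<Omega>) u t) (weak_time_derivative (L2 \<Omega>) (L2_norm \<Omega>) v t)"
proof -
  have u: "u \<in> solution_space \<Omega>" and v: "v \<in> solution_space \<Omega>" using sol by (auto simp: weak_solution_def)
  note us = solution_spaceD[OF u] and vs = solution_spaceD[OF v]
  have "AE t in lebesgue_on {0<..}. \<forall>\<zeta>\<in>Z. (\<integral>x. weak_time_derivative (L2 \<Omega>) (L2_norm \<Omega>) u t x * \<zeta> x
    + ((\<eta> + (v t x)\<^sup>2) *\<^sub>R weak_gradient \<Omega> (u t) x) \<bullet> gradient \<zeta> x \<partial>lebesgue_on \<Omega>) = 0"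
    unfolding AE_ball_countable[OF Z(1)] using weak_solution_slice_u[OF sol] Z(2) by blast
  moreover have "AE t in lebesgue_on {0<..}. \<forall>\<zeta>\<in>Z. (\<integral>x. (weak_time_derivative (L2 \<Omega>) (L2_norm \<Omega>) v t x + (v t x - 1) / (4 * \<epsilon>)
        + v t x * (norm (weak_gradient \<Omega> (u t) x))\<^sup>2) * \<zeta> x
      + (\<epsilon> *\<^sub>R weak_gradient \<Omega> (v t) x) \<bullet> gradient \<zeta> x \<partial>lebesgue_on \<Omega>) = 0"
    unfolding AE_ball_countable[OF Z(1)] using weak_solution_slice_v[OF sol] Z(2) by blast
  ultimately show ?thesis
    using L2_loc_in[OF us(1)] L2_loc_in[OF vs(1)] L2_loc_in[OF us(5)] L2_loc_in[OF vs(5)] C int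
    by eventually_elim (simp add: slice_solution_def)
qed

text \<open>
  The initial value is chosen as \<open>w 0\<close> for some continuous representative; this recovers \<open>w\<close>.
\<close>

lemma initial_value_representative:
  assumes u: "has_weak_time_derivative (L2 \<Omega>) (L2_norm \<Omega>) u u'"
  obtains w where "continuous_representative (L2 \<Omega>) (L2_norm \<Omega>) u w"
    "initial_value (L2 \<Omega>) (L2_norm \<Omega>) u = w 0"
proof -
  have "\<exists>f w. continuous_representative (L2 \<Omega>) (L2_norm \<Omega>) u w \<and> f = w 0"
    using continuous_representative_exists[OF u] by auto
  from someI_ex[OF this] show thesis unfolding initial_value_def[symmetric] using that by blast
qed

lemma continuous_representative_eq:
  assumes "continuous_representative (L2 \<Omega>) (L2_norm \<Omega>) u w"
  shows "AE t in lebesgue_on {0<..}. w t \<in> L2 \<Omega> \<and> (AE x in lebesgue_on \<Omega>. u t x = w t x)"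
proof -
  have wL: "\<And>t. t \<ge> 0 \<Longrightarrow> w t \<in> L2 \<Omega>"
    and ae: "AE t in lebesgue_on {0<..}. u t \<in> L2 \<Omega> \<and> L2_norm \<Omega> (\<lambda>x. u t x - w t x) = 0"
    using assms by (auto simp: continuous_representative_def)
  show ?thesis using ae AE_space
  proof eventually_elim
    case (elim t)
    then have w: "w t \<in> L2 \<Omega>" by (intro wL) auto
    have "AE x in lebesgue_on \<Omega>. u t x - w t x = 0"
      by (rule Lp2_norm_eq_0) (use elim Lp2_diff w in auto)
    then show ?case using w by simp
  qed
qed

section \<open>Uniqueness\<close>

lemma equal_initial_values:
  assumes w1: "continuous_representative (L2 \<Omega>) (L2_norm \<Omega>) u1 w1"
    and w2: "continuous_representative (L2 \<Omega>) (L2_norm \<Omega>) u2 w2"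
    and eq: "AE x in lebesgue_on \<Omega>. w1 0 x = f x" "AE x in lebesgue_on \<Omega>. w2 0 x = f x"
  shows "L2_norm \<Omega> (\<lambda>x. w1 0 x - w2 0 x) = 0"
proof -
  have L: "w1 0 \<in> L2 \<Omega>" "w2 0 \<in> L2 \<Omega>" using w1 w2 by (auto simp: continuous_representative_def)
  have "AE x in lebesgue_on \<Omega>. w1 0 x - w2 0 x = 0" using eq by eventually_elim simp
  from Lp_norm_cong_AE[OF this Lp2_measurable[OF Lp2_diff[OF L]]] show ?thesis by simp
qed

lemma difference_H10:
  assumes "weak_solution \<Omega> \<epsilon> \<eta> g u0 v0 u1 v1" "weak_solution \<Omega> \<epsilon> \<eta> g u0 v0 u2 v2"
  shows "AE t in lebesgue_on {0<..}. (\<lambda>x. u1 t x - u2 t x) \<in> H10 \<Omega>"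
    "AE t in lebesgue_on {0<..}. (\<lambda>x. v1 t x - v2 t x) \<in> H10 \<Omega>"
proof -
  have 1: "AE t in lebesgue_on {0<..}. (\<lambda>x. u1 t x - g t x) \<in> H10 \<Omega> \<and> (\<lambda>x. v1 t x - 1) \<in> H10 \<Omega>"
    and 2: "AE t in lebesgue_on {0<..}. (\<lambda>x. u2 t x - g t x) \<in> H10 \<Omega> \<and> (\<lambda>x. v2 t x - 1) \<in> H10 \<Omega>"
    using assms by (auto simp: weak_solution_def)
  show "AE t in lebesgue_on {0<..}. (\<lambda>x. u1 t x - u2 t x) \<in> H10 \<Omega>"
    using 1 2
  proof eventually_elim
    case (elim t)
    then show ?case using H10_diff[of "\<lambda>x. u1 t x - g t x" "\<lambda>x. u2 t x - g t x"] by simp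
  qed
  show "AE t in lebesgue_on {0<..}. (\<lambda>x. v1 t x - v2 t x) \<in> H10 \<Omega>"
    using 1 2
  proof eventually_elim
    case (elim t)
    then show ?case using H10_diff[of "\<lambda>x. v1 t x - 1" "\<lambda>x. v2 t x - 1"] by simp
  qed
qed

text \<open>
  The squared norm \<open>y\<close> of the difference of the continuous representatives starts from zero and
  satisfies the hypothesis of Gronwall's lemma, where \<open>k\<close> is twice the factor in the estimate at a
  fixed time.
\<close>

theorem weak_solutions_unique:
  fixes u1 v1 u2 v2 :: "real \<Rightarrow> 'a \<Rightarrow> real"
  assumes \<epsilon>: "\<epsilon> > 0" and \<eta>: "\<eta> > 0"
    and sol1: "weak_solution \<Omega> \<epsilon> \<eta> g u0 v0 u1 v1" and sol2: "weak_solution \<Omega> \<epsilon> \<eta> g u0 v0 u2 v2"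
    and grad1: "\<And>T. T > 0 \<Longrightarrow> (\<lambda>t. weak_gradient \<Omega> (u1 t)) \<in> Bochner_Lp (real DIM('a) + 2) (lebesgue_on {0<..<T})
      (Lp (real DIM('a) + 2) (lebesgue_on \<Omega>)) (Lp_norm (real DIM('a) + 2) (lebesgue_on \<Omega>))"
    and grad2: "\<And>T. T > 0 \<Longrightarrow> (\<lambda>t. weak_gradient \<Omega> (u2 t)) \<in> Bochner_Lp (real DIM('a) + 2) (lebesgue_on {0<..<T})
      (Lp (real DIM('a) + 2) (lebesgue_on \<Omega>)) (Lp_norm (real DIM('a) + 2) (lebesgue_on \<Omega>))"
  shows "AE (t, x) in lebesgue_on ({0<..} \<times> \<Omega>). u1 t x = u2 t x \<and> v1 t x = v2 t x"
proof -
  let ?M = "lebesgue_on \<Omega>" and ?N = "L2_norm \<Omega>" and ?D = "weak_time_derivative (L2 \<Omega>) (L2_norm \<Omega>)"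
  have S: "u1 \<in> solution_space \<Omega>" "v1 \<in> solution_space \<Omega>" "u2 \<in> solution_space \<Omega>" "v2 \<in> solution_space \<Omega>"
    and iv: "AE x in ?M. initial_value (L2 \<Omega>) ?N u1 x = u0 x" "AE x in ?M. initial_value (L2 \<Omega>) ?N v1 x = v0 x"
      "AE x in ?M. initial_value (L2 \<Omega>) ?N u2 x = u0 x" "AE x in ?M. initial_value (L2 \<Omega>) ?N v2 x = v0 x"
    using sol1 sol2 by (auto simp: weak_solution_def)
  note d = S[THEN solution_spaceD(3)]
  obtain wu1 where wu1: "continuous_representative (L2 \<Omega>) ?N u1 wu1" "initial_value (L2 \<Omega>) ?N u1 = wu1 0"
    by (rule initial_value_representative[OF d(1)])
  obtain wv1 where wv1: "continuous_representative (L2 \<Omega>) ?N v1 wv1" "initial_value (L2 \<Omega>) ?N v1 = wv1 0"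
    by (rule initial_value_representative[OF d(2)])
  obtain wu2 where wu2: "continuous_representative (L2 \<Omega>) ?N u2 wu2" "initial_value (L2 \<Omega>) ?N u2 = wu2 0"
    by (rule initial_value_representative[OF d(3)])
  obtain wv2 where wv2: "continuous_representative (L2 \<Omega>) ?N v2 wv2" "initial_value (L2 \<Omega>) ?N v2 = wv2 0"
    by (rule initial_value_representative[OF d(4)])
  define yU where "yU t = ?N (\<lambda>x. wu1 t x - wu2 t x)" for t
  define yV where "yV t = ?N (\<lambda>x. wv1 t x - wv2 t x)" for t
  define eU where "eU r = (\<integral>x. (?D u1 r x - ?D u2 r x) * (wu1 r x - wu2 r x) \<partial>?M)" for r
  define eV where "eV r = (\<integral>x. (?D v1 r x - ?D v2 r x) * (wv1 r x - wv2 r x) \<partial>?M)" for r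
  have y0: "yU 0 = 0" "yV 0 = 0"
    unfolding yU_def yV_def
    using equal_initial_values[OF wu1(1) wu2(1)] equal_initial_values[OF wv1(1) wv2(1)] iv
    unfolding wu1(2) wu2(2) wv1(2) wv2(2) by blast+
  note EU = energy_difference[OF d(1,3) wu1(1) wu2(1), folded yU_def eU_def]
  note EV = energy_difference[OF d(2,4) wv1(1) wv2(1), folded yV_def eV_def]
  define A1 where "A1 t = (\<integral>x. norm (weak_gradient \<Omega> (u1 t) x) ^ (DIM('a) + 2) \<partial>?M)" for t
  define A2 where "A2 t = (\<integral>x. norm (weak_gradient \<Omega> (u2 t) x) ^ (DIM('a) + 2) \<partial>?M)" for t
  have A1: "AE t in lebesgue_on {0<..}. integrable ?M (\<lambda>x. norm (weak_gradient \<Omega> (u1 t) x) ^ (DIM('a) + 2))"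
      "\<And>T. T > 0 \<Longrightarrow> A1 absolutely_integrable_on {0..T}"
    unfolding A1_def[abs_def] by (rule gradient_power_integrable[OF grad1]; assumption)+
  have A2: "AE t in lebesgue_on {0<..}. integrable ?M (\<lambda>x. norm (weak_gradient \<Omega> (u2 t) x) ^ (DIM('a) + 2))"
      "\<And>T. T > 0 \<Longrightarrow> A2 absolutely_integrable_on {0..T}"
    unfolding A2_def[abs_def] by (rule gradient_power_integrable[OF grad2]; assumption)+
  have A0: "A1 t \<ge> 0" "A2 t \<ge> 0" for t unfolding A1_def A2_def by (auto intro!: integral_nonneg_AE)
  \<comment> \<open>One countable set of test functions and one bound serve both solutions at almost every time.\<close>
  note HU = difference_H10(1)[OF sol1 sol2] and HV = difference_H10(2)[OF sol1 sol2]
  obtain ZU where ZU: "countable ZU" "ZU \<subseteq> test_functions \<Omega>"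
      "AE t in lebesgue_on {0<..}. \<forall>e>0. \<exists>\<zeta>\<in>ZU. H1_norm \<Omega> (\<lambda>x. (u1 t x - u2 t x) - \<zeta> x) < e"
    using countable_test_functions[OF solution_spaceD(1)[OF S(1)] solution_spaceD(1)[OF S(3)] HU] by blast
  obtain ZV where ZV: "countable ZV" "ZV \<subseteq> test_functions \<Omega>"
      "AE t in lebesgue_on {0<..}. \<forall>e>0. \<exists>\<zeta>\<in>ZV. H1_norm \<Omega> (\<lambda>x. (v1 t x - v2 t x) - \<zeta> x) < e"
    using countable_test_functions[OF solution_spaceD(1)[OF S(2)] solution_spaceD(1)[OF S(4)] HV] by blast
  define Z where "Z = ZU \<union> ZV"
  have Z: "countable Z" "Z \<subseteq> test_functions \<Omega>" using ZU ZV by (auto simp: Z_def)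
  obtain C1 where C1: "AE t in lebesgue_on {0<..}. AE x in ?M. \<bar>v1 t x\<bar> \<le> C1"
    by (rule solution_slice_bounded[OF S(2)])
  obtain C2 where C2: "AE t in lebesgue_on {0<..}. AE x in ?M. \<bar>v2 t x\<bar> \<le> C2"
    by (rule solution_slice_bounded[OF S(4)])
  define C where "C = max C1 C2"
  have mono: "AE t in lebesgue_on {0<..}. AE x in ?M. \<bar>v t x\<bar> \<le> c'"
    if "AE t in lebesgue_on {0<..}. AE x in ?M. \<bar>v t x\<bar> \<le> c" "c \<le> c'" for v and c c' :: real
    using that(1) by (rule eventually_mono, elim eventually_mono) (use that(2) in linarith)
  have C: "AE t in lebesgue_on {0<..}. AE x in ?M. \<bar>v1 t x\<bar> \<le> C" "AE t in lebesgue_on {0<..}. AE x in ?M. \<bar>v2 t x\<bar> \<le> C"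
    using mono[OF C1] mono[OF C2] by (auto simp: C_def)
  obtain K where K: "K \<ge> 0" and est: "\<And>Z u1 v1 a1 b1 u2 v2 a2 b2. slice_solution \<epsilon> \<eta> C Z u1 v1 a1 b1 \<Longrightarrow>
    slice_solution \<epsilon> \<eta> C Z u2 v2 a2 b2 \<Longrightarrow>
    Z \<subseteq> test_functions \<Omega> \<Longrightarrow> (\<lambda>x. u1 x - u2 x) \<in> H10 \<Omega> \<Longrightarrow> (\<lambda>x. v1 x - v2 x) \<in> H10 \<Omega> \<Longrightarrow>
    (\<forall>e>0. \<exists>\<zeta>\<in>Z. H1_norm \<Omega> (\<lambda>x. (u1 x - u2 x) - \<zeta> x) < e) \<Longrightarrow>
    (\<forall>e>0. \<exists>\<zeta>\<in>Z. H1_norm \<Omega> (\<lambda>x. (v1 x - v2 x) - \<zeta> x) < e) \<Longrightarrow>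
    (\<integral>x. (a1 x - a2 x) * (u1 x - u2 x) \<partial>?M) + (\<integral>x. (b1 x - b2 x) * (v1 x - v2 x) \<partial>?M)
      \<le> K * (1 + (\<integral>x. norm (weak_gradient \<Omega> u1 x) ^ (DIM('a) + 2) \<partial>?M)
          + (\<integral>x. norm (weak_gradient \<Omega> u2 x) ^ (DIM('a) + 2) \<partial>?M)) * (?N (\<lambda>x. v1 x - v2 x))\<^sup>2"
    using slice_energy_estimate[OF \<epsilon> \<eta>, of C] by blast
  define k where "k r = 2 * K * (1 + A1 r + A2 r)" for r
  define y where "y t = (yU t)\<^sup>2 + (yV t)\<^sup>2" for t
  have k0: "k r \<ge> 0" for r unfolding k_def using K A0[of r] by simp
  have AEle: "AE r in lebesgue_on {0<..}. 2 * (eU r + eV r) \<le> k r * y r"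
    using weak_solution_slices[OF sol1 Z C(1) A1(1)] weak_solution_slices[OF sol2 Z C(2) A2(1)]
      HU HV ZU(3) ZV(3) continuous_representative_eq[OF wu1(1)] continuous_representative_eq[OF wu2(1)]
      continuous_representative_eq[OF wv1(1)] continuous_representative_eq[OF wv2(1)]
      L2_loc_in[OF solution_spaceD(5)[OF S(1)]] L2_loc_in[OF solution_spaceD(5)[OF S(3)]]
      L2_loc_in[OF solution_spaceD(5)[OF S(2)]] L2_loc_in[OF solution_spaceD(5)[OF S(4)]]
      L2_loc_in[OF solution_spaceD(4)[OF S(1)]] L2_loc_in[OF solution_spaceD(4)[OF S(3)]]
      L2_loc_in[OF solution_spaceD(4)[OF S(2)]] L2_loc_in[OF solution_spaceD(4)[OF S(4)]]
  proof eventually_elim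
    case (elim r)
    have dU: "\<forall>e>0. \<exists>\<zeta>\<in>Z. H1_norm \<Omega> (\<lambda>x. (u1 r x - u2 r x) - \<zeta> x) < e" using elim(5) unfolding Z_def by blast
    have dV: "\<forall>e>0. \<exists>\<zeta>\<in>Z. H1_norm \<Omega> (\<lambda>x. (v1 r x - v2 r x) - \<zeta> x) < e" using elim(6) unfolding Z_def by blast
    \<comment> \<open>The representatives \<open>w\<close> agree with the solutions at this time up to null sets of \<open>x\<close>.\<close>
    have pair: "(\<integral>x. (a1 x - a2 x) * (w1 x - w2 x) \<partial>?M) = (\<integral>x. (a1 x - a2 x) * (f1 x - f2 x) \<partial>?M)"
      "?N (\<lambda>x. w1 x - w2 x) = ?N (\<lambda>x. f1 x - f2 x)"
      if "w1 \<in> L2 \<Omega> \<and> (AE x in ?M. f1 x = w1 x)" "w2 \<in> L2 \<Omega> \<and> (AE x in ?M. f2 x = w2 x)"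
        "a1 \<in> L2 \<Omega>" "a2 \<in> L2 \<Omega>" "f1 \<in> L2 \<Omega>" "f2 \<in> L2 \<Omega>" for a1 a2 w1 w2 f1 f2
    proof -
      have m: "(\<lambda>x. w1 x - w2 x) \<in> borel_measurable ?M" "(\<lambda>x. f1 x - f2 x) \<in> borel_measurable ?M"
        "(\<lambda>x. a1 x - a2 x) \<in> borel_measurable ?M" using that by (auto intro!: Lp2_measurable Lp2_diff)
      have ae: "AE x in ?M. w1 x - w2 x = f1 x - f2 x"
        using conjunct2[OF that(1)] conjunct2[OF that(2)] by eventually_elim simp
      show "?N (\<lambda>x. w1 x - w2 x) = ?N (\<lambda>x. f1 x - f2 x)" by (rule Lp_norm_cong_AE[OF ae m(1,2)])
      show "(\<integral>x. (a1 x - a2 x) * (w1 x - w2 x) \<partial>?M) = (\<integral>x. (a1 x - a2 x) * (f1 x - f2 x) \<partial>?M)"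
      proof (rule integral_cong_AE)
        show "AE x in ?M. (a1 x - a2 x) * (w1 x - w2 x) = (a1 x - a2 x) * (f1 x - f2 x)"
          using ae by eventually_elim simp
      qed (intro borel_measurable_times m)+
    qed
    have "eU r + eV r \<le> K * (1 + A1 r + A2 r) * (yV r)\<^sup>2"
      using est[OF elim(1,2) Z(2) elim(3,4) dU dV]
        pair(1)[OF elim(7,8,11,12,15,16)] pair[OF elim(9,10,13,14,17,18)]
      by (simp add: eU_def eV_def yV_def A1_def A2_def)
    also have "\<dots> \<le> K * (1 + A1 r + A2 r) * y r"
      using K A0[of r] by (intro mult_left_mono) (auto simp: y_def)
    finally show ?case by (simp add: k_def)
  qed
  have yc: "continuous_on {0..} y" unfolding y_def[abs_def] by (intro continuous_intros EU(1) EV(1))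
  have ki: "k absolutely_integrable_on {0..T}" if T: "T > 0" for T
    unfolding k_def[abs_def]
    by (intro set_integrable_mult_right set_integral_add(1) A1(2) A2(2) T absolutely_integrable_continuous_real continuous_intros)
  have kyi: "(\<lambda>r. k r * y r) absolutely_integrable_on {0..T}" if T: "T > 0" for T
  proof -
    have c: "continuous_on {0..T} y" by (rule continuous_on_subset[OF yc]) auto
    have "(\<lambda>r. y r * k r) absolutely_integrable_on {0..T}"
    proof (rule absolutely_integrable_bounded_measurable_product_real)
      show "y \<in> borel_measurable (lebesgue_on {0..T})"
        by (rule continuous_imp_measurable_on_sets_lebesgue[OF c]) simp
      show "bounded (y ` {0..T})" by (intro compact_imp_bounded compact_continuous_image c) simp
    qed (use ki[OF T] in auto)
    then show ?thesis by (simp add: mult.commute)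
  qed
  have le: "y t \<le> integral {0..t} (\<lambda>r. k r * y r)" if t: "t \<ge> 0" for t
  proof -
    have i: "eU absolutely_integrable_on {0..t}" "eV absolutely_integrable_on {0..t}"
      using absolutely_integrable_between(1)[OF EU(2) order_refl] absolutely_integrable_between(1)[OF EV(2) order_refl] by auto
    then have "y t = integral {0..t} (\<lambda>r. 2 * (eU r + eV r))"
      using EU(3)[OF t] EV(3)[OF t] y0 Henstock_Kurzweil_Integration.integral_add[of eU "{0..t}" eV]
      by (simp add: y_def set_lebesgue_integral_eq_integral(1) del: distrib_left_numeral) simp
    also have "\<dots> \<le> integral {0..t} (\<lambda>r. k r * y r)"
      by (rule integral_mono_AE_Icc[OF _ absolutely_integrable_between(1)[OF kyi order_refl] AE_half_line_between[OF AEle order_refl]])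
        (intro set_integrable_mult_right set_integral_add(1) i)
    finally show ?thesis .
  qed
  have y: "y t = 0" if "t \<ge> 0" for t
    by (rule Gronwall_zero[OF yc _ ki k0 le that]) (simp_all add: y_def)
  have conclude: "AE t in lebesgue_on {0<..}. AE x in ?M. f1 t x = f2 t x"
    if w: "continuous_representative (L2 \<Omega>) ?N f1 w1" "continuous_representative (L2 \<Omega>) ?N f2 w2"
      and n: "\<And>t. t \<ge> 0 \<Longrightarrow> ?N (\<lambda>x. w1 t x - w2 t x) = 0" for f1 f2 w1 w2
    using continuous_representative_eq[OF w(1)] continuous_representative_eq[OF w(2)] AE_space
  proof eventually_elim
    case (elim t)
    have "?N (\<lambda>x. w1 t x - w2 t x) = 0" using elim(3) by (intro n) simp
    moreover have "(\<lambda>x. w1 t x - w2 t x) \<in> L2 \<Omega>" using elim by (auto intro: Lp2_diff)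
    ultimately have "AE x in ?M. w1 t x - w2 t x = 0" by (intro Lp2_norm_eq_0)
    with conjunct2[OF elim(1)] conjunct2[OF elim(2)] show ?case by eventually_elim simp
  qed
  have zero: "yU t = 0" "yV t = 0" if "t \<ge> 0" for t
    using y[OF that] by (simp_all add: y_def sum_power2_eq_zero_iff)
  have "AE (t, x) in lebesgue_on ({0<..} \<times> \<Omega>). u1 t x = u2 t x"
    by (rule AE_space_time_eq[OF solution_spaceD(2)[OF S(1)] solution_spaceD(2)[OF S(3)]
        conclude[OF wu1(1) wu2(1) zero(1)[unfolded yU_def]]])
  moreover have "AE (t, x) in lebesgue_on ({0<..} \<times> \<Omega>). v1 t x = v2 t x"
    by (rule AE_space_time_eq[OF solution_spaceD(2)[OF S(2)] solution_spaceD(2)[OF S(4)]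
        conclude[OF wv1(1) wv2(1) zero(2)[unfolded yV_def]]])
  ultimately show ?thesis by eventually_elim auto
qed

end

theorem theorem2p2:
  fixes \<Omega> :: "(real ^ 'd) set"
    and \<epsilon> \<eta> :: real
    and u0 v0 :: "real ^ 'd \<Rightarrow> real"
    and g u1 v1 u2 v2 :: "real \<Rightarrow> real ^ 'd \<Rightarrow> real"
  assumes "open \<Omega>" "connected \<Omega>" "\<Omega> \<noteq> {}" "bounded \<Omega>" "C2_boundary \<Omega>"
    and "\<epsilon> > 0" "\<eta> > 0"
    and H1_initial: "u0 \<in> H1 \<Omega> \<inter> L_inf (lebesgue_on \<Omega>)" "v0 \<in> H1 \<Omega> \<inter> L_inf (lebesgue_on \<Omega>)"
    and H1_boundary: "g \<in> H1_loc (H1 \<Omega>) (H1_norm \<Omega>) \<inter> L_inf_space_time \<Omega>"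
    and H2: "AE x in lebesgue_on \<Omega>. initial_value (H1 \<Omega>) (H1_norm \<Omega>) g x = u0 x"
            "AE x in lebesgue_on \<Omega>. 0 \<le> v0 x \<and> v0 x \<le> 1"
    and H3: "(\<lambda>x. u0 x - initial_value (H1 \<Omega>) (H1_norm \<Omega>) g x) \<in> H10 \<Omega>"
            "(\<lambda>x. v0 x - 1) \<in> H10 \<Omega>"
    and H4: "AE t in lebesgue_on {0<..}.
               \<exists>h. has_trace \<Omega> (g t) h \<and> h \<in> L_inf (surface_measure \<Omega>) \<inter> H_half_boundary \<Omega>"
    and sol1: "weak_solution \<Omega> \<epsilon> \<eta> g u0 v0 u1 v1"
    and sol2: "weak_solution \<Omega> \<epsilon> \<eta> g u0 v0 u2 v2"
    and grad1: "\<And>T. T > 0 \<Longrightarrow> (\<lambda>t. weak_gradient \<Omega> (u1 t)) \<in>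
                  Bochner_Lp (real CARD('d) + 2) (lebesgue_on {0<..<T})
                    (Lp (real CARD('d) + 2) (lebesgue_on \<Omega>))
                    (Lp_norm (real CARD('d) + 2) (lebesgue_on \<Omega>))"
    and grad2: "\<And>T. T > 0 \<Longrightarrow> (\<lambda>t. weak_gradient \<Omega> (u2 t)) \<in>
                  Bochner_Lp (real CARD('d) + 2) (lebesgue_on {0<..<T})
                    (Lp (real CARD('d) + 2) (lebesgue_on \<Omega>))
                    (Lp_norm (real CARD('d) + 2) (lebesgue_on \<Omega>))"
  shows "AE (t, x) in lebesgue_on ({0<..} \<times> \<Omega>). u1 t x = u2 t x \<and> v1 t x = v2 t x"
proof -
  interpret bounded_open \<Omega> by standard (fact assms)+
  have d: "real CARD('d) + 2 = real DIM(real ^ 'd) + 2" by simp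
  show ?thesis
    by (rule weak_solutions_unique[OF \<open>\<epsilon> > 0\<close> \<open>\<eta> > 0\<close> sol1 sol2 grad1[unfolded d] grad2[unfolded d]])
qed

end
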